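(* Let $\mathcal{VS}$ be the class of all finite vector spaces over finite fields. Then $\mathsf{CRT}|_{\mathcal{VS}}$, the restriction of the decision problem $\mathsf{CRT}$ to instances whose algebra is in $\mathcal{VS}$, is in $\mathrm{P}$.
   Context: An algebra is a structure of a first-order language with no relation symbols. A congruence of an algebra $\mathbf{A}$ with universe $A$ is an equivalence relation on $A$ compatible with all fundamental operations of $\mathbf{A}$. The join $\theta\vee\delta$ of two congruences is the transitive closure of $\theta\cup\delta$. A tuple $\langle\theta_1,\ldots,\theta_k\rangle$ of congruences of $\mathbf{A}$ is a Chinese Remainder tuple (CR tuple) of $\mathbf{A}$ if for all $a_1,\ldots,a_k\in A$ with $\langle a_i,a_j\rangle\in\theta_i\vee\theta_j$ for all $i,j$ there is $a\in A$ with $\langle a,a_i\rangle\in\theta_i$ for all $i$. The problem $\mathsf{CRT}$: given a finite algebra $\mathbf{A}$ and congruences $\theta_1,\ldots,\theta_k$ of $\mathbf{A}$, decide whether $\langle\theta_1,\ldots,\theta_k\rangle$ is a CR tuple of $\mathbf{A}$. A fixed reasonable encoding of finite algebras and congruences as strings over a finite alphabet is assumed (e.g. by operation tables and lists of pairs). For a finite field $\mathbf{F}$ with universe $F$, an $\mathbf{F}$-vector space is regarded as an algebra in the language $\{+,-,0\}\cup\{\lambda_r: r\in F\}$, where each $\lambda_r$ is a unary symbol for scalar multiplication by $r$. *)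

theory Defs
  imports "HOL-Algebra.Module" "HOL-Computational_Algebra.Polynomial"
begin

section \<open>Deterministic polynomial time\<close>

text \<open>Deterministic Turing machines with finitely many two-way infinite tapes, one head per tape.
  States, tape symbols and tapes are numbered from 0; the start state is 0 and the input is written
  on tape 0. The symbol 0 is the blank, and the symbols 1 and 2 stand for the input bits.\<close>

datatype move = Left | Stay | Right

record turing_machine =
  num_tapes :: nat
  num_states :: nat
  num_syms :: nat
  accept :: nat
  reject :: nat
  delta :: "nat \<Rightarrow> nat list \<Rightarrow> nat \<times> (nat \<times> move) list"

definition wf_tm :: "turing_machine \<Rightarrow> bool" where
  "wf_tm M \<longleftrightarrow>
     0 < num_tapes M \<and> 0 < num_states M \<and> 3 \<le> num_syms M \<and>
     accept M < num_states M \<and> reject M < num_states M \<and> accept M \<noteq> reject M \<and>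
     (\<forall>q ss. q < num_states M \<and> length ss = num_tapes M \<and> (\<forall>s\<in>set ss. s < num_syms M) \<longrightarrow>
        fst (delta M q ss) < num_states M \<and>
        length (snd (delta M q ss)) = num_tapes M \<and>
        (\<forall>(s, d)\<in>set (snd (delta M q ss)). s < num_syms M))"

type_synonym tape = "(int \<Rightarrow> nat) \<times> int"

fun tape_read :: "tape \<Rightarrow> nat" where
  "tape_read (c, h) = c h"

fun move_head :: "move \<Rightarrow> int \<Rightarrow> int" where
  "move_head Left h = h - 1"
| "move_head Stay h = h"
| "move_head Right h = h + 1"

fun tape_act :: "nat \<times> move \<Rightarrow> tape \<Rightarrow> tape" where
  "tape_act (s, d) (c, h) = (c(h := s), move_head d h)"

type_synonym config = "nat \<times> tape list"

fun tm_step :: "turing_machine \<Rightarrow> config \<Rightarrow> config" where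
  "tm_step M (q, ts) =
     (if q = accept M \<or> q = reject M then (q, ts)
      else let (q', as) = delta M q (map tape_read ts) in (q', map2 tape_act as ts))"

definition blank_tape :: tape where
  "blank_tape = (\<lambda>_. 0, 0)"

definition input_tape :: "bool list \<Rightarrow> tape" where
  "input_tape w =
     (\<lambda>i. if 0 \<le> i \<and> i < int (length w) then (if w ! nat i then 2 else 1) else 0, 0)"

definition initial_config :: "turing_machine \<Rightarrow> bool list \<Rightarrow> config" where
  "initial_config M w = (0, input_tape w # replicate (num_tapes M - 1) blank_tape)"

text \<open>Halting states are fixed by \<^const>\<open>tm_step\<close>, so the state after exactly \<open>t\<close> steps is the
  state in which \<open>M\<close> has halted if \<open>M\<close> halts within \<open>t\<close> steps.\<close>

definition decides_in_time ::
  "turing_machine \<Rightarrow> bool list set \<Rightarrow> (nat \<Rightarrow> nat) \<Rightarrow> bool" where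
  "decides_in_time M L T \<longleftrightarrow>
     (\<forall>w. fst ((tm_step M ^^ T (length w)) (initial_config M w)) =
            (if w \<in> L then accept M else reject M))"

definition complexity_P :: "bool list set set" where
  "complexity_P =
     {L. \<exists>M (p :: nat poly). wf_tm M \<and> decides_in_time M L (\<lambda>n. poly p n)}"


section \<open>Algebras, congruences and CR tuples\<close>

text \<open>\<open>interp A f\<close> is only meaningful on argument lists over the universe of length \<open>arity A f\<close>.\<close>

record ('f, 'a) fo_algebra =
  universe :: "'a set"
  fsyms :: "'f set"
  arity :: "'f \<Rightarrow> nat"
  interp :: "'f \<Rightarrow> 'a list \<Rightarrow> 'a"

definition is_algebra :: "('f, 'a) fo_algebra \<Rightarrow> bool" where
  "is_algebra A \<longleftrightarrow>
     universe A \<noteq> {} \<and>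
     (\<forall>f\<in>fsyms A. \<forall>xs. length xs = arity A f \<and> set xs \<subseteq> universe A \<longrightarrow>
        interp A f xs \<in> universe A)"

definition is_congruence :: "('f, 'a) fo_algebra \<Rightarrow> 'a rel \<Rightarrow> bool" where
  "is_congruence A \<theta> \<longleftrightarrow>
     equiv (universe A) \<theta> \<and>
     (\<forall>f\<in>fsyms A. \<forall>xs ys. length xs = arity A f \<and> length ys = arity A f \<and>
        list_all2 (\<lambda>x y. (x, y) \<in> \<theta>) xs ys \<longrightarrow>
        (interp A f xs, interp A f ys) \<in> \<theta>)"

definition cong_join :: "'a rel \<Rightarrow> 'a rel \<Rightarrow> 'a rel" where
  "cong_join \<theta> \<delta> = (\<theta> \<union> \<delta>)\<^sup>+"

definition CR_tuple :: "('f, 'a) fo_algebra \<Rightarrow> 'a rel list \<Rightarrow> bool" where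
  "CR_tuple A \<theta>s \<longleftrightarrow>
     (\<forall>as. length as = length \<theta>s \<and> set as \<subseteq> universe A \<and>
        (\<forall>i<length \<theta>s. \<forall>j<length \<theta>s. (as ! i, as ! j) \<in> cong_join (\<theta>s ! i) (\<theta>s ! j)) \<longrightarrow>
        (\<exists>a\<in>universe A. \<forall>i<length \<theta>s. (a, as ! i) \<in> \<theta>s ! i))"


section \<open>The problem CRT\<close>

text \<open>A finite algebra in a finite language is presented with its elements and its function symbols
  numbered from 0.\<close>

definition is_coded_algebra :: "(nat, nat) fo_algebra \<Rightarrow> bool" where
  "is_coded_algebra A \<longleftrightarrow>
     is_algebra A \<and> (\<exists>n. universe A = {..<n}) \<and> (\<exists>m. fsyms A = {..<m})"

text \<open>An instance is written as the size of the universe, the number of function symbols, for each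
  symbol its arity and its operation table (the values on all argument tuples in lexicographic
  order), the number of congruences, and for each congruence its characteristic matrix, row by row.
  Numbers are written as self-delimiting unary blocks. An operation of positive arity has at least
  one table entry, and a congruence at least one matrix bit, for each element, so the unary
  notation for elements only changes the length of such presentations polynomially.\<close>

definition enc_nat :: "nat \<Rightarrow> bool list" where
  "enc_nat n = replicate n True @ [False]"

definition enc_operation :: "nat \<Rightarrow> nat \<Rightarrow> (nat list \<Rightarrow> nat) \<Rightarrow> bool list" where
  "enc_operation n r g =
     enc_nat r @ concat (map (\<lambda>xs. enc_nat (g xs)) (product_lists (replicate r [0..<n])))"

definition enc_relation :: "nat \<Rightarrow> nat rel \<Rightarrow> bool list" where
  "enc_relation n \<theta> = map (\<lambda>xy. xy \<in> \<theta>) (List.product [0..<n] [0..<n])"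

definition enc_instance :: "(nat, nat) fo_algebra \<Rightarrow> nat rel list \<Rightarrow> bool list" where
  "enc_instance A \<theta>s =
     (let n = card (universe A); m = card (fsyms A) in
        enc_nat n @ enc_nat m @
        concat (map (\<lambda>f. enc_operation n (arity A f) (interp A f)) [0..<m]) @
        enc_nat (length \<theta>s) @ concat (map (enc_relation n) \<theta>s))"

text \<open>The restriction of CRT to a class \<open>K\<close> of algebras, as the language of all encodings of
  yes-instances whose algebra is in \<open>K\<close>. In particular, strings that do not encode an instance with
  algebra in \<open>K\<close> have to be rejected.\<close>

definition CRT_restricted :: "(nat, nat) fo_algebra set \<Rightarrow> bool list set" where
  "CRT_restricted K =
     {enc_instance A \<theta>s | A \<theta>s.
        is_coded_algebra A \<and> A \<in> K \<and> (\<forall>\<theta>\<in>set \<theta>s. is_congruence A \<theta>) \<and> CR_tuple A \<theta>s}"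


section \<open>Finite vector spaces over finite fields\<close>

text \<open>\<open>A\<close> is the \<open>F\<close>-vector space \<open>V\<close> regarded as an algebra. The function symbols are
  numbered as follows: 0 is addition, 1 is the (unary) additive inverse, 2 is the constant zero, and
  \<open>3 + r\<close> is scalar multiplication by the field element \<open>r\<close>. To this end the elements
  of \<open>F\<close> are numbered from 0, in an arbitrary way.\<close>

definition is_vector_space_algebra ::
  "nat ring \<Rightarrow> (nat, nat) module \<Rightarrow> (nat, nat) fo_algebra \<Rightarrow> bool" where
  "is_vector_space_algebra F V A \<longleftrightarrow>
     field F \<and> Module.module F V \<and> universe A = carrier V \<and>
     (\<exists>q. carrier F = {..<q} \<and> fsyms A = {..<3 + q}) \<and>
     arity A 0 = 2 \<and> (\<forall>x\<in>carrier V. \<forall>y\<in>carrier V. interp A 0 [x, y] = x \<oplus>\<^bsub>V\<^esub> y) \<and>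
     arity A 1 = 1 \<and> (\<forall>x\<in>carrier V. interp A 1 [x] = \<ominus>\<^bsub>V\<^esub> x) \<and>
     arity A 2 = 0 \<and> interp A 2 [] = \<zero>\<^bsub>V\<^esub> \<and>
     (\<forall>r\<in>carrier F. arity A (3 + r) = 1 \<and>
        (\<forall>x\<in>carrier V. interp A (3 + r) [x] = r \<odot>\<^bsub>V\<^esub> x))"

definition VS :: "(nat, nat) fo_algebra set" where
  "VS = {A. finite (universe A) \<and> (\<exists>F V. is_vector_space_algebra F V A)}"

end

theory Submission
  imports Defs "HOL-Algebra.Sylow" "HOL-Algebra.Multiplicative_Group"
    "HOL-Computational_Algebra.Polynomial_Factorial" Complex_Main
begin

text \<open>Let \<open>\<theta>\<^sub>1, \<dots>, \<theta>\<^sub>k\<close> be congruences of a vector space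
  \<open>V\<close> with \<open>n\<close> elements, and let \<open>W\<^sub>i\<close> be the class of zero of
  \<open>\<theta>\<^sub>i\<close>. A tuple \<open>h\<close> in \<open>V\<^sup>k\<close> satisfies the hypothesis
  of the Chinese remainder property if and only if \<open>h\<^sub>i - h\<^sub>j\<close> lies in \<open>W\<^sub>i
  + W\<^sub>j\<close> for all \<open>i \<noteq> j\<close>. These tuples form a subgroup \<open>D\<close> of
  \<open>V\<^sup>k\<close>, and the tuples that have a solution form another one. So the tuple of congruences is
  a CR tuple if and only if every member of a set of generators of \<open>D\<close> has a solution, and for a
  single tuple this is tested by trying all elements of \<open>V\<close>. Only the additive group of
  \<open>V\<close> matters here.

  It remains to find few generators of \<open>D\<close>, although \<open>V\<^sup>k\<close> itself is too large
  to be listed. The group \<open>V\<^sup>k\<close> is generated by the tuples with at most one nonzero entry.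
  The constraints are imposed one after the other: if \<open>X\<close> generates the group \<open>H\<close> of
  the tuples that satisfy the constraints so far, the next constraint cuts out the kernel of the homomorphism
  \<open>h \<mapsto> h\<^sub>i - h\<^sub>j\<close> from \<open>H\<close> to \<open>V / (W\<^sub>i +
  W\<^sub>j)\<close>. As \<open>V\<close> is given by its operation tables, the at most \<open>n\<close> values
  of this homomorphism can be listed, with a representative \<open>t c\<close> in \<open>H\<close> of every
  value \<open>c\<close>: start with zero as the representative of the elements of \<open>W\<^sub>i +
  W\<^sub>j\<close>, and close under adding the values of the generators. By Schreier's argument the kernel is
  generated by the tuples \<open>x - t (x\<^sub>i - x\<^sub>j)\<close>, for \<open>x\<close> in
  \<open>X\<close>, and \<open>t c + t d - t (c + d)\<close>, for values \<open>c, d\<close> (lemma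
  \<open>kernel_generated\<close>). Each constraint adds at most \<open>n\<^sup>2\<close> generators, so their
  number remains polynomial (lemma \<open>good_step\<close>, theorem \<open>CR_tuple_iff\<close>).

  Strings that do not encode a vector space have to be rejected. A space with at least two elements determines
  its field, which is recovered from the scalar multiplications. On the trivial space every field acts, so that
  the question is whether there is a field with \<open>q\<close> elements; this is the case if and only if
  \<open>q\<close> is a prime power (theorem \<open>finite_field_iff\<close>; the field of order
  \<open>q\<close> is constructed as \<open>\<int>[X] / M\<close>, for a maximal ideal \<open>M\<close> that
  contains the prime and an irreducible factor of \<open>X\<^sup>q\<^sup>-\<^sup>1 - 1\<close> that vanishes at
  a primitive root of unity).

  For the time bound, the algorithm is written in a small language of loop programs: the data are relations on
  \<open>{..<N}\<close>, where \<open>N\<close> is the length of the input plus four, assignments evaluate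
  first-order formulas, and loops run over \<open>{..<N}\<close>. Every program of this language is compiled to
  a multi-tape machine that runs in time polynomial in \<open>N\<close> (theorem
  \<open>loop_program_in_P\<close>). The loops of the program define the order and the arithmetic of
  \<open>{..<N}\<close>, then the numbers in the blocks of the input, the tables of the operations and of the
  congruences, and finally the generators of \<open>D\<close>.\<close>

section \<open>Structured tape programs\<close>

text \<open>Programs acting on tapes that are named by elements of a type \<open>'i\<close>: write a symbol, move a
  head, test the scanned symbol. \<open>Until i a c\<close> repeats \<open>c\<close> until tape \<open>i\<close> scans \<open>a\<close>.\<close>

datatype 'i prog =
    Write 'i nat
  | Move 'i move
  | Seq "'i prog" "'i prog"
  | Cond 'i nat "'i prog" "'i prog"
  | Until 'i nat "'i prog"

type_synonym 'i tapes = "'i \<Rightarrow> tape"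

text \<open>\<open>run c s t s'\<close>: started on the tapes \<open>s\<close>, the program \<open>c\<close> ends after \<open>t\<close> machine steps with the
  tapes \<open>s'\<close>. The step counts are those of the translation into jumping code below.\<close>

inductive run :: "'i prog \<Rightarrow> 'i tapes \<Rightarrow> nat \<Rightarrow> 'i tapes \<Rightarrow> bool" where
  run_Write: "run (Write i a) s 1 (s(i := tape_act (a, Stay) (s i)))"
| run_Move: "run (Move i d) s 1 (s(i := tape_act (tape_read (s i), d) (s i)))"
| run_Seq: "run c s t s' \<Longrightarrow> run d s' u s'' \<Longrightarrow> run (Seq c d) s (t + u) s''"
| run_CondT: "tape_read (s i) = a \<Longrightarrow> run c s t s' \<Longrightarrow> run (Cond i a c d) s (t + 2) s'"
| run_CondF: "tape_read (s i) \<noteq> a \<Longrightarrow> run d s t s' \<Longrightarrow> run (Cond i a c d) s (t + 1) s'"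
| run_UntilT: "tape_read (s i) = a \<Longrightarrow> run (Until i a c) s 1 s"
| run_UntilF: "tape_read (s i) \<noteq> a \<Longrightarrow> run c s t s' \<Longrightarrow> run (Until i a c) s' u s'' \<Longrightarrow>
    run (Until i a c) s (t + u + 2) s''"

fun tape_names :: "'i prog \<Rightarrow> 'i set" where
  "tape_names (Write i a) = {i}"
| "tape_names (Move i d) = {i}"
| "tape_names (Seq c d) = tape_names c \<union> tape_names d"
| "tape_names (Cond i a c d) = {i} \<union> tape_names c \<union> tape_names d"
| "tape_names (Until i a c) = {i} \<union> tape_names c"

text \<open>Programs that only write the symbols 0, 1 and 2.\<close>

fun small_syms :: "'i prog \<Rightarrow> bool" where
  "small_syms (Write i a) \<longleftrightarrow> a < 3"
| "small_syms (Move i d) \<longleftrightarrow> True"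
| "small_syms (Seq c d) \<longleftrightarrow> small_syms c \<and> small_syms d"
| "small_syms (Cond i a c d) \<longleftrightarrow> small_syms c \<and> small_syms d"
| "small_syms (Until i a c) \<longleftrightarrow> small_syms c"

subsection \<open>Translation into jumping code\<close>

text \<open>\<open>ITest i a m\<close> jumps to \<open>m\<close> unless tape \<open>i\<close> scans \<open>a\<close>, \<open>ITest2\<close> jumps to \<open>m\<close> if it does.\<close>

datatype 'i instr =
    IWrite 'i nat
  | IMove 'i move
  | ITest 'i nat nat
  | ITest2 'i nat nat
  | IJump nat

fun csize :: "'i prog \<Rightarrow> nat" where
  "csize (Write i a) = 1"
| "csize (Move i d) = 1"
| "csize (Seq c d) = csize c + csize d"
| "csize (Cond i a c d) = csize c + csize d + 2"
| "csize (Until i a c) = csize c + 2"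

text \<open>\<open>code n c\<close> is the code of \<open>c\<close> when it is placed at address \<open>n\<close>.\<close>

fun code :: "nat \<Rightarrow> 'i prog \<Rightarrow> 'i instr list" where
  "code n (Write i a) = [IWrite i a]"
| "code n (Move i d) = [IMove i d]"
| "code n (Seq c d) = code n c @ code (n + csize c) d"
| "code n (Cond i a c d) =
     ITest i a (n + csize c + 2) # code (n + 1) c @
     IJump (n + csize c + csize d + 2) # code (n + csize c + 2) d"
| "code n (Until i a c) = ITest2 i a (n + csize c + 2) # code (n + 1) c @ [IJump n]"

lemma length_code [simp]: "length (code n c) = csize c"
  by (induction n c rule: code.induct) auto

text \<open>One instruction, and one step of a code, act on a program counter and the tapes. A code whose
  counter has run off the end is stuck.\<close>

fun istep :: "'i instr \<Rightarrow> nat \<times> 'i tapes \<Rightarrow> nat \<times> 'i tapes" where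
  "istep (IWrite i a) (q, s) = (q + 1, s(i := tape_act (a, Stay) (s i)))"
| "istep (IMove i d) (q, s) = (q + 1, s(i := tape_act (tape_read (s i), d) (s i)))"
| "istep (ITest i a m) (q, s) = (if tape_read (s i) = a then q + 1 else m, s)"
| "istep (ITest2 i a m) (q, s) = (if tape_read (s i) = a then m else q + 1, s)"
| "istep (IJump m) (q, s) = (m, s)"

definition code_step :: "'i instr list \<Rightarrow> nat \<times> 'i tapes \<Rightarrow> nat \<times> 'i tapes" where
  "code_step P qs = (if fst qs < length P then istep (P ! fst qs) qs else qs)"

lemma code_step_at: "q = length A \<Longrightarrow> code_step (A @ x # B) (q, s) = istep x (q, s)"
  by (simp add: code_step_def)

lemma funpow_trans: "(f ^^ m) x = y \<Longrightarrow> (f ^^ n) y = z \<Longrightarrow> (f ^^ (m + n)) x = z"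
  by (metis comp_apply funpow_add add.commute)

text \<open>The code of \<open>c\<close>, placed anywhere in a longer code, simulates a run of \<open>c\<close>
  with exactly its step count.\<close>

lemma code_run:
  assumes "run c s t s'" "n = length A"
  shows "(code_step (A @ code n c @ B) ^^ t) (n, s) = (n + csize c, s')"
  using assms
proof (induction arbitrary: n A B rule: run.induct)
  case (run_Seq c s t s' d u s'')
  have 1: "(code_step (A @ code n (Seq c d) @ B) ^^ t) (n, s) = (n + csize c, s')"
    using run_Seq.IH(1)[OF run_Seq.prems, of "code (n + csize c) d @ B"] by simp
  have 2: "(code_step (A @ code n (Seq c d) @ B) ^^ u) (n + csize c, s') = (n + csize c + csize d, s'')"
    using run_Seq.IH(2)[of "n + csize c" "A @ code n c" B] run_Seq.prems by simp
  from funpow_trans[OF 1 2] show ?case by simp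
next
  case (run_CondT s i a c t s' d)
  let ?P = "A @ code n (Cond i a c d) @ B"
  have 1: "(code_step ?P ^^ 1) (n, s) = (n + 1, s)"
    using run_CondT by (simp add: code_step_at)
  have 2: "(code_step ?P ^^ t) (n + 1, s) = (n + 1 + csize c, s')"
    using run_CondT.IH[of "n + 1" "A @ [ITest i a (n + csize c + 2)]"
        "IJump (n + csize c + csize d + 2) # code (n + csize c + 2) d @ B"] run_CondT.prems by simp
  have 3: "(code_step ?P ^^ 1) (n + 1 + csize c, s') = (n + csize (Cond i a c d), s')"
    using code_step_at[of "n + 1 + csize c" "A @ ITest i a (n + csize c + 2) # code (n + 1) c"
        "IJump (n + csize c + csize d + 2)" "code (n + csize c + 2) d @ B" s'] run_CondT.prems by simp
  from funpow_trans[OF funpow_trans[OF 1 2] 3] show ?case by (simp add: numeral_2_eq_2)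
next
  case (run_CondF s i a d t s' c)
  let ?P = "A @ code n (Cond i a c d) @ B"
  have 1: "(code_step ?P ^^ 1) (n, s) = (n + csize c + 2, s)"
    using run_CondF by (simp add: code_step_at)
  have 2: "(code_step ?P ^^ t) (n + csize c + 2, s) = (n + csize c + 2 + csize d, s')"
    using run_CondF.IH[of "n + csize c + 2" "A @ ITest i a (n + csize c + 2) # code (n + 1) c @
        [IJump (n + csize c + csize d + 2)]" B] run_CondF.prems by simp
  from funpow_trans[OF 1 2] show ?case by (simp add: add_ac)
next
  case (run_UntilT s i a c)
  then show ?case by (simp add: code_step_at)
next
  case (run_UntilF s i a c t s' u s'')
  let ?P = "A @ code n (Until i a c) @ B"
  have 1: "(code_step ?P ^^ 1) (n, s) = (n + 1, s)"
    using run_UntilF by (simp add: code_step_at)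
  have 2: "(code_step ?P ^^ t) (n + 1, s) = (n + 1 + csize c, s')"
    using run_UntilF.IH(1)[of "n + 1" "A @ [ITest2 i a (n + csize c + 2)]" "IJump n # B"]
      run_UntilF.prems by simp
  have 3: "(code_step ?P ^^ 1) (n + 1 + csize c, s') = (n, s')"
    using code_step_at[of "n + 1 + csize c" "A @ ITest2 i a (n + csize c + 2) # code (n + 1) c"
        "IJump n" "B" s'] run_UntilF.prems by simp
  have 4: "(code_step ?P ^^ u) (n, s') = (n + csize (Until i a c), s'')"
    using run_UntilF.IH(2) run_UntilF.prems by simp
  from funpow_trans[OF funpow_trans[OF funpow_trans[OF 1 2] 3] 4]
  show ?case by (simp add: add_ac numeral_2_eq_2)
qed (simp_all add: code_step_at)

subsection \<open>The Turing machine of a program\<close>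

text \<open>The tapes of the machine are those in the list \<open>ids\<close>; its states are the addresses of the code,
  followed by a final test of the tape \<open>fl\<close> and the two halting states.\<close>

fun instr_delta :: "'i list \<Rightarrow> 'i instr \<Rightarrow> nat \<Rightarrow> nat list \<Rightarrow> nat \<times> (nat \<times> move) list" where
  "instr_delta ids (IWrite i a) q ss =
     (q + 1, map2 (\<lambda>j r. (if j = i then a else r, Stay)) ids ss)"
| "instr_delta ids (IMove i d) q ss =
     (q + 1, map2 (\<lambda>j r. (r, if j = i then d else Stay)) ids ss)"
| "instr_delta ids (ITest i a m) q ss =
     (if map_of (zip ids ss) i = Some a then q + 1 else m, map (\<lambda>r. (r, Stay)) ss)"
| "instr_delta ids (ITest2 i a m) q ss =
     (if map_of (zip ids ss) i = Some a then m else q + 1, map (\<lambda>r. (r, Stay)) ss)"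
| "instr_delta ids (IJump m) q ss = (m, map (\<lambda>r. (r, Stay)) ss)"

definition full_code :: "'i \<Rightarrow> 'i prog \<Rightarrow> 'i instr list" where
  "full_code fl c = code 0 c @ [ITest fl 1 (csize c + 2)]"

definition machine :: "'i list \<Rightarrow> 'i \<Rightarrow> 'i prog \<Rightarrow> turing_machine" where
  "machine ids fl c =
     \<lparr>num_tapes = length ids, num_states = csize c + 3, num_syms = 3,
      accept = csize c + 1, reject = csize c + 2,
      delta = (\<lambda>q ss. if q < csize c + 1 then instr_delta ids (full_code fl c ! q) q ss
                      else (q, map (\<lambda>r. (r, Stay)) ss))\<rparr>"

text \<open>The instruction only refers to tapes in \<open>I\<close> and to states below
  \<open>n\<close>.\<close>

fun ins_ok :: "'i set \<Rightarrow> nat \<Rightarrow> 'i instr \<Rightarrow> bool" where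
  "ins_ok I n (IWrite i a) \<longleftrightarrow> i \<in> I \<and> a < 3"
| "ins_ok I n (IMove i d) \<longleftrightarrow> i \<in> I"
| "ins_ok I n (ITest i a m) \<longleftrightarrow> i \<in> I \<and> m < n"
| "ins_ok I n (ITest2 i a m) \<longleftrightarrow> i \<in> I \<and> m < n"
| "ins_ok I n (IJump m) \<longleftrightarrow> m < n"

lemma code_ok:
  "small_syms c \<Longrightarrow> tape_names c \<subseteq> I \<Longrightarrow> n + csize c < N \<Longrightarrow> list_all (ins_ok I N) (code n c)"
  by (induction n c rule: code.induct) auto

lemma full_code_ok:
  assumes "small_syms c" "tape_names c \<subseteq> I" "fl \<in> I" "q < csize c + 1"
  shows "ins_ok I (csize c + 3) (full_code fl c ! q)"
proof -
  have "list_all (ins_ok I (csize c + 3)) (full_code fl c)"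
    using assms by (auto simp: full_code_def intro: code_ok)
  then show ?thesis using assms by (simp add: list_all_length full_code_def)
qed

lemma instr_delta_wf:
  assumes "ins_ok I n x" "q + 1 < n" "length ss = length ids" "\<forall>s\<in>set ss. s < 3"
  shows "fst (instr_delta ids x q ss) < n \<and> length (snd (instr_delta ids x q ss)) = length ids \<and>
    (\<forall>(s, d)\<in>set (snd (instr_delta ids x q ss)). s < 3)"
  using assms by (cases x) (auto dest: set_zip_rightD)

lemma machine_sel:
  "num_tapes (machine ids fl c) = length ids" "num_states (machine ids fl c) = csize c + 3"
  "num_syms (machine ids fl c) = 3" "accept (machine ids fl c) = csize c + 1"
  "reject (machine ids fl c) = csize c + 2"
  by (simp_all add: machine_def)

lemma wf_machine:
  assumes "small_syms c" "tape_names c \<subseteq> set ids" "fl \<in> set ids"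
  shows "wf_tm (machine ids fl c)"
proof -
  have "fst (delta (machine ids fl c) q ss) < csize c + 3 \<and>
      length (snd (delta (machine ids fl c) q ss)) = length ids \<and>
      (\<forall>(s, d)\<in>set (snd (delta (machine ids fl c) q ss)). s < 3)"
    if "length ss = length ids" "\<forall>s\<in>set ss. s < 3" "q < csize c + 3" for q ss
  proof (cases "q < csize c + 1")
    case True
    then show ?thesis
      using instr_delta_wf[OF full_code_ok[OF assms True] _ that(1,2), of q]
      by (auto simp: machine_def)
  next
    case False
    then show ?thesis using that by (auto simp: machine_def)
  qed
  moreover have "0 < length ids" using assms by (cases ids) auto
  ultimately show ?thesis
    unfolding wf_tm_def by (simp add: machine_sel) blast
qed

lemma map2_map_same: "map2 f (map g xs) (map h xs) = map (\<lambda>x. f (g x) (h x)) xs"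
  by (induction xs) auto

lemma map2_map_right: "map2 f xs (map h xs) = map (\<lambda>x. f x (h x)) xs"
  by (induction xs) auto

lemma tape_act_same [simp]: "tape_act (tape_read p, Stay) p = p"
  by (cases p) simp

lemma map_of_zip_read: "i \<in> set ids \<Longrightarrow> map_of (zip ids (map f ids)) i = Some (f i)"
  by (simp add: map_of_zip_map)

lemma instr_delta_istep:
  assumes "ins_ok (set ids) n x"
  shows "(case instr_delta ids x q (map tape_read (map s ids)) of
            (q', as) \<Rightarrow> (q', map2 tape_act as (map s ids))) =
         (let (q', s') = istep x (q, s) in (q', map s' ids))"
  using assms
  by (cases x) (auto simp: map2_map_same map2_map_right map_of_zip_read comp_def)

lemma tm_step_machine:
  assumes "small_syms c" "tape_names c \<subseteq> set ids" "fl \<in> set ids" "code_step (full_code fl c) (q, s) = (q', s')"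
  shows "tm_step (machine ids fl c) (q, map s ids) = (q', map s' ids)"
proof (cases "q < csize c + 1")
  case True
  have "code_step (full_code fl c) (q, s) = istep (full_code fl c ! q) (q, s)"
    using True by (simp add: code_step_def full_code_def)
  then have "istep (full_code fl c ! q) (q, s) = (q', s')" using assms(4) by simp
  then show ?thesis
    using instr_delta_istep[OF full_code_ok[OF assms(1-3) True], where q = q and s = s] True
    by (simp add: machine_def)
next
  case False
  then show ?thesis using assms(4)
    by (auto simp: machine_def code_step_def full_code_def map2_map_same comp_def)
qed

lemma tm_steps_machine:
  assumes "small_syms c" "tape_names c \<subseteq> set ids" "fl \<in> set ids"
  shows "(code_step (full_code fl c) ^^ t) (q, s) = (q', s') \<Longrightarrow>
    (tm_step (machine ids fl c) ^^ t) (q, map s ids) = (q', map s' ids)"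
proof (induction t arbitrary: q' s')
  case (Suc t)
  obtain q1 s1 where 1: "(code_step (full_code fl c) ^^ t) (q, s) = (q1, s1)"
    by (cases "(code_step (full_code fl c) ^^ t) (q, s)") auto
  with Suc.prems have "code_step (full_code fl c) (q1, s1) = (q', s')" by simp
  from tm_step_machine[OF assms this] Suc.IH[OF 1] show ?case by simp
qed simp

lemma tm_step_halted:
  assumes "q = accept M \<or> q = reject M"
  shows "(tm_step M ^^ t) (q, ts) = (q, ts)"
  using assms by (induction t) auto

text \<open>A program that computes, in polynomial time, membership of the input in \<open>L\<close> into the cell
  scanned on the tape \<open>fl\<close> yields a machine witnessing that \<open>L\<close> is in P.\<close>

theorem complexity_P_by_program:
  fixes p :: "nat poly"
  assumes "small_syms c" "tape_names c \<subseteq> set ids" "fl \<in> set ids" and ids: "ids = inp # ids'"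
    and init: "\<And>w. \<forall>i\<in>set ids. s0 w i = (if i = inp then input_tape w else blank_tape)"
    and "inp \<notin> set ids'"
    and comp: "\<And>w. \<exists>t s'. t \<le> poly p (length w) \<and> run c (s0 w) t s' \<and>
      (tape_read (s' fl) = 1 \<longleftrightarrow> w \<in> L)"
  shows "L \<in> complexity_P"
proof -
  let ?M = "machine ids fl c"
  have "fst ((tm_step ?M ^^ poly (p + 1) (length w)) (initial_config ?M w)) =
      (if w \<in> L then accept ?M else reject ?M)" for w
  proof -
    obtain t s' where t: "t \<le> poly p (length w)" "run c (s0 w) t s'"
      "tape_read (s' fl) = 1 \<longleftrightarrow> w \<in> L" using comp by blast
    have ic: "initial_config ?M w = (0, map (s0 w) ids)"
    proof -
      have "map (s0 w) ids' = replicate (length ids') blank_tape"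
        using init[of w] ids assms(6) by (auto simp: map_replicate_const[symmetric])
      then show ?thesis using init[of w] ids
        by (simp add: initial_config_def machine_def)
    qed
    have "(code_step (full_code fl c) ^^ t) (0, s0 w) = (csize c, s')"
      using code_run[OF t(2), of 0 "[]" "[ITest fl 1 (csize c + 2)]"] by (simp add: full_code_def)
    moreover have "code_step (full_code fl c) (csize c, s') =
        (if w \<in> L then csize c + 1 else csize c + 2, s')"
      using t(3) by (simp add: code_step_def full_code_def nth_append)
    ultimately have "(code_step (full_code fl c) ^^ (t + 1)) (0, s0 w) =
        (if w \<in> L then csize c + 1 else csize c + 2, s')" by simp
    from tm_steps_machine[OF assms(1-3) this]
    have 1: "(tm_step ?M ^^ (t + 1)) (initial_config ?M w) =
        (if w \<in> L then accept ?M else reject ?M, map s' ids)"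
      by (simp add: ic del: One_nat_def add_Suc_right) (simp add: machine_def)
    obtain r where "poly (p + 1) (length w) = (t + 1) + r"
      using t(1) by (metis add_le_mono1 le_iff_add poly_1 poly_add)
    then show ?thesis using funpow_trans[OF 1 tm_step_halted, of r] by simp
  qed
  then show ?thesis
    using wf_machine[OF assms(1-3)]
    unfolding complexity_P_def decides_in_time_def by blast
qed

section \<open>A loop language over finite relations\<close>

text \<open>Formulas and programs refer to a domain \<open>{..<N}\<close>. Relation symbols and variables are numbers;
  variables are only bound by quantifiers and by loops over the whole domain, so that every program
  runs in time polynomial in \<open>N\<close>.\<close>

datatype fm =
    Tr
  | Rel nat "nat list"
  | Neg fm
  | And fm fm
  | Ex nat fm

datatype cmd =
    Skip
  | Set nat "nat list" fm
  | Comp cmd cmd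
  | For nat cmd
  | If fm cmd

type_synonym store = "nat \<Rightarrow> nat list \<Rightarrow> bool"
type_synonym env = "nat \<Rightarrow> nat"

text \<open>Truth of a formula and effect of a program, with the values of the relations in
  \<open>\<sigma>\<close> and those of the variables in \<open>\<rho>\<close>.\<close>

fun holds :: "nat \<Rightarrow> store \<Rightarrow> env \<Rightarrow> fm \<Rightarrow> bool" where
  "holds N \<sigma> \<rho> Tr \<longleftrightarrow> True"
| "holds N \<sigma> \<rho> (Rel R xs) \<longleftrightarrow> \<sigma> R (map \<rho> xs)"
| "holds N \<sigma> \<rho> (Neg \<phi>) \<longleftrightarrow> \<not> holds N \<sigma> \<rho> \<phi>"
| "holds N \<sigma> \<rho> (And \<phi> \<psi>) \<longleftrightarrow> holds N \<sigma> \<rho> \<phi> \<and> holds N \<sigma> \<rho> \<psi>"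
| "holds N \<sigma> \<rho> (Ex x \<phi>) \<longleftrightarrow> (\<exists>v<N. holds N \<sigma> (\<rho>(x := v)) \<phi>)"

fun exec :: "nat \<Rightarrow> cmd \<Rightarrow> env \<Rightarrow> store \<Rightarrow> store" where
  "exec N Skip \<rho> \<sigma> = \<sigma>"
| "exec N (Set R xs \<phi>) \<rho> \<sigma> = \<sigma>(R := (\<sigma> R)(map \<rho> xs := holds N \<sigma> \<rho> \<phi>))"
| "exec N (Comp c d) \<rho> \<sigma> = exec N d \<rho> (exec N c \<rho> \<sigma>)"
| "exec N (For x c) \<rho> \<sigma> = fold (\<lambda>v. exec N c (\<rho>(x := v))) [0..<N] \<sigma>"
| "exec N (If \<phi> c) \<rho> \<sigma> = (if holds N \<sigma> \<rho> \<phi> then exec N c \<rho> \<sigma> else \<sigma>)"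

text \<open>Well-formedness with respect to the arities \<open>ar\<close> and the variables \<open>V\<close> in scope; shadowing is
  forbidden because a variable is held by one counter of the machine.\<close>

fun wff :: "(nat \<Rightarrow> nat) \<Rightarrow> nat set \<Rightarrow> fm \<Rightarrow> bool" where
  "wff ar V Tr \<longleftrightarrow> True"
| "wff ar V (Rel R xs) \<longleftrightarrow> length xs = ar R \<and> set xs \<subseteq> V"
| "wff ar V (Neg \<phi>) \<longleftrightarrow> wff ar V \<phi>"
| "wff ar V (And \<phi> \<psi>) \<longleftrightarrow> wff ar V \<phi> \<and> wff ar V \<psi>"
| "wff ar V (Ex x \<phi>) \<longleftrightarrow> x \<notin> V \<and> wff ar (insert x V) \<phi>"

fun wfc :: "(nat \<Rightarrow> nat) \<Rightarrow> nat set \<Rightarrow> cmd \<Rightarrow> bool" where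
  "wfc ar V Skip \<longleftrightarrow> True"
| "wfc ar V (Set R xs \<phi>) \<longleftrightarrow> length xs = ar R \<and> set xs \<subseteq> V \<and> wff ar V \<phi>"
| "wfc ar V (Comp c d) \<longleftrightarrow> wfc ar V c \<and> wfc ar V d"
| "wfc ar V (For x c) \<longleftrightarrow> x \<notin> V \<and> wfc ar (insert x V) c"
| "wfc ar V (If \<phi> c) \<longleftrightarrow> wff ar V \<phi> \<and> wfc ar V c"

subsection \<open>Timed runs\<close>

text \<open>Runs with an upper bound on their time.\<close>

definition runs :: "'i prog \<Rightarrow> 'i tapes \<Rightarrow> nat \<Rightarrow> 'i tapes \<Rightarrow> bool" where
  "runs c s T s' \<longleftrightarrow> (\<exists>t\<le>T. run c s t s')"

lemma runs_mono: "runs c s T s' \<Longrightarrow> T \<le> U \<Longrightarrow> runs c s U s'"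
  unfolding runs_def using order_trans by blast

lemma runs_Write: "s' = s(i := tape_act (a, Stay) (s i)) \<Longrightarrow> 1 \<le> T \<Longrightarrow> runs (Write i a) s T s'"
  unfolding runs_def using run_Write[of i a s] by (intro exI[of _ 1]) simp

lemma runs_Move: "s' = s(i := tape_act (tape_read (s i), d) (s i)) \<Longrightarrow> 1 \<le> T \<Longrightarrow> runs (Move i d) s T s'"
  unfolding runs_def using run_Move[of i d s] by (intro exI[of _ 1]) simp

lemma runs_Seq:
  assumes "runs c s T s'" "runs d s' U s''" "T + U \<le> W"
  shows "runs (Seq c d) s W s''"
proof -
  obtain t u where "t \<le> T" "run c s t s'" "u \<le> U" "run d s' u s''"
    using assms(1,2) unfolding runs_def by blast
  with run_Seq[OF this(2,4)] assms(3) show ?thesis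
    unfolding runs_def by (intro exI[of _ "t + u"]) simp
qed

lemma runs_Cond:
  assumes "tape_read (s i) = a \<Longrightarrow> runs c s T s'" "tape_read (s i) \<noteq> a \<Longrightarrow> runs d s T s'" "T + 2 \<le> U"
  shows "runs (Cond i a c d) s U s'"
proof (cases "tape_read (s i) = a")
  case True
  then obtain t where "t \<le> T" "run c s t s'" using assms(1) unfolding runs_def by blast
  with run_CondT[OF True this(2)] assms(3) show ?thesis
    unfolding runs_def by (intro exI[of _ "t + 2"]) simp
next
  case False
  then obtain t where "t \<le> T" "run d s t s'" using assms(2) unfolding runs_def by blast
  with run_CondF[OF False this(2)] assms(3) show ?thesis
    unfolding runs_def by (intro exI[of _ "t + 1"]) simp
qed

lemma runs_Until:
  assumes "P 0 s"
    and "\<And>v s. v < n \<Longrightarrow> P v s \<Longrightarrow> tape_read (s i) \<noteq> a \<and> (\<exists>s'. runs c s T s' \<and> P (Suc v) s')"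
    and "\<And>s. P n s \<Longrightarrow> tape_read (s i) = a"
  shows "\<exists>s'. P n s' \<and> runs (Until i a c) s (n * (T + 2) + 1) s'"
  using assms
proof (induction n arbitrary: P s)
  case 0
  then have "run (Until i a c) s 1 s" by (intro run_UntilT) auto
  with 0 show ?case unfolding runs_def by (intro exI[of _ s]) auto
next
  case (Suc n)
  obtain s1 where s1: "tape_read (s i) \<noteq> a" "runs c s T s1" "P (Suc 0) s1"
    using Suc.prems(2)[OF _ Suc.prems(1)] by blast
  have "\<exists>s2. P (Suc n) s2 \<and> runs (Until i a c) s1 (n * (T + 2) + 1) s2"
    by (rule Suc.IH[of "\<lambda>v. P (Suc v)"]) (use s1 Suc.prems(2,3) in auto)
  then obtain s2 where s2: "P (Suc n) s2" "runs (Until i a c) s1 (n * (T + 2) + 1) s2" by blast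
  obtain t u where tu: "t \<le> T" "run c s t s1" "u \<le> n * (T + 2) + 1" "run (Until i a c) s1 u s2"
    using s1(2) s2(2) unfolding runs_def by blast
  have "run (Until i a c) s (t + u + 2) s2" by (rule run_UntilF[OF s1(1) tu(2,4)])
  moreover have "t + u + 2 \<le> Suc n * (T + 2) + 1" using tu by simp
  ultimately show ?case using s2(1) unfolding runs_def by blast
qed

text \<open>The version of the loop rule for a loop that passes through the known states \<open>S 0, \<dots>, S
  n\<close>.\<close>

lemma runs_Until_fun:
  assumes "\<And>v. v < n \<Longrightarrow> tape_read (S v i) \<noteq> a \<and> runs c (S v) T (S (Suc v))" "tape_read (S n i) = a"
    and "s = S 0" "s' = S n" "n * (T + 2) + 1 \<le> U"
  shows "runs (Until i a c) s U s'"
proof -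
  have "\<exists>s'. s' = S n \<and> runs (Until i a c) s (n * (T + 2) + 1) s'"
    by (rule runs_Until[of "\<lambda>v s. s = S v"]) (use assms(1-3) in auto)
  with assms(4,5) show ?thesis using runs_mono by blast
qed

subsection \<open>Counters, relations and the flag\<close>

text \<open>A counter has its head on the cell given by its value; the cells 0 and \<open>N\<close> are marked. The tape
  of a relation holds its characteristic function, in a linear arrangement, with a marker to the
  left of the first cell.\<close>

text \<open>The tapes are the input, the flag that holds truth values, a scratch counter, one counter for each
  variable, one counter for each power in an offset \<open>N ^ j\<close>, and one tape for each
  relation.\<close>

datatype tid = InT | FlT | ScT | CtT nat | PwT nat | RlT nat

definition ctr :: "nat \<Rightarrow> nat \<Rightarrow> tape" where
  "ctr N v = (\<lambda>i. if i = 0 then 1 else if i = int N then 2 else 0, int v)"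

definition rlt :: "(nat \<Rightarrow> bool) \<Rightarrow> int \<Rightarrow> tape" where
  "rlt B h = (\<lambda>i. if i = -1 then 2 else if 0 \<le> i \<and> B (nat i) then 1 else 0, h)"

definition flg :: "bool \<Rightarrow> tape" where
  "flg b = (\<lambda>i. if i = 0 \<and> b then 1 else 0, 0)"

text \<open>The tapes between two commands: all heads of relations are on their first cell, and the counters
  that do not hold a variable are zero.\<close>

fun st :: "nat \<Rightarrow> tape \<Rightarrow> env \<Rightarrow> (nat \<Rightarrow> nat \<Rightarrow> bool) \<Rightarrow> bool \<Rightarrow> tid tapes" where
  "st N ip \<rho> \<beta> b InT = ip"
| "st N ip \<rho> \<beta> b FlT = flg b"
| "st N ip \<rho> \<beta> b ScT = ctr N 0"
| "st N ip \<rho> \<beta> b (CtT x) = ctr N (\<rho> x)"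
| "st N ip \<rho> \<beta> b (PwT j) = ctr N 0"
| "st N ip \<rho> \<beta> b (RlT R) = rlt (\<beta> R) 0"

lemma ctr_read: "0 < N \<Longrightarrow> tape_read (ctr N v) = (if v = 0 then 1 else if v = N then 2 else 0)"
  by (simp add: ctr_def)

lemma act_move: "tape_act (tape_read p, d) p = (fst p, move_head d (snd p))"
  by (cases p) simp

lemma ctr_left [simp]: "0 < v \<Longrightarrow> tape_act (tape_read (ctr N v), Left) (ctr N v) = ctr N (v - 1)"
  unfolding act_move by (auto simp: ctr_def)

lemma ctr_right [simp]: "tape_act (tape_read (ctr N v), Right) (ctr N v) = ctr N (Suc v)"
  unfolding act_move by (auto simp: ctr_def)

lemma rlt_read: "-1 \<le> h \<Longrightarrow> tape_read (rlt B h) = (if h = -1 then 2 else if B (nat h) then 1 else 0)"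
  by (auto simp: rlt_def)

lemma rlt_move [simp]: "tape_act (tape_read (rlt B h), d) (rlt B h) = rlt B (move_head d h)"
  unfolding act_move by (simp add: rlt_def)

lemma runs_dec:
  "s i = ctr N v \<Longrightarrow> 0 < v \<Longrightarrow> s' = s(i := ctr N (v - 1)) \<Longrightarrow> runs (Move i Left) s 1 s'"
  by (rule runs_Move) simp_all

lemma runs_shift:
  "s i = rlt B h \<Longrightarrow> s' = s(i := rlt B (move_head d h)) \<Longrightarrow> runs (Move i d) s 1 s'"
  by (rule runs_Move) simp_all

lemma rlt_write:
  "tape_act (if b then Suc 0 else 0, Stay) (rlt B (int h)) = rlt (B(h := b)) (int h)"
  by (auto simp: rlt_def fun_eq_iff)

lemma flg_read [simp]: "tape_read (flg b) = (if b then 1 else 0)"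
  by (simp add: flg_def)

lemma flg_write_0 [simp]: "tape_act (0, Stay) (flg b') = flg False"
  and flg_write_1 [simp]: "tape_act (Suc 0, Stay) (flg b') = flg True"
  by (auto simp: flg_def fun_eq_iff)

lemma runs_ctr_zero:
  assumes "0 < N" "s i = ctr N v" "v * 3 + 1 \<le> U"
  shows "runs (Until i 1 (Move i Left)) s U (s(i := ctr N 0))"
proof (rule runs_Until_fun[where S = "\<lambda>u. s(i := ctr N (v - u))" and n = v and T = 1])
  fix u assume u: "u < v"
  have "runs (Move i Left) (s(i := ctr N (v - u))) 1 (s(i := ctr N (v - Suc u)))"
    by (rule runs_dec[where N = N and v = "v - u"]) (use u in auto)
  then show "tape_read ((s(i := ctr N (v - u))) i) \<noteq> 1 \<and>
      runs (Move i Left) (s(i := ctr N (v - u))) 1 (s(i := ctr N (v - Suc u)))"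
    using u assms(1) by (simp add: ctr_read)
qed (use assms in \<open>auto simp: ctr_read\<close>)

text \<open>Runs \<open>c\<close> with the counter \<open>i\<close> going through \<open>0, \<dots>, N -
  1\<close>, and resets the counter to zero.\<close>

definition for_prog :: "'i \<Rightarrow> 'i prog \<Rightarrow> 'i prog" where
  "for_prog i c =
     Seq (Until i 2 (Seq c (Move i Right))) (Seq (Move i Left) (Until i 1 (Move i Left)))"

lemma runs_for:
  assumes "0 < N" "P 0 s"
    and step: "\<And>v s. v < N \<Longrightarrow> P v s \<Longrightarrow>
      \<exists>s'. runs c s T s' \<and> s' i = ctr N v \<and> P (Suc v) (s'(i := ctr N (Suc v)))"
    and ctr: "\<And>v s. v \<le> N \<Longrightarrow> P v s \<Longrightarrow> s i = ctr N v"
  shows "\<exists>s'. P N s' \<and> runs (for_prog i c) s (N * (T + 6) + 3) (s'(i := ctr N 0))"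
proof -
  have "\<exists>s'. P N s' \<and> runs (Until i 2 (Seq c (Move i Right))) s (N * ((T + 1) + 2) + 1) s'"
  proof (rule runs_Until)
    fix v s assume v: "v < N" "P v s"
    obtain s' where s': "runs c s T s'" "s' i = ctr N v" "P (Suc v) (s'(i := ctr N (Suc v)))"
      using step v by blast
    have "runs (Seq c (Move i Right)) s (T + 1) (s'(i := ctr N (Suc v)))"
      using s' by (auto intro!: runs_Seq runs_Move)
    then show "tape_read (s i) \<noteq> 2 \<and>
        (\<exists>s'. runs (Seq c (Move i Right)) s (T + 1) s' \<and> P (Suc v) s')"
      using ctr[of v s] v s' by (auto simp: ctr_read)
  next
    fix s assume "P N s"
    then have "s i = ctr N N" using ctr by blast
    then show "tape_read (s i) = 2" using assms(1) by (simp add: ctr_read)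
  qed fact
  then obtain s' where s': "P N s'"
    "runs (Until i 2 (Seq c (Move i Right))) s (N * ((T + 1) + 2) + 1) s'" by blast
  have "runs (Move i Left) s' 1 (s'(i := ctr N (N - 1)))"
    by (rule runs_Move) (use ctr[OF _ s'(1)] assms(1) in auto)
  moreover have "runs (Until i 1 (Move i Left)) (s'(i := ctr N (N - 1))) (N * 3 + 1) (s'(i := ctr N 0))"
    using runs_ctr_zero[OF assms(1), of "s'(i := ctr N (N - 1))" i "N - 1"] by simp
  ultimately have "runs (for_prog i c) s (N * (T + 6) + 3) (s'(i := ctr N 0))"
    unfolding for_prog_def using s'(2)
    by (fastforce intro!: runs_Seq simp: algebra_simps)
  then show ?thesis using s' by blast
qed

lemma runs_for_fun:
  assumes "0 < N" and "\<And>v. v < N \<Longrightarrow> runs c (S v) T (S' v)"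
    and "\<And>v. v < N \<Longrightarrow> S' v i = ctr N v" "\<And>v. v < N \<Longrightarrow> S (Suc v) = (S' v)(i := ctr N (Suc v))"
    and "\<And>v. v \<le> N \<Longrightarrow> S v i = ctr N v" "s = S 0" "s' = (S N)(i := ctr N 0)"
    and "N * (T + 6) + 3 \<le> U"
  shows "runs (for_prog i c) s U s'"
proof -
  have "\<exists>s'. s' = S N \<and> runs (for_prog i c) s (N * (T + 6) + 3) (s'(i := ctr N 0))"
    by (rule runs_for) (use assms in auto)
  then show ?thesis using assms by (auto intro: runs_mono)
qed

subsection \<open>Access to relations\<close>

text \<open>The tuple \<open>xs\<close> over \<open>{..<N}\<close> is stored in cell \<open>idx N xs\<close>.\<close>

fun idx :: "nat \<Rightarrow> nat list \<Rightarrow> nat" where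
  "idx N [] = 0"
| "idx N (x # xs) = x + N * idx N xs"

lemma idx_less: "set xs \<subseteq> {..<N} \<Longrightarrow> idx N xs < N ^ length xs"
proof (induction xs)
  case (Cons x xs)
  then have "Suc (idx N xs) \<le> N ^ length xs" by auto
  then have "N * Suc (idx N xs) \<le> N * N ^ length xs" using mult_le_mono2 by blast
  with Cons show ?case by auto
qed simp

lemma idx_inj:
  "length xs = length ys \<Longrightarrow> set xs \<subseteq> {..<N} \<Longrightarrow> set ys \<subseteq> {..<N} \<Longrightarrow> idx N xs = idx N ys \<Longrightarrow> xs = ys"
proof (induction xs ys rule: list_induct2)
  case (Cons x xs y ys)
  then have l: "x < N" "y < N" by auto
  have "(x + N * idx N xs) mod N = (y + N * idx N ys) mod N" using Cons by simp
  then have "x = y" using l by simp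
  with Cons show ?case using l by auto
qed simp

text \<open>Moves the head of \<open>R\<close> by \<open>N ^ j\<close> cells.\<close>

fun pow_move :: "nat \<Rightarrow> nat \<Rightarrow> tid prog" where
  "pow_move R 0 = Move (RlT R) Right"
| "pow_move R (Suc j) = for_prog (PwT j) (pow_move R j)"

fun pow_time :: "nat \<Rightarrow> nat \<Rightarrow> nat" where
  "pow_time 0 N = 1"
| "pow_time (Suc j) N = N * (pow_time j N + 6) + 3"

lemma runs_pow_move:
  assumes "0 < N" "s (RlT R) = rlt B h" "\<And>i. i < j \<Longrightarrow> s (PwT i) = ctr N 0"
  shows "runs (pow_move R j) s (pow_time j N) (s(RlT R := rlt B (h + int (N ^ j))))"
  using assms
proof (induction j arbitrary: s h)
  case 0
  then show ?case by (auto intro!: runs_Move)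
next
  case (Suc j)
  let ?S = "\<lambda>v. s(PwT j := ctr N v, RlT R := rlt B (h + int (v * N ^ j)))"
  let ?S' = "\<lambda>v. s(PwT j := ctr N v, RlT R := rlt B (h + int (v * N ^ j) + int (N ^ j)))"
  have 1: "runs (pow_move R j) (?S v) (pow_time j N) (?S' v)" for v
  proof -
    have "runs (pow_move R j) (?S v) (pow_time j N)
        ((?S v)(RlT R := rlt B (h + int (v * N ^ j) + int (N ^ j))))"
      by (rule Suc.IH) (use Suc.prems in auto)
    then show ?thesis by (simp only: fun_upd_upd)
  qed
  have 2: "?S (Suc v) = (?S' v)(PwT j := ctr N (Suc v))" for v
    by (rule ext) (simp add: algebra_simps)
  have 3: "s = ?S 0" "s(RlT R := rlt B (h + int (N ^ Suc j))) = (?S N)(PwT j := ctr N 0)"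
    by (rule ext, use Suc.prems in auto)+
  show ?case unfolding pow_move.simps pow_time.simps
    by (rule runs_for_fun[where N = N and T = "pow_time j N" and S = ?S and S' = ?S'])
      (use Suc.prems(1) 1 2 3 in auto)
qed

text \<open>Moves the head of \<open>R\<close> by the value of \<open>x\<close> times \<open>N ^ j\<close> cells. The counter \<open>x\<close> is emptied into
  \<open>ScT\<close> and restored afterwards.\<close>

definition mul_move :: "nat \<Rightarrow> nat \<Rightarrow> nat \<Rightarrow> tid prog" where
  "mul_move R x j =
     Seq (Until (CtT x) 1 (Seq (Move (CtT x) Left) (Seq (pow_move R j) (Move ScT Right))))
         (Until ScT 1 (Seq (Move ScT Left) (Move (CtT x) Right)))"

definition mul_time :: "nat \<Rightarrow> nat \<Rightarrow> nat" where
  "mul_time j N = N * (pow_time j N + 4) + 1 + (N * 4 + 1)"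

lemma runs_mul_move:
  assumes "0 < N" "s (RlT R) = rlt B h" "\<And>i. s (PwT i) = ctr N 0" "s ScT = ctr N 0"
    and "s (CtT x) = ctr N v" "v < N"
  shows "runs (mul_move R x j) s (mul_time j N) (s(RlT R := rlt B (h + int (v * N ^ j))))"
proof -
  let ?S = "\<lambda>u. s(CtT x := ctr N (v - u), ScT := ctr N u, RlT R := rlt B (h + int (u * N ^ j)))"
  let ?S' = "\<lambda>u. s(CtT x := ctr N u, ScT := ctr N (v - u), RlT R := rlt B (h + int (v * N ^ j)))"
  have "runs (Seq (Move (CtT x) Left) (Seq (pow_move R j) (Move ScT Right))) (?S u)
      (pow_time j N + 2) (?S (Suc u))" if "u < v" for u
  proof -
    let ?s1 = "(?S u)(CtT x := ctr N (v - Suc u))"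
    have "runs (Move (CtT x) Left) (?S u) 1 ?s1"
      by (rule runs_Move) (use that in \<open>auto simp: fun_eq_iff\<close>)
    moreover have "runs (pow_move R j) ?s1 (pow_time j N)
        (?s1(RlT R := rlt B (h + int (u * N ^ j) + int (N ^ j))))"
      by (rule runs_pow_move) (use assms in auto)
    moreover have "runs (Move ScT Right) (?s1(RlT R := rlt B (h + int (u * N ^ j) + int (N ^ j)))) 1
        (?S (Suc u))"
      by (rule runs_Move) (auto simp: fun_eq_iff algebra_simps)
    ultimately show ?thesis by (fastforce intro!: runs_Seq)
  qed
  then have 1: "runs (Until (CtT x) 1 (Seq (Move (CtT x) Left) (Seq (pow_move R j) (Move ScT Right))))
      (?S 0) (v * (pow_time j N + 2 + 2) + 1) (?S v)"
    by (intro runs_Until_fun[where S = ?S and n = v]) (use assms in \<open>auto simp: ctr_read\<close>)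
  have 2: "runs (Until ScT 1 (Seq (Move ScT Left) (Move (CtT x) Right))) (?S' 0)
      (v * (2 + 2) + 1) (?S' v)"
  proof (rule runs_Until_fun[where S = ?S' and n = v and T = 2])
    fix u assume "u < v"
    then have "runs (Seq (Move ScT Left) (Move (CtT x) Right)) (?S' u) 2 (?S' (Suc u))"
      by (intro runs_Seq[where s' = "(?S' u)(ScT := ctr N (v - Suc u))" and T = 1 and U = 1] runs_Move)
        (auto simp: fun_eq_iff)
    with \<open>u < v\<close> show "tape_read (?S' u ScT) \<noteq> 1 \<and>
        runs (Seq (Move ScT Left) (Move (CtT x) Right)) (?S' u) 2 (?S' (Suc u))"
      using assms by (simp add: ctr_read)
  qed (use assms in \<open>auto simp: ctr_read\<close>)
  have 3: "?S v = ?S' 0" by simp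
  have 4: "?S 0 = s" "?S' v = s(RlT R := rlt B (h + int (v * N ^ j)))"
    using assms by (auto simp: fun_eq_iff)
  have 5: "v * (pow_time j N + 2 + 2) + 1 + (v * (2 + 2) + 1) \<le> mul_time j N"
  proof -
    have "v * (pow_time j N + 4) \<le> N * (pow_time j N + 4)" "v * 4 \<le> N * 4"
      using assms(6) by (auto intro: mult_le_mono1)
    then show ?thesis unfolding mul_time_def by (simp add: algebra_simps)
  qed
  show ?thesis unfolding mul_move_def
    by (rule runs_Seq[OF 1[unfolded 3 4(1)] 2[unfolded 4(2)] 5])
qed

text \<open>Moves the head of \<open>R\<close> to the cell of the tuple \<open>xs\<close>, scaled by \<open>N ^
  j\<close>, and continues with \<open>c\<close>.\<close>

fun seek :: "nat \<Rightarrow> nat \<Rightarrow> nat list \<Rightarrow> tid prog \<Rightarrow> tid prog" where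
  "seek R j [] c = c"
| "seek R j (x # xs) c = Seq (mul_move R x j) (seek R (Suc j) xs c)"

fun seek_time :: "nat \<Rightarrow> nat \<Rightarrow> nat \<Rightarrow> nat" where
  "seek_time j 0 N = 0"
| "seek_time j (Suc d) N = mul_time j N + seek_time (Suc j) d N"

lemma runs_seek:
  assumes "0 < N" "s (RlT R) = rlt B h" "\<And>i. s (PwT i) = ctr N 0" "s ScT = ctr N 0"
    and "\<And>x. x \<in> set xs \<Longrightarrow> s (CtT x) = ctr N (\<rho> x) \<and> \<rho> x < N"
    and "runs c (s(RlT R := rlt B (h + int (N ^ j * idx N (map \<rho> xs))))) T s'"
  shows "runs (seek R j xs c) s (seek_time j (length xs) N + T) s'"
  using assms
proof (induction xs arbitrary: s j h)
  case Nil
  then have "s = s(RlT R := rlt B h)" by auto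
  with Nil show ?case by simp
next
  case (Cons x xs)
  let ?s = "s(RlT R := rlt B (h + int (\<rho> x * N ^ j)))"
  have 1: "runs (mul_move R x j) s (mul_time j N) ?s"
    using Cons.prems by (intro runs_mul_move) auto
  have "runs (seek R (Suc j) xs c) ?s (seek_time (Suc j) (length xs) N + T) s'"
  proof (rule Cons.IH)
    have "h + int (\<rho> x * N ^ j) + int (N ^ Suc j * idx N (map \<rho> xs)) =
        h + int (N ^ j * idx N (map \<rho> (x # xs)))" by (simp add: algebra_simps)
    then show "runs c (?s(RlT R := rlt B (h + int (\<rho> x * N ^ j) +
        int (N ^ Suc j * idx N (map \<rho> xs))))) T s'"
      using Cons.prems(6) by (simp only: fun_upd_upd)
  qed (use Cons.prems in auto)
  with 1 show ?case by (auto intro: runs_Seq)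
qed

text \<open>Moves the head of \<open>R\<close> back to its first cell, to the right of the marker.\<close>

definition home :: "nat \<Rightarrow> tid prog" where
  "home R = Seq (Until (RlT R) 2 (Move (RlT R) Left)) (Move (RlT R) Right)"

lemma runs_home:
  assumes "s (RlT R) = rlt B (int h)" "h * 3 + 6 \<le> T"
  shows "runs (home R) s T (s(RlT R := rlt B 0))"
  unfolding home_def
proof (rule runs_Seq)
  show "runs (Until (RlT R) 2 (Move (RlT R) Left)) s (Suc h * (1 + 2) + 1) (s(RlT R := rlt B (-1)))"
  proof (rule runs_Until_fun[where S = "\<lambda>u. s(RlT R := rlt B (int h - int u))" and n = "Suc h"])
    fix u assume u: "u < Suc h"
    have "runs (Move (RlT R) Left) (s(RlT R := rlt B (int h - int u))) 1
        (s(RlT R := rlt B (int h - int (Suc u))))"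
      by (rule runs_shift[where B = B and h = "int h - int u"]) (simp_all add: algebra_simps)
    then show "tape_read ((s(RlT R := rlt B (int h - int u))) (RlT R)) \<noteq> 2 \<and>
        runs (Move (RlT R) Left) (s(RlT R := rlt B (int h - int u))) 1
          (s(RlT R := rlt B (int h - int (Suc u))))"
      using u by (simp add: rlt_read)
  qed (use assms in \<open>auto simp: rlt_read\<close>)
  show "runs (Move (RlT R) Right) (s(RlT R := rlt B (-1))) 1 (s(RlT R := rlt B 0))"
    by (rule runs_Move) auto
qed (use assms in auto)

text \<open>Copying the entry of \<open>R\<close> at \<open>xs\<close> to the flag, and the flag to that
  entry.\<close>

definition rd :: "nat \<Rightarrow> nat list \<Rightarrow> tid prog" where
  "rd R xs = seek R 0 xs (Seq (Cond (RlT R) 1 (Write FlT 1) (Write FlT 0)) (home R))"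

definition wr :: "nat \<Rightarrow> nat list \<Rightarrow> tid prog" where
  "wr R xs = seek R 0 xs (Seq (Cond FlT 1 (Write (RlT R) 1) (Write (RlT R) 0)) (home R))"

definition acc_time :: "nat \<Rightarrow> nat \<Rightarrow> nat" where
  "acc_time d N = seek_time 0 d N + (N ^ d * 3 + 9)"

lemma runs_rd:
  assumes "0 < N" "\<And>x. x \<in> set xs \<Longrightarrow> \<rho> x < N"
  shows "runs (rd R xs) (st N ip \<rho> \<beta> b) (acc_time (length xs) N) (st N ip \<rho> \<beta> (\<beta> R (idx N (map \<rho> xs))))"
proof -
  let ?h = "idx N (map \<rho> xs)"
  let ?s = "(st N ip \<rho> \<beta> b)(RlT R := rlt (\<beta> R) (int ?h))"
  let ?s' = "(st N ip \<rho> \<beta> (\<beta> R ?h))(RlT R := rlt (\<beta> R) (int ?h))"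
  have h: "?h < N ^ length xs" using idx_less[of "map \<rho> xs" N] assms(2) by auto
  have fl: "?s(FlT := flg (\<beta> R ?h)) = ?s'"
    by (rule ext) (rename_tac t, case_tac t, auto)
  have "runs (Cond (RlT R) 1 (Write FlT 1) (Write FlT 0)) ?s 3 ?s'"
    unfolding fl[symmetric]
    by (rule runs_Cond[where T = 1]) (auto intro!: runs_Write simp: rlt_read split: if_splits)
  moreover have "runs (home R) ?s' (N ^ length xs * 3 + 6) (?s'(RlT R := rlt (\<beta> R) 0))"
    by (rule runs_home[where h = ?h]) (use h in auto)
  moreover have "?s'(RlT R := rlt (\<beta> R) 0) = st N ip \<rho> \<beta> (\<beta> R ?h)"
    by (rule ext) (rename_tac t, case_tac t, auto)
  ultimately have "runs (Seq (Cond (RlT R) 1 (Write FlT 1) (Write FlT 0)) (home R)) ?s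
      (N ^ length xs * 3 + 9) (st N ip \<rho> \<beta> (\<beta> R ?h))"
    by (fastforce intro: runs_Seq)
  then show ?thesis unfolding rd_def acc_time_def
    by (intro runs_seek[where B = "\<beta> R" and h = 0 and \<rho> = \<rho>]) (use assms in auto)
qed

lemma runs_wr:
  assumes "0 < N" "\<And>x. x \<in> set xs \<Longrightarrow> \<rho> x < N"
  shows "runs (wr R xs) (st N ip \<rho> \<beta> b) (acc_time (length xs) N)
    (st N ip \<rho> (\<beta>(R := (\<beta> R)(idx N (map \<rho> xs) := b))) b)"
proof -
  let ?h = "idx N (map \<rho> xs)"
  let ?s = "(st N ip \<rho> \<beta> b)(RlT R := rlt (\<beta> R) (int ?h))"
  let ?s' = "(st N ip \<rho> \<beta> b)(RlT R := rlt ((\<beta> R)(?h := b)) (int ?h))"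
  have h: "?h < N ^ length xs" using idx_less[of "map \<rho> xs" N] assms(2) by auto
  have "runs (Cond FlT 1 (Write (RlT R) 1) (Write (RlT R) 0)) ?s 3 ?s'"
    using rlt_write[of b "\<beta> R" ?h]
    by (intro runs_Cond[where T = 1]) (auto intro!: runs_Write split: if_splits)
  moreover have "runs (home R) ?s' (N ^ length xs * 3 + 6) (?s'(RlT R := rlt ((\<beta> R)(?h := b)) 0))"
    by (rule runs_home[where h = ?h]) (use h in auto)
  moreover have "?s'(RlT R := rlt ((\<beta> R)(?h := b)) 0) = st N ip \<rho> (\<beta>(R := (\<beta> R)(?h := b))) b"
    by (rule ext) (rename_tac t, case_tac t, auto)
  ultimately have "runs (Seq (Cond FlT 1 (Write (RlT R) 1) (Write (RlT R) 0)) (home R)) ?s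
      (N ^ length xs * 3 + 9) (st N ip \<rho> (\<beta>(R := (\<beta> R)(?h := b))) b)"
    by (fastforce intro: runs_Seq)
  then show ?thesis unfolding wr_def acc_time_def
    by (intro runs_seek[where B = "\<beta> R" and h = 0 and \<rho> = \<rho>]) (use assms in auto)
qed

subsection \<open>Compiling formulas and programs\<close>

text \<open>A formula is compiled to a program that leaves its truth value in the flag; a command may change the
  flag in any way.\<close>

fun cfm :: "fm \<Rightarrow> tid prog" where
  "cfm Tr = Write FlT 1"
| "cfm (Rel R xs) = rd R xs"
| "cfm (Neg \<phi>) = Seq (cfm \<phi>) (Cond FlT 1 (Write FlT 0) (Write FlT 1))"
| "cfm (And \<phi> \<psi>) = Seq (cfm \<phi>) (Cond FlT 1 (cfm \<psi>) (Write FlT 0))"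
| "cfm (Ex x \<phi>) = Seq (Write FlT 0) (for_prog (CtT x) (Cond FlT 1 (Write FlT 1) (cfm \<phi>)))"

fun fm_time :: "fm \<Rightarrow> nat \<Rightarrow> nat" where
  "fm_time Tr N = 1"
| "fm_time (Rel R xs) N = acc_time (length xs) N"
| "fm_time (Neg \<phi>) N = fm_time \<phi> N + 3"
| "fm_time (And \<phi> \<psi>) N = fm_time \<phi> N + (fm_time \<psi> N + 3)"
| "fm_time (Ex x \<phi>) N = 1 + (N * (fm_time \<phi> N + 3 + 6) + 3)"

fun ccmd :: "cmd \<Rightarrow> tid prog" where
  "ccmd Skip = Write FlT 0"
| "ccmd (Set R xs \<phi>) = Seq (cfm \<phi>) (wr R xs)"
| "ccmd (Comp c d) = Seq (ccmd c) (ccmd d)"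
| "ccmd (For x c) = for_prog (CtT x) (ccmd c)"
| "ccmd (If \<phi> c) = Seq (cfm \<phi>) (Cond FlT 1 (ccmd c) (Write FlT 0))"

fun cmd_time :: "cmd \<Rightarrow> nat \<Rightarrow> nat" where
  "cmd_time Skip N = 1"
| "cmd_time (Set R xs \<phi>) N = fm_time \<phi> N + acc_time (length xs) N"
| "cmd_time (Comp c d) N = cmd_time c N + cmd_time d N"
| "cmd_time (For x c) N = N * (cmd_time c N + 6) + 3"
| "cmd_time (If \<phi> c) N = fm_time \<phi> N + (cmd_time c N + 3)"

text \<open>The linear arrangements \<open>\<beta>\<close> represent the relations \<open>\<sigma>\<close> on
  the tuples over \<open>{..<N}\<close> of the right length.\<close>

definition repr :: "nat \<Rightarrow> (nat \<Rightarrow> nat) \<Rightarrow> (nat \<Rightarrow> nat \<Rightarrow> bool) \<Rightarrow> store \<Rightarrow> bool" where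
  "repr N ar \<beta> \<sigma> \<longleftrightarrow> (\<forall>R xs. length xs = ar R \<and> set xs \<subseteq> {..<N} \<longrightarrow> \<beta> R (idx N xs) = \<sigma> R xs)"

lemma st_flag: "(st N ip \<rho> \<beta> b)(FlT := flg b') = st N ip \<rho> \<beta> b'"
  by (rule ext) (rename_tac t, case_tac t, auto)

lemma st_ctr: "(st N ip \<rho> \<beta> b)(CtT x := ctr N v) = st N ip (\<rho>(x := v)) \<beta> b"
  by (rule ext) (rename_tac t, case_tac t, auto)

lemma st_read_flag: "tape_read (st N ip \<rho> \<beta> b FlT) = 1 \<longleftrightarrow> b"
  by simp

lemma runs_cfm:
  assumes "0 < N" "repr N ar \<beta> \<sigma>"
  shows "wff ar V \<phi> \<Longrightarrow> (\<And>x. \<rho> x < N) \<Longrightarrow> (\<And>x. x \<notin> V \<Longrightarrow> \<rho> x = 0) \<Longrightarrow>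
    runs (cfm \<phi>) (st N ip \<rho> \<beta> b) (fm_time \<phi> N) (st N ip \<rho> \<beta> (holds N \<sigma> \<rho> \<phi>))"
proof (induction \<phi> arbitrary: \<rho> V b)
  case Tr
  then show ?case by (auto intro!: runs_Write simp: st_flag)
next
  case (Rel R xs)
  then have "length (map \<rho> xs) = ar R \<and> set (map \<rho> xs) \<subseteq> {..<N}" by auto
  then have "\<beta> R (idx N (map \<rho> xs)) = \<sigma> R (map \<rho> xs)"
    using assms(2)[unfolded repr_def, rule_format, of "map \<rho> xs" R] by simp
  then show ?case using runs_rd[OF assms(1), of xs \<rho> R ip \<beta> b] Rel by simp
next
  case (Neg \<phi>)
  have "runs (Cond FlT 1 (Write FlT 0) (Write FlT 1)) (st N ip \<rho> \<beta> (holds N \<sigma> \<rho> \<phi>)) 3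
      (st N ip \<rho> \<beta> (\<not> holds N \<sigma> \<rho> \<phi>))"
    by (rule runs_Cond[where T = 1]) (auto intro!: runs_Write simp: st_flag split: if_splits)
  moreover have "runs (cfm \<phi>) (st N ip \<rho> \<beta> b) (fm_time \<phi> N) (st N ip \<rho> \<beta> (holds N \<sigma> \<rho> \<phi>))"
    by (rule Neg.IH) (use Neg.prems in auto)
  ultimately show ?case by (simp add: runs_Seq[OF _ _ order_refl])
next
  case (And \<phi> \<psi>)
  have "runs (Cond FlT 1 (cfm \<psi>) (Write FlT 0)) (st N ip \<rho> \<beta> (holds N \<sigma> \<rho> \<phi>)) (fm_time \<psi> N + 3)
      (st N ip \<rho> \<beta> (holds N \<sigma> \<rho> (And \<phi> \<psi>)))"
  proof (rule runs_Cond[where T = "fm_time \<psi> N + 1"])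
    assume "tape_read (st N ip \<rho> \<beta> (holds N \<sigma> \<rho> \<phi>) FlT) = 1"
    then have "holds N \<sigma> \<rho> \<phi>" unfolding st_read_flag .
    moreover have "runs (cfm \<psi>) (st N ip \<rho> \<beta> (holds N \<sigma> \<rho> \<phi>)) (fm_time \<psi> N) (st N ip \<rho> \<beta> (holds N \<sigma> \<rho> \<psi>))"
      by (rule And.IH(2)) (use And.prems in auto)
    ultimately show "runs (cfm \<psi>) (st N ip \<rho> \<beta> (holds N \<sigma> \<rho> \<phi>)) (fm_time \<psi> N + 1)
        (st N ip \<rho> \<beta> (holds N \<sigma> \<rho> (And \<phi> \<psi>)))"
      by (auto intro: runs_mono)
  next
    assume "tape_read (st N ip \<rho> \<beta> (holds N \<sigma> \<rho> \<phi>) FlT) \<noteq> 1"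
    then have "\<not> holds N \<sigma> \<rho> \<phi>" unfolding st_read_flag .
    then show "runs (Write FlT 0) (st N ip \<rho> \<beta> (holds N \<sigma> \<rho> \<phi>)) (fm_time \<psi> N + 1)
        (st N ip \<rho> \<beta> (holds N \<sigma> \<rho> (And \<phi> \<psi>)))"
      by (auto intro!: runs_Write simp: st_flag)
  qed simp
  moreover have "runs (cfm \<phi>) (st N ip \<rho> \<beta> b) (fm_time \<phi> N) (st N ip \<rho> \<beta> (holds N \<sigma> \<rho> \<phi>))"
    by (rule And.IH(1)) (use And.prems in auto)
  ultimately show ?case unfolding cfm.simps fm_time.simps by (rule runs_Seq[OF _ _ order_refl, rotated])
next
  case (Ex x \<phi>)
  let ?b = "\<lambda>v. \<exists>u<v. holds N \<sigma> (\<rho>(x := u)) \<phi>"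
  have x: "\<rho> x = 0" using Ex.prems by auto
  have "runs (for_prog (CtT x) (Cond FlT 1 (Write FlT 1) (cfm \<phi>))) (st N ip \<rho> \<beta> False)
      (N * (fm_time \<phi> N + 3 + 6) + 3) (st N ip \<rho> \<beta> (?b N))"
  proof (rule runs_for_fun[where T = "fm_time \<phi> N + 3" and N = N and
        S = "\<lambda>v. st N ip (\<rho>(x := v)) \<beta> (?b v)" and S' = "\<lambda>v. st N ip (\<rho>(x := v)) \<beta> (?b (Suc v))"])
    fix v assume v: "v < N"
    show "runs (Cond FlT 1 (Write FlT 1) (cfm \<phi>)) (st N ip (\<rho>(x := v)) \<beta> (?b v)) (fm_time \<phi> N + 3)
        (st N ip (\<rho>(x := v)) \<beta> (?b (Suc v)))"
    proof (rule runs_Cond[where T = "fm_time \<phi> N + 1"])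
      assume "tape_read (st N ip (\<rho>(x := v)) \<beta> (?b v) FlT) = 1"
      then have "?b v" unfolding st_read_flag .
      then have *: "?b (Suc v) = True" using less_SucI by blast
      show "runs (Write FlT 1) (st N ip (\<rho>(x := v)) \<beta> (?b v)) (fm_time \<phi> N + 1)
          (st N ip (\<rho>(x := v)) \<beta> (?b (Suc v)))"
        unfolding * by (auto intro!: runs_Write simp: st_flag)
    next
      assume "tape_read (st N ip (\<rho>(x := v)) \<beta> (?b v) FlT) \<noteq> 1"
      then have "\<not> ?b v" unfolding st_read_flag .
      then have *: "?b (Suc v) = holds N \<sigma> (\<rho>(x := v)) \<phi>" by (auto simp: less_Suc_eq)
      have "runs (cfm \<phi>) (st N ip (\<rho>(x := v)) \<beta> (?b v)) (fm_time \<phi> N)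
          (st N ip (\<rho>(x := v)) \<beta> (holds N \<sigma> (\<rho>(x := v)) \<phi>))"
        by (rule Ex.IH[where V = "insert x V"]) (use Ex.prems v in auto)
      then show "runs (cfm \<phi>) (st N ip (\<rho>(x := v)) \<beta> (?b v)) (fm_time \<phi> N + 1)
          (st N ip (\<rho>(x := v)) \<beta> (?b (Suc v)))"
        unfolding * by (rule runs_mono) simp
    qed simp
  next
    show "st N ip \<rho> \<beta> False = st N ip (\<rho>(x := 0)) \<beta> (?b 0)"
      using x by (simp add: fun_upd_idem)
    show "st N ip \<rho> \<beta> (?b N) = (st N ip (\<rho>(x := N)) \<beta> (?b N))(CtT x := ctr N 0)"
      using x by (simp add: st_ctr fun_upd_idem)
  qed (use assms in \<open>auto simp: st_ctr\<close>)
  moreover have "runs (Write FlT 0) (st N ip \<rho> \<beta> b) 1 (st N ip \<rho> \<beta> False)"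
    by (auto intro!: runs_Write simp: st_flag)
  ultimately show ?case unfolding cfm.simps fm_time.simps holds.simps
    by (rule runs_Seq[OF _ _ order_refl, rotated])
qed

lemma repr_update:
  assumes "repr N ar \<beta> \<sigma>" "length ys = ar R" "set ys \<subseteq> {..<N}"
  shows "repr N ar (\<beta>(R := (\<beta> R)(idx N ys := b))) (\<sigma>(R := (\<sigma> R)(ys := b)))"
  unfolding repr_def
proof (intro allI impI)
  fix R' xs assume xs: "length xs = ar R' \<and> set xs \<subseteq> {..<N}"
  have "idx N xs = idx N ys \<longleftrightarrow> xs = ys" if "R' = R"
    using idx_inj[of xs ys N] xs assms(2,3) that by auto
  then show "(\<beta>(R := (\<beta> R)(idx N ys := b))) R' (idx N xs) = (\<sigma>(R := (\<sigma> R)(ys := b))) R' xs"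
    using assms(1) xs unfolding repr_def by auto
qed

lemma runs_ccmd:
  assumes "0 < N"
  shows "wfc ar V c \<Longrightarrow> (\<And>x. \<rho> x < N) \<Longrightarrow> (\<And>x. x \<notin> V \<Longrightarrow> \<rho> x = 0) \<Longrightarrow> repr N ar \<beta> \<sigma> \<Longrightarrow>
    \<exists>\<beta>' b'. runs (ccmd c) (st N ip \<rho> \<beta> b) (cmd_time c N) (st N ip \<rho> \<beta>' b') \<and>
      repr N ar \<beta>' (exec N c \<rho> \<sigma>)"
proof (induction c arbitrary: \<rho> V b \<beta> \<sigma>)
  case Skip
  then show ?case
    by (intro exI[of _ \<beta>] exI[of _ False]) (auto intro!: runs_Write simp: st_flag)
next
  case (Set R xs \<phi>)
  let ?b = "holds N \<sigma> \<rho> \<phi>"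
  let ?\<beta> = "\<beta>(R := (\<beta> R)(idx N (map \<rho> xs) := ?b))"
  have "runs (cfm \<phi>) (st N ip \<rho> \<beta> b) (fm_time \<phi> N) (st N ip \<rho> \<beta> ?b)"
    by (rule runs_cfm) (use assms Set.prems in auto)
  moreover have "runs (wr R xs) (st N ip \<rho> \<beta> ?b) (acc_time (length xs) N) (st N ip \<rho> ?\<beta> ?b)"
    by (rule runs_wr) (use assms Set.prems in auto)
  moreover have "repr N ar ?\<beta> (exec N (Set R xs \<phi>) \<rho> \<sigma>)"
    unfolding exec.simps by (rule repr_update) (use Set.prems in auto)
  ultimately show ?case unfolding ccmd.simps cmd_time.simps by (blast intro: runs_Seq)
next
  case (Comp c d)
  obtain \<beta>1 b1 where 1: "runs (ccmd c) (st N ip \<rho> \<beta> b) (cmd_time c N) (st N ip \<rho> \<beta>1 b1)"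
    "repr N ar \<beta>1 (exec N c \<rho> \<sigma>)"
    using Comp.IH(1)[of V \<rho> \<beta> \<sigma> b] Comp.prems by auto
  obtain \<beta>2 b2 where "runs (ccmd d) (st N ip \<rho> \<beta>1 b1) (cmd_time d N) (st N ip \<rho> \<beta>2 b2)"
    "repr N ar \<beta>2 (exec N d \<rho> (exec N c \<rho> \<sigma>))"
    using Comp.IH(2)[of V \<rho> \<beta>1 "exec N c \<rho> \<sigma>" b1] Comp.prems 1 by auto
  with 1 show ?case unfolding ccmd.simps cmd_time.simps exec.simps by (blast intro: runs_Seq)
next
  case (For x c)
  let ?P = "\<lambda>v s. \<exists>\<beta>' b'. s = st N ip (\<rho>(x := v)) \<beta>' b' \<and>
      repr N ar \<beta>' (fold (\<lambda>v. exec N c (\<rho>(x := v))) [0..<v] \<sigma>)"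
  have x: "\<rho>(x := 0) = \<rho>" using For.prems by (auto simp: fun_upd_idem)
  have "\<exists>s'. ?P N s' \<and> runs (for_prog (CtT x) (ccmd c)) (st N ip \<rho> \<beta> b)
      (N * (cmd_time c N + 6) + 3) (s'(CtT x := ctr N 0))"
  proof (rule runs_for[where P = ?P])
    show "?P 0 (st N ip \<rho> \<beta> b)" using For.prems x by auto
  next
    fix v s assume v: "v < N" "?P v s"
    then obtain \<beta>1 b1 where 1: "s = st N ip (\<rho>(x := v)) \<beta>1 b1"
      "repr N ar \<beta>1 (fold (\<lambda>v. exec N c (\<rho>(x := v))) [0..<v] \<sigma>)" by blast
    have "\<exists>\<beta>' b'. runs (ccmd c) s (cmd_time c N) (st N ip (\<rho>(x := v)) \<beta>' b') \<and>
      repr N ar \<beta>' (exec N c (\<rho>(x := v)) (fold (\<lambda>v. exec N c (\<rho>(x := v))) [0..<v] \<sigma>))"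
      unfolding 1(1) by (rule For.IH[where V = "insert x V"]) (use For.prems v 1 in auto)
    then show "\<exists>s'. runs (ccmd c) s (cmd_time c N) s' \<and> s' (CtT x) = ctr N v \<and>
        ?P (Suc v) (s'(CtT x := ctr N (Suc v)))"
      by (force simp: st_ctr)
  qed (use assms in auto)
  then show ?case using x by (force simp: st_ctr)
next
  case (If \<phi> c)
  let ?b = "holds N \<sigma> \<rho> \<phi>"
  have 1: "runs (cfm \<phi>) (st N ip \<rho> \<beta> b) (fm_time \<phi> N) (st N ip \<rho> \<beta> ?b)"
    by (rule runs_cfm) (use assms If.prems in auto)
  have "\<exists>\<beta>' b'. runs (Cond FlT 1 (ccmd c) (Write FlT 0)) (st N ip \<rho> \<beta> ?b) (cmd_time c N + 3)
      (st N ip \<rho> \<beta>' b') \<and> repr N ar \<beta>' (exec N (If \<phi> c) \<rho> \<sigma>)"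
  proof (cases ?b)
    case True
    obtain \<beta>' b' where "runs (ccmd c) (st N ip \<rho> \<beta> ?b) (cmd_time c N) (st N ip \<rho> \<beta>' b')"
      "repr N ar \<beta>' (exec N c \<rho> \<sigma>)"
      using If.IH[of V \<rho> \<beta> \<sigma> ?b] If.prems by auto
    with True show ?thesis
      by (intro exI[of _ \<beta>'] exI[of _ b']) (auto intro!: runs_Cond[where T = "cmd_time c N + 1"] intro: runs_mono)
  next
    case False
    then show ?thesis using If.prems
      by (intro exI[of _ \<beta>] exI[of _ False])
        (auto intro!: runs_Cond[where T = "cmd_time c N + 1"] runs_Write simp: st_flag)
  qed
  then obtain \<beta>' b' where "runs (Cond FlT 1 (ccmd c) (Write FlT 0)) (st N ip \<rho> \<beta> ?b) (cmd_time c N + 3)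
      (st N ip \<rho> \<beta>' b')" "repr N ar \<beta>' (exec N (If \<phi> c) \<rho> \<sigma>)" by blast
  then show ?case unfolding ccmd.simps cmd_time.simps using runs_Seq[OF 1] by blast
qed

subsection \<open>Polynomial time\<close>

text \<open>Functions bounded by a polynomial.\<close>

definition poly_bdd :: "(nat \<Rightarrow> nat) \<Rightarrow> bool" where
  "poly_bdd f \<longleftrightarrow> (\<exists>p :: nat poly. \<forall>n. f n \<le> poly p n)"

lemma poly_bdd_const: "poly_bdd (\<lambda>n. k)"
  unfolding poly_bdd_def by (rule exI[of _ "[:k:]"]) simp

lemma poly_bdd_id: "poly_bdd (\<lambda>n. n)"
  unfolding poly_bdd_def by (rule exI[of _ "[:0, 1:]"]) simp

lemma poly_bdd_add:
  assumes "poly_bdd f" "poly_bdd g" shows "poly_bdd (\<lambda>n. f n + g n)"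
proof -
  obtain p q where "\<forall>n. f n \<le> poly p n" "\<forall>n. g n \<le> poly q n"
    using assms unfolding poly_bdd_def by auto
  then show ?thesis unfolding poly_bdd_def
    by (intro exI[of _ "p + q"]) (auto intro: add_mono)
qed

lemma poly_bdd_mult:
  assumes "poly_bdd f" "poly_bdd g" shows "poly_bdd (\<lambda>n. f n * g n)"
proof -
  obtain p q where "\<forall>n. f n \<le> poly p n" "\<forall>n. g n \<le> poly q n"
    using assms unfolding poly_bdd_def by auto
  then show ?thesis unfolding poly_bdd_def
    by (intro exI[of _ "p * q"]) (auto intro: mult_le_mono)
qed

lemma poly_bdd_power: "poly_bdd f \<Longrightarrow> poly_bdd (\<lambda>n. f n ^ d)"
  by (induction d) (auto intro: poly_bdd_mult poly_bdd_const)

lemma poly_bdd_shift: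
  assumes "poly_bdd f" shows "poly_bdd (\<lambda>n. f (n + k))"
proof -
  obtain p where "\<forall>n. f n \<le> poly p n" using assms unfolding poly_bdd_def by auto
  then show ?thesis unfolding poly_bdd_def
    by (intro exI[of _ "pcompose p [:k, 1:]"]) (auto simp: poly_pcompose add_ac)
qed

lemmas poly_bdd_intros =
  poly_bdd_const poly_bdd_id poly_bdd_add poly_bdd_mult poly_bdd_power

lemma poly_bdd_pow_time: "poly_bdd (pow_time j)"
proof (induction j)
  case 0
  have "pow_time 0 = (\<lambda>N. 1)" by (rule ext) simp
  then show ?case using poly_bdd_const by presburger
next
  case (Suc j)
  then have "poly_bdd (\<lambda>N. N * (pow_time j N + 6) + 3)" by (intro poly_bdd_intros)
  moreover have "pow_time (Suc j) = (\<lambda>N. N * (pow_time j N + 6) + 3)" by (rule ext) simp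
  ultimately show ?case by simp
qed

lemma poly_bdd_seek_time: "poly_bdd (seek_time j d)"
proof (induction d arbitrary: j)
  case 0
  have "seek_time j 0 = (\<lambda>N. 0)" by (rule ext) simp
  then show ?case using poly_bdd_const by presburger
next
  case (Suc d)
  have "poly_bdd (\<lambda>N. N * (pow_time j N + 4) + 1 + (N * 4 + 1) + seek_time (Suc j) d N)"
    by (intro poly_bdd_intros poly_bdd_pow_time Suc)
  moreover have "seek_time j (Suc d) = (\<lambda>N. N * (pow_time j N + 4) + 1 + (N * 4 + 1) + seek_time (Suc j) d N)"
    by (rule ext) (simp add: mul_time_def)
  ultimately show ?case by simp
qed

lemma poly_bdd_acc_time: "poly_bdd (acc_time d)"
proof -
  have "poly_bdd (\<lambda>N. seek_time 0 d N + (N ^ d * 3 + 9))"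
    by (intro poly_bdd_intros poly_bdd_seek_time)
  then show ?thesis by (simp add: acc_time_def[abs_def])
qed

lemma poly_bdd_fm_time: "poly_bdd (\<lambda>N. fm_time \<phi> N)"
  by (induction \<phi>) (simp_all only: fm_time.simps poly_bdd_intros poly_bdd_acc_time)

lemma poly_bdd_cmd_time: "poly_bdd (\<lambda>N. cmd_time c N)"
  by (induction c) (simp_all only: cmd_time.simps poly_bdd_intros poly_bdd_acc_time poly_bdd_fm_time)

subsection \<open>Initialisation\<close>

text \<open>Runs \<open>f i\<close> for all \<open>i\<close> in the list; the trailing write is a no-op on the blank flag tape.\<close>

fun each :: "('i \<Rightarrow> tid prog) \<Rightarrow> 'i list \<Rightarrow> tid prog" where
  "each f [] = Write FlT 0"
| "each f (i # is) = Seq (f i) (each f is)"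

lemma runs_each:
  assumes "distinct is" "FlT \<notin> set is" "s FlT = blank_tape"
    and "\<And>i s. i \<in> set is \<Longrightarrow> P i (s i) \<Longrightarrow> runs (f i) s T (s(i := g i (s i)))"
    and "\<And>i. i \<in> set is \<Longrightarrow> P i (s i)"
    and "length is * T + 1 \<le> U" "s' = (\<lambda>j. if j \<in> set is then g j (s j) else s j)"
  shows "runs (each f is) s U s'"
proof -
  have "runs (each f is) s (length is * T + 1) (\<lambda>j. if j \<in> set is then g j (s j) else s j)"
    using assms(1-5)
  proof (induction "is" arbitrary: s)
    case Nil
    then show ?case by (auto intro!: runs_Write simp: fun_eq_iff blank_tape_def)
  next
    case (Cons i "is")
    let ?s = "s(i := g i (s i))"
    have 1: "runs (f i) s T ?s"
      by (rule Cons.prems(4)[OF _ Cons.prems(5)]) simp_all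
    have "runs (each f is) ?s (length is * T + 1) (\<lambda>j. if j \<in> set is then g j (?s j) else ?s j)"
      by (rule Cons.IH) (use Cons.prems in auto)
    moreover have "(\<lambda>j. if j \<in> set is then g j (?s j) else ?s j) =
        (\<lambda>j. if j \<in> set (i # is) then g j (s j) else s j)"
      using Cons.prems by (auto simp: fun_eq_iff)
    ultimately show ?case using runs_Seq[OF 1] by auto
  qed
  then show ?thesis using assms(6,7) runs_mono by blast
qed

definition counters :: "nat \<Rightarrow> tid list" where
  "counters M = ScT # map CtT [0..<M] @ map PwT [0..<M]"

definition relations :: "nat \<Rightarrow> tid list" where
  "relations M = map RlT [0..<M]"

definition tape_ids :: "nat \<Rightarrow> tid list" where
  "tape_ids M = InT # FlT # counters M @ relations M"

lemma set_counters: "set (counters M) = {ScT} \<union> CtT ` {..<M} \<union> PwT ` {..<M}"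
  by (auto simp: counters_def)

lemma set_relations: "set (relations M) = RlT ` {..<M}"
  by (auto simp: relations_def)

lemma set_tape_ids: "set (tape_ids M) = {InT, FlT} \<union> set (counters M) \<union> set (relations M)"
  by (auto simp: tape_ids_def)

lemma distinct_counters: "distinct (counters M)"
  by (auto simp: counters_def distinct_map inj_on_def)

lemma distinct_relations: "distinct (relations M)"
  by (auto simp: relations_def distinct_map inj_on_def)

text \<open>The input is copied to the relations 0 (bits of the input) and 1 (positions below its length),
  while all counters are moved along, so that the end mark \<open>N\<close> can be written to them.\<close>

definition advance :: "nat \<Rightarrow> tid prog" where
  "advance M = Seq (Cond InT 2 (Write (RlT 0) 1) (Write (RlT 0) 0))
     (Seq (Write (RlT 1) 1) (each (\<lambda>i. Move i Right) (InT # RlT 0 # RlT 1 # counters M)))"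

text \<open>Moves a counter four cells further, writes the end mark there, and resets the counter to
  zero.\<close>

definition finish :: "tid \<Rightarrow> tid prog" where
  "finish i = Seq (Move i Right) (Seq (Move i Right) (Seq (Move i Right) (Seq (Move i Right)
     (Seq (Write i 2) (Until i 1 (Move i Left))))))"

text \<open>Marks the beginnings of all counters and relations, copies the input, and then writes the end mark
  of the counters four cells beyond the length of the input.\<close>

definition boot :: "nat \<Rightarrow> tid prog" where
  "boot M = Seq (each (\<lambda>i. Write i 1) (counters M))
     (Seq (each (\<lambda>i. Seq (Move i Left) (Seq (Write i 2) (Move i Right))) (relations M))
     (Seq (Until InT 0 (advance M))
     (Seq (each finish (counters M)) (Seq (home 0) (home 1)))))"

text \<open>A counter whose end mark has not been written.\<close>

definition pre_ctr :: "int \<Rightarrow> tape" where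
  "pre_ctr h = (\<lambda>i. if i = 0 then 1 else 0, h)"

lemma pre_ctr_move [simp]: "tape_act (tape_read (pre_ctr h), d) (pre_ctr h) = pre_ctr (move_head d h)"
  unfolding act_move by (simp add: pre_ctr_def)

text \<open>The tapes when the input has been scanned up to position \<open>v\<close>. Tapes that are not used hold
  their final contents from the beginning.\<close>

fun scan :: "nat \<Rightarrow> bool list \<Rightarrow> nat \<Rightarrow> tid tapes" where
  "scan M w v InT = (fst (input_tape w), int v)"
| "scan M w v FlT = blank_tape"
| "scan M w v ScT = pre_ctr (int v)"
| "scan M w v (CtT x) = (if x < M then pre_ctr (int v) else ctr (length w + 4) 0)"
| "scan M w v (PwT x) = (if x < M then pre_ctr (int v) else ctr (length w + 4) 0)"
| "scan M w v (RlT R) =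
     (if R = 0 then rlt (\<lambda>i. i < v \<and> w ! i) (int v)
      else if R = 1 then rlt (\<lambda>i. i < v) (int v) else rlt (\<lambda>_. False) 0)"

text \<open>The initial contents of the relations, in linear arrangement.\<close>

definition bits0 :: "bool list \<Rightarrow> nat \<Rightarrow> nat \<Rightarrow> bool" where
  "bits0 w R i \<longleftrightarrow> (R = 0 \<and> i < length w \<and> w ! i) \<or> (R = 1 \<and> i < length w)"

text \<open>The initial tapes of the machine, extended to tapes that it does not have, which are assumed to hold
  their final contents.\<close>

definition start_tapes :: "nat \<Rightarrow> bool list \<Rightarrow> tid tapes" where
  "start_tapes M w i = (if i \<in> set (tape_ids M) then (if i = InT then input_tape w else blank_tape)
     else scan M w 0 i)"

lemma input_read:
  "v \<le> length w \<Longrightarrow> tape_read (fst (input_tape w), int v) = (if v < length w then (if w ! v then 2 else 1) else 0)"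
  by (simp add: input_tape_def)

lemma runs_advance:
  assumes "v < length w" "2 \<le> M"
  shows "runs (advance M) (scan M w v) (length (counters M) + 9) (scan M w (Suc v))"
proof -
  let ?is = "InT # RlT 0 # RlT 1 # counters M"
  let ?s1 = "(scan M w v)(RlT 0 := rlt (\<lambda>i. i < Suc v \<and> w ! i) (int v))"
  let ?s2 = "?s1(RlT 1 := rlt (\<lambda>i. i < Suc v) (int v))"
  let ?f = "\<lambda>i. i < v \<and> w ! i"
  have e1: "tape_act (if w ! v then Suc 0 else 0, Stay) (rlt ?f (int v)) = rlt (\<lambda>i. i < Suc v \<and> w ! i) (int v)"
    unfolding rlt_write by (rule arg_cong[where f = "\<lambda>f. rlt f (int v)"]) (auto simp: fun_eq_iff less_Suc_eq)
  have e2: "tape_act (Suc 0, Stay) (rlt (\<lambda>i. i < v) (int v)) = rlt (\<lambda>i. i < Suc v) (int v)"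
    using rlt_write[of True "\<lambda>i. i < v" v]
    by (auto simp: fun_upd_def less_Suc_eq intro!: arg_cong[where f = "\<lambda>f. rlt f (int v)"])
  have 1: "runs (Cond InT 2 (Write (RlT 0) 1) (Write (RlT 0) 0)) (scan M w v) 3 ?s1"
  proof (rule runs_Cond[where T = 1])
    have rd: "tape_read (scan M w v InT) = 2 \<longleftrightarrow> w ! v"
      unfolding scan.simps using input_read[of v w] assms by simp
    show "runs (Write (RlT 0) 1) (scan M w v) 1 ?s1" if "tape_read (scan M w v InT) = 2"
      by (rule runs_Write) (use that rd e1 in simp_all)
    show "runs (Write (RlT 0) 0) (scan M w v) 1 ?s1" if "tape_read (scan M w v InT) \<noteq> 2"
      by (rule runs_Write) (use that rd e1 in simp_all)
  qed simp
  have 2: "runs (Write (RlT 1) 1) ?s1 1 ?s2"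
    by (rule runs_Write) (use e2 in auto)
  have 3: "runs (each (\<lambda>i. Move i Right) ?is) ?s2 (length (counters M) + 4) (scan M w (Suc v))"
  proof (rule runs_each[where T = 1 and g = "\<lambda>_ p. tape_act (tape_read p, Right) p" and P = "\<lambda>_ _. True"])
    show "distinct ?is" using distinct_counters by (auto simp: set_counters)
    show "scan M w (Suc v) = (\<lambda>j. if j \<in> set ?is then tape_act (tape_read (?s2 j), Right) (?s2 j) else ?s2 j)"
    proof
      fix j
      show "scan M w (Suc v) j = (if j \<in> set ?is then tape_act (tape_read (?s2 j), Right) (?s2 j) else ?s2 j)"
        by (cases j) (auto simp: set_counters act_move algebra_simps, simp_all add: pre_ctr_def rlt_def)
    qed
  qed (auto simp: set_counters intro!: runs_Move)
  show ?thesis unfolding advance_def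
    by (rule runs_Seq[OF 1 runs_Seq[OF 2 3 order_refl]]) simp
qed

lemma runs_finish:
  assumes "s i = pre_ctr (int L)"
  shows "runs (finish i) s (3 * L + 18) (s(i := ctr (L + 4) 0))"
proof -
  have m: "runs (Move i Right) (s(i := pre_ctr (int l))) 1 (s(i := pre_ctr (int (Suc l))))" for l
    by (rule runs_Move) (auto simp: algebra_simps)
  have s: "s = s(i := pre_ctr (int L))" using assms by auto
  have w: "runs (Write i 2) (s(i := pre_ctr (int (Suc (Suc (Suc (Suc L))))))) 1 (s(i := ctr (L + 4) (L + 4)))"
    by (rule runs_Write) (auto simp: pre_ctr_def ctr_def fun_eq_iff)
  have z: "runs (Until i 1 (Move i Left)) (s(i := ctr (L + 4) (L + 4))) (3 * L + 13) (s(i := ctr (L + 4) 0))"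
    using runs_ctr_zero[of "L + 4" "s(i := ctr (L + 4) (L + 4))" i "L + 4"] by simp
  show ?thesis unfolding finish_def
    by (subst s) (rule runs_Seq[OF m runs_Seq[OF m runs_Seq[OF m runs_Seq[OF m runs_Seq[OF w z
      order_refl] order_refl] order_refl] order_refl]], simp)
qed

lemma runs_boot:
  assumes "2 \<le> M" "L = length w"
  shows "runs (boot M) (start_tapes M w) (L * (2 * M + 12) + (2 * M + 1) * (3 * L + 18) + 6 * L + 6 * M + 17)
    (st (L + 4) (fst (input_tape w), int L) (\<lambda>_. 0) (bits0 w) False)"
proof -
  let ?s1 = "\<lambda>i. if i \<in> set (counters M) then pre_ctr 0 else start_tapes M w i"
  have lc: "length (counters M) = 2 * M + 1" "length (relations M) = M"
    by (auto simp: counters_def relations_def)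
  have b: "tape_act (Suc 0, Stay) blank_tape = pre_ctr 0"
    by (auto simp: blank_tape_def pre_ctr_def)
  have 1: "runs (each (\<lambda>i. Write i 1) (counters M)) (start_tapes M w) (2 * M + 2) ?s1"
    by (rule runs_each[where T = 1 and g = "\<lambda>_ p. tape_act (1, Stay) p" and P = "\<lambda>_ _. True"])
      (auto simp: set_counters set_tape_ids start_tapes_def lc b distinct_counters intro!: runs_Write)
  have r: "runs (Seq (Move i Left) (Seq (Write i 2) (Move i Right))) s 3 (s(i := rlt (\<lambda>_. False) 0))"
    if "s i = blank_tape" for i and s :: "tid tapes"
  proof -
    have "runs (Move i Left) s 1 (s(i := (\<lambda>_. 0, -1)))"
      by (rule runs_Move) (simp_all only: that act_move, simp add: blank_tape_def)
    moreover have "runs (Write i 2) (s(i := (\<lambda>_. 0, -1))) 1 (s(i := rlt (\<lambda>_. False) (-1)))"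
      by (rule runs_Write) (auto simp: rlt_def fun_eq_iff)
    moreover have "runs (Move i Right) (s(i := rlt (\<lambda>_. False) (-1))) 1 (s(i := rlt (\<lambda>_. False) 0))"
      by (rule runs_shift[where B = "\<lambda>_. False" and h = "-1"]) auto
    ultimately show ?thesis by (auto intro!: runs_Seq)
  qed
  have 2: "runs (each (\<lambda>i. Seq (Move i Left) (Seq (Write i 2) (Move i Right))) (relations M)) ?s1
      (3 * M + 1) (scan M w 0)"
  proof (rule runs_each[where T = 3 and g = "\<lambda>_ _. rlt (\<lambda>_. False) 0" and P = "\<lambda>_ p. p = blank_tape"])
    show "scan M w 0 = (\<lambda>j. if j \<in> set (relations M) then rlt (\<lambda>_. False) 0 else ?s1 j)"
    proof
      fix j
      show "scan M w 0 j = (if j \<in> set (relations M) then rlt (\<lambda>_. False) 0 else ?s1 j)"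
        using assms(1)
        by (cases j) (auto simp: set_relations set_counters start_tapes_def set_tape_ids input_tape_def)
    qed
  qed (use r in \<open>auto simp: set_counters set_tape_ids set_relations start_tapes_def lc distinct_relations\<close>)
  have 3: "runs (Until InT 0 (advance M)) (scan M w 0) (L * (2 * M + 12) + 1) (scan M w L)"
  proof (rule runs_Until_fun[where S = "scan M w" and n = L and T = "2 * M + 10"])
    fix v assume "v < L"
    moreover from this have "tape_read (scan M w v InT) \<noteq> 0"
      unfolding scan.simps using input_read[of v w] assms by simp
    ultimately show "tape_read (scan M w v InT) \<noteq> 0 \<and>
        runs (advance M) (scan M w v) (2 * M + 10) (scan M w (Suc v))"
      using runs_advance[of v w M] assms by (simp add: lc algebra_simps)
  qed (auto simp: input_tape_def assms)
  let ?s4 = "\<lambda>j. if j \<in> set (counters M) then ctr (L + 4) 0 else scan M w L j"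
  have 4: "runs (each finish (counters M)) (scan M w L) ((2 * M + 1) * (3 * L + 18) + 1) ?s4"
    by (rule runs_each[where T = "3 * L + 18" and g = "\<lambda>_ _. ctr (L + 4) 0" and P = "\<lambda>_ p. p = pre_ctr (int L)"])
      (use runs_finish in \<open>auto simp: set_counters lc distinct_counters\<close>)
  let ?B0 = "\<lambda>i. i < L \<and> w ! i" and ?B1 = "\<lambda>i. i < L"
  have 5: "runs (home 0) ?s4 (3 * L + 6) (?s4(RlT 0 := rlt ?B0 0))"
    by (rule runs_home[where h = L]) (auto simp: set_counters)
  have 6: "runs (home 1) (?s4(RlT 0 := rlt ?B0 0)) (3 * L + 6) (?s4(RlT 0 := rlt ?B0 0, RlT 1 := rlt ?B1 0))"
    by (rule runs_home[where h = L]) (auto simp: set_counters)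
  have 7: "?s4(RlT 0 := rlt ?B0 0, RlT 1 := rlt ?B1 0) =
      st (L + 4) (fst (input_tape w), int L) (\<lambda>_. 0) (bits0 w) False"
  proof
    fix j
    show "(?s4(RlT 0 := rlt ?B0 0, RlT 1 := rlt ?B1 0)) j =
        st (L + 4) (fst (input_tape w), int L) (\<lambda>_. 0) (bits0 w) False j"
      using assms by (cases j) (auto simp: set_counters bits0_def[abs_def] flg_def blank_tape_def)
  qed
  show ?thesis unfolding boot_def 7[symmetric]
    by (rule runs_Seq[OF 1 runs_Seq[OF 2 runs_Seq[OF 3 runs_Seq[OF 4 runs_Seq[OF 5 6
      order_refl] order_refl] order_refl] order_refl]]) simp
qed

text \<open>Programs start with the input in relations 0 and 1, over the domain of size four more than the
  length of the input, so that small constants are always available.\<close>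

definition store0 :: "bool list \<Rightarrow> store" where
  "store0 w R xs \<longleftrightarrow>
     (\<exists>i. xs = [i] \<and> i < length w \<and> (R = 0 \<and> w ! i \<or> R = 1))"

lemma finite_tape_names: "finite (tape_names c)"
  by (induction c) auto

lemma small_syms_each: "(\<And>i. small_syms (f i)) \<Longrightarrow> small_syms (each f is)"
  by (induction "is") auto

lemma tape_names_each: "tape_names (each f is) = (\<Union>i\<in>set is. tape_names (f i)) \<union> {FlT}"
  by (induction "is") auto

lemma small_syms_pow_move: "small_syms (pow_move R j)"
  by (induction j) (auto simp: for_prog_def)

lemma small_syms_seek: "small_syms c \<Longrightarrow> small_syms (seek R j xs c)"
  by (induction R j xs c rule: seek.induct) (auto simp: mul_move_def small_syms_pow_move)

lemma small_syms_cfm: "small_syms (cfm \<phi>)"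
  by (induction \<phi>) (auto simp: for_prog_def rd_def home_def small_syms_seek)

lemma small_syms_ccmd: "small_syms (ccmd c)"
  by (induction c) (auto simp: for_prog_def wr_def home_def small_syms_seek small_syms_cfm)

lemma small_syms_boot: "small_syms (boot M)"
  by (auto simp: boot_def advance_def finish_def home_def intro!: small_syms_each)

lemma tape_names_boot: "2 \<le> M \<Longrightarrow> tape_names (boot M) \<subseteq> set (tape_ids M)"
  by (auto simp: boot_def advance_def finish_def home_def tape_names_each set_tape_ids set_relations)

lemma tape_ids_cover: "finite A \<Longrightarrow> \<exists>M\<ge>2. A \<subseteq> set (tape_ids M)"
proof (induction A rule: finite_induct)
  case (insert a A)
  then obtain M where M: "2 \<le> M" "A \<subseteq> set (tape_ids M)" by blast
  obtain K where K: "a \<in> set (tape_ids K)"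
  proof (cases a)
    case (CtT x) then show ?thesis by (intro that[of "Suc x"]) (auto simp: set_tape_ids set_counters)
  next
    case (PwT x) then show ?thesis by (intro that[of "Suc x"]) (auto simp: set_tape_ids set_counters)
  next
    case (RlT x) then show ?thesis by (intro that[of "Suc x"]) (auto simp: set_tape_ids set_relations)
  qed (auto intro!: that[of 0] simp: set_tape_ids set_counters)
  have mono: "set (tape_ids K') \<subseteq> set (tape_ids (max K M))" if "K' \<le> max K M" for K'
    using that by (auto simp: set_tape_ids set_counters set_relations)
  show ?case
    by (rule exI[of _ "max K M"]) (use M K mono[of K] mono[of M] in auto)
qed auto

text \<open>Loop programs decide languages in P. They start with empty relations, apart from 0 and 1.\<close>

theorem loop_program_in_P:
  assumes "wfc ar {} c" "wff ar {} \<phi>" "ar 0 = 1" "ar 1 = 1"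
  shows "{w. let N = length w + 4 in holds N (exec N c (\<lambda>_. 0) (store0 w)) (\<lambda>_. 0) \<phi>} \<in> complexity_P"
proof -
  obtain M where M: "2 \<le> M" "tape_names (ccmd c) \<union> tape_names (cfm \<phi>) \<subseteq> set (tape_ids M)"
    using tape_ids_cover finite_tape_names by (metis finite_UnI)
  let ?prog = "Seq (boot M) (Seq (ccmd c) (cfm \<phi>))"
  let ?T = "\<lambda>L. (L * (2 * M + 12) + (2 * M + 1) * (3 * L + 18) + 6 * L + 6 * M + 17) +
      (cmd_time c (L + 4) + fm_time \<phi> (L + 4))"
  have "poly_bdd ?T"
    by (intro poly_bdd_intros poly_bdd_shift[where f = "\<lambda>N. cmd_time c N"]
        poly_bdd_shift[where f = "\<lambda>N. fm_time \<phi> N"] poly_bdd_cmd_time poly_bdd_fm_time)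
  then obtain p where p: "\<And>L. ?T L \<le> poly p L" unfolding poly_bdd_def by blast
  show ?thesis
  proof (rule complexity_P_by_program[where c = ?prog and ids = "tape_ids M" and inp = InT and fl = FlT and
        ids' = "FlT # counters M @ relations M" and ?s0.0 = "start_tapes M" and p = p])
    show "small_syms ?prog"
      by (simp add: small_syms_boot small_syms_ccmd small_syms_cfm)
    show "tape_names ?prog \<subseteq> set (tape_ids M)" using tape_names_boot M by auto
    show "\<exists>t s'. t \<le> poly p (length w) \<and> run ?prog (start_tapes M w) t s' \<and>
      (tape_read (s' FlT) = 1 \<longleftrightarrow> w \<in> {w. let N = length w + 4 in
        holds N (exec N c (\<lambda>_. 0) (store0 w)) (\<lambda>_. 0) \<phi>})" for w
    proof -
      let ?N = "length w + 4" and ?ip = "(fst (input_tape w), int (length w))"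
      have r0: "repr ?N ar (bits0 w) (store0 w)"
        unfolding repr_def
      proof (intro allI impI)
        fix R xs assume *: "length xs = ar R \<and> set xs \<subseteq> {..<?N}"
        show "bits0 w R (idx ?N xs) = store0 w R xs"
        proof (cases "R \<le> 1")
          case True
          then have "length xs = 1" using * assms(3,4) by (cases R) auto
          then obtain i where "xs = [i]" by (auto simp: length_Suc_conv)
          then show ?thesis by (auto simp: bits0_def store0_def)
        qed (auto simp: bits0_def store0_def)
      qed
      obtain \<beta> b where 1: "runs (ccmd c) (st ?N ?ip (\<lambda>_. 0) (bits0 w) False) (cmd_time c ?N) (st ?N ?ip (\<lambda>_. 0) \<beta> b)"
        "repr ?N ar \<beta> (exec ?N c (\<lambda>_. 0) (store0 w))"
        using runs_ccmd[OF _ assms(1), where N = ?N and \<rho> = "\<lambda>_. 0" and \<beta> = "bits0 w" and \<sigma> = "store0 w" and ip = ?ip and b = False] r0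
        by auto
      have 2: "runs (cfm \<phi>) (st ?N ?ip (\<lambda>_. 0) \<beta> b) (fm_time \<phi> ?N)
          (st ?N ?ip (\<lambda>_. 0) \<beta> (holds ?N (exec ?N c (\<lambda>_. 0) (store0 w)) (\<lambda>_. 0) \<phi>))"
        by (rule runs_cfm[OF _ 1(2) assms(2)]) auto
      have "runs ?prog (start_tapes M w) (?T (length w))
          (st ?N ?ip (\<lambda>_. 0) \<beta> (holds ?N (exec ?N c (\<lambda>_. 0) (store0 w)) (\<lambda>_. 0) \<phi>))"
        by (rule runs_Seq[OF runs_boot[OF M(1) refl] runs_Seq[OF 1(1) 2 order_refl] order_refl])
      then obtain t where "t \<le> ?T (length w)" "run ?prog (start_tapes M w) t
          (st ?N ?ip (\<lambda>_. 0) \<beta> (holds ?N (exec ?N c (\<lambda>_. 0) (store0 w)) (\<lambda>_. 0) \<phi>))"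
        unfolding runs_def by blast
      moreover from this have "t \<le> poly p (length w)" using p order_trans by blast
      ultimately show ?thesis
        by (intro exI conjI) (assumption+, simp add: Let_def)
    qed
  qed (auto simp: tape_ids_def start_tapes_def set_counters set_relations)
qed

section \<open>Orders of finite fields\<close>

text \<open>Polynomials are those of type \<open>poly\<close>.\<close>

hide_const (open) UnivPoly.monom UnivPoly.coeff

subsection \<open>Maximal ideals of integer polynomials\<close>

text \<open>Ideals of \<open>\<int>[X]\<close>.\<close>

definition poly_ideal :: "int poly set \<Rightarrow> bool" where
  "poly_ideal I \<longleftrightarrow> 0 \<in> I \<and> (\<forall>a\<in>I. \<forall>b\<in>I. a + b \<in> I) \<and> (\<forall>a\<in>I. \<forall>r. r * a \<in> I)"

lemma poly_idealD:
  assumes "poly_ideal I"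
  shows "0 \<in> I" "a \<in> I \<Longrightarrow> b \<in> I \<Longrightarrow> a + b \<in> I" "a \<in> I \<Longrightarrow> r * a \<in> I" "a \<in> I \<Longrightarrow> a * r \<in> I"
    "a \<in> I \<Longrightarrow> b \<in> I \<Longrightarrow> a - b \<in> I" "a \<in> I \<Longrightarrow> - a \<in> I"
proof -
  show "0 \<in> I" "a \<in> I \<Longrightarrow> b \<in> I \<Longrightarrow> a + b \<in> I" and m: "a \<in> I \<Longrightarrow> r * a \<in> I" for a b r
    using assms unfolding poly_ideal_def by auto
  show "a \<in> I \<Longrightarrow> a * r \<in> I" using m by (simp add: mult.commute)
  show n: "a \<in> I \<Longrightarrow> - a \<in> I" for a using m[of a "-1"] by simp
  show "a \<in> I \<Longrightarrow> b \<in> I \<Longrightarrow> a - b \<in> I"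
    using assms n[of b] unfolding poly_ideal_def by (metis uminus_add_conv_diff add.commute)
qed

lemma sum_in_ideal: "poly_ideal I \<Longrightarrow> (\<And>j. j \<in> A \<Longrightarrow> f j \<in> I) \<Longrightarrow> sum f A \<in> I"
  by (induction A rule: infinite_finite_induct) (auto simp: poly_idealD)

text \<open>A proper ideal is contained in a maximal one. Maximality is only used in the form that every element
  outside of the ideal is invertible modulo the ideal.\<close>

lemma maximal_ideal_exists:
  assumes "poly_ideal J" "1 \<notin> J"
  obtains M where "poly_ideal M" "J \<subseteq> M" "1 \<notin> M" "\<And>g. g \<notin> M \<Longrightarrow> \<exists>h. 1 - g * h \<in> M"
proof -
  let ?A = "{I. poly_ideal I \<and> J \<subseteq> I \<and> 1 \<notin> I}"
  have "\<exists>M\<in>?A. \<forall>X\<in>?A. M \<subseteq> X \<longrightarrow> X = M"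
  proof (rule subset_Zorn_nonempty)
    show "?A \<noteq> {}" using assms by auto
  next
    fix C assume C: "C \<noteq> {}" "subset.chain ?A C"
    have sub: "I \<in> C \<Longrightarrow> poly_ideal I \<and> J \<subseteq> I \<and> 1 \<notin> I" for I
      using C(2) unfolding subset_chain_def by blast
    have tot: "I \<in> C \<Longrightarrow> K \<in> C \<Longrightarrow> I \<subseteq> K \<or> K \<subseteq> I" for I K
      using C(2) unfolding subset_chain_def by blast
    have "poly_ideal (\<Union>C)"
      unfolding poly_ideal_def
    proof (intro conjI ballI allI)
      show "0 \<in> \<Union>C" using C(1) sub poly_idealD(1) by blast
      show "a + b \<in> \<Union>C" if "a \<in> \<Union>C" "b \<in> \<Union>C" for a b
      proof -
        obtain I K where "I \<in> C" "a \<in> I" "K \<in> C" "b \<in> K" using \<open>a \<in> \<Union>C\<close> \<open>b \<in> \<Union>C\<close> by blast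
        then obtain L where "L \<in> C" "a \<in> L" "b \<in> L" using tot[of I K] by blast
        then have "a + b \<in> L" using sub poly_idealD(2) by blast
        then show ?thesis using \<open>L \<in> C\<close> by blast
      qed
      show "r * a \<in> \<Union>C" if "a \<in> \<Union>C" for a r
      proof -
        obtain I where "I \<in> C" "a \<in> I" using \<open>a \<in> \<Union>C\<close> by blast
        then have "r * a \<in> I" using sub poly_idealD(3) by blast
        then show ?thesis using \<open>I \<in> C\<close> by blast
      qed
    qed
    then show "\<Union>C \<in> ?A" using C(1) sub by auto
  qed
  then obtain M where M: "poly_ideal M" "J \<subseteq> M" "1 \<notin> M"
    and max: "\<And>X. poly_ideal X \<Longrightarrow> 1 \<notin> X \<Longrightarrow> M \<subseteq> X \<Longrightarrow> X = M" by auto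
  have "\<exists>h. 1 - g * h \<in> M" if g: "g \<notin> M" for g
  proof (rule ccontr)
    assume no: "\<not> (\<exists>h. 1 - g * h \<in> M)"
    let ?X = "{a + g * h |a h. a \<in> M}"
    have "poly_ideal ?X"
      unfolding poly_ideal_def
    proof (intro conjI ballI allI)
      show "0 \<in> ?X" using poly_idealD(1)[OF M(1)] by (auto intro!: exI[of _ 0])
      show "u + v \<in> ?X" if uv: "u \<in> ?X" "v \<in> ?X" for u v
      proof -
        obtain a h b k where "u = a + g * h" "v = b + g * k" "a \<in> M" "b \<in> M" using uv by auto
        then have "u + v = (a + b) + g * (h + k)" "a + b \<in> M"
          using poly_idealD(2)[OF M(1)] by (auto simp: algebra_simps)
        then show ?thesis by blast
      qed
      show "r * u \<in> ?X" if u: "u \<in> ?X" for r u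
      proof -
        obtain a h where "u = a + g * h" "a \<in> M" using u by auto
        then have "r * u = r * a + g * (r * h)" "r * a \<in> M"
          using poly_idealD(3)[OF M(1)] by (auto simp: algebra_simps)
        then show ?thesis by blast
      qed
    qed
    moreover have "M \<subseteq> ?X"
    proof
      fix a assume "a \<in> M"
      then show "a \<in> ?X" by (intro CollectI exI[of _ a] exI[of _ 0]) simp
    qed
    moreover have "g \<in> ?X" using poly_idealD(1)[OF M(1)] by (intro CollectI exI[of _ 0] exI[of _ 1]) simp
    moreover have "1 \<notin> ?X"
    proof
      assume "1 \<in> ?X"
      then obtain a h where "1 = a + g * h" "a \<in> M" by auto
      then have "1 - g * h \<in> M" by (metis add_diff_cancel_right')
      with no show False by blast
    qed
    ultimately show False using max g by blast
  qed
  with M that show ?thesis by blast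
qed

text \<open>A monic polynomial over a residue ring without zero divisors has no more roots than its degree.\<close>

lemma roots_mod_ideal:
  fixes P :: "int poly poly"
  assumes M: "poly_ideal M" "1 \<notin> M" "\<And>a b. a * b \<in> M \<Longrightarrow> a \<in> M \<or> b \<in> M"
  shows "lead_coeff P = 1 \<Longrightarrow> degree P = d \<Longrightarrow> (\<And>i. i < d \<Longrightarrow> poly P (r i) \<in> M) \<Longrightarrow>
    (\<And>i j. i < j \<Longrightarrow> j < d \<Longrightarrow> r i - r j \<notin> M) \<Longrightarrow> poly P b \<in> M \<Longrightarrow> \<exists>i<d. b - r i \<in> M"
proof (induction d arbitrary: P)
  case 0
  then obtain c where "P = [:c:]" by (auto elim: degree_eq_zeroE)
  with 0 have "P = 1" by (auto simp: one_pCons)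
  with 0 M(2) show ?case by simp
next
  case (Suc d)
  let ?c = "r d"
  define Q where "Q = synthetic_div P ?c"
  have ev: "poly P y = (y - ?c) * poly Q y + poly P ?c" for y
  proof -
    have "poly ([:- ?c, 1:] * Q + [:poly P ?c:]) y = poly P y"
      unfolding Q_def by (subst synthetic_div_correct') simp
    then show ?thesis by (simp add: algebra_simps)
  qed
  have degQ: "degree Q = d" using Suc.prems(2) by (simp add: Q_def degree_synthetic_div)
  have lcQ: "lead_coeff Q = 1"
  proof -
    have "P = [:- ?c, 1:] * Q + [:poly P ?c:]" unfolding Q_def by (rule synthetic_div_correct'[symmetric])
    then have "coeff P (Suc d) = coeff ([:- ?c, 1:] * Q + [:poly P ?c:]) (Suc d)" by simp
    also have "\<dots> = coeff Q d - ?c * coeff Q (Suc d)" by simp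
    also have "coeff Q (Suc d) = 0" using degQ by (simp add: coeff_eq_0)
    finally show ?thesis using Suc.prems(1,2) degQ by simp
  qed
  have red: "y - ?c \<in> M \<or> poly Q y \<in> M" if "poly P y \<in> M" for y
  proof -
    have "(y - ?c) * poly Q y = poly P y - poly P ?c" using ev[of y] by simp
    also have "\<dots> \<in> M" using poly_idealD(5)[OF M(1) that] Suc.prems(3)[of d] by simp
    finally show ?thesis using M(3) by blast
  qed
  show ?case
  proof (cases "b - ?c \<in> M")
    case False
    have "\<exists>i<d. b - r i \<in> M"
    proof (rule Suc.IH[OF lcQ degQ])
      show "poly Q (r i) \<in> M" if "i < d" for i
        using red[of "r i"] Suc.prems(3)[of i] Suc.prems(4)[of i d] that by auto
      show "poly Q b \<in> M" using red[of b] Suc.prems(5) False by auto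
    qed (use Suc.prems in auto)
    then show ?thesis using less_SucI by blast
  qed blast
qed

lemma frobenius_mod_ideal:
  assumes M: "poly_ideal M" "of_nat p \<in> M" and "prime p"
  shows "(a + b) ^ (p ^ k) - (a ^ (p ^ k) + b ^ (p ^ k)) \<in> M"
proof (induction k)
  case 0
  show ?case using poly_idealD(1)[OF M(1)] by simp
next
  case (Suc k)
  have step: "(u + v) ^ p - (u ^ p + v ^ p) \<in> M" for u v
  proof -
    have p: "0 < p" using \<open>prime p\<close> prime_gt_0_nat by blast
    have "(u + v) ^ p = (\<Sum>j\<le>p. of_nat (p choose j) * u ^ j * v ^ (p - j))" by (rule binomial_ring)
    also have "{..p} = insert 0 (insert p {1..<p})" using p by auto
    also have "(\<Sum>j\<in>insert 0 (insert p {1..<p}). of_nat (p choose j) * u ^ j * v ^ (p - j)) =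
        v ^ p + (u ^ p + (\<Sum>j\<in>{1..<p}. of_nat (p choose j) * u ^ j * v ^ (p - j)))"
      using p by simp
    finally have "(u + v) ^ p - (u ^ p + v ^ p) = (\<Sum>j\<in>{1..<p}. of_nat (p choose j) * u ^ j * v ^ (p - j))"
      by simp
    moreover have "(\<Sum>j\<in>{1..<p}. of_nat (p choose j) * u ^ j * v ^ (p - j)) \<in> M"
    proof -
      have "of_nat (p choose j) * u ^ j * v ^ (p - j) \<in> M" if "j \<in> {1..<p}" for j
      proof -
        have "p dvd (p choose j)" using that \<open>prime p\<close> by (intro dvd_choose_prime) auto
        then obtain c where "p choose j = p * c" by auto
        then have "of_nat (p choose j) * u ^ j * v ^ (p - j) = of_nat p * (of_nat c * u ^ j * v ^ (p - j))"
          by (simp only: of_nat_mult mult.assoc)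
        then show ?thesis using poly_idealD(4)[OF M(1,2)] by metis
      qed
      then show ?thesis by (intro sum_in_ideal[OF M(1)]) auto
    qed
    ultimately show ?thesis by simp
  qed
  let ?A = "a ^ (p ^ k)" and ?B = "b ^ (p ^ k)" and ?C = "(a + b) ^ (p ^ k)"
  have cong: "x ^ n - y ^ n \<in> M" if "x - y \<in> M" for x y n
    using that poly_idealD(4)[OF M(1)] power_diff_sumr2[of x n y] by metis
  have "?C ^ p - (?A + ?B) ^ p \<in> M" using cong[OF Suc] .
  moreover have "(?A + ?B) ^ p - (?A ^ p + ?B ^ p) \<in> M" by (rule step)
  ultimately have "?C ^ p - (?A + ?B) ^ p + ((?A + ?B) ^ p - (?A ^ p + ?B ^ p)) \<in> M"
    by (rule poly_idealD(2)[OF M(1)])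
  then show ?case by (simp add: power_mult[symmetric] mult.commute algebra_simps)
qed

subsection \<open>Existence\<close>

text \<open>A prime factor \<open>f\<close> of \<open>X\<^sup>m - 1\<close> that vanishes at a primitive \<open>m\<close>-th root of unity, and hence
  divides no \<open>X\<^sup>i - 1\<close> with \<open>0 < i < m\<close>.\<close>

lemma primitive_factor_exists:
  assumes "0 < m"
  obtains f :: "int poly" where "prime_elem f" "f dvd monom 1 m - 1" "0 < degree f" "\<bar>lead_coeff f\<bar> = 1"
    "\<And>i. 0 < i \<Longrightarrow> i < m \<Longrightarrow> \<not> f dvd monom 1 i - 1"
proof -
  define z where "z = cis (2 * pi / real m)"
  define ev :: "int poly \<Rightarrow> complex" where "ev = (\<lambda>g. poly (map_poly of_int g) z)"
  have ev_mult: "ev (g * h) = ev g * ev h" for g h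
  proof -
    have "map_poly of_int (g * h) = (map_poly of_int g * map_poly of_int h :: complex poly)"
      by (rule poly_eqI) (simp add: coeff_map_poly coeff_mult)
    then show ?thesis by (simp add: ev_def)
  qed
  have ev_X: "ev (monom 1 i - 1) = z ^ i - 1" for i
  proof -
    have "map_poly of_int (monom 1 i - 1) = (monom 1 i - 1 :: complex poly)"
      by (rule poly_eqI) (simp add: coeff_map_poly)
    then show ?thesis by (simp add: ev_def poly_monom)
  qed
  have ev_C: "ev [:c:] = of_int c" for c by (simp add: ev_def map_poly_pCons)
  have ev_1: "ev 1 = 1" using ev_C[of 1] by (simp add: one_pCons)
  have zpow: "z ^ i = cis (2 * pi * real i / real m)" for i
    by (simp add: z_def DeMoivre mult.commute)
  have zm: "z ^ m = 1" using assms by (simp add: zpow)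
  have zi: "z ^ i \<noteq> 1" if "0 < i" "i < m" for i
  proof
    assume "z ^ i = 1"
    then have "cos (2 * pi * real i / real m) = 1" unfolding zpow by (metis cis.sel(1) one_complex.sel(1))
    then obtain k :: int where "2 * pi * real i / real m = of_int k * 2 * pi"
      using cos_one_2pi_int by blast
    then have "real i = of_int k * real m" using assms by (simp add: field_simps)
    then have "int i = k * int m" by (metis of_int_eq_iff of_int_mult of_int_of_nat_eq)
    then show False using that by (metis dvd_triv_right int_dvd_int_iff nat_dvd_not_less)
  qed
  let ?P = "monom 1 m - 1 :: int poly"
  have coeffP: "coeff ?P m = 1" using assms by (simp add: coeff_1)
  have P0: "?P \<noteq> 0" using coeffP by (metis coeff_0 zero_neq_one)
  have degP: "degree ?P = m"
    by (rule antisym, rule degree_diff_le) (use assms coeffP in \<open>auto simp: degree_monom_le intro!: le_degree\<close>)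
  have "?P dvd prod_mset (prime_factorization ?P)"
    using P0 by (metis dvd_normalize_iff dvd_refl normalize_dvd_iff prod_mset_prime_factorization_weak)
  then obtain g where "prod_mset (prime_factorization ?P) = ?P * g" by auto
  then have "ev (prod_mset (prime_factorization ?P)) = 0" by (simp add: ev_mult ev_X zm)
  moreover have "ev (prod_mset A) = 0 \<Longrightarrow> \<exists>f\<in>#A. ev f = 0" for A
    by (induction A) (auto simp: ev_mult ev_1)
  ultimately obtain f where f: "f \<in># prime_factorization ?P" "ev f = 0" by blast
  have pe: "prime_elem f" and dvd: "f dvd ?P"
    using f(1) P0 by (auto dest: in_prime_factors_imp_prime in_prime_factors_imp_dvd)
  obtain h where h: "?P = f * h" using dvd by auto
  have "lead_coeff f * lead_coeff h = 1"
    using coeffP degP h by (metis lead_coeff_mult)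
  then have lc: "\<bar>lead_coeff f\<bar> = 1" by (metis zmult_eq_1_iff abs_1 abs_minus_cancel)
  have "0 < degree f"
  proof (rule ccontr)
    assume "\<not> 0 < degree f"
    then obtain c where c: "f = [:c:]" by (auto elim: degree_eq_zeroE)
    with f(2) have "c = 0" by (simp add: ev_C)
    with c pe show False by simp
  qed
  moreover have "\<not> f dvd monom 1 i - 1" if "0 < i" "i < m" for i
  proof
    assume "f dvd monom 1 i - 1"
    then obtain g where "monom 1 i - 1 = f * g" by auto
    then have "z ^ i - 1 = 0" using f(2) ev_mult ev_X by (metis mult_zero_left)
    with zi[OF that] show False by simp
  qed
  ultimately show ?thesis using that pe dvd lc by blast
qed

text \<open>The ideal generated by a prime number and a polynomial of positive degree with leading
  coefficient 1 or -1 is proper.\<close>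

lemma prime_and_monic_proper:
  fixes f :: "int poly"
  assumes "prime p" "0 < degree f" "\<bar>lead_coeff f\<bar> = 1"
  shows "1 \<noteq> of_nat p * a + f * b"
proof
  assume eq: "1 = of_nat p * a + f * b"
  let ?J = "{j. \<not> int p dvd coeff b j}"
  have fin: "finite ?J"
    by (rule finite_subset[of _ "{..degree b}"]) (auto intro: le_degree)
  have cP: "coeff (of_nat p * a) j = int p * coeff a j" for j
    by (simp add: of_nat_poly)
  show False
  proof (cases "?J = {}")
    case True
    have "int p dvd coeff (of_nat p * a + f * b) 0"
      unfolding coeff_add cP using True by (simp add: coeff_mult)
    then have "int p dvd 1" unfolding eq[symmetric] by simp
    then show False using \<open>prime p\<close> by (simp add: prime_gt_1_nat)
  next
    case False
    define j where "j = Max ?J"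
    have j: "\<not> int p dvd coeff b j" using Max_in[OF fin False] by (simp add: j_def)
    have above: "int p dvd coeff b i" if "j < i" for i
      using Max_ge[OF fin, of i] that by (force simp: j_def)
    let ?n = "degree f + j"
    have "coeff (f * b) ?n = (\<Sum>i\<le>?n. coeff f i * coeff b (?n - i))" by (rule coeff_mult)
    also have "\<dots> = coeff f (degree f) * coeff b j +
        (\<Sum>i\<in>{..?n} - {degree f}. coeff f i * coeff b (?n - i))"
      by (subst sum.remove[of _ "degree f"]) auto
    finally have c: "coeff (f * b) ?n = lead_coeff f * coeff b j +
        (\<Sum>i\<in>{..?n} - {degree f}. coeff f i * coeff b (?n - i))" .
    have rest: "int p dvd (\<Sum>i\<in>{..?n} - {degree f}. coeff f i * coeff b (?n - i))"
    proof (rule dvd_sum)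
      fix i assume "i \<in> {..?n} - {degree f}"
      then consider "i < degree f" | "degree f < i" by force
      then show "int p dvd coeff f i * coeff b (?n - i)"
      proof cases
        case 1
        then show ?thesis using above[of "?n - i"] by (intro dvd_mult) auto
      qed (simp add: coeff_eq_0)
    qed
    have "coeff (of_nat p * a + f * b) ?n = 0" unfolding eq[symmetric] using assms(2) by (simp add: coeff_1)
    then have "int p * coeff a ?n + coeff (f * b) ?n = 0" by (simp only: coeff_add cP)
    then have "lead_coeff f * coeff b j = - int p * coeff a ?n -
        (\<Sum>i\<in>{..?n} - {degree f}. coeff f i * coeff b (?n - i))" using c by linarith
    then have "int p dvd lead_coeff f * coeff b j"
      using dvd_diff[OF _ rest, of "- int p * coeff a ?n"] by simp
    moreover have "lead_coeff f = 1 \<or> lead_coeff f = -1" using assms(3) by linarith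
    ultimately have "int p dvd coeff b j" by auto
    with j show False by simp
  qed
qed

text \<open>With \<open>m = q - 1\<close>, let \<open>M\<close> be a maximal ideal that contains
  \<open>p\<close> and the factor \<open>f\<close> of the previous lemma. The class of \<open>X\<close> has
  order \<open>m\<close> in the residue field, and every residue is a root of \<open>Y\<^sup>q - Y\<close>, so
  that the residue field consists of zero and the powers of \<open>X\<close> and has exactly \<open>q\<close>
  elements.\<close>

lemma finite_field_exists:
  assumes "prime p" "0 < k" "q = p ^ k"
  shows "\<exists>F :: nat ring. field F \<and> carrier F = {..<q}"
proof -
  have "p ^ 1 \<le> p ^ k" using assms
    using prime_ge_1_nat[OF assms(1)] by (intro power_increasing) auto
  then have q2: "2 \<le> q" using prime_ge_2_nat[OF assms(1)] assms(3) by simp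
  define m where "m = q - 1"
  have m: "0 < m" "q = Suc m" using q2 by (auto simp: m_def)
  obtain f :: "int poly" where f: "prime_elem f" "f dvd monom 1 m - 1" "0 < degree f" "\<bar>lead_coeff f\<bar> = 1"
    "\<And>i. 0 < i \<Longrightarrow> i < m \<Longrightarrow> \<not> f dvd monom 1 i - 1"
    using primitive_factor_exists[OF m(1)] by blast
  let ?J = "{of_nat p * a + f * b |a b. True}"
  have J: "poly_ideal ?J"
    unfolding poly_ideal_def
  proof (intro conjI ballI allI)
    show "0 \<in> ?J" by (intro CollectI exI[of _ 0]) simp
    show "u + v \<in> ?J" if uv: "u \<in> ?J" "v \<in> ?J" for u v
    proof -
      obtain a b c d where "u = of_nat p * a + f * b" "v = of_nat p * c + f * d" using uv by auto
      then have "u + v = of_nat p * (a + c) + f * (b + d)" by (simp add: algebra_simps)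
      then show ?thesis by blast
    qed
    show "r * u \<in> ?J" if u: "u \<in> ?J" for r u
    proof -
      obtain a b where "u = of_nat p * a + f * b" using u by auto
      then have "r * u = of_nat p * (r * a) + f * (r * b)" by (simp add: algebra_simps)
      then show ?thesis by blast
    qed
  qed
  have "1 \<notin> ?J" using prime_and_monic_proper[OF assms(1) f(3,4)] by auto
  then obtain M where M: "poly_ideal M" "?J \<subseteq> M" "1 \<notin> M" and inv: "\<And>g. g \<notin> M \<Longrightarrow> \<exists>h. 1 - g * h \<in> M"
    using maximal_ideal_exists[OF J] by blast
  note I = poly_idealD[OF M(1)]
  have "of_nat p * 1 + f * 0 \<in> ?J" by blast
  then have pM: "of_nat p \<in> M" using M(2) by auto
  have fM: "f dvd g \<Longrightarrow> g \<in> M" for g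
  proof -
    assume "f dvd g"
    then obtain h where "g = of_nat p * 0 + f * h" by auto
    then have "g \<in> ?J" by blast
    then show "g \<in> M" using M(2) by blast
  qed
  have prime: "a \<in> M \<or> b \<in> M" if "a * b \<in> M" for a b
  proof (rule ccontr)
    assume no: "\<not> (a \<in> M \<or> b \<in> M)"
    then obtain h where "1 - a * h \<in> M" using inv by blast
    then have "b * (1 - a * h) + a * b * h \<in> M" using I(2)[OF I(3) I(4)[OF that]] by blast
    moreover have "b * (1 - a * h) + a * b * h = b" by (simp add: algebra_simps)
    ultimately show False using no by simp
  qed
  let ?X = "monom 1 1 :: int poly"
  have X: "?X ^ i = monom 1 i" for i by (simp add: monom_power)
  have fX: "f dvd ?X ^ m - 1" using f(2) X by simp
  have Xm: "?X ^ m - 1 \<in> M" using fM f(2) X by simp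
  \<comment> \<open>Otherwise the sum of the powers \<open>(X^i)^j\<close> for \<open>j < m\<close>, which lies in \<open>M\<close> as a multiple of \<open>f\<close>, would be congruent to \<open>m = q - 1\<close>, and hence to \<open>-1\<close>.\<close>
  have Xi: "?X ^ i - 1 \<notin> M" if i: "0 < i" "i < m" for i
  proof
    assume *: "?X ^ i - 1 \<in> M"
    let ?S = "\<Sum>j<m. (?X ^ i) ^ j"
    have "(?X ^ i - 1) * ?S = (?X ^ i) ^ m - 1" by (simp add: power_diff_1_eq)
    also have "\<dots> = (?X ^ m) ^ i - 1" by (simp add: power_mult[symmetric] mult.commute)
    also have "f dvd \<dots>" using fX unfolding power_diff_1_eq[of "?X ^ m" i] by (rule dvd_mult2)
    finally have "f dvd (monom 1 i - 1) * ?S" unfolding X .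
    then have "f dvd ?S" using f(1) f(5)[OF i] prime_elem_dvd_mult_iff X by metis
    then have S: "?S \<in> M" by (rule fM)
    have "(?X ^ i) ^ j - 1 \<in> M" for j
      unfolding power_diff_1_eq[of "?X ^ i" j] using I(4)[OF *] .
    then have "(\<Sum>j<m. (?X ^ i) ^ j - 1) \<in> M" by (intro sum_in_ideal[OF M(1)]) auto
    then have "?S - of_nat m \<in> M" by (simp add: sum_subtractf)
    then have "of_nat m \<in> M" using I(5)[OF S] by fastforce
    moreover have "(of_nat q :: int poly) \<in> M"
    proof -
      obtain l where "k = Suc l" using assms(2) by (cases k) auto
      then have "(of_nat q :: int poly) = of_nat p * of_nat (p ^ l)" using assms(3) by (simp only: power_Suc of_nat_mult)
      then show ?thesis using I(4)[OF pM] by simp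
    qed
    ultimately have "of_nat q - of_nat m \<in> M" by (rule I(5)[rotated])
    then show False using M(3) m(2) by simp
  qed
  have Xne: "?X ^ i \<notin> M" if "i \<le> m" for i
  proof
    assume "?X ^ i \<in> M"
    then have "?X ^ i * ?X ^ (m - i) \<in> M" by (rule I(4))
    then have "?X ^ m \<in> M" using that by (simp add: power_add[symmetric])
    from I(5)[OF this Xm] show False using M(3) by simp
  qed
  have Xij: "?X ^ i - ?X ^ j \<notin> M" if "i < j" "j < m" for i j
  proof
    assume "?X ^ i - ?X ^ j \<in> M"
    moreover have "?X ^ i - ?X ^ j = - (?X ^ i * (?X ^ (j - i) - 1))"
      using that by (simp add: algebra_simps power_add[symmetric])
    ultimately have "?X ^ i * (?X ^ (j - i) - 1) \<in> M" using I(6) by fastforce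
    then have "?X ^ i \<in> M \<or> ?X ^ (j - i) - 1 \<in> M" by (rule prime)
    then show False using Xne[of i] Xi[of "j - i"] that by auto
  qed
  have frob: "(a + b) ^ q - (a ^ q + b ^ q) \<in> M" for a b
    unfolding assms(3) by (rule frobenius_mod_ideal[OF M(1) pM assms(1)])
  \<comment> \<open>The fixed points of the Frobenius map form a ring that contains \<open>X\<close>, hence all polynomials.\<close>
  define S where "S = {g. g ^ q - g \<in> M}"
  have S_add: "a + b \<in> S" if "a \<in> S" "b \<in> S" for a b
  proof -
    have "((a + b) ^ q - (a ^ q + b ^ q)) + ((a ^ q - a) + (b ^ q - b)) \<in> M"
      using that frob I(2) unfolding S_def by blast
    then show ?thesis unfolding S_def by (simp add: algebra_simps)
  qed
  have S_mult: "a * b \<in> S" if "a \<in> S" "b \<in> S" for a b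
  proof -
    have "(a ^ q - a) * b ^ q + a * (b ^ q - b) \<in> M"
      using that I(2)[OF I(4) I(3)] unfolding S_def by blast
    then show ?thesis unfolding S_def by (simp add: algebra_simps power_mult_distrib)
  qed
  have S_0: "0 \<in> S" and S_1: "1 \<in> S" using I(1) q2 by (auto simp: S_def power_0_left)
  have S_minus: "- a \<in> S" if "a \<in> S" for a
  proof -
    have "(a + - a) ^ q - (a ^ q + (- a) ^ q) \<in> M" by (rule frob)
    then have "- (a ^ q + (- a) ^ q) \<in> M" using q2 by (simp add: power_0_left)
    then have "a ^ q + (- a) ^ q \<in> M"
      using I(6)[of "- (a ^ q + (- a) ^ q)"] by (simp add: add.commute)
    then have "a ^ q + (- a) ^ q - (a ^ q - a) \<in> M" by (rule I(5)) (use that in \<open>simp add: S_def\<close>)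
    then show ?thesis unfolding S_def by simp
  qed
  have S_X: "?X \<in> S"
  proof -
    have "?X * (?X ^ m - 1) \<in> M" using I(3)[OF Xm] .
    then show ?thesis unfolding S_def m(2) by (simp add: algebra_simps)
  qed
  have S_nat: "of_nat n \<in> S" for n by (induction n) (auto simp: S_0 intro: S_add S_1)
  have S_const: "[:c:] \<in> S" for c
  proof (cases c)
    case (nonneg n)
    then show ?thesis using S_nat[of n] by (simp add: of_nat_poly)
  next
    case (neg n)
    then have "[:c:] = - of_nat (Suc n)" by (simp add: of_nat_poly)
    then show ?thesis using S_minus[OF S_nat] by metis
  qed
  have S_all: "g \<in> S" for g
  proof (induction g)
    case 0
    show ?case by (rule S_0)
  next
    case (pCons c g)
    have "pCons c g = [:c:] + ?X * g" by (simp add: monom_Suc)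
    then show ?case using S_add[OF S_const S_mult[OF S_X pCons(2)]] by metis
  qed
  have covers: "\<exists>i<m. g - ?X ^ i \<in> M" if g: "g \<notin> M" for g
  proof (rule roots_mod_ideal[OF M(1,3) prime])
    let ?P = "monom 1 m - 1 :: int poly poly"
    have c: "coeff ?P m = 1" using m(1) by (simp add: coeff_1)
    have d: "degree ?P = m"
      by (rule antisym, rule degree_diff_le) (use c in \<open>auto simp: degree_monom_le intro!: le_degree\<close>)
    show "degree ?P = m" "lead_coeff ?P = 1" using c d by auto
    show "poly ?P (?X ^ i) \<in> M" if "i < m" for i
    proof -
      have "(?X ^ i) ^ m - 1 = (?X ^ m) ^ i - 1" by (simp add: power_mult[symmetric] mult.commute)
      also have "\<dots> \<in> M" unfolding power_diff_1_eq[of "?X ^ m" i] by (rule I(4)[OF Xm])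
      finally show ?thesis by (simp add: poly_monom)
    qed
    have "g * (g ^ m - 1) \<in> M" using S_all[of g] unfolding S_def m(2) by (simp add: algebra_simps)
    then show "poly ?P g \<in> M" using prime g by (auto simp: poly_monom)
  qed (assumption, rule Xij)
  \<comment> \<open>Representatives of the \<open>q\<close> residue classes; \<open>cl\<close> maps a polynomial to the number of its class.\<close>
  define rep where "rep = (\<lambda>j. if j = 0 then 0 else ?X ^ (j - 1))"
  have rep_ex: "\<exists>j<q. g - rep j \<in> M" for g
  proof (cases "g \<in> M")
    case True
    then show ?thesis using q2 by (intro exI[of _ 0]) (auto simp: rep_def)
  next
    case False
    then obtain i where "i < m" "g - ?X ^ i \<in> M" using covers by blast
    then show ?thesis using m(2) by (intro exI[of _ "Suc i"]) (auto simp: rep_def)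
  qed
  have rep_lt: "rep i - rep j \<notin> M" if "i < j" "j < q" for i j
  proof (cases "i = 0")
    case True
    then show ?thesis using Xne[of "j - 1"] I(6)[of "- (?X ^ (j - 1))"] that m(2) by (auto simp: rep_def)
  next
    case False
    then show ?thesis using Xij[of "i - 1" "j - 1"] that m(2) by (auto simp: rep_def)
  qed
  have rep_inj: "i = j" if "rep i - rep j \<in> M" "i < q" "j < q" for i j
  proof (rule ccontr)
    assume "i \<noteq> j"
    moreover have "rep j - rep i \<in> M" using I(6)[OF that(1)] by simp
    ultimately show False using rep_lt[of i j] rep_lt[of j i] that by (cases "i < j") auto
  qed
  define cl where "cl = (\<lambda>g. SOME j. j < q \<and> g - rep j \<in> M)"
  have cl: "cl g < q" "g - rep (cl g) \<in> M" for g
    using someI_ex[OF rep_ex[of g, folded Bex_def, unfolded Bex_def]] unfolding cl_def by auto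
  have cl_eq: "cl g = cl h" if "g - h \<in> M" for g h
  proof (rule rep_inj)
    have "(h - rep (cl h)) - (g - rep (cl g)) + (g - h) \<in> M"
      by (rule I(2)[OF I(5)[OF cl(2) cl(2)] that])
    then show "rep (cl g) - rep (cl h) \<in> M" by (simp add: algebra_simps)
  qed (use cl in auto)
  have cl_rep: "cl (rep i) = i" if "i < q" for i
    using cl(2)[of "rep i"] rep_inj[of i "cl (rep i)"] cl(1) that by auto
  have sym: "rep (cl g) - g \<in> M" for g using I(6)[OF cl(2)[of g]] by simp
  have cl_add: "cl (rep (cl g) + h) = cl (g + h)" "cl (h + rep (cl g)) = cl (h + g)" for g h
    by (rule cl_eq; use sym[of g] in simp)+
  have cl_mult: "cl (rep (cl g) * h) = cl (g * h)" "cl (h * rep (cl g)) = cl (h * g)" for g h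
    by (rule cl_eq; use I(4)[OF sym[of g], of h] in \<open>simp add: algebra_simps\<close>)+
  define F :: "nat ring" where "F = \<lparr>carrier = {..<q}, monoid.mult = (\<lambda>a b. cl (rep a * rep b)), one = cl 1,
    zero = cl 0, add = (\<lambda>a b. cl (rep a + rep b))\<rparr>"
  have F: "carrier F = {..<q}" "x \<otimes>\<^bsub>F\<^esub> y = cl (rep x * rep y)" "\<one>\<^bsub>F\<^esub> = cl 1" "\<zero>\<^bsub>F\<^esub> = cl 0"
    "x \<oplus>\<^bsub>F\<^esub> y = cl (rep x + rep y)" for x y by (simp_all add: F_def)
  have cr: "cring F"
  proof (rule cringI)
    show "abelian_group F"
    proof (rule abelian_groupI)
      show "\<exists>y\<in>carrier F. y \<oplus>\<^bsub>F\<^esub> x = \<zero>\<^bsub>F\<^esub>" if "x \<in> carrier F" for x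
        by (intro bexI[of _ "cl (- rep x)"]) (auto simp: F cl_add cl)
    qed (auto simp: F cl_add cl cl_rep algebra_simps)
    show "comm_monoid F"
      by (rule comm_monoidI) (auto simp: F cl_mult cl cl_rep algebra_simps)
  qed (auto simp: F cl_add cl_mult cl algebra_simps)
  interpret F: cring F by (rule cr)
  have "field F"
  proof (rule F.cring_fieldI2)
    show "\<zero>\<^bsub>F\<^esub> \<noteq> \<one>\<^bsub>F\<^esub>"
    proof
      assume "\<zero>\<^bsub>F\<^esub> = \<one>\<^bsub>F\<^esub>"
      then have "cl 1 = cl 0" by (simp add: F)
      then have "(1 - rep (cl 1)) - (0 - rep (cl 0)) \<in> M" using I(5)[OF cl(2) cl(2)] by blast
      then show False using M(3) \<open>cl 1 = cl 0\<close> by simp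
    qed
    show "\<exists>b\<in>carrier F. a \<otimes>\<^bsub>F\<^esub> b = \<one>\<^bsub>F\<^esub>" if a: "a \<in> carrier F" "a \<noteq> \<zero>\<^bsub>F\<^esub>" for a
    proof -
      have "rep a \<notin> M"
      proof
        assume "rep a \<in> M"
        then have "cl (rep a) = cl 0" by (intro cl_eq) simp
        with a show False by (simp add: F cl_rep)
      qed
      then obtain h where "1 - rep a * h \<in> M" using inv by blast
      then have "cl (rep a * h) = cl 1" by (rule cl_eq[symmetric])
      then show ?thesis by (intro bexI[of _ "cl h"]) (auto simp: F cl_mult cl)
    qed
  qed
  with F(1) show ?thesis by blast
qed

subsection \<open>The possible orders\<close>

lemma (in group) cauchy_prime:
  assumes "prime r" "r dvd order G" "finite (carrier G)"
  obtains x where "x \<in> carrier G" "x \<noteq> \<one>" "x [^] r = \<one>"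
proof -
  obtain l where "order G = r ^ 1 * l" using assms(2) by auto
  then obtain H where H: "subgroup H G" "card H = r ^ 1"
    using sylow_thm[OF assms(1) is_group _ assms(3)] by blast
  interpret H: group "G\<lparr>carrier := H\<rparr>" using H(1) by (rule subgroup_imp_group)
  have "1 < card H" using H(2) prime_gt_1_nat[OF assms(1)] by simp
  then have "H \<noteq> {\<one>}" by auto
  moreover have "\<one> \<in> H" using H(1) by (simp add: subgroup.one_closed)
  ultimately obtain x where x: "x \<in> H" "x \<noteq> \<one>" by blast
  have "x [^]\<^bsub>G\<lparr>carrier := H\<rparr>\<^esub> order (G\<lparr>carrier := H\<rparr>) = \<one>"
    using H.pow_order_eq_1[of x] x by simp
  then have "x [^] r = \<one>" using H(2) by (simp add: order_def nat_pow_consistent[symmetric])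
  then show ?thesis using that x subgroup.mem_carrier[OF H(1)] by blast
qed

text \<open>By Cauchy's theorem, every prime that divides the order annihilates a nonzero element, and hence the
  field; this is impossible for two different primes.\<close>

lemma finite_field_order:
  assumes "field F" "finite (carrier F)"
  shows "2 \<le> card (carrier F) \<and> (\<exists>p\<ge>2. \<forall>d\<ge>2. d dvd card (carrier F) \<longrightarrow> p dvd d)"
proof -
  interpret F: field F by fact
  have "{\<zero>\<^bsub>F\<^esub>, \<one>\<^bsub>F\<^esub>} \<subseteq> carrier F" by auto
  then have "card {\<zero>\<^bsub>F\<^esub>, \<one>\<^bsub>F\<^esub>} \<le> card (carrier F)" by (rule card_mono[OF assms(2)])
  then have q2: "2 \<le> card (carrier F)" by simp
  have char: "[r] \<cdot>\<^bsub>F\<^esub> \<one>\<^bsub>F\<^esub> = \<zero>\<^bsub>F\<^esub>" if r: "prime r" "r dvd card (carrier F)" for r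
  proof -
    obtain x where x: "x \<in> carrier F" "x \<noteq> \<zero>\<^bsub>F\<^esub>" "[r] \<cdot>\<^bsub>F\<^esub> x = \<zero>\<^bsub>F\<^esub>"
      using F.add.cauchy_prime[OF r(1)] r(2) assms(2) by (auto simp: order_def)
    have "([r] \<cdot>\<^bsub>F\<^esub> \<one>\<^bsub>F\<^esub>) \<otimes>\<^bsub>F\<^esub> x = [r] \<cdot>\<^bsub>F\<^esub> x"
      using x(1) by (simp add: F.add_pow_ldistr)
    then show ?thesis using x F.integral by (metis F.add.nat_pow_closed F.one_closed)
  qed
  obtain p where p: "prime p" "p dvd card (carrier F)"
    using prime_factor_nat[of "card (carrier F)"] q2 by auto
  have "p dvd d" if d: "2 \<le> d" "d dvd card (carrier F)" for d
  proof -
    obtain r where r: "prime r" "r dvd d" using prime_factor_nat[of d] d by auto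
    have "p = r"
    proof (rule ccontr)
      assume "p \<noteq> r"
      then have "coprime p r" using primes_coprime p r by blast
      then obtain u v where "p * u = r * v + 1 "
        using bezout_nat[of p r] prime_gt_0_nat[OF p(1)] coprime_iff_gcd_eq_1 by (metis less_numeral_extra(3))
      then have eq: "([(p * u)] \<cdot>\<^bsub>F\<^esub> \<one>\<^bsub>F\<^esub>) = ([(r * v + 1)] \<cdot>\<^bsub>F\<^esub> \<one>\<^bsub>F\<^esub>)" by simp
      have "r dvd card (carrier F)" using r d dvd_trans by blast
      then have "[(p * u)] \<cdot>\<^bsub>F\<^esub> \<one>\<^bsub>F\<^esub> = \<zero>\<^bsub>F\<^esub>" "[(r * v)] \<cdot>\<^bsub>F\<^esub> \<one>\<^bsub>F\<^esub> = \<zero>\<^bsub>F\<^esub>"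
        using F.add.nat_pow_pow[of "\<one>\<^bsub>F\<^esub>", symmetric] char p r F.add.nat_pow_one by simp_all
      then have "\<one>\<^bsub>F\<^esub> = \<zero>\<^bsub>F\<^esub>"
        using eq by (simp add: F.add.nat_pow_mult[symmetric] del: add_Suc_right)
      then show False by simp
    qed
    with r show ?thesis by simp
  qed
  with q2 p show ?thesis using prime_ge_2_nat by blast
qed

text \<open>The criterion says that all divisors of \<open>q\<close> other than 1 have a common divisor
  \<open>p\<close> other than 1, that is, \<open>q\<close> is a power of a prime. This form only quantifies over
  divisibility.\<close>

theorem finite_field_iff:
  "(\<exists>F :: nat ring. field F \<and> carrier F = {..<q}) \<longleftrightarrow>
     2 \<le> q \<and> (\<exists>p\<ge>2. \<forall>d\<ge>2. d dvd q \<longrightarrow> p dvd d)"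
proof
  assume "\<exists>F :: nat ring. field F \<and> carrier F = {..<q}"
  then show "2 \<le> q \<and> (\<exists>p\<ge>2. \<forall>d\<ge>2. d dvd q \<longrightarrow> p dvd d)"
    using finite_field_order by (metis card_lessThan finite_lessThan)
next
  assume *: "2 \<le> q \<and> (\<exists>p\<ge>2. \<forall>d\<ge>2. d dvd q \<longrightarrow> p dvd d)"
  then obtain p where p: "2 \<le> p" "\<And>d. 2 \<le> d \<Longrightarrow> d dvd q \<Longrightarrow> p dvd d" by blast
  have pq: "p dvd q" using p(2)[of q] * by simp
  have only: "d = p" if "prime d" "d dvd q" for d
  proof -
    have "p dvd d" using p(2) that prime_ge_2_nat by blast
    then have "p = 1 \<or> p = d" using that(1) prime_nat_iff by blast
    then show ?thesis using p(1) by simp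
  qed
  obtain r where "prime r" "r dvd q" using prime_factor_nat[of q] * by auto
  then have pr: "prime p" using only by simp
  obtain k c where kc: "q = p ^ k * c" "\<not> p dvd c"
    using multiplicity_decompose'[of q p] * pr by (metis not_numeral_le_zero not_prime_unit)
  have "c = 1"
  proof (rule ccontr)
    assume "c \<noteq> 1"
    then obtain r where "prime r" "r dvd c" using prime_factor_nat by blast
    then show False using only[of r] kc by auto
  qed
  then have "q = p ^ k" using kc by simp
  moreover from this have "0 < k" using * by (cases k) auto
  ultimately show "\<exists>F :: nat ring. field F \<and> carrier F = {..<q}" using finite_field_exists pr by blast
qed

section \<open>CR tuples of congruences of a finite abelian group\<close>

text \<open>Generators are numbered by quadruples over \<open>{..<N}\<close>. The quadruples starting with \<open>i, j\<close>,
  for \<open>i \<noteq> j\<close>, are reserved for the defects that arise when the constraint for \<open>i, j\<close> is imposed.\<close>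

definition quads :: "nat \<Rightarrow> nat list set" where
  "quads N = {g. length g = 4 \<and> set g \<subseteq> {..<N}}"

text \<open>Abelian groups on \<open>{..<n}\<close>. The operations are arbitrary outside of
  \<open>{..<n}\<close>.\<close>

locale abgrp =
  fixes n :: nat and add :: "nat \<Rightarrow> nat \<Rightarrow> nat" and neg :: "nat \<Rightarrow> nat" and z :: nat
  assumes z: "z < n"
    and add_less: "x < n \<Longrightarrow> y < n \<Longrightarrow> add x y < n"
    and neg_less: "x < n \<Longrightarrow> neg x < n"
    and assoc: "x < n \<Longrightarrow> y < n \<Longrightarrow> w < n \<Longrightarrow> add (add x y) w = add x (add y w)"
    and comm: "x < n \<Longrightarrow> y < n \<Longrightarrow> add x y = add y x"
    and zero: "x < n \<Longrightarrow> add z x = x"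
    and neg: "x < n \<Longrightarrow> add (neg x) x = z"
begin

definition sub :: "nat \<Rightarrow> nat \<Rightarrow> nat" where "sub x y = add x (neg y)"

lemma lcomm: "x < n \<Longrightarrow> y < n \<Longrightarrow> w < n \<Longrightarrow> add x (add y w) = add y (add x w)"
  by (metis assoc comm)

lemma zero_right: "x < n \<Longrightarrow> add x z = x"
  using zero comm z by metis

lemma sub_less: "x < n \<Longrightarrow> y < n \<Longrightarrow> sub x y < n"
  by (simp add: sub_def add_less neg_less)

lemma sub_add: "x < n \<Longrightarrow> y < n \<Longrightarrow> add (sub x y) y = x"
  by (simp add: sub_def assoc neg_less neg zero_right)

lemma cancel: "x < n \<Longrightarrow> y < n \<Longrightarrow> w < n \<Longrightarrow> add x w = add y w \<Longrightarrow> x = y"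
  by (metis assoc comm neg neg_less zero)

lemma subI: "u < n \<Longrightarrow> y < n \<Longrightarrow> x < n \<Longrightarrow> add u y = x \<Longrightarrow> sub x y = u"
  by (metis cancel sub_add sub_less)

lemma sub_self: "x < n \<Longrightarrow> sub x x = z"
  by (rule subI) (auto simp: zero z)

lemma sub_add_add:
  assumes "x < n" "y < n" "u < n" "v < n"
  shows "sub (add x y) (add u v) = add (sub x u) (sub y v)"
proof (rule subI)
  have "add (add (sub x u) (sub y v)) (add u v) = add (add (sub x u) u) (add (sub y v) v)"
    using assms by (simp add: assoc comm lcomm sub_less add_less)
  then show "add (add (sub x u) (sub y v)) (add u v) = add x y" using assms by (simp add: sub_add)
qed (use assms in \<open>auto simp: add_less sub_less\<close>)

end

text \<open>Congruences of the group are given by predicates \<open>\<theta> i\<close>, for \<open>i < k\<close>.\<close>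

locale crt = abgrp +
  fixes k :: nat and \<theta> :: "nat \<Rightarrow> nat \<Rightarrow> nat \<Rightarrow> bool"
  assumes \<theta>_less: "i < k \<Longrightarrow> \<theta> i x y \<Longrightarrow> x < n \<and> y < n"
    and \<theta>_refl: "i < k \<Longrightarrow> x < n \<Longrightarrow> \<theta> i x x"
    and \<theta>_sym: "i < k \<Longrightarrow> \<theta> i x y \<Longrightarrow> \<theta> i y x"
    and \<theta>_trans: "i < k \<Longrightarrow> \<theta> i x y \<Longrightarrow> \<theta> i y w \<Longrightarrow> \<theta> i x w"
    and \<theta>_add: "i < k \<Longrightarrow> \<theta> i x y \<Longrightarrow> \<theta> i u v \<Longrightarrow> \<theta> i (add x u) (add y v)"
begin

text \<open>The class of zero under the join of \<open>\<theta> i\<close> and \<open>\<theta> j\<close>, which permute.\<close>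

definition Z :: "nat \<Rightarrow> nat \<Rightarrow> nat \<Rightarrow> bool" where
  "Z i j v \<longleftrightarrow> (\<exists>u. \<theta> i v u \<and> \<theta> j u z)"

lemma \<theta>_neg: "i < k \<Longrightarrow> \<theta> i x y \<Longrightarrow> \<theta> i (neg x) (neg y)"
proof -
  assume i: "i < k" and xy: "\<theta> i x y"
  have l: "x < n" "y < n" "neg x < n" "neg y < n" using \<theta>_less[OF i xy] neg_less by auto
  have "\<theta> i (add (neg x) (neg y)) (add (neg x) (neg y))" using \<theta>_refl i l add_less by blast
  then have "\<theta> i (add (add (neg x) (neg y)) x) (add (add (neg x) (neg y)) y)"
    using \<theta>_add[OF i _ xy] by blast
  moreover have "add (add (neg x) (neg y)) x = neg y"
    using l by (metis assoc comm neg zero_right)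
  moreover have "add (add (neg x) (neg y)) y = neg x"
    using l by (simp add: assoc neg zero_right)
  ultimately show "\<theta> i (neg x) (neg y)" using \<theta>_sym[OF i] by simp
qed

lemma Z_less: "i < k \<Longrightarrow> Z i j v \<Longrightarrow> v < n"
  unfolding Z_def using \<theta>_less by blast

lemma Z_zero: "i < k \<Longrightarrow> j < k \<Longrightarrow> Z i j z"
  unfolding Z_def using \<theta>_refl z by blast

lemma Z_add: "i < k \<Longrightarrow> j < k \<Longrightarrow> Z i j v \<Longrightarrow> Z i j w \<Longrightarrow> Z i j (add v w)"
  unfolding Z_def using \<theta>_add zero z by metis

lemma Z_neg: "i < k \<Longrightarrow> j < k \<Longrightarrow> Z i j v \<Longrightarrow> Z i j (neg v)"
proof -
  assume "i < k" "j < k" "Z i j v"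
  moreover have "neg z = z" using neg[OF z] zero_right[OF neg_less[OF z]] by simp
  ultimately show ?thesis unfolding Z_def using \<theta>_neg by metis
qed

lemma Z_cancel:
  assumes "i < k" "j < k" "a < n" "Z i j (add a b)" "Z i j b"
  shows "Z i j a"
proof -
  have b: "b < n" using Z_less assms by blast
  have "Z i j (add (add a b) (neg b))" using Z_add Z_neg assms by blast
  moreover have "add (add a b) (neg b) = a"
    using assms(3) b by (metis assoc comm neg neg_less zero_right)
  ultimately show ?thesis by simp
qed

lemma \<theta>_Z: "i < k \<Longrightarrow> j < k \<Longrightarrow> \<theta> i x y \<Longrightarrow> Z i j (sub x y)"
proof -
  assume i: "i < k" "j < k" and xy: "\<theta> i x y"
  have l: "x < n" "y < n" using \<theta>_less[OF i(1) xy] by auto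
  have "\<theta> i (add x (neg y)) (add y (neg y))"
    using \<theta>_add[OF i(1) xy] \<theta>_refl[OF i(1)] neg_less l by blast
  then show ?thesis using sub_self[of y] \<theta>_refl[OF i(2) z] l unfolding Z_def sub_def by metis
qed

lemma \<theta>_Z': "i < k \<Longrightarrow> j < k \<Longrightarrow> \<theta> j x y \<Longrightarrow> Z i j (sub x y)"
proof -
  assume i: "i < k" "j < k" and xy: "\<theta> j x y"
  have l: "x < n" "y < n" using \<theta>_less[OF i(2) xy] by auto
  have "\<theta> j (add x (neg y)) (add y (neg y))"
    using \<theta>_add[OF i(2) xy] \<theta>_refl[OF i(2)] neg_less l by blast
  then show ?thesis using sub_self[of y] \<theta>_refl[OF i(1)] l sub_less[OF l] unfolding Z_def sub_def by metis
qed

subsection \<open>Compatible tuples and their generators\<close>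

text \<open>Elements of the \<open>k\<close>-th power of the group, as functions that are zero from
  \<open>k\<close> on.\<close>

definition tuple :: "(nat \<Rightarrow> nat) \<Rightarrow> bool" where
  "tuple h \<longleftrightarrow> (\<forall>l. h l < n) \<and> (\<forall>l\<ge>k. h l = z)"

definition tadd :: "(nat \<Rightarrow> nat) \<Rightarrow> (nat \<Rightarrow> nat) \<Rightarrow> nat \<Rightarrow> nat" where
  "tadd g h = (\<lambda>l. add (g l) (h l))"

abbreviation tz :: "nat \<Rightarrow> nat" where "tz \<equiv> \<lambda>_. z"

lemma tuple_tz: "tuple tz"
  using z by (simp add: tuple_def)

lemma tuple_tadd: "tuple g \<Longrightarrow> tuple h \<Longrightarrow> tuple (tadd g h)"
  by (auto simp: tuple_def tadd_def add_less zero z)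

lemma tadd_assoc: "tuple f \<Longrightarrow> tuple g \<Longrightarrow> tuple h \<Longrightarrow> tadd (tadd f g) h = tadd f (tadd g h)"
  by (auto simp: tuple_def tadd_def assoc)

lemma tadd_lcomm: "tuple f \<Longrightarrow> tuple g \<Longrightarrow> tuple h \<Longrightarrow> tadd f (tadd g h) = tadd g (tadd f h)"
  by (auto simp: tuple_def tadd_def lcomm)

lemma tadd_tz: "tuple h \<Longrightarrow> tadd tz h = h" "tuple h \<Longrightarrow> tadd h tz = h"
  by (auto simp: tuple_def tadd_def zero zero_right)

text \<open>The submonoid generated by \<open>X\<close>; by finiteness this is the subgroup generated by \<open>X\<close>.\<close>

inductive gen :: "(nat \<Rightarrow> nat) set \<Rightarrow> (nat \<Rightarrow> nat) \<Rightarrow> bool" for X where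
  gen_zero: "gen X tz"
| gen_step: "x \<in> X \<Longrightarrow> gen X h \<Longrightarrow> gen X (tadd x h)"

lemma gen_tuple: "gen X h \<Longrightarrow> (\<And>x. x \<in> X \<Longrightarrow> tuple x) \<Longrightarrow> tuple h"
  by (induction rule: gen.induct) (auto intro: tuple_tz tuple_tadd)

lemma gen_base: "x \<in> X \<Longrightarrow> tuple x \<Longrightarrow> gen X x"
  using gen_step[OF _ gen_zero, of x X] by (simp add: tadd_tz)

lemma gen_tadd:
  assumes "\<And>x. x \<in> X \<Longrightarrow> tuple x" "gen X g" "gen X h"
  shows "gen X (tadd g h)"
  using assms(2,3)
proof (induction rule: gen.induct)
  case gen_zero
  then show ?case using gen_tuple[OF gen_zero assms(1)] by (simp add: tadd_tz)
next
  case (gen_step x g)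
  have "tadd (tadd x g) h = tadd x (tadd g h)"
    using gen_step assms(1) gen_tuple[OF _ assms(1)] by (simp add: tadd_assoc)
  then show ?case using gen_step gen.gen_step by simp
qed

text \<open>The homomorphism whose value modulo \<open>Z i j\<close> is to vanish, and the tuples that satisfy
  the constraints for the pairs in \<open>C\<close>.\<close>

definition \<phi> :: "nat \<Rightarrow> nat \<Rightarrow> (nat \<Rightarrow> nat) \<Rightarrow> nat" where
  "\<phi> i j h = sub (h i) (h j)"

lemma \<phi>_less: "tuple h \<Longrightarrow> \<phi> i j h < n"
  by (auto simp: \<phi>_def tuple_def sub_less)

lemma \<phi>_tadd: "tuple g \<Longrightarrow> tuple h \<Longrightarrow> \<phi> i j (tadd g h) = add (\<phi> i j g) (\<phi> i j h)"
  by (auto simp: \<phi>_def tuple_def tadd_def sub_add_add)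

lemma \<phi>_tz: "\<phi> i j tz = z"
  by (simp add: \<phi>_def sub_self z)

definition sat :: "(nat \<times> nat) set \<Rightarrow> (nat \<Rightarrow> nat) \<Rightarrow> bool" where
  "sat C h \<longleftrightarrow> (\<forall>(i, j)\<in>C. Z i j (\<phi> i j h))"

lemma sat_gen:
  assumes "C \<subseteq> {..<k} \<times> {..<k}" "\<And>x. x \<in> X \<Longrightarrow> tuple x \<and> sat C x" "gen X h"
  shows "sat C h"
  using assms(3)
proof (induction rule: gen.induct)
  case gen_zero
  show ?case using assms(1) Z_zero by (auto simp: sat_def \<phi>_tz)
next
  case (gen_step x h)
  have "tuple x" "sat C x" "tuple h" using gen_step assms(2) gen_tuple[of X h] by auto
  then show ?case using gen_step.IH assms(1) by (auto simp: sat_def \<phi>_tadd intro!: Z_add)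
qed

text \<open>A table of representatives for the values of the homomorphism \<open>\<phi> i j\<close>, taken modulo \<open>Z i j\<close>,
  on the group generated by \<open>X\<close>: its entry at \<open>q \<in> P\<close> has the value \<open>q\<close>, up to an element of \<open>Z i j\<close>. A
  closed table contains all values.\<close>

definition is_table :: "nat \<Rightarrow> nat \<Rightarrow> (nat \<Rightarrow> nat) set \<Rightarrow> nat set \<Rightarrow> (nat \<Rightarrow> nat \<Rightarrow> nat) \<Rightarrow> bool" where
  "is_table i j X P t \<longleftrightarrow> P \<subseteq> {..<n} \<and>
     (\<forall>q\<in>P. gen X (t q) \<and> (\<exists>\<zeta>. Z i j \<zeta> \<and> q = add \<zeta> (\<phi> i j (t q)))) \<and>
     (\<forall>q. Z i j q \<longrightarrow> q \<in> P \<and> t q = tz)"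

definition table_closed :: "nat \<Rightarrow> nat \<Rightarrow> (nat \<Rightarrow> nat) set \<Rightarrow> nat set \<Rightarrow> bool" where
  "table_closed i j X P \<longleftrightarrow> (\<forall>q\<in>P. \<forall>x\<in>X. add q (\<phi> i j x) \<in> P)"

lemma is_table_start:
  assumes "i < k" "j < k"
  shows "is_table i j X {q. Z i j q} (\<lambda>_. tz)"
  using Z_less[OF assms(1)] gen_zero by (auto simp: is_table_def \<phi>_tz zero_right)

lemma is_table_extend:
  assumes "is_table i j X P t" "\<And>x. x \<in> X \<Longrightarrow> tuple x" "i < k" "j < k"
    and "q \<in> P" "x \<in> X" "add q (\<phi> i j x) \<notin> P"
  shows "is_table i j X (insert (add q (\<phi> i j x)) P) (t(add q (\<phi> i j x) := tadd (t q) x))"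
proof -
  let ?e = "add q (\<phi> i j x)"
  obtain \<zeta> where \<zeta>: "gen X (t q)" "Z i j \<zeta>" "q = add \<zeta> (\<phi> i j (t q))" "q < n"
    using assms(1,5) unfolding is_table_def by blast
  have tu: "tuple x" "tuple (t q)" using assms(2,6) gen_tuple \<zeta>(1) by auto
  have "?e < n" using \<zeta>(4) \<phi>_less tu add_less by auto
  moreover have "gen X (tadd (t q) x)" by (rule gen_tadd[OF assms(2) \<zeta>(1) gen_base[OF assms(6)]]) (use tu in auto)
  moreover have "?e = add \<zeta> (\<phi> i j (tadd (t q) x))"
    using \<zeta> Z_less[OF assms(3)] \<phi>_less tu by (metis \<phi>_tadd assoc)
  ultimately show ?thesis
    using assms(1,7) \<zeta>(2) unfolding is_table_def by (auto simp: insert_subset)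
qed

lemma closed_table_values:
  assumes tab: "is_table i j X P t" "table_closed i j X P" and X: "\<And>x. x \<in> X \<Longrightarrow> tuple x"
    and ij: "i < k" "j < k"
  shows "q \<in> P \<Longrightarrow> gen X h \<Longrightarrow> add q (\<phi> i j h) \<in> P"
    and "gen X h \<Longrightarrow> \<phi> i j h \<in> P"
    and "q \<in> P \<Longrightarrow> r \<in> P \<Longrightarrow> add q r \<in> P"
proof -
  have P: "q \<in> P \<Longrightarrow> q < n" for q using tab unfolding is_table_def by auto
  have main: "\<forall>q\<in>P. add q (\<phi> i j h) \<in> P" if "gen X h" for h
    using that
  proof (induction rule: gen.induct)
    case gen_zero
    then show ?case using P by (auto simp: \<phi>_tz zero_right)
  next
    case (gen_step x h)
    show ?case
    proof
      fix q assume q: "q \<in> P"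
      have tu: "tuple x" "tuple h" using gen_step X gen_tuple by auto
      have "add (add q (\<phi> i j x)) (\<phi> i j h) \<in> P"
        using gen_step q tab(2) unfolding table_closed_def by blast
      then show "add q (\<phi> i j (tadd x h)) \<in> P"
        using tu P[OF q] \<phi>_less by (simp add: \<phi>_tadd assoc)
    qed
  qed
  then show "q \<in> P \<Longrightarrow> gen X h \<Longrightarrow> add q (\<phi> i j h) \<in> P" by blast
  have zP: "z \<in> P" using tab(1) Z_zero[OF ij] unfolding is_table_def by blast
  show "gen X h \<Longrightarrow> \<phi> i j h \<in> P"
    using main zP zero \<phi>_less gen_tuple[of X h] X by metis
  show "add q r \<in> P" if qr: "q \<in> P" "r \<in> P"
  proof -
    obtain \<zeta> \<xi> where q: "gen X (t q)" "Z i j \<zeta>" "q = add \<zeta> (\<phi> i j (t q))"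
      and r: "gen X (t r)" "Z i j \<xi>" "r = add \<xi> (\<phi> i j (t r))"
      using tab(1) qr unfolding is_table_def by meson
    have tu: "\<phi> i j (t q) < n" "\<phi> i j (t r) < n" "\<zeta> < n" "\<xi> < n"
      using q r gen_tuple X \<phi>_less Z_less[OF ij(1)] by auto
    have "add \<zeta> \<xi> \<in> P" using tab(1) Z_add[OF ij q(2) r(2)] unfolding is_table_def by blast
    then have "add (add (add \<zeta> \<xi>) (\<phi> i j (t q))) (\<phi> i j (t r)) \<in> P" using main q(1) r(1) by blast
    also have "add (add (add \<zeta> \<xi>) (\<phi> i j (t q))) (\<phi> i j (t r)) =
        add (add \<zeta> (\<phi> i j (t q))) (add \<xi> (\<phi> i j (t r)))"
      using tu by (simp add: assoc lcomm add_less)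
    finally show ?thesis using q(3) r(3) by simp
  qed
qed

text \<open>Schreier's argument: if \<open>Y\<close> contains the differences of the generators from the
  representatives of their values, and the defects of the representatives, then \<open>Y\<close> generates the
  kernel of \<open>\<phi> i j\<close> modulo \<open>Z i j\<close>.\<close>

lemma kernel_generated:
  assumes tab: "is_table i j X P t" "table_closed i j X P" and X: "\<And>x. x \<in> X \<Longrightarrow> tuple x"
    and Y: "\<And>y. y \<in> Y \<Longrightarrow> tuple y" and ij: "i < k" "j < k"
    and Y1: "\<And>x. x \<in> X \<Longrightarrow> \<exists>y. gen Y y \<and> tadd y (t (\<phi> i j x)) = x"
    and Y2: "\<And>q r. q \<in> P \<Longrightarrow> r \<in> P \<Longrightarrow> \<exists>y. gen Y y \<and> tadd y (t (add q r)) = tadd (t q) (t r)"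
    and h: "gen X h" "Z i j (\<phi> i j h)"
  shows "gen Y h"
proof -
  note vals = closed_table_values[OF tab X ij]
  have tt: "q \<in> P \<Longrightarrow> tuple (t q)" for q using tab(1) gen_tuple X unfolding is_table_def by blast
  have "\<exists>y. gen Y y \<and> h = tadd y (t (\<phi> i j h))" using h(1)
  proof (induction rule: gen.induct)
    case gen_zero
    have "t z = tz" using tab(1) Z_zero[OF ij] unfolding is_table_def by blast
    then show ?case by (intro exI[of _ tz]) (simp add: \<phi>_tz gen.gen_zero tadd_tz tuple_tz)
  next
    case (gen_step x s)
    obtain y1 where y1: "gen Y y1" "tadd y1 (t (\<phi> i j x)) = x" using Y1 gen_step(1) by blast
    obtain y2 where y2: "gen Y y2" "s = tadd y2 (t (\<phi> i j s))" using gen_step by blast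
    have tu: "tuple x" "tuple s" "tuple y1" "tuple y2" using gen_step X gen_tuple y1 y2 Y by auto
    have P: "\<phi> i j x \<in> P" "\<phi> i j s \<in> P" using vals(2) gen_base gen_step tu by auto
    obtain y3 where y3: "gen Y y3"
      "tadd y3 (t (add (\<phi> i j x) (\<phi> i j s))) = tadd (t (\<phi> i j x)) (t (\<phi> i j s))"
      using Y2[OF P] by blast
    have tu3: "tuple y3" using y3(1) gen_tuple Y by blast
    have tus: "tuple (t (\<phi> i j x))" "tuple (t (\<phi> i j s))" "tuple (t (add (\<phi> i j x) (\<phi> i j s)))"
      using tt P vals(3) by auto
    have "tadd x s = tadd (tadd y1 (t (\<phi> i j x))) (tadd y2 (t (\<phi> i j s)))" using y1 y2 by simp
    also have "\<dots> = tadd (tadd y1 y2) (tadd (t (\<phi> i j x)) (t (\<phi> i j s)))"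
      using tu tus by (simp add: tadd_assoc tadd_lcomm tuple_tadd)
    also have "\<dots> = tadd (tadd (tadd y1 y2) y3) (t (add (\<phi> i j x) (\<phi> i j s)))"
      using tu tus tu3 y3(2)[symmetric] by (simp add: tadd_assoc tuple_tadd)
    also have "add (\<phi> i j x) (\<phi> i j s) = \<phi> i j (tadd x s)" using tu by (simp add: \<phi>_tadd)
    finally have "tadd x s = tadd (tadd (tadd y1 y2) y3) (t (\<phi> i j (tadd x s)))" .
    moreover have "gen Y (tadd (tadd y1 y2) y3)" using gen_tadd Y y1 y2 y3 by blast
    ultimately show ?case by blast
  qed
  then obtain y where y: "gen Y y" "h = tadd y (t (\<phi> i j h))" by blast
  have "t (\<phi> i j h) = tz" using tab(1) h(2) unfolding is_table_def by blast
  with y show ?thesis using gen_tuple[OF y(1) Y] by (simp add: tadd_tz)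
qed

text \<open>The family \<open>x\<close> generates the group of all tuples that satisfy the constraints in
  \<open>C\<close>, and the quadruples reserved for constraints outside of \<open>C\<close> are not in
  use.\<close>

definition good :: "nat \<Rightarrow> (nat \<times> nat) set \<Rightarrow> (nat list \<Rightarrow> nat \<Rightarrow> nat) \<Rightarrow> bool" where
  "good N C x \<longleftrightarrow> (\<forall>g\<in>quads N. tuple (x g) \<and> sat C (x g)) \<and>
     (\<forall>h. tuple h \<and> sat C h \<longrightarrow> gen (x ` quads N) h) \<and>
     (\<forall>a b c d. a \<noteq> b \<and> (a, b) \<notin> C \<longrightarrow> x [a, b, c, d] = tz)"

text \<open>Without constraints, \<open>[a, a, c, d]\<close> numbers the tuple with entry \<open>c\<close> at
  \<open>a\<close> and zeros elsewhere.\<close>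

lemma good_start:
  assumes "n < N" "k < N"
    and x: "\<And>a b c d l. x [a, b, c, d] l = (if a = b \<and> l = a \<and> c < n \<and> a < k then c else z)"
  shows "good N {} x"
proof -
  have quadE: "g \<in> quads N \<Longrightarrow> \<exists>a b c d. g = [a, b, c, d]" for g
    by (auto simp: quads_def length_Suc_conv numeral_eq_Suc)
  have tu: "tuple (x g)" if "g \<in> quads N" for g
    using quadE[OF that] z x by (auto simp: tuple_def)
  have "gen (x ` quads N) h" if h: "tuple h" for h
  proof -
    have "gen (x ` quads N) (\<lambda>l. if l < m then h l else z)" if "m \<le> k" for m
      using that
    proof (induction m)
      case 0
      then show ?case by (simp add: gen_zero)
    next
      case (Suc m)
      have "[m, m, h m, 0] \<in> quads N"
        using Suc.prems assms(1,2) h by (auto simp: quads_def tuple_def intro: less_trans)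
      moreover have "(\<lambda>l. if l < Suc m then h l else z) = tadd (x [m, m, h m, 0]) (\<lambda>l. if l < m then h l else z)"
        using h Suc.prems z by (auto simp: x tadd_def tuple_def zero zero_right fun_eq_iff less_Suc_eq)
      ultimately show ?case using Suc gen_step by auto
    qed
    moreover have "(\<lambda>l. if l < k then h l else z) = h" using h by (auto simp: tuple_def)
    ultimately show ?thesis by (metis order_refl)
  qed
  then show ?thesis using tu x by (auto simp: good_def sat_def)
qed

text \<open>Imposing the constraint for \<open>i, j\<close>, by Schreier's argument. The old generators are
  replaced by their differences from the representatives; the quadruples starting with \<open>i, j\<close> get
  the defects.\<close>

lemma good_step:
  assumes good: "good N C x" and ij: "i < k" "j < k" "i \<noteq> j" "(i, j) \<notin> C" "C \<subseteq> {..<k} \<times> {..<k}"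
    and "n < N" "k < N"
    and tab: "is_table i j (x ` quads N) P t" "table_closed i j (x ` quads N) P"
    and y_tuple: "\<And>g. g \<in> quads N \<Longrightarrow> tuple (y g)"
    and y_zero: "\<And>a b c d. a \<noteq> b \<Longrightarrow> (a, b) \<notin> insert (i, j) C \<Longrightarrow> y [a, b, c, d] = tz"
    and y_new: "\<And>c d. c \<in> P \<Longrightarrow> d \<in> P \<Longrightarrow> tadd (y [i, j, c, d]) (t (add c d)) = tadd (t c) (t d)"
    and y_none: "\<And>c d. [i, j, c, d] \<in> quads N \<Longrightarrow> \<not> (c \<in> P \<and> d \<in> P) \<Longrightarrow> y [i, j, c, d] = tz"
    and y_old: "\<And>a b c d. [a, b, c, d] \<in> quads N \<Longrightarrow> (a, b) \<noteq> (i, j) \<Longrightarrow>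
      tadd (y [a, b, c, d]) (t (\<phi> i j (x [a, b, c, d]))) = x [a, b, c, d]"
  shows "good N (insert (i, j) C) y"
proof -
  let ?X = "x ` quads N" and ?Y = "y ` quads N"
  have X: "u \<in> ?X \<Longrightarrow> tuple u \<and> sat C u" for u using good unfolding good_def by auto
  then have Xt: "u \<in> ?X \<Longrightarrow> tuple u" for u by blast
  have Yt: "u \<in> ?Y \<Longrightarrow> tuple u" for u using y_tuple by auto
  note vals = closed_table_values[OF tab Xt ij(1,2)]
  have P: "q \<in> P \<Longrightarrow> q < n" for q using tab(1) unfolding is_table_def by blast
  have genX: "q \<in> P \<Longrightarrow> gen ?X (t q)" for q using tab(1) unfolding is_table_def by blast
  have tt: "q \<in> P \<Longrightarrow> tuple (t q)" for q using genX gen_tuple Xt by blast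
  have tsat: "q \<in> P \<Longrightarrow> sat C (t q)" for q using sat_gen[OF ij(5) X genX] .
  have tZ: "\<exists>\<zeta>. Z i j \<zeta> \<and> q = add \<zeta> (\<phi> i j (t q))" if "q \<in> P" for q
    using tab(1) that unfolding is_table_def by blast
  have quadE: "\<exists>a b c d. g = [a, b, c, d]" if "g \<in> quads N" for g
    using that by (auto simp: quads_def length_Suc_conv numeral_eq_Suc)
  have xP: "\<phi> i j (x g) \<in> P" if "g \<in> quads N" for g
    using vals(2) gen_base[of "x g" ?X] Xt that by blast
  have quadI: "[i, j, c, d] \<in> quads N" if "c \<in> P" "d \<in> P" for c d
    using P[OF that(1)] P[OF that(2)] ij assms(7,8) by (auto simp: quads_def)
  \<comment> \<open>Constraints pass from a sum and one of its summands to the other summand; the next fact is the same for the new constraint.\<close>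
  have satcancel: "sat C u" if "tadd u v = w" "tuple u" "tuple v" "sat C v" "sat C w" for u v w
    unfolding sat_def
  proof (clarify)
    fix a b assume ab: "(a, b) \<in> C"
    then have "a < k" "b < k" using ij(5) by auto
    then show "Z a b (\<phi> a b u)"
      by (rule Z_cancel[where b = "\<phi> a b v"])
        (use that ab \<phi>_less \<phi>_tadd[of u v a b] in \<open>auto simp: sat_def\<close>)
  qed
  have Zcancel: "Z i j (\<phi> i j u)"
    if "tadd u (t q) = w" "tuple u" "q \<in> P" "\<phi> i j w = add \<xi> q" "Z i j \<xi>" for u q w \<xi>
  proof -
    obtain \<zeta> where \<zeta>: "Z i j \<zeta>" "q = add \<zeta> (\<phi> i j (t q))" using tZ[OF \<open>q \<in> P\<close>] by blast
    have l: "\<phi> i j u < n" "\<phi> i j (t q) < n" "\<zeta> < n" "\<xi> < n"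
      using \<phi>_less that tt \<zeta> Z_less[OF ij(1)] by auto
    have "add (\<phi> i j u) (\<phi> i j (t q)) = add \<xi> q" using that \<phi>_tadd[of u "t q" i j] tt by auto
    also have "\<dots> = add (add \<xi> \<zeta>) (\<phi> i j (t q))" by (subst \<zeta>(2)) (use l in \<open>simp add: assoc\<close>)
    finally have "\<phi> i j u = add \<xi> \<zeta>" using l cancel add_less by blast
    then show ?thesis using Z_add ij that \<zeta> by simp
  qed
  have sat': "sat (insert (i, j) C) (y g)" if g: "g \<in> quads N" for g
  proof -
    obtain a b c d where g4: "g = [a, b, c, d]" using quadE[OF g] by blast
    have "sat C (y g) \<and> Z i j (\<phi> i j (y g))"
    proof (cases "(a, b) = (i, j)")
      case True
      show ?thesis
      proof (cases "c \<in> P \<and> d \<in> P")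
        case cd: True
        have eq: "tadd (y g) (t (add c d)) = tadd (t c) (t d)" using y_new cd True g4 by simp
        have cdP: "add c d \<in> P" using vals(3) cd by blast
        have "gen ?X (tadd (t c) (t d))" using gen_tadd Xt genX cd by blast
        then have "sat C (tadd (t c) (t d))" using sat_gen[OF ij(5) X] by blast
        then have 1: "sat C (y g)" using satcancel[OF eq] y_tuple[OF g] tt[OF cdP] tsat[OF cdP] by blast
        obtain \<zeta> \<xi> where \<zeta>: "Z i j \<zeta>" "c = add \<zeta> (\<phi> i j (t c))" and \<xi>: "Z i j \<xi>" "d = add \<xi> (\<phi> i j (t d))"
          using tZ cd by meson
        have l: "\<zeta> < n" "\<xi> < n" "\<phi> i j (t c) < n" "\<phi> i j (t d) < n"
          using \<zeta> \<xi> Z_less[OF ij(1)] \<phi>_less tt cd by auto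
        have nZ: "Z i j (neg (add \<zeta> \<xi>))" using Z_neg Z_add ij \<zeta> \<xi> by blast
        have "add c d = add (add \<zeta> \<xi>) (add (\<phi> i j (t c)) (\<phi> i j (t d)))"
          by (subst \<zeta>(2), subst \<xi>(2)) (use l in \<open>simp add: assoc lcomm add_less\<close>)
        then have "add (neg (add \<zeta> \<xi>)) (add c d) = add (\<phi> i j (t c)) (\<phi> i j (t d))"
          using l by (metis add_less assoc neg neg_less zero)
        then have "\<phi> i j (tadd (t c) (t d)) = add (neg (add \<zeta> \<xi>)) (add c d)"
          using tt cd by (simp add: \<phi>_tadd)
        from Zcancel[OF eq y_tuple[OF g] cdP this nZ] 1 show ?thesis by blast
      next
        case False
        then have "y g = tz" using y_none True g g4 by auto
        then show ?thesis using Z_zero ij by (auto simp: sat_def \<phi>_tz)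
      qed
    next
      case False
      have eq: "tadd (y g) (t (\<phi> i j (x g))) = x g" using y_old False g g4 by auto
      have 1: "sat C (y g)" using satcancel[OF eq] y_tuple[OF g] tt tsat xP[OF g] X g by blast
      have "\<phi> i j (x g) = add z (\<phi> i j (x g))" using \<phi>_less X g zero by auto
      from Zcancel[OF eq y_tuple[OF g] xP[OF g] this Z_zero] 1 ij show ?thesis by blast
    qed
    then show ?thesis by (auto simp: sat_def)
  qed
  have "gen ?Y h" if h: "tuple h" "sat (insert (i, j) C) h" for h
  proof (rule kernel_generated[OF tab Xt Yt ij(1,2)])
    show "gen ?X h" using good h unfolding good_def sat_def by auto
    show "Z i j (\<phi> i j h)" using h by (auto simp: sat_def)
    show "\<exists>u. gen ?Y u \<and> tadd u (t (\<phi> i j v)) = v" if "v \<in> ?X" for v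
    proof -
      obtain g where g: "g \<in> quads N" "v = x g" using \<open>v \<in> ?X\<close> by blast
      obtain a b c d where g4: "g = [a, b, c, d]" using quadE[OF g(1)] by blast
      show ?thesis
      proof (cases "(a, b) = (i, j)")
        case True
        then have "v = tz" using good ij g g4 unfolding good_def by auto
        moreover have "t z = tz" using tab(1) Z_zero[OF ij(1,2)] unfolding is_table_def by blast
        ultimately show ?thesis by (intro exI[of _ tz]) (simp add: gen_zero \<phi>_tz tadd_tz tuple_tz)
      next
        case False
        then show ?thesis using y_old g g4 gen_base[of "y g" ?Y] Yt by (intro exI[of _ "y g"]) auto
      qed
    qed
    show "\<exists>u. gen ?Y u \<and> tadd u (t (add q r)) = tadd (t q) (t r)" if "q \<in> P" "r \<in> P" for q r
      using y_new[OF that] gen_base[of "y [i, j, q, r]" ?Y] quadI[OF that] Yt by blast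
  qed auto
  then show ?thesis unfolding good_def using y_tuple sat' y_zero by blast
qed

subsection \<open>The criterion\<close>

text \<open>The tuple \<open>h\<close> has a common solution modulo the congruences.\<close>

definition solvable :: "(nat \<Rightarrow> nat) \<Rightarrow> bool" where
  "solvable h \<longleftrightarrow> (\<exists>a<n. \<forall>i<k. \<theta> i a (h i))"

definition pairs :: "(nat \<times> nat) set" where
  "pairs = {(i, j). i < k \<and> j < k \<and> i \<noteq> j}"

lemma solvable_gen:
  assumes "\<And>x. x \<in> X \<Longrightarrow> solvable x" "gen X h"
  shows "solvable h"
  using assms(2)
proof (induction rule: gen.induct)
  case gen_zero
  show ?case unfolding solvable_def using z \<theta>_refl by blast
next
  case (gen_step x h)
  obtain a b where "a < n" "\<forall>i<k. \<theta> i a (x i)" "b < n" "\<forall>i<k. \<theta> i b (h i)"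
    using gen_step assms(1) unfolding solvable_def by blast
  then have "add a b < n" "\<forall>i<k. \<theta> i (add a b) (add (x i) (h i))" using add_less \<theta>_add by auto
  then show ?case unfolding solvable_def tadd_def by blast
qed

text \<open>Congruences of a group permute, so that their join is their composition.\<close>

lemma join_iff:
  assumes "i < k" "j < k" "x < n" "y < n"
  shows "(x, y) \<in> cong_join {(u, v). \<theta> i u v} {(u, v). \<theta> j u v} \<longleftrightarrow> Z i j (sub x y)"
proof
  assume "(x, y) \<in> cong_join {(u, v). \<theta> i u v} {(u, v). \<theta> j u v}"
  then have "(x, y) \<in> ({(u, v). \<theta> i u v} \<union> {(u, v). \<theta> j u v})\<^sup>+" unfolding cong_join_def .
  then have "x < n \<and> y < n \<and> Z i j (sub x y)"
  proof (induction rule: trancl_induct)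
    case (base y)
    then show ?case using \<theta>_Z \<theta>_Z' \<theta>_less assms by blast
  next
    case (step y w)
    have w: "Z i j (sub y w)" "w < n" "y < n" using step \<theta>_Z \<theta>_Z' \<theta>_less assms by blast+
    have "sub x w = add (sub x y) (sub y w)"
      by (rule subI) (use step w in \<open>auto simp: sub_less add_less assoc sub_add\<close>)
    then show ?case using step w Z_add assms by simp
  qed
  then show "Z i j (sub x y)" by blast
next
  assume "Z i j (sub x y)"
  then obtain u where u: "\<theta> i (sub x y) u" "\<theta> j u z" unfolding Z_def by blast
  have "\<theta> i (add (sub x y) y) (add u y)" "\<theta> j (add u y) (add z y)"
    using u \<theta>_add \<theta>_refl assms by blast+
  then have "\<theta> i x (add u y)" "\<theta> j (add u y) y" using assms by (simp_all add: sub_add zero)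
  then have "(x, add u y) \<in> {(u, v). \<theta> i u v} \<union> {(u, v). \<theta> j u v}"
    "(add u y, y) \<in> {(u, v). \<theta> i u v} \<union> {(u, v). \<theta> j u v}" by auto
  then show "(x, y) \<in> cong_join {(u, v). \<theta> i u v} {(u, v). \<theta> j u v}"
    unfolding cong_join_def by (rule trancl_into_trancl[OF r_into_trancl])
qed

text \<open>The compatible tuples and the solvable tuples are closed under addition, so that it suffices to test
  generators.\<close>

theorem CR_tuple_iff:
  assumes good: "good N pairs x" and A: "universe A = {..<n}"
    and \<theta>s: "\<theta>s = map (\<lambda>i. {(u, v). \<theta> i u v}) [0..<k]"
  shows "CR_tuple A \<theta>s \<longleftrightarrow> (\<forall>g\<in>quads N. solvable (x g))"
proof -
  have len: "length \<theta>s = k" and nth: "\<And>i. i < k \<Longrightarrow> \<theta>s ! i = {(u, v). \<theta> i u v}"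
    by (simp_all add: \<theta>s)
  have Zself: "Z i i (sub a a)" if "i < k" "a < n" for i a
    using that Z_zero sub_self by simp
  show ?thesis
  proof
    assume CR: "CR_tuple A \<theta>s"
    show "\<forall>g\<in>quads N. solvable (x g)"
    proof
      fix g assume g: "g \<in> quads N"
      have xg: "tuple (x g)" "sat pairs (x g)" using good g unfolding good_def by auto
      let ?as = "map (x g) [0..<k]"
      have "length ?as = length \<theta>s \<and> set ?as \<subseteq> universe A" using xg A len by (auto simp: tuple_def)
      moreover have "(?as ! i, ?as ! j) \<in> cong_join (\<theta>s ! i) (\<theta>s ! j)" if ij: "i < length \<theta>s" "j < length \<theta>s" for i j
      proof -
        have "Z i j (sub (x g i) (x g j))"
          using xg ij len Zself[of i "x g i"] by (cases "i = j") (auto simp: sat_def pairs_def \<phi>_def tuple_def)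
        then show ?thesis using join_iff xg ij len nth by (simp add: tuple_def)
      qed
      ultimately obtain a where "a \<in> universe A" "\<forall>i<length \<theta>s. (a, ?as ! i) \<in> \<theta>s ! i"
        using CR unfolding CR_tuple_def by blast
      then show "solvable (x g)" unfolding solvable_def using A len nth by auto
    qed
  next
    assume sol: "\<forall>g\<in>quads N. solvable (x g)"
    show "CR_tuple A \<theta>s"
      unfolding CR_tuple_def
    proof (intro allI impI, elim conjE)
      fix as assume as: "length as = length \<theta>s" "set as \<subseteq> universe A"
        and co: "\<forall>i<length \<theta>s. \<forall>j<length \<theta>s. (as ! i, as ! j) \<in> cong_join (\<theta>s ! i) (\<theta>s ! j)"
      let ?h = "\<lambda>l. if l < k then as ! l else z"
      have l: "as ! i < n" if "i < k" for i
        using as A len that by (metis lessThan_iff nth_mem subsetD)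
      have "tuple ?h" using l z by (auto simp: tuple_def)
      moreover have "sat pairs ?h"
        using co join_iff l len nth by (auto simp: sat_def pairs_def \<phi>_def)
      ultimately have "gen (x ` quads N) ?h" using good unfolding good_def by blast
      then have "solvable ?h" by (rule solvable_gen[rotated]) (use sol in auto)
      then show "\<exists>a\<in>universe A. \<forall>i<length \<theta>s. (a, as ! i) \<in> \<theta>s ! i"
        unfolding solvable_def using A len nth by auto
    qed
  qed
qed

end

section \<open>Vector spaces recognised from their operation tables\<close>

text \<open>The algebra \<open>A\<close> has the format of a vector space with \<open>n\<close> elements over a field with \<open>q\<close>
  elements, with addition \<open>a\<close>, negation \<open>ng\<close>, zero \<open>z\<close> and scalar multiplications \<open>s\<close>.\<close>

definition agrees ::
  "(nat, nat) fo_algebra \<Rightarrow> nat \<Rightarrow> nat \<Rightarrow> (nat \<Rightarrow> nat \<Rightarrow> nat) \<Rightarrow> (nat \<Rightarrow> nat) \<Rightarrow> nat \<Rightarrow> (nat \<Rightarrow> nat \<Rightarrow> nat) \<Rightarrow> bool" where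
  "agrees A n q a ng z s \<longleftrightarrow>
     universe A = {..<n} \<and> fsyms A = {..<3 + q} \<and>
     arity A 0 = 2 \<and> arity A 1 = 1 \<and> arity A 2 = 0 \<and> (\<forall>r<q. arity A (3 + r) = 1) \<and>
     (\<forall>x<n. \<forall>y<n. interp A 0 [x, y] = a x y) \<and> (\<forall>x<n. interp A 1 [x] = ng x) \<and>
     interp A 2 [] = z \<and> (\<forall>r<q. \<forall>x<n. interp A (3 + r) [x] = s r x)"

text \<open>The operations map into the universe.\<close>

definition closed_ops ::
  "nat \<Rightarrow> nat \<Rightarrow> (nat \<Rightarrow> nat \<Rightarrow> nat) \<Rightarrow> (nat \<Rightarrow> nat) \<Rightarrow> nat \<Rightarrow> (nat \<Rightarrow> nat \<Rightarrow> nat) \<Rightarrow> bool" where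
  "closed_ops n q a ng z s \<longleftrightarrow>
     (\<forall>x<n. \<forall>y<n. a x y < n) \<and> (\<forall>x<n. ng x < n) \<and> z < n \<and> (\<forall>r<q. \<forall>x<n. s r x < n)"

text \<open>A vector space with at least two elements determines its field, since the field acts
  faithfully; on the trivial space there is an action of every field.\<close>

definition field_action ::
  "nat \<Rightarrow> nat \<Rightarrow> (nat \<Rightarrow> nat \<Rightarrow> nat) \<Rightarrow> (nat \<Rightarrow> nat) \<Rightarrow> nat \<Rightarrow> (nat \<Rightarrow> nat \<Rightarrow> nat) \<Rightarrow> bool" where
  "field_action n q a ng z s \<longleftrightarrow>
     (\<forall>r<q. \<forall>t<q. (\<forall>x<n. s r x = s t x) \<longrightarrow> r = t) \<and>
     (\<exists>e<q. \<forall>x<n. s e x = x) \<and>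
     (\<exists>e<q. \<forall>x<n. s e x = z) \<and>
     (\<forall>r<q. \<forall>t<q. \<exists>u<q. \<forall>x<n. s u x = a (s r x) (s t x)) \<and>
     (\<forall>r<q. \<exists>u<q. \<forall>x<n. s u x = ng (s r x)) \<and>
     (\<forall>r<q. \<forall>t<q. \<exists>u<q. \<forall>x<n. s u x = s r (s t x)) \<and>
     (\<forall>r<q. \<forall>t<q. \<forall>x<n. s r (s t x) = s t (s r x)) \<and>
     (\<forall>r<q. (\<exists>x<n. s r x \<noteq> z) \<longrightarrow> (\<exists>u<q. \<forall>x<n. s u (s r x) = x))"

text \<open>A first-order description of the vector spaces among the tables. The last condition for \<open>n =
  1\<close> says that there is a field with \<open>q\<close> elements.\<close>

definition vs_cond ::
  "nat \<Rightarrow> nat \<Rightarrow> (nat \<Rightarrow> nat \<Rightarrow> nat) \<Rightarrow> (nat \<Rightarrow> nat) \<Rightarrow> nat \<Rightarrow> (nat \<Rightarrow> nat \<Rightarrow> nat) \<Rightarrow> bool" where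
  "vs_cond n q a ng z s \<longleftrightarrow> abgrp n a ng z \<and>
     (\<forall>r<q. \<forall>x<n. \<forall>y<n. s r (a x y) = a (s r x) (s r y)) \<and>
     (if n = 1 then 2 \<le> q \<and> (\<exists>p\<ge>2. \<forall>d\<ge>2. d dvd q \<longrightarrow> p dvd d) else field_action n q a ng z s)"

lemma vs_cond_imp_VS:
  assumes ag: "agrees A n q a ng z s" and cl: "closed_ops n q a ng z s" and vs: "vs_cond n q a ng z s"
  shows "A \<in> VS"
proof -
  interpret G: abgrp n a ng z using vs by (simp add: vs_cond_def)
  have s_less: "r < q \<Longrightarrow> x < n \<Longrightarrow> s r x < n" for r x using cl by (auto simp: closed_ops_def)
  have s_add: "r < q \<Longrightarrow> x < n \<Longrightarrow> y < n \<Longrightarrow> s r (a x y) = a (s r x) (s r y)" for r x y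
    using vs by (auto simp: vs_cond_def)
  define V :: "(nat, nat) module" where
    "V = \<lparr>carrier = {..<n}, monoid.mult = (\<lambda>_ _. 0), one = 0, zero = z, add = a, module.smult = s\<rparr>"
  have V: "carrier V = {..<n}" "\<zero>\<^bsub>V\<^esub> = z" "x \<oplus>\<^bsub>V\<^esub> y = a x y" "r \<odot>\<^bsub>V\<^esub> x = s r x" for x y r
    by (simp_all add: V_def)
  have Vgrp: "abelian_group V"
    by (rule abelian_groupI)
      (use G.neg G.neg_less in \<open>auto simp: V G.add_less G.assoc G.zero G.z intro: G.comm\<close>)
  then interpret V: abelian_group V .
  have Vneg: "\<ominus>\<^bsub>V\<^esub> x = ng x" if "x < n" for x
    using V.minus_equality[of "ng x" x] G.neg[OF that] G.neg_less[OF that] that by (simp add: V)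
  have result: "A \<in> VS" if F: "field F" "carrier F = {..<q}" "Module.module F V" for F :: "nat ring"
    using ag F Vneg unfolding VS_def is_vector_space_algebra_def agrees_def
    by (auto simp: V intro!: exI[of _ F] exI[of _ V] exI[of _ q])
  show ?thesis
  proof (cases "n = 1")
    case True
    then obtain F :: "nat ring" where F: "field F" "carrier F = {..<q}"
      using vs finite_field_iff[of q] by (auto simp: vs_cond_def)
    interpret F: field F by (rule F(1))
    have s0: "s r 0 = 0" if "r < q" for r using s_less[of r 0] that True by simp
    have a0: "a 0 0 = 0" using G.add_less[of 0 0] True by simp
    have cls: "r \<oplus>\<^bsub>F\<^esub> t < q" "r \<otimes>\<^bsub>F\<^esub> t < q" "\<one>\<^bsub>F\<^esub> < q" if "r < q" "t < q" for r t
      using F.a_closed[of r t] F.m_closed[of r t] F.one_closed F(2) that by auto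
    have "Module.module F V"
      by (rule moduleI)
        (use F.is_cring Vgrp F.one_closed in \<open>auto simp: F(2) V True s0 a0 cls\<close>)
    then show ?thesis using result F by blast
  next
    case False
    have fa: "field_action n q a ng z s" using vs False by (simp add: vs_cond_def)
    \<comment> \<open>The field operations are read off from the action: \<open>pick f\<close> is the scalar that acts as \<open>f\<close>.\<close>
    define pick where "pick = (\<lambda>f. THE t. t < q \<and> (\<forall>x<n. s t x = f x))"
    have ext: "r = t" if "r < q" "t < q" "\<And>x. x < n \<Longrightarrow> s r x = s t x" for r t
      using fa[unfolded field_action_def, THEN conjunct1, rule_format, OF that(1,2)] that(3) by simp
    have pick: "pick f < q \<and> (\<forall>x<n. s (pick f) x = f x)" if ex: "\<exists>t<q. \<forall>x<n. s t x = f x" for f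
    proof -
      obtain t where t: "t < q \<and> (\<forall>x<n. s t x = f x)" using ex by (elim exE)
      show ?thesis unfolding pick_def
      proof (rule theI[where P = "\<lambda>t. t < q \<and> (\<forall>x<n. s t x = f x)", OF t])
        fix u assume u: "u < q \<and> (\<forall>x<n. s u x = f x)"
        show "u = t" by (rule ext) (use t u in simp_all)
      qed
    qed
    note fc = fa[unfolded field_action_def]
    note f1 = fc[THEN conjunct2] note f2 = f1[THEN conjunct2] note f3 = f2[THEN conjunct2]
    note f4 = f3[THEN conjunct2] note f5 = f4[THEN conjunct2] note f6 = f5[THEN conjunct2]
    note f7 = f6[THEN conjunct2]
    have one: "pick (\<lambda>x. x) < q" "x < n \<Longrightarrow> s (pick (\<lambda>x. x)) x = x" for x
      using pick[OF f1[THEN conjunct1]] by simp_all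
    have zro: "pick (\<lambda>x. z) < q" "x < n \<Longrightarrow> s (pick (\<lambda>x. z)) x = z" for x
      using pick[OF f2[THEN conjunct1]] by simp_all
    have pls: "pick (\<lambda>x. a (s r x) (s t x)) < q"
      "x < n \<Longrightarrow> s (pick (\<lambda>x. a (s r x) (s t x))) x = a (s r x) (s t x)" if "r < q" "t < q" for x r t
      using pick[OF f3[THEN conjunct1, rule_format, OF that]] by simp_all
    have ngs: "pick (\<lambda>x. ng (s r x)) < q"
      "x < n \<Longrightarrow> s (pick (\<lambda>x. ng (s r x))) x = ng (s r x)" if "r < q" for x r
      using pick[OF f4[THEN conjunct1, rule_format, OF that]] by simp_all
    have tms: "pick (\<lambda>x. s r (s t x)) < q"
      "x < n \<Longrightarrow> s (pick (\<lambda>x. s r (s t x))) x = s r (s t x)" if "r < q" "t < q" for x r t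
      using pick[OF f5[THEN conjunct1, rule_format, OF that]] by simp_all
    note cm = f6[THEN conjunct1, rule_format]
    define F :: "nat ring" where
      "F = \<lparr>carrier = {..<q}, monoid.mult = (\<lambda>r t. pick (\<lambda>x. s r (s t x))), one = pick (\<lambda>x. x),
        zero = pick (\<lambda>x. z), add = (\<lambda>r t. pick (\<lambda>x. a (s r x) (s t x)))\<rparr>"
    have F: "carrier F = {..<q}" "\<one>\<^bsub>F\<^esub> = pick (\<lambda>x. x)" "\<zero>\<^bsub>F\<^esub> = pick (\<lambda>x. z)"
      "r \<oplus>\<^bsub>F\<^esub> t = pick (\<lambda>x. a (s r x) (s t x))" "r \<otimes>\<^bsub>F\<^esub> t = pick (\<lambda>x. s r (s t x))" for r t
      by (simp_all add: F_def)
    have C: "r \<in> carrier F \<longleftrightarrow> r < q" for r by (simp add: F)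
    have Fs: "r \<oplus>\<^bsub>F\<^esub> t < q" "x < n \<Longrightarrow> s (r \<oplus>\<^bsub>F\<^esub> t) x = a (s r x) (s t x)"
      "r \<otimes>\<^bsub>F\<^esub> t < q" "x < n \<Longrightarrow> s (r \<otimes>\<^bsub>F\<^esub> t) x = s r (s t x)" if "r < q" "t < q" for r t x
      using pls[OF that] tms[OF that] by (simp_all add: F)
    have Fz: "\<zero>\<^bsub>F\<^esub> < q" "\<one>\<^bsub>F\<^esub> < q" "x < n \<Longrightarrow> s \<zero>\<^bsub>F\<^esub> x = z" "x < n \<Longrightarrow> s \<one>\<^bsub>F\<^esub> x = x" for x
      using one zro by (simp_all add: F)
    have "cring F"
    proof (rule cringI)
      show "abelian_group F"
      proof (rule abelian_groupI; unfold C)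
        show "\<exists>y\<in>carrier F. y \<oplus>\<^bsub>F\<^esub> r = \<zero>\<^bsub>F\<^esub>" if r: "r < q" for r
        proof (intro bexI)
          show "pick (\<lambda>x. ng (s r x)) \<oplus>\<^bsub>F\<^esub> r = \<zero>\<^bsub>F\<^esub>"
            by (rule ext) (use r ngs[OF r] in \<open>simp_all add: Fs Fz s_less G.neg\<close>)
        qed (use ngs[OF r] C in simp)
        show "r \<oplus>\<^bsub>F\<^esub> t \<oplus>\<^bsub>F\<^esub> u = r \<oplus>\<^bsub>F\<^esub> (t \<oplus>\<^bsub>F\<^esub> u)" if "r < q" "t < q" "u < q" for r t u
          by (rule ext) (use that in \<open>simp_all add: Fs s_less G.assoc\<close>)
        show "r \<oplus>\<^bsub>F\<^esub> t = t \<oplus>\<^bsub>F\<^esub> r" if "r < q" "t < q" for r t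
          by (rule ext) (use that in \<open>simp_all add: Fs s_less G.comm\<close>)
        show "\<zero>\<^bsub>F\<^esub> \<oplus>\<^bsub>F\<^esub> r = r" if "r < q" for r
          by (rule ext) (use that in \<open>simp_all add: Fs Fz s_less G.zero\<close>)
      qed (simp_all add: Fs Fz)
      show "comm_monoid F"
      proof (rule comm_monoidI; unfold C)
        show "r \<otimes>\<^bsub>F\<^esub> t \<otimes>\<^bsub>F\<^esub> u = r \<otimes>\<^bsub>F\<^esub> (t \<otimes>\<^bsub>F\<^esub> u)" if "r < q" "t < q" "u < q" for r t u
          by (rule ext) (use that in \<open>simp_all add: Fs s_less\<close>)
        show "r \<otimes>\<^bsub>F\<^esub> t = t \<otimes>\<^bsub>F\<^esub> r" if "r < q" "t < q" for r t
          by (rule ext) (use that cm[of r t] in \<open>simp_all add: Fs s_less\<close>)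
        show "\<one>\<^bsub>F\<^esub> \<otimes>\<^bsub>F\<^esub> r = r" if "r < q" for r
          by (rule ext) (use that in \<open>simp_all add: Fs Fz s_less\<close>)
      qed (simp_all add: Fs Fz)
      show "(r \<oplus>\<^bsub>F\<^esub> t) \<otimes>\<^bsub>F\<^esub> u = r \<otimes>\<^bsub>F\<^esub> u \<oplus>\<^bsub>F\<^esub> t \<otimes>\<^bsub>F\<^esub> u"
        if "r \<in> carrier F" "t \<in> carrier F" "u \<in> carrier F" for r t u
        by (rule ext) (use that in \<open>simp_all add: C Fs s_less\<close>)
    qed
    then interpret F: cring F .
    obtain x1 where x1: "x1 < n" "x1 \<noteq> z"
    proof -
      have "2 \<le> n" using False G.z by auto
      then show ?thesis using that[of 0] that[of 1] by (cases "z = 0") auto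
    qed
    have "field F"
    proof (rule F.cring_fieldI2)
      show "\<zero>\<^bsub>F\<^esub> \<noteq> \<one>\<^bsub>F\<^esub>" using Fz(3,4)[OF x1(1)] x1 by auto
      show "\<exists>u\<in>carrier F. r \<otimes>\<^bsub>F\<^esub> u = \<one>\<^bsub>F\<^esub>" if r: "r \<in> carrier F" "r \<noteq> \<zero>\<^bsub>F\<^esub>" for r
      proof -
        have rq: "r < q" using r by (simp add: F)
        have "\<exists>x<n. s r x \<noteq> z"
        proof (rule ccontr)
          assume no: "\<not> (\<exists>x<n. s r x \<noteq> z)"
          have "r = \<zero>\<^bsub>F\<^esub>" by (rule ext) (use no rq in \<open>simp_all add: Fz\<close>)
          with r(2) show False by simp
        qed
        then obtain u where "u < q" and u: "\<forall>x<n. s u (s r x) = x" using f7[rule_format, OF rq] by blast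
        have "r \<otimes>\<^bsub>F\<^esub> u = \<one>\<^bsub>F\<^esub>"
          by (rule ext) (use rq \<open>u < q\<close> u cm[of r u] in \<open>simp_all add: Fs Fz\<close>)
        then show ?thesis using \<open>u < q\<close> C by blast
      qed
    qed
    moreover have "Module.module F V"
      by (rule moduleI) (use F.is_cring Vgrp in \<open>simp_all add: C V Fs Fz s_less s_add\<close>)
    ultimately show ?thesis using result F(1) by blast
  qed
qed

lemma VS_imp_vs_cond:
  assumes "is_vector_space_algebra F V A" and ag: "agrees A n q a ng z s"
  shows "closed_ops n q a ng z s \<and> vs_cond n q a ng z s"
proof -
  have cV: "carrier V = {..<n}" and cF: "carrier F = {..<q}" and FV: "field F" "Module.module F V"
    using assms unfolding is_vector_space_algebra_def agrees_def by auto
  note isv = assms(1)[unfolded is_vector_space_algebra_def cV cF] and ag' = ag[unfolded agrees_def]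
  have "a x y = x \<oplus>\<^bsub>V\<^esub> y" if "x < n" "y < n" for x y using isv ag' that by (metis lessThan_iff)
  moreover have "ng x = \<ominus>\<^bsub>V\<^esub> x" if "x < n" for x using isv ag' that by (metis lessThan_iff)
  moreover have "s r x = r \<odot>\<^bsub>V\<^esub> x" if "r < q" "x < n" for r x using isv ag' that by (metis lessThan_iff)
  moreover have "z = \<zero>\<^bsub>V\<^esub>" using isv ag' by metis
  ultimately have 1: "field F" "Module.module F V" "carrier V = {..<n}" "carrier F = {..<q}"
    "\<And>x y. x < n \<Longrightarrow> y < n \<Longrightarrow> a x y = x \<oplus>\<^bsub>V\<^esub> y" "\<And>x. x < n \<Longrightarrow> ng x = \<ominus>\<^bsub>V\<^esub> x" "z = \<zero>\<^bsub>V\<^esub>"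
    "\<And>r x. r < q \<Longrightarrow> x < n \<Longrightarrow> s r x = r \<odot>\<^bsub>V\<^esub> x"
    using cV cF FV by blast+
  interpret F: field F by (rule 1)
  interpret M: Module.module F V by (rule 1)
  have c: "x < n \<longleftrightarrow> x \<in> carrier V" "r < q \<longleftrightarrow> r \<in> carrier F" for x r using 1 by auto
  have cl: "closed_ops n q a ng z s"
    unfolding closed_ops_def using 1(5-8) by (simp add: c)
  have grp: "abgrp n a ng z"
    by unfold_locales (use 1(5-8) M.a_assoc M.a_comm M.l_neg in \<open>simp_all add: c\<close>)
  have "field_action n q a ng z s" if "n \<noteq> 1"
  proof -
    have sm: "r \<in> carrier F \<Longrightarrow> x \<in> carrier V \<Longrightarrow> s r x = r \<odot>\<^bsub>V\<^esub> x" for r x using 1(8) c by simp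
    have ad: "x \<in> carrier V \<Longrightarrow> y \<in> carrier V \<Longrightarrow> a x y = x \<oplus>\<^bsub>V\<^esub> y" for x y using 1(5) c by simp
    have nx: "x \<in> carrier V \<Longrightarrow> ng x = \<ominus>\<^bsub>V\<^esub> x" for x using 1(6) c by simp
    have "\<zero>\<^bsub>V\<^esub> \<in> carrier V" by simp
    then have "0 < n" using 1(3) by auto
    with that have "2 \<le> n" by simp
    then have "\<exists>x<n. x \<noteq> \<zero>\<^bsub>V\<^esub>"
      by (intro exI[of _ "if \<zero>\<^bsub>V\<^esub> = 0 then 1 else 0"]) auto
    then obtain x1 where x1: "x1 \<in> carrier V" "x1 \<noteq> \<zero>\<^bsub>V\<^esub>" using 1(3) by auto
    have inv: "\<exists>u\<in>carrier F. u \<otimes>\<^bsub>F\<^esub> r = \<one>\<^bsub>F\<^esub>" if "r \<in> carrier F" "r \<noteq> \<zero>\<^bsub>F\<^esub>" for r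
      using F.field_Units that F.Units_l_inv_ex by auto
    have zero_act: "r = \<zero>\<^bsub>F\<^esub>" if "r \<in> carrier F" "x \<in> carrier V" "x \<noteq> \<zero>\<^bsub>V\<^esub>" "r \<odot>\<^bsub>V\<^esub> x = \<zero>\<^bsub>V\<^esub>" for r x
    proof (rule ccontr)
      assume "r \<noteq> \<zero>\<^bsub>F\<^esub>"
      then obtain u where u: "u \<in> carrier F" "u \<otimes>\<^bsub>F\<^esub> r = \<one>\<^bsub>F\<^esub>" using inv \<open>r \<in> carrier F\<close> by blast
      show False using u that M.smult_assoc1[of u r x] by simp
    qed
    show ?thesis unfolding field_action_def
    proof (intro conjI allI impI)
      fix r t assume r: "r < q" "t < q"
      show "r = t" if eq: "\<forall>x<n. s r x = s t x"
      proof -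
        have rt: "r \<in> carrier F" "t \<in> carrier F" using r c by auto
        have "r \<odot>\<^bsub>V\<^esub> x1 = t \<odot>\<^bsub>V\<^esub> x1" using eq x1(1) rt sm c by metis
        then have "(r \<ominus>\<^bsub>F\<^esub> t) \<odot>\<^bsub>V\<^esub> x1 = \<zero>\<^bsub>V\<^esub>"
          using rt x1 by (simp add: F.minus_eq M.smult_l_distr M.smult_l_minus M.r_neg)
        then have "r \<ominus>\<^bsub>F\<^esub> t = \<zero>\<^bsub>F\<^esub>" using zero_act x1 rt by auto
        then show "r = t" using rt by simp
      qed
      show "\<exists>u<q. \<forall>x<n. s u x = a (s r x) (s t x)"
        by (rule exI[of _ "r \<oplus>\<^bsub>F\<^esub> t"]) (use r in \<open>simp add: c sm ad M.smult_l_distr\<close>)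
      show "\<exists>u<q. \<forall>x<n. s u x = s r (s t x)"
        by (rule exI[of _ "r \<otimes>\<^bsub>F\<^esub> t"]) (use r in \<open>simp add: c sm M.smult_assoc1\<close>)
      show "s r (s t x) = s t (s r x)" if "x < n" for x
      proof -
        have "r \<in> carrier F" "t \<in> carrier F" "x \<in> carrier V" using r that c by auto
        then show ?thesis using M.smult_assoc1[of r t x] M.smult_assoc1[of t r x] F.m_comm by (simp add: sm)
      qed
    next
      show "\<exists>e<q. \<forall>x<n. s e x = x"
        by (rule exI[of _ "\<one>\<^bsub>F\<^esub>"]) (simp add: c sm)
      show "\<exists>e<q. \<forall>x<n. s e x = z"
        by (rule exI[of _ "\<zero>\<^bsub>F\<^esub>"]) (simp add: c sm 1(7))
    next
      fix r assume r: "r < q"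
      show "\<exists>u<q. \<forall>x<n. s u x = ng (s r x)"
        by (rule exI[of _ "\<ominus>\<^bsub>F\<^esub> r"]) (use r in \<open>simp add: c sm nx M.smult_l_minus\<close>)
      show "\<exists>u<q. \<forall>x<n. s u (s r x) = x" if "\<exists>x<n. s r x \<noteq> z"
      proof -
        have rF: "r \<in> carrier F" using r c by simp
        have "r \<noteq> \<zero>\<^bsub>F\<^esub>" using that rF by (auto simp: c sm 1(7))
        then obtain u where "u \<in> carrier F" "u \<otimes>\<^bsub>F\<^esub> r = \<one>\<^bsub>F\<^esub>" using inv rF by blast
        then show ?thesis using rF
          by (intro exI[of _ u]) (simp add: c sm M.smult_assoc1[symmetric])
      qed
    qed
  qed
  moreover have "2 \<le> q \<and> (\<exists>p\<ge>2. \<forall>d\<ge>2. d dvd q \<longrightarrow> p dvd d)"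
    using finite_field_iff[of q] 1(1,4) by blast
  moreover have "\<forall>r<q. \<forall>x<n. \<forall>y<n. s r (a x y) = a (s r x) (s r y)"
    using 1(5,8) by (simp add: c M.smult_r_distr)
  ultimately show ?thesis using cl grp by (simp add: vs_cond_def)
qed

subsection \<open>Congruences\<close>

text \<open>The congruence axioms for the tables.\<close>

definition cong_cond ::
  "nat \<Rightarrow> nat \<Rightarrow> (nat \<Rightarrow> nat \<Rightarrow> nat) \<Rightarrow> (nat \<Rightarrow> nat) \<Rightarrow> (nat \<Rightarrow> nat \<Rightarrow> nat) \<Rightarrow> (nat \<Rightarrow> nat \<Rightarrow> bool) \<Rightarrow> bool" where
  "cong_cond n q a ng s \<theta> \<longleftrightarrow>
     (\<forall>x<n. \<theta> x x) \<and> (\<forall>x<n. \<forall>y<n. \<theta> x y \<longrightarrow> \<theta> y x) \<and>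
     (\<forall>x<n. \<forall>y<n. \<forall>w<n. \<theta> x y \<and> \<theta> y w \<longrightarrow> \<theta> x w) \<and>
     (\<forall>x<n. \<forall>y<n. \<forall>u<n. \<forall>v<n. \<theta> x y \<and> \<theta> u v \<longrightarrow> \<theta> (a x u) (a y v)) \<and>
     (\<forall>x<n. \<forall>y<n. \<theta> x y \<longrightarrow> \<theta> (ng x) (ng y)) \<and>
     (\<forall>r<q. \<forall>x<n. \<forall>y<n. \<theta> x y \<longrightarrow> \<theta> (s r x) (s r y))"

lemma is_congruence_iff:
  assumes ag: "agrees A n q a ng z s" and cl: "closed_ops n q a ng z s"
  shows "is_congruence A {(x, y). x < n \<and> y < n \<and> \<theta> x y} \<longleftrightarrow> cong_cond n q a ng s \<theta>"
proof
  let ?\<theta> = "{(x, y). x < n \<and> y < n \<and> \<theta> x y}"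
  assume co: "is_congruence A ?\<theta>"
  have U: "universe A = {..<n}" using ag by (simp add: agrees_def)
  have eq: "equiv {..<n} ?\<theta>" using co U by (simp add: is_congruence_def)
  have ops: "(interp A f xs, interp A f ys) \<in> ?\<theta>" if "f < 3 + q" "length xs = arity A f"
    "list_all2 (\<lambda>x y. (x, y) \<in> ?\<theta>) xs ys" for f xs ys
    using co ag that list_all2_lengthD[OF that(3)] unfolding is_congruence_def agrees_def by auto
  have "\<theta> (a x u) (a y v)" if "x < n" "y < n" "u < n" "v < n" "\<theta> x y" "\<theta> u v" for x y u v
    using ops[of 0 "[x, u]" "[y, v]"] ag that by (simp add: agrees_def)
  moreover have "\<theta> (ng x) (ng y)" if "x < n" "y < n" "\<theta> x y" for x y
    using ops[of 1 "[x]" "[y]"] ag that by (simp add: agrees_def)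
  moreover have "\<theta> (s r x) (s r y)" if "r < q" "x < n" "y < n" "\<theta> x y" for r x y
    using ops[of "3 + r" "[x]" "[y]"] ag that by (simp add: agrees_def)
  moreover have "\<forall>x<n. \<theta> x x" using eq by (auto simp: equiv_def refl_on_def)
  moreover have "\<forall>x<n. \<forall>y<n. \<theta> x y \<longrightarrow> \<theta> y x" using eq by (auto simp: equiv_def sym_def)
  moreover have "\<forall>x<n. \<forall>y<n. \<forall>w<n. \<theta> x y \<and> \<theta> y w \<longrightarrow> \<theta> x w"
    using eq unfolding equiv_def trans_def by blast
  ultimately show "cong_cond n q a ng s \<theta>"
    unfolding cong_cond_def by blast
next
  let ?\<theta> = "{(x, y). x < n \<and> y < n \<and> \<theta> x y}"
  assume co: "cong_cond n q a ng s \<theta>"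
  note cc = co[unfolded cong_cond_def]
  note c_refl = cc[THEN conjunct1, rule_format]
    and c_sym = cc[THEN conjunct2, THEN conjunct1, rule_format]
    and c_trans = cc[THEN conjunct2, THEN conjunct2, THEN conjunct1, rule_format, OF _ _ _ conjI]
    and c_a = cc[THEN conjunct2, THEN conjunct2, THEN conjunct2, THEN conjunct1, rule_format, OF _ _ _ _ conjI]
    and c_ng = cc[THEN conjunct2, THEN conjunct2, THEN conjunct2, THEN conjunct2, THEN conjunct1, rule_format]
    and c_s = cc[THEN conjunct2, THEN conjunct2, THEN conjunct2, THEN conjunct2, THEN conjunct2, rule_format]
  have eq: "equiv {..<n} ?\<theta>"
  proof (rule equivI)
    show "trans ?\<theta>" unfolding trans_def using c_trans by blast
    show "sym ?\<theta>" using c_sym unfolding sym_def by blast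
    show "refl_on {..<n} ?\<theta>" using c_refl unfolding refl_on_def by blast
  qed auto
  have "(interp A f xs, interp A f ys) \<in> ?\<theta>" if f: "f < 3 + q" "length xs = arity A f"
    "list_all2 (\<lambda>x y. (x, y) \<in> ?\<theta>) xs ys" for f xs ys
  proof -
    consider "f = 0" | "f = 1" | "f = 2" | r where "f = 3 + r" "r < q"
    proof -
      have "f = 0 \<or> f = 1 \<or> f = 2 \<or> (f = 3 + (f - 3) \<and> f - 3 < q)" using f(1) by arith
      then show ?thesis using that by blast
    qed
    then show ?thesis
    proof cases
      case 1
      then have "length xs = 2" using f ag by (simp add: agrees_def)
      then obtain x u where xs: "xs = [x, u]" by (auto simp: length_Suc_conv numeral_2_eq_2)
      then obtain y v where ys: "ys = [y, v]" using f(3) by (auto simp: list_all2_Cons1)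
      show ?thesis using 1 f(3) xs ys ag cl by (simp add: agrees_def closed_ops_def c_refl c_a c_ng c_s)
    next
      case 2
      then have "length xs = 1" using f ag by (simp add: agrees_def)
      then obtain x where xs: "xs = [x]" by (auto simp: length_Suc_conv)
      then obtain y where ys: "ys = [y]" using f(3) by (auto simp: list_all2_Cons1)
      show ?thesis using 2 f(3) xs ys ag cl by (simp add: agrees_def closed_ops_def c_refl c_a c_ng c_s)
    next
      case 3
      then have "length xs = 0" using f ag by (simp add: agrees_def)
      then have "xs = []" "ys = []" using f(3) by auto
      then show ?thesis using 3 ag cl by (simp add: agrees_def closed_ops_def c_refl c_a c_ng c_s)
    next
      case 4
      then have "length xs = 1" using f ag by (simp add: agrees_def)
      then obtain x where xs: "xs = [x]" by (auto simp: length_Suc_conv)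
      then obtain y where ys: "ys = [y]" using f(3) by (auto simp: list_all2_Cons1)
      show ?thesis using 4 f(3) xs ys ag cl by (simp add: agrees_def closed_ops_def c_refl c_a c_ng c_s)
    qed
  qed
  then show "is_congruence A ?\<theta>"
    using eq ag unfolding is_congruence_def agrees_def by auto
qed

section \<open>Reading an encoded instance\<close>

text \<open>\<open>unary_at w p v\<close>: the block of the number \<open>v\<close> starts at position \<open>p\<close>. \<open>tok_pos w t p\<close>: the
  block number \<open>t\<close> starts at position \<open>p\<close>; \<open>val w t v\<close>: it denotes \<open>v\<close>.\<close>

definition unary_at :: "bool list \<Rightarrow> nat \<Rightarrow> nat \<Rightarrow> bool" where
  "unary_at w p v \<longleftrightarrow> p + v < length w \<and> \<not> w ! (p + v) \<and> (\<forall>u<v. w ! (p + u))"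

primrec tok_pos :: "bool list \<Rightarrow> nat \<Rightarrow> nat \<Rightarrow> bool" where
  "tok_pos w 0 p \<longleftrightarrow> p = 0"
| "tok_pos w (Suc t) p \<longleftrightarrow> (\<exists>p' v. tok_pos w t p' \<and> unary_at w p' v \<and> p = p' + v + 1)"

definition val :: "bool list \<Rightarrow> nat \<Rightarrow> nat \<Rightarrow> bool" where
  "val w t v \<longleftrightarrow> (\<exists>p. tok_pos w t p \<and> unary_at w p v)"

lemma unary_at_unique: "unary_at w p v \<Longrightarrow> unary_at w p v' \<Longrightarrow> v = v'"
  unfolding unary_at_def by (metis linorder_neqE_nat)

lemma tok_pos_unique: "tok_pos w t p \<Longrightarrow> tok_pos w t p' \<Longrightarrow> p = p'"
  by (induction t arbitrary: p p') (auto dest: unary_at_unique)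

lemma val_unique: "val w t v \<Longrightarrow> val w t v' \<Longrightarrow> v = v'"
  unfolding val_def using tok_pos_unique unary_at_unique by blast

lemma unary_at_enc: "unary_at (us @ enc_nat v @ vs) (length us) v"
  by (auto simp: unary_at_def enc_nat_def nth_append)

lemma unary_at_drop: "unary_at w p v \<Longrightarrow> drop p w = enc_nat v @ drop (p + v + 1) w"
proof -
  assume u: "unary_at w p v"
  then have l: "p + v < length w" by (simp add: unary_at_def)
  have "drop p w = take v (drop p w) @ drop v (drop p w)" by (rule append_take_drop_id[symmetric])
  also have "drop v (drop p w) = w ! (p + v) # drop (p + v + 1) w"
    using Cons_nth_drop_Suc[OF l] by (simp add: add.commute)
  also have "take v (drop p w) = replicate v True"
    using u by (intro nth_equalityI) (auto simp: unary_at_def)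
  finally show ?thesis using u by (simp add: enc_nat_def unary_at_def)
qed

lemma concat_enc_split:
  assumes "t < length ts"
  shows "concat (map enc_nat ts) =
    concat (map enc_nat (take t ts)) @ enc_nat (ts ! t) @ concat (map enc_nat (drop (Suc t) ts))"
  using arg_cong[OF id_take_nth_drop[OF assms], of "\<lambda>ts. concat (map enc_nat ts)"] by simp

lemma tok_pos_decode:
  assumes "w = concat (map enc_nat ts) @ bs"
  shows "t \<le> length ts \<Longrightarrow> tok_pos w t p \<longleftrightarrow> p = length (concat (map enc_nat (take t ts)))"
proof (induction t arbitrary: p)
  case (Suc t)
  let ?p = "length (concat (map enc_nat (take t ts)))"
  have "t < length ts" using Suc.prems by simp
  from concat_enc_split[OF this]
  have "w = concat (map enc_nat (take t ts)) @ enc_nat (ts ! t) @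
      (concat (map enc_nat (drop (Suc t) ts)) @ bs)" unfolding assms by (simp only: append_assoc)
  then have u: "unary_at w ?p (ts ! t)" by (elim ssubst) (rule unary_at_enc)
  have "tok_pos w (Suc t) p \<longleftrightarrow> p = ?p + ts ! t + 1"
  proof -
    have IH: "tok_pos w t p' \<longleftrightarrow> p' = ?p" for p' using Suc.IH Suc.prems by simp
    show ?thesis unfolding tok_pos.simps IH using u unary_at_unique[OF u] by blast
  qed
  also have "?p + ts ! t + 1 = length (concat (map enc_nat (take (Suc t) ts)))"
    using Suc.prems by (simp add: take_Suc_conv_app_nth enc_nat_def)
  finally show ?case .
qed simp

lemma val_decode:
  assumes "w = concat (map enc_nat ts) @ bs" "t < length ts"
  shows "val w t (ts ! t)"
proof -
  let ?p = "length (concat (map enc_nat (take t ts)))"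
  from concat_enc_split[OF assms(2)]
  have "w = concat (map enc_nat (take t ts)) @ enc_nat (ts ! t) @
      (concat (map enc_nat (drop (Suc t) ts)) @ bs)" unfolding assms(1) by (simp only: append_assoc)
  then have u: "unary_at w ?p (ts ! t)" by (elim ssubst) (rule unary_at_enc)
  with tok_pos_decode[OF assms(1), of t ?p] assms(2) show ?thesis unfolding val_def by auto
qed

lemma val_encode:
  assumes "\<And>t. t < length ts \<Longrightarrow> val w t (ts ! t)" "tok_pos w (length ts) p"
  shows "w = concat (map enc_nat ts) @ drop p w"
proof -
  have "t \<le> length ts \<Longrightarrow> tok_pos w t p \<Longrightarrow> w = concat (map enc_nat (take t ts)) @ drop p w" for t p
  proof (induction t arbitrary: p)
    case (Suc t)
    obtain p' v where p': "tok_pos w t p'" "unary_at w p' v" "p = p' + v + 1" using Suc.prems by auto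
    have "v = ts ! t" using assms(1)[of t] Suc.prems(1) p' tok_pos_unique unary_at_unique
      unfolding val_def by (metis Suc_le_eq)
    have "w = concat (map enc_nat (take t ts)) @ drop p' w" using Suc p' by simp
    also have "drop p' w = enc_nat v @ drop p w" using unary_at_drop[OF p'(2)] p'(3) by simp
    finally show ?case using Suc.prems(1) \<open>v = ts ! t\<close> by (simp add: take_Suc_conv_app_nth)
  qed simp
  from this[of "length ts" p] assms(2) show ?thesis by simp
qed

subsection \<open>Arrays\<close>

lemma length_concat_uniform:
  "(\<And>i. i < m \<Longrightarrow> length (f i) = c) \<Longrightarrow> length (concat (map f [0..<m])) = m * c"
  by (induction m) (auto simp: add.commute)

lemma nth_concat_uniform:
  "(\<And>i. i < m \<Longrightarrow> length (f i) = c) \<Longrightarrow> i < m \<Longrightarrow> j < c \<Longrightarrow> concat (map f [0..<m]) ! (i * c + j) = f i ! j"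
proof (induction m)
  case (Suc m)
  have len: "length (concat (map f [0..<m])) = m * c" using Suc.prems by (intro length_concat_uniform) auto
  show ?case
  proof (cases "i < m")
    case True
    then have "Suc i * c \<le> m * c" by (intro mult_le_mono1) auto
    then have "i * c + j < m * c" using Suc.prems(3) by simp
    then show ?thesis using Suc True len by (simp add: nth_append)
  next
    case False
    then have "i = m" using Suc.prems by simp
    then show ?thesis using len by (simp add: nth_append)
  qed
qed simp

lemma concat_uniform_eqI:
  assumes "\<And>i. i < m \<Longrightarrow> length (f i) = c" "length xs = m * c"
    and "\<And>i j. i < m \<Longrightarrow> j < c \<Longrightarrow> xs ! (i * c + j) = f i ! j"
  shows "concat (map f [0..<m]) = xs"
proof (rule nth_equalityI)
  show "length (concat (map f [0..<m])) = length xs" using length_concat_uniform[of m f c] assms by simp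
  fix t assume "t < length (concat (map f [0..<m]))"
  then have t: "t < m * c" using length_concat_uniform[of m f c] assms by simp
  then have "0 < c" by (cases c) auto
  then have "t div c < m" "t mod c < c" "t = (t div c) * c + t mod c"
    using t by (auto simp: less_mult_imp_div_less)
  then show "concat (map f [0..<m]) ! t = xs ! t"
    using nth_concat_uniform[of m f c "t div c" "t mod c"] assms(1,3) by metis
qed

lemma pair_index_less:
  fixes x :: nat
  assumes "x < m" "y < c" shows "x * c + y < m * c"
proof -
  have "Suc x * c \<le> m * c" using assms by (intro mult_le_mono1) auto
  then show ?thesis using assms by simp
qed

lemma nth_enc_relation:
  assumes "x < n" "y < n"
  shows "enc_relation n \<theta> ! (x * n + y) \<longleftrightarrow> (x, y) \<in> \<theta>"
proof -
  have "List.product [0..<n] [0..<n] ! (x * n + y) = (x, y)"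
    using assms pair_index_less[OF assms] by (subst product_nth) auto
  moreover have "x * n + y < n * n" using pair_index_less[OF assms] .
  ultimately show ?thesis by (simp add: enc_relation_def)
qed

subsection \<open>The encoding of a vector space instance\<close>

text \<open>The numbers written in the encoding of an instance with \<open>k\<close> congruences.\<close>

definition toks ::
  "nat \<Rightarrow> nat \<Rightarrow> nat \<Rightarrow> (nat \<Rightarrow> nat \<Rightarrow> nat) \<Rightarrow> (nat \<Rightarrow> nat) \<Rightarrow> nat \<Rightarrow> (nat \<Rightarrow> nat \<Rightarrow> nat) \<Rightarrow> nat list" where
  "toks n q k a ng z s =
     [n, 3 + q, 2] @ concat (map (\<lambda>x. map (a x) [0..<n]) [0..<n]) @ [1] @ map ng [0..<n] @ [0, z] @
     concat (map (\<lambda>r. 1 # map (s r) [0..<n]) [0..<q]) @ [k]"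

lemma upt_3: "[0..<3 + q] = [0, 1, 2] @ map (\<lambda>r. 3 + r) [0..<q]"
  using upt_add_eq_append[of 0 3 q] map_add_upt[of 3 q]
  by (simp add: upt_rec numeral_3_eq_3 add.commute[of 3])

lemma concat_enc_concat:
  "concat (map enc_nat (concat xss)) = concat (map (\<lambda>xs. concat (map enc_nat xs)) xss)"
  by (induction xss) auto

lemma enc_instance_eq:
  assumes "agrees A n q a ng z s"
  shows "enc_instance A \<theta>s = concat (map enc_nat (toks n q (length \<theta>s) a ng z s)) @
    concat (map (enc_relation n) \<theta>s)"
proof -
  have ar: "arity A 0 = Suc (Suc 0)" "arity A (Suc 0) = Suc 0" "arity A 2 = 0"
    "r < q \<Longrightarrow> arity A (3 + r) = Suc 0" for r using assms by (auto simp: agrees_def)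
  have "enc_operation n (arity A 0) (interp A 0) =
      concat (map enc_nat (2 # concat (map (\<lambda>x. map (a x) [0..<n]) [0..<n])))"
  proof -
    have 1: "map (\<lambda>y. enc_nat (interp A 0 [x, y])) [0..<n] = map (\<lambda>y. enc_nat (a x y)) [0..<n]" if "x < n" for x
      using assms that by (auto simp: agrees_def)
    have "concat (concat (map (\<lambda>x. map (\<lambda>y. enc_nat (interp A 0 [x, y])) [0..<n]) [0..<n])) =
        concat (concat (map (\<lambda>x. map (\<lambda>y. enc_nat (a x y)) [0..<n]) [0..<n]))"
      by (rule arg_cong[where f = "\<lambda>x. concat (concat x)"], rule map_cong) (simp_all add: 1)
    then show ?thesis by (simp add: enc_operation_def ar concat_enc_concat comp_def concat_map_singleton
      map_concat numeral_2_eq_2)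
  qed
  moreover have "enc_operation n (arity A 1) (interp A 1) = concat (map enc_nat (1 # map ng [0..<n]))"
  proof -
    have "concat (map (\<lambda>y. enc_nat (interp A (Suc 0) [y])) [0..<n]) = concat (map (\<lambda>y. enc_nat (ng y)) [0..<n])"
      using assms by (intro arg_cong[where f = concat] map_cong) (auto simp: agrees_def)
    then show ?thesis by (simp add: enc_operation_def ar map_concat comp_def concat_map_singleton)
  qed
  moreover have "enc_operation n (arity A 2) (interp A 2) = concat (map enc_nat [0, z])"
    using assms by (simp add: enc_operation_def ar agrees_def)
  moreover have "enc_operation n (arity A (3 + r)) (interp A (3 + r)) =
      concat (map enc_nat (1 # map (s r) [0..<n]))" if "r < q" for r
  proof -
    have "concat (map (\<lambda>y. enc_nat (interp A (3 + r) [y])) [0..<n]) = concat (map (\<lambda>y. enc_nat (s r y)) [0..<n])"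
      using assms that by (intro arg_cong[where f = concat] map_cong) (auto simp: agrees_def)
    then show ?thesis using that by (simp add: enc_operation_def ar map_concat comp_def concat_map_singleton)
  qed
  then have "concat (map (\<lambda>r. enc_operation n (arity A (3 + r)) (interp A (3 + r))) [0..<q]) =
      concat (map enc_nat (concat (map (\<lambda>r. 1 # map (s r) [0..<n]) [0..<q])))"
    unfolding concat_enc_concat map_map comp_def
    by (intro arg_cong[where f = concat] map_cong) auto
  ultimately have "concat (map (\<lambda>f. enc_operation n (arity A f) (interp A f)) [0..<3 + q]) =
    concat (map enc_nat ((2 # concat (map (\<lambda>x. map (a x) [0..<n]) [0..<n])) @ (1 # map ng [0..<n]) @ [0, z] @
      concat (map (\<lambda>r. 1 # map (s r) [0..<n]) [0..<q])))"
    unfolding upt_3 by (simp add: comp_def)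
  moreover have "card (universe A) = n" "card (fsyms A) = 3 + q" using assms by (auto simp: agrees_def)
  ultimately show ?thesis by (simp add: enc_instance_def Let_def toks_def)
qed

text \<open>The string \<open>w\<close> encodes an instance with the given tables and \<open>k\<close>
  congruences, whose matrices start at position \<open>B\<close>. The conditions fix the number in every block
  and the total length.\<close>

definition fmt ::
  "bool list \<Rightarrow> nat \<Rightarrow> nat \<Rightarrow> nat \<Rightarrow> nat \<Rightarrow> (nat \<Rightarrow> nat \<Rightarrow> nat) \<Rightarrow> (nat \<Rightarrow> nat) \<Rightarrow> nat \<Rightarrow> (nat \<Rightarrow> nat \<Rightarrow> nat) \<Rightarrow> bool" where
  "fmt w n q k B a ng z s \<longleftrightarrow>
     val w 0 n \<and> val w 1 (3 + q) \<and> val w 2 2 \<and> (\<forall>x<n. \<forall>y<n. val w (3 + (x * n + y)) (a x y)) \<and>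
     val w (3 + n * n) 1 \<and> (\<forall>x<n. val w (4 + n * n + x) (ng x)) \<and>
     val w (4 + n * n + n) 0 \<and> val w (5 + n * n + n) z \<and>
     (\<forall>r<q. val w (6 + n * n + n + r * (n + 1)) 1 \<and> (\<forall>x<n. val w (6 + n * n + n + (r * (n + 1) + (1 + x))) (s r x))) \<and>
     val w (6 + n * n + n + q * (n + 1)) k \<and> tok_pos w (7 + n * n + n + q * (n + 1)) B \<and>
     length w = B + k * (n * n)"

lemma toks_nth:
  fixes n q k a ng z s
  defines "ts \<equiv> toks n q k a ng z s"
  shows "length ts = 7 + n * n + n + q * (n + 1)"
    and "ts ! 0 = n" "ts ! 1 = 3 + q" "ts ! 2 = 2"
    and "x < n \<Longrightarrow> y < n \<Longrightarrow> ts ! (3 + (x * n + y)) = a x y"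
    and "ts ! (3 + n * n) = 1" "x < n \<Longrightarrow> ts ! (4 + n * n + x) = ng x"
    and "ts ! (4 + n * n + n) = 0" "ts ! (5 + n * n + n) = z"
    and "r < q \<Longrightarrow> ts ! (6 + n * n + n + r * (n + 1)) = 1"
    and "r < q \<Longrightarrow> x < n \<Longrightarrow> ts ! (6 + n * n + n + (r * (n + 1) + (1 + x))) = s r x"
    and "ts ! (6 + n * n + n + q * (n + 1)) = k"
proof -
  let ?A = "concat (map (\<lambda>x. map (a x) [0..<n]) [0..<n])"
  let ?S = "concat (map (\<lambda>r. 1 # map (s r) [0..<n]) [0..<q])"
  let ?rest = "[1] @ map ng [0..<n] @ [0, z] @ ?S @ [k]"
  have lA: "length ?A = n * n" by (rule length_concat_uniform) simp
  have lS: "length ?S = q * (n + 1)" by (rule length_concat_uniform) simp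
  have ts: "ts = [n, 3 + q, 2] @ ?A @ ?rest" by (simp add: ts_def toks_def)
  show "length ts = 7 + n * n + n + q * (n + 1)" unfolding ts using lA lS by simp
  show "ts ! 0 = n" "ts ! 1 = 3 + q" "ts ! 2 = 2" by (simp_all add: ts)
  have tl: "ts ! (3 + t) = (?A @ ?rest) ! t" for t
    unfolding ts by (simp add: nth_append numeral_3_eq_3)
  show "ts ! (3 + (x * n + y)) = a x y" if "x < n" "y < n"
    unfolding tl using nth_concat_uniform[of n "\<lambda>x. map (a x) [0..<n]" n x y] pair_index_less[OF that] that lA
    by (simp add: nth_append)
  have tr: "ts ! (3 + n * n + t) = ?rest ! t" for t
    unfolding add.assoc tl using lA by (simp add: nth_append)
  show "ts ! (3 + n * n) = 1" using tr[of 0] by simp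
  show "ts ! (4 + n * n + x) = ng x" if "x < n" using tr[of "Suc x"] that by (simp add: nth_append add.assoc)
  show "ts ! (4 + n * n + n) = 0" using tr[of "Suc n"] by (simp add: nth_append add.assoc)
  show "ts ! (5 + n * n + n) = z" using tr[of "Suc (Suc n)"] by (simp add: nth_append add.assoc)
  have tS: "ts ! (6 + n * n + n + t) = (?S @ [k]) ! t" for t
    using tr[of "Suc (Suc (Suc (n + t)))"] by (simp add: nth_append add.assoc)
  have S: "?S ! (r * (n + 1) + j) = (1 # map (s r) [0..<n]) ! j" "r * (n + 1) + j < q * (n + 1)"
    if "r < q" "j < n + 1" for r j
    using nth_concat_uniform[OF _ that, of "\<lambda>r. 1 # map (s r) [0..<n]"] pair_index_less[OF that] by auto
  show "ts ! (6 + n * n + n + r * (n + 1)) = 1" if "r < q"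
    unfolding tS using S[OF that, of 0] lS by (simp add: nth_append)
  show "ts ! (6 + n * n + n + (r * (n + 1) + (1 + x))) = s r x" if "r < q" "x < n"
    unfolding tS using S[OF that(1), of "1 + x"] that(2) lS by (simp add: nth_append)
  show "ts ! (6 + n * n + n + q * (n + 1)) = k" unfolding tS using lS by (simp add: nth_append)
qed

lemma fmt_iff:
  fixes n q k a ng z s defines "ts \<equiv> toks n q k a ng z s"
  shows "fmt w n q k B a ng z s \<longleftrightarrow>
    w = concat (map enc_nat ts) @ drop B w \<and> B = length (concat (map enc_nat ts)) \<and> length w = B + k * (n * n)"
    (is "_ \<longleftrightarrow> ?rhs")
proof
  assume f: "fmt w n q k B a ng z s"
  note tn = toks_nth[where n = n and q = q and k = k and a = a and ng = ng and z = z and s = s, folded ts_def]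
  have "val w t (ts ! t)" if t: "t < length ts" for t
  proof -
    consider "t = 0" | "t = 1" | "t = 2" | "3 \<le> t \<and> t < 3 + n * n" | "t = 3 + n * n"
      | "4 + n * n \<le> t \<and> t < 4 + n * n + n" | "t = 4 + n * n + n" | "t = 5 + n * n + n"
      | "6 + n * n + n \<le> t \<and> t < 6 + n * n + n + q * (n + 1)" | "t = 6 + n * n + n + q * (n + 1)"
      using t unfolding tn(1) by linarith
    then show ?thesis
    proof cases
      case 4
      define u where "u = t - 3"
      have u: "t = 3 + u" "u < n * n" using 4 by (auto simp: u_def)
      then have "0 < n" by (cases n) auto
      then have d: "u div n < n" "u mod n < n" "u = (u div n) * n + u mod n"
        using u by (auto simp: less_mult_imp_div_less)
      have "val w (3 + ((u div n) * n + u mod n)) (a (u div n) (u mod n))"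
        using f d(1,2) unfolding fmt_def by blast
      then show ?thesis using tn(5)[OF d(1,2)] u d(3) by simp
    next
      case 6
      then obtain x where x: "t = 4 + n * n + x" "x < n"
        by (metis add_less_cancel_left le_iff_add)
      then show ?thesis using f tn(7)[OF x(2)] unfolding fmt_def by simp
    next
      case 9
      then obtain u where u: "t = 6 + n * n + n + u" "u < q * (n + 1)"
        by (metis add_less_cancel_left le_iff_add)
      define r j where "r = u div (n + 1)" and "j = u mod (n + 1)"
      have d: "r < q" "j < n + 1" "u = r * (n + 1) + j"
        using u unfolding r_def j_def by (auto simp only: less_mult_imp_div_less mod_less_divisor div_mult_mod_eq)
      show ?thesis
      proof (cases j)
        case 0
        then show ?thesis using f tn(10)[OF d(1)] u d unfolding fmt_def by simp
      next
        case (Suc x)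
        then have x: "x < n" "u = r * (n + 1) + (1 + x)" using d by auto
        have "val w (6 + n * n + n + (r * (n + 1) + (1 + x))) (s r x)" using f d(1) x(1) unfolding fmt_def by blast
        then show ?thesis using tn(11)[OF d(1) x(1)] u(1) x(2) by simp
      qed
    qed (use f tn in \<open>simp_all only: fmt_def\<close>)
  qed
  moreover have tp: "tok_pos w (length ts) B" using f tn(1) unfolding fmt_def by simp
  ultimately have w: "w = concat (map enc_nat ts) @ drop B w" by (rule val_encode)
  moreover have "B = length (concat (map enc_nat ts))"
    using tok_pos_decode[OF w, of "length ts" B] tp by simp
  ultimately show ?rhs using f unfolding fmt_def by simp
next
  assume r: ?rhs
  note tn = toks_nth[where n = n and q = q and k = k and a = a and ng = ng and z = z and s = s, folded ts_def]
  have w: "w = concat (map enc_nat ts) @ drop B w" using r by blast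
  have v: "val w t v" if "t < length ts" "ts ! t = v" for t v using val_decode[OF w that(1)] that(2) by simp
  have A: "x < n \<Longrightarrow> y < n \<Longrightarrow> 3 + (x * n + y) < length ts" for x y
    using pair_index_less[of x n y n] unfolding tn(1) by simp
  have S: "r < q \<Longrightarrow> j < n + 1 \<Longrightarrow> 6 + n * n + n + (r * (n + 1) + j) < length ts" for r j
    using pair_index_less[of r q j "n + 1"] unfolding tn(1) by simp
  have S0: "r < q \<Longrightarrow> 6 + n * n + n + r * (n + 1) < length ts" for r
    using S[of r 0] by simp
  have S1: "r < q \<Longrightarrow> x < n \<Longrightarrow> 6 + n * n + n + (r * (n + 1) + (1 + x)) < length ts" for r x
    by (rule S) simp_all
  have tp: "tok_pos w (7 + n * n + n + q * (n + 1)) B"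
    using tok_pos_decode[OF w, of "length ts" B] r unfolding tn(1)[symmetric] by simp
  have vk: "val w (6 + n * n + n + q * (n + 1)) k"
    by (rule v[OF _ tn(12)]) (simp add: tn(1))
  show "fmt w n q k B a ng z s"
    unfolding fmt_def
    by (intro conjI allI impI tp; (rule vk | rule v)?; (intro A S0 S1 tn(2-6,8-12))?; (rule tn(7))?) (use r in \<open>simp_all add: tn(1)\<close>)
qed

text \<open>The matrix entry of the \<open>i\<close>-th congruence at \<open>x, y\<close>.\<close>

definition \<theta>_bit :: "bool list \<Rightarrow> nat \<Rightarrow> nat \<Rightarrow> nat \<Rightarrow> nat \<Rightarrow> nat \<Rightarrow> bool" where
  "\<theta>_bit w B n i x y \<longleftrightarrow> w ! (B + (i * (n * n) + (x * n + y)))"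

text \<open>The algebra with the given tables.\<close>

definition table_alg ::
  "nat \<Rightarrow> nat \<Rightarrow> (nat \<Rightarrow> nat \<Rightarrow> nat) \<Rightarrow> (nat \<Rightarrow> nat) \<Rightarrow> nat \<Rightarrow> (nat \<Rightarrow> nat \<Rightarrow> nat) \<Rightarrow> (nat, nat) fo_algebra" where
  "table_alg n q a ng z s =
     \<lparr>universe = {..<n}, fsyms = {..<3 + q}, arity = (\<lambda>f. if f = 0 then 2 else if f = 2 then 0 else 1),
      interp = (\<lambda>f xs. if f = 0 then a (xs ! 0) (xs ! 1) else if f = 1 then ng (xs ! 0)
                 else if f = 2 then z else s (f - 3) (xs ! 0))\<rparr>"

lemma agrees_table_alg: "agrees (table_alg n q a ng z s) n q a ng z s"
  by (simp add: agrees_def table_alg_def)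

lemma is_algebra_table_alg:
  assumes "closed_ops n q a ng z s"
  shows "is_algebra (table_alg n q a ng z s)"
proof -
  have "interp (table_alg n q a ng z s) f xs < n"
    if "f < 3 + q" "length xs = arity (table_alg n q a ng z s) f" "set xs \<subseteq> {..<n}" for f xs
  proof (cases "f = 0")
    case True
    then have "length xs = Suc (Suc 0)" using that by (simp add: table_alg_def)
    then obtain x y where "xs = [x, y]" by (auto simp: length_Suc_conv)
    then show ?thesis using True that assms by (simp add: table_alg_def closed_ops_def)
  next
    case False
    show ?thesis
    proof (cases "f = 2")
      case False
      then have "length xs = Suc 0" using that \<open>f \<noteq> 0\<close> by (simp add: table_alg_def)
      then obtain x where x: "xs = [x]" by (auto simp: length_Suc_conv)
      have "f - 3 < q" if "f \<noteq> 1" using that \<open>f \<noteq> 0\<close> \<open>f \<noteq> 2\<close> \<open>f < 3 + q\<close> by arith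
      then show ?thesis using False \<open>f \<noteq> 0\<close> that assms x by (auto simp: table_alg_def closed_ops_def)
    qed (use assms in \<open>simp add: table_alg_def closed_ops_def\<close>)
  qed
  moreover have "{..<n} \<noteq> {}" using assms by (auto simp: closed_ops_def)
  ultimately show ?thesis by (auto simp: is_algebra_def table_alg_def)
qed

lemma CR_tuple_cong: "universe A = universe A' \<Longrightarrow> CR_tuple A \<theta>s = CR_tuple A' \<theta>s"
  by (simp add: CR_tuple_def)

definition bit_congs :: "bool list \<Rightarrow> nat \<Rightarrow> nat \<Rightarrow> nat \<Rightarrow> nat rel list" where
  "bit_congs w B n k = map (\<lambda>i. {(x, y). x < n \<and> y < n \<and> \<theta>_bit w B n i x y}) [0..<k]"

text \<open>Membership in the language, in terms of the tables and matrices written in the string; the field is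
  no longer mentioned.\<close>

lemma in_CRT_VS_iff:
  "w \<in> CRT_restricted VS \<longleftrightarrow>
     (\<exists>n q k B a ng z s. fmt w n q k B a ng z s \<and> closed_ops n q a ng z s \<and> vs_cond n q a ng z s \<and>
        (\<forall>i<k. cong_cond n q a ng s (\<theta>_bit w B n i)) \<and>
        CR_tuple (table_alg n q a ng z s) (bit_congs w B n k))"
proof
  assume "w \<in> CRT_restricted VS"
  then obtain A \<theta>s where w: "w = enc_instance A \<theta>s" and A: "is_coded_algebra A" "A \<in> VS"
    "\<forall>\<theta>\<in>set \<theta>s. is_congruence A \<theta>" "CR_tuple A \<theta>s" unfolding CRT_restricted_def by blast
  obtain F V where FV: "is_vector_space_algebra F V A" using A(2) unfolding VS_def by blast
  obtain n where n: "universe A = {..<n}" using A(1) unfolding is_coded_algebra_def by blast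
  obtain q where q: "carrier F = {..<q}" "fsyms A = {..<3 + q}"
    using FV unfolding is_vector_space_algebra_def by blast
  define a ng z s where "a = (\<lambda>x y. interp A 0 [x, y])" and "ng = (\<lambda>x. interp A 1 [x])"
    and "z = interp A 2 []" and "s = (\<lambda>r x. interp A (3 + r) [x])"
  have ag: "agrees A n q a ng z s"
    using FV n q unfolding agrees_def is_vector_space_algebra_def a_def ng_def z_def s_def by auto
  have vs: "closed_ops n q a ng z s" "vs_cond n q a ng z s" using VS_imp_vs_cond[OF FV ag] by auto
  let ?k = "length \<theta>s"
  let ?ts = "toks n q ?k a ng z s"
  let ?B = "length (concat (map enc_nat ?ts))"
  let ?bits = "concat (map (enc_relation n) \<theta>s)"
  have w': "w = concat (map enc_nat ?ts) @ ?bits" using enc_instance_eq[OF ag] w by simp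
  have bits: "?bits = concat (map (\<lambda>i. enc_relation n (\<theta>s ! i)) [0..<?k])"
    by (rule arg_cong[where f = concat], rule nth_equalityI) simp_all
  have le: "length (enc_relation n \<theta>) = n * n" for \<theta> by (simp add: enc_relation_def)
  have lb: "length ?bits = ?k * (n * n)" unfolding bits by (rule length_concat_uniform) (rule le)
  have f: "fmt w n q ?k ?B a ng z s" unfolding fmt_iff using w' lb by simp
  have bit: "\<theta>_bit w ?B n i x y \<longleftrightarrow> (x, y) \<in> \<theta>s ! i" if "i < ?k" "x < n" "y < n" for i x y
  proof -
    have "w ! (?B + (i * (n * n) + (x * n + y))) = ?bits ! (i * (n * n) + (x * n + y))"
      unfolding w' by (simp add: nth_append)
    also have "\<dots> = enc_relation n (\<theta>s ! i) ! (x * n + y)"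
      unfolding bits by (rule nth_concat_uniform[OF le that(1)]) (rule pair_index_less[OF that(2,3)])
    finally show ?thesis using nth_enc_relation that by (simp add: \<theta>_bit_def)
  qed
  have sub: "\<theta>s ! i \<subseteq> {..<n} \<times> {..<n}" if "i < ?k" for i
    using A(3) nth_mem[OF that] n unfolding is_congruence_def equiv_def refl_on_def by auto
  have th: "{(x, y). x < n \<and> y < n \<and> \<theta>_bit w ?B n i x y} = \<theta>s ! i" if "i < ?k" for i
    using bit[OF that] sub[OF that] by auto
  have "bit_congs w ?B n ?k = \<theta>s"
    unfolding bit_congs_def by (rule nth_equalityI) (use th in auto)
  then have "CR_tuple (table_alg n q a ng z s) (bit_congs w ?B n ?k)"
    using A(4) CR_tuple_cong[of A "table_alg n q a ng z s"] n by (simp add: table_alg_def)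
  moreover have "cong_cond n q a ng s (\<theta>_bit w ?B n i)" if "i < ?k" for i
    using is_congruence_iff[OF ag vs(1), of "\<theta>_bit w ?B n i"] A(3) nth_mem[OF that] th[OF that] by simp
  ultimately show "\<exists>n q k B a ng z s. fmt w n q k B a ng z s \<and> closed_ops n q a ng z s \<and> vs_cond n q a ng z s \<and>
        (\<forall>i<k. cong_cond n q a ng s (\<theta>_bit w B n i)) \<and>
        CR_tuple (table_alg n q a ng z s) (bit_congs w B n k)"
    using f vs by blast
next
  assume "\<exists>n q k B a ng z s. fmt w n q k B a ng z s \<and> closed_ops n q a ng z s \<and> vs_cond n q a ng z s \<and>
        (\<forall>i<k. cong_cond n q a ng s (\<theta>_bit w B n i)) \<and>
        CR_tuple (table_alg n q a ng z s) (bit_congs w B n k)"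
  then obtain n q k B a ng z s where f: "fmt w n q k B a ng z s" and cl: "closed_ops n q a ng z s"
    and vs: "vs_cond n q a ng z s" and co: "\<forall>i<k. cong_cond n q a ng s (\<theta>_bit w B n i)"
    and CR: "CR_tuple (table_alg n q a ng z s) (bit_congs w B n k)" by blast
  let ?A = "table_alg n q a ng z s" and ?\<theta>s = "bit_congs w B n k"
  note ag = agrees_table_alg[of n q a ng z s]
  have w: "w = concat (map enc_nat (toks n q k a ng z s)) @ drop B w" and len: "length w = B + k * (n * n)"
    using f unfolding fmt_iff by blast+
  have "concat (map (\<lambda>i. enc_relation n {(x, y). x < n \<and> y < n \<and> \<theta>_bit w B n i x y}) [0..<k]) = drop B w"
  proof (rule concat_uniform_eqI)
    show "length (enc_relation n {(x, y). x < n \<and> y < n \<and> \<theta>_bit w B n i x y}) = n * n" for i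
      by (simp add: enc_relation_def)
    show "length (drop B w) = k * (n * n)" using len by simp
    fix i j assume ij: "i < k" "j < n * n"
    then have "0 < n" by (cases n) auto
    then have d: "j div n < n" "j mod n < n" "j = (j div n) * n + j mod n"
      using ij by (auto simp: less_mult_imp_div_less)
    have "drop B w ! (i * (n * n) + j) = \<theta>_bit w B n i (j div n) (j mod n)"
      using len by (simp add: \<theta>_bit_def)
    also have "\<dots> = enc_relation n {(x, y). x < n \<and> y < n \<and> \<theta>_bit w B n i x y} ! ((j div n) * n + j mod n)"
      using nth_enc_relation[OF d(1,2)] d by simp
    finally show "drop B w ! (i * (n * n) + j) =
        enc_relation n {(x, y). x < n \<and> y < n \<and> \<theta>_bit w B n i x y} ! j" using d(3) by simp
  qed
  then have "concat (map (enc_relation n) ?\<theta>s) = drop B w" by (simp add: bit_congs_def comp_def)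
  moreover have "length ?\<theta>s = k" by (simp add: bit_congs_def)
  ultimately have "w = enc_instance ?A ?\<theta>s" using enc_instance_eq[OF ag, of ?\<theta>s] w by simp
  moreover have "is_coded_algebra ?A"
    using is_algebra_table_alg[OF cl] by (auto simp: is_coded_algebra_def table_alg_def)
  moreover have "?A \<in> VS" by (rule vs_cond_imp_VS[OF ag cl vs])
  moreover have "\<forall>\<theta>\<in>set ?\<theta>s. is_congruence ?A \<theta>"
    using co is_congruence_iff[OF ag cl] by (auto simp: bit_congs_def)
  ultimately show "w \<in> CRT_restricted VS" using CR unfolding CRT_restricted_def by blast
qed

section \<open>Defining relations by loops\<close>

definition Or :: "fm \<Rightarrow> fm \<Rightarrow> fm" where "Or \<phi> \<psi> = Neg (And (Neg \<phi>) (Neg \<psi>))"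
definition Imp :: "fm \<Rightarrow> fm \<Rightarrow> fm" where "Imp \<phi> \<psi> = Neg (And \<phi> (Neg \<psi>))"
definition All :: "nat \<Rightarrow> fm \<Rightarrow> fm" where "All x \<phi> = Neg (Ex x (Neg \<phi>))"

text \<open>Relations read by a formula, and relations changed by a program.\<close>

fun rels :: "fm \<Rightarrow> nat set" where
  "rels Tr = {}"
| "rels (Rel R xs) = {R}"
| "rels (Neg \<phi>) = rels \<phi>"
| "rels (And \<phi> \<psi>) = rels \<phi> \<union> rels \<psi>"
| "rels (Ex x \<phi>) = rels \<phi>"

lemma holds_Or [simp]: "holds N \<sigma> \<rho> (Or \<phi> \<psi>) \<longleftrightarrow> holds N \<sigma> \<rho> \<phi> \<or> holds N \<sigma> \<rho> \<psi>"
  and holds_Imp [simp]: "holds N \<sigma> \<rho> (Imp \<phi> \<psi>) \<longleftrightarrow> (holds N \<sigma> \<rho> \<phi> \<longrightarrow> holds N \<sigma> \<rho> \<psi>)"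
  and holds_All [simp]: "holds N \<sigma> \<rho> (All x \<phi>) \<longleftrightarrow> (\<forall>v\<in>{..<N}. holds N \<sigma> (\<rho>(x := v)) \<phi>)"
  and holds_Ex: "holds N \<sigma> \<rho> (Ex x \<phi>) \<longleftrightarrow> (\<exists>v\<in>{..<N}. holds N \<sigma> (\<rho>(x := v)) \<phi>)"
  by (auto simp: Or_def Imp_def All_def)

lemma wff_Or [simp]: "wff ar V (Or \<phi> \<psi>) \<longleftrightarrow> wff ar V \<phi> \<and> wff ar V \<psi>"
  and wff_Imp [simp]: "wff ar V (Imp \<phi> \<psi>) \<longleftrightarrow> wff ar V \<phi> \<and> wff ar V \<psi>"
  and wff_All [simp]: "wff ar V (All x \<phi>) \<longleftrightarrow> x \<notin> V \<and> wff ar (insert x V) \<phi>"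
  by (auto simp: Or_def Imp_def All_def)

lemma rels_Or [simp]: "rels (Or \<phi> \<psi>) = rels \<phi> \<union> rels \<psi>"
  and rels_Imp [simp]: "rels (Imp \<phi> \<psi>) = rels \<phi> \<union> rels \<psi>"
  and rels_All [simp]: "rels (All x \<phi>) = rels \<phi>"
  by (auto simp: Or_def Imp_def All_def)

fun writes :: "cmd \<Rightarrow> nat set" where
  "writes Skip = {}"
| "writes (Set R xs \<phi>) = {R}"
| "writes (Comp c d) = writes c \<union> writes d"
| "writes (For x c) = writes c"
| "writes (If \<phi> c) = writes c"

lemma holds_cong: "(\<And>R. R \<in> rels \<phi> \<Longrightarrow> \<sigma> R = \<sigma>' R) \<Longrightarrow> holds N \<sigma> \<rho> \<phi> = holds N \<sigma>' \<rho> \<phi>"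
  by (induction \<phi> arbitrary: \<rho>) auto

lemma exec_frame: "R \<notin> writes c \<Longrightarrow> exec N c \<rho> \<sigma> R = \<sigma> R"
proof (induction c arbitrary: \<rho> \<sigma>)
  case (For x c)
  have "fold (\<lambda>v. exec N c (\<rho>(x := v))) vs \<sigma> R = \<sigma> R" for vs
    by (induction vs arbitrary: \<sigma>) (use For in auto)
  then show ?case by simp
qed auto

text \<open>Parallel assignment of values to variables.\<close>

fun upd :: "env \<Rightarrow> nat list \<Rightarrow> nat list \<Rightarrow> env" where
  "upd \<rho> (x # xs) (v # vs) = upd (\<rho>(x := v)) xs vs"
| "upd \<rho> _ _ = \<rho>"

lemma upd_other: "y \<notin> set xs \<Longrightarrow> upd \<rho> xs vs y = \<rho> y"
proof (induction xs arbitrary: \<rho> vs)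
  case (Cons x xs)
  then show ?case by (cases vs) simp_all
qed simp

lemma map_upd_self: "distinct xs \<Longrightarrow> length vs = length xs \<Longrightarrow> map (upd \<rho> xs vs) xs = vs"
proof (induction xs arbitrary: \<rho> vs)
  case (Cons x xs)
  obtain v us where vs: "vs = v # us" using Cons.prems(2) by (cases vs) auto
  have "map (upd (\<rho>(x := v)) xs us) xs = us" by (rule Cons.IH) (use Cons.prems vs in auto)
  moreover have "upd (\<rho>(x := v)) xs us x = v" using upd_other[of x xs "\<rho>(x := v)" us] Cons.prems by simp
  ultimately show ?case unfolding vs by (simp del: fun_upd_apply)
qed simp

lemma map_upd_other: "set ys \<inter> set xs = {} \<Longrightarrow> map (upd \<rho> xs vs) ys = map \<rho> ys"
  by (rule map_cong) (auto intro: upd_other)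

text \<open>All tuples of length \<open>d\<close> over \<open>{..<N}\<close>, in the order in which nested loops
  visit them.\<close>

fun tuples :: "nat \<Rightarrow> nat \<Rightarrow> nat list list" where
  "tuples N 0 = [[]]"
| "tuples N (Suc d) = concat (map (\<lambda>v. map ((#) v) (tuples N d)) [0..<N])"

lemma set_tuples: "set (tuples N d) = {vs. length vs = d \<and> set vs \<subseteq> {..<N}}"
proof (induction d)
  case (Suc d)
  show ?case by (auto simp: Suc length_Suc_conv)
qed auto

definition Fors :: "nat list \<Rightarrow> cmd \<Rightarrow> cmd" where "Fors xs c = foldr For xs c"

lemma Fors_simps [simp]: "Fors [] c = c" "Fors (x # xs) c = For x (Fors xs c)"
  by (simp_all add: Fors_def)

lemma fold_concat: "fold f (concat xss) s = fold (\<lambda>xs. fold f xs) xss s"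
  by (induction xss arbitrary: s) auto

lemma exec_Fors: "exec N (Fors xs c) \<rho> \<sigma> = fold (\<lambda>vs. exec N c (upd \<rho> xs vs)) (tuples N (length xs)) \<sigma>"
proof (induction xs arbitrary: \<rho> \<sigma>)
  case (Cons x xs)
  have "fold f (map ((#) v) vss) s = fold (\<lambda>vs. f (v # vs)) vss s" for f :: "nat list \<Rightarrow> store \<Rightarrow> store" and v vss s
    by (induction vss arbitrary: s) auto
  then have "fold (\<lambda>vs. exec N c (upd \<rho> (x # xs) vs)) (tuples N (length (x # xs))) \<sigma> =
      fold (\<lambda>v \<sigma>. fold (\<lambda>vs. exec N c (upd (\<rho>(x := v)) xs vs)) (tuples N (length xs)) \<sigma>) [0..<N] \<sigma>"
    unfolding tuples.simps list.size by (simp only: fold_concat fold_map comp_def upd.simps tuples.simps add_0_right add_Suc_right)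
  moreover have "exec N (Fors xs c) \<rho>' = fold (\<lambda>vs. exec N c (upd \<rho>' xs vs)) (tuples N (length xs))" for \<rho>'
    by (rule ext) (rule Cons.IH)
  ultimately show ?case by (simp only: Fors_simps exec.simps)
qed simp

lemma fold_processed:
  assumes "\<And>v D \<sigma>. v \<in> set vs \<Longrightarrow> P D \<sigma> \<Longrightarrow> P (insert v D) (f v \<sigma>)" "P D \<sigma>"
  shows "P (D \<union> set vs) (fold f vs \<sigma>)"
  using assms
proof (induction vs arbitrary: D \<sigma>)
  case (Cons v vs)
  have "P (insert v D \<union> set vs) (fold f vs (f v \<sigma>))" by (rule Cons.IH) (use Cons.prems in auto)
  then show ?case by simp
qed simp

text \<open>Invariant rule for nested loops: the invariant refers to the set of the tuples that have been
  processed.\<close>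

lemma exec_Fors_processed:
  assumes "\<And>vs D \<sigma>. length vs = length xs \<Longrightarrow> set vs \<subseteq> {..<N} \<Longrightarrow> P D \<sigma> \<Longrightarrow>
      P (insert vs D) (exec N c (upd \<rho> xs vs) \<sigma>)" and "P {} \<sigma>"
  shows "P {vs. length vs = length xs \<and> set vs \<subseteq> {..<N}} (exec N (Fors xs c) \<rho> \<sigma>)"
  using fold_processed[of "tuples N (length xs)" P "\<lambda>vs. exec N c (upd \<rho> xs vs)" "{}" \<sigma>] assms
  by (auto simp: exec_Fors set_tuples)

lemma exec_For_inv:
  assumes "P 0 \<sigma>" "\<And>v \<sigma>. v < N \<Longrightarrow> P v \<sigma> \<Longrightarrow> P (Suc v) (exec N c (\<rho>(x := v)) \<sigma>)"
  shows "P N (exec N (For x c) \<rho> \<sigma>)"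
proof -
  have "m \<le> N \<Longrightarrow> P m (fold (\<lambda>v. exec N c (\<rho>(x := v))) [0..<m] \<sigma>)" for m
    by (induction m) (use assms in auto)
  then show ?thesis by simp
qed

text \<open>\<open>Def R ys xs \<phi>\<close> sets \<open>R\<close>, at all tuples that extend the values of \<open>ys\<close>, to the values of \<open>\<phi>\<close>.\<close>

definition Def :: "nat \<Rightarrow> nat list \<Rightarrow> nat list \<Rightarrow> fm \<Rightarrow> cmd" where
  "Def R ys xs \<phi> = Fors xs (Set R (ys @ xs) \<phi>)"

lemma exec_Def:
  assumes "R \<notin> rels \<phi>" "distinct xs" "set ys \<inter> set xs = {}"
  shows "R' \<noteq> R \<Longrightarrow> exec N (Def R ys xs \<phi>) \<rho> \<sigma> R' = \<sigma> R'"
    and "length vs = length xs \<Longrightarrow> set vs \<subseteq> {..<N} \<Longrightarrow>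
      exec N (Def R ys xs \<phi>) \<rho> \<sigma> R (map \<rho> ys @ vs) = holds N \<sigma> (upd \<rho> xs vs) \<phi>"
    and "\<not> (\<exists>vs. us = map \<rho> ys @ vs \<and> length vs = length xs \<and> set vs \<subseteq> {..<N}) \<Longrightarrow>
      exec N (Def R ys xs \<phi>) \<rho> \<sigma> R us = \<sigma> R us"
proof -
  let ?P = "\<lambda>D \<sigma>'. (\<forall>R'. R' \<noteq> R \<longrightarrow> \<sigma>' R' = \<sigma> R') \<and>
    (\<forall>vs\<in>D. \<sigma>' R (map \<rho> ys @ vs) = holds N \<sigma> (upd \<rho> xs vs) \<phi>) \<and>
    (\<forall>us. us \<notin> (\<lambda>vs. map \<rho> ys @ vs) ` D \<longrightarrow> \<sigma>' R us = \<sigma> R us)"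
  have "?P {vs. length vs = length xs \<and> set vs \<subseteq> {..<N}} (exec N (Fors xs (Set R (ys @ xs) \<phi>)) \<rho> \<sigma>)"
  proof (rule exec_Fors_processed[where P = ?P])
    fix vs :: "nat list" and D \<sigma>' assume vs: "length vs = length xs" and P: "?P D \<sigma>'"
    have e: "holds N \<sigma>' (upd \<rho> xs vs) \<phi> = holds N \<sigma> (upd \<rho> xs vs) \<phi>"
      using P assms(1) by (intro holds_cong) metis
    have m: "map (upd \<rho> xs vs) (ys @ xs) = map \<rho> ys @ vs"
      unfolding map_append map_upd_self[OF assms(2) vs] map_upd_other[OF assms(3)] ..
    have "exec N (Set R (ys @ xs) \<phi>) (upd \<rho> xs vs) \<sigma>' =
        \<sigma>'(R := (\<sigma>' R)(map \<rho> ys @ vs := holds N \<sigma> (upd \<rho> xs vs) \<phi>))" unfolding exec.simps e m ..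
    then show "?P (insert vs D) (exec N (Set R (ys @ xs) \<phi>) (upd \<rho> xs vs) \<sigma>')" using P by auto
  qed auto
  note r = this[folded Def_def]
  show "R' \<noteq> R \<Longrightarrow> exec N (Def R ys xs \<phi>) \<rho> \<sigma> R' = \<sigma> R'"
    using r[THEN conjunct1] by blast
  show "length vs = length xs \<Longrightarrow> set vs \<subseteq> {..<N} \<Longrightarrow>
      exec N (Def R ys xs \<phi>) \<rho> \<sigma> R (map \<rho> ys @ vs) = holds N \<sigma> (upd \<rho> xs vs) \<phi>"
    using r[THEN conjunct2, THEN conjunct1] by blast
  assume us: "\<not> (\<exists>vs. us = map \<rho> ys @ vs \<and> length vs = length xs \<and> set vs \<subseteq> {..<N})"
  then have "us \<notin> (\<lambda>vs. map \<rho> ys @ vs) ` {vs. length vs = length xs \<and> set vs \<subseteq> {..<N}}" by blast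
  then show "exec N (Def R ys xs \<phi>) \<rho> \<sigma> R us = \<sigma> R us"
    using r[THEN conjunct2, THEN conjunct2] by blast
qed

text \<open>Definition by recursion on the first argument.\<close>

lemma exec_RecDef:
  assumes "distinct (t # xs)"
    and step: "\<And>v vs \<sigma>'. v < N \<Longrightarrow> length vs = length xs \<Longrightarrow> set vs \<subseteq> {..<N} \<Longrightarrow>
      (\<And>R'. R' \<noteq> R \<Longrightarrow> \<sigma>' R' = \<sigma> R') \<Longrightarrow>
      (\<And>u us. u < v \<Longrightarrow> length us = length xs \<Longrightarrow> set us \<subseteq> {..<N} \<Longrightarrow> \<sigma>' R (u # us) = Q u us) \<Longrightarrow>
      holds N \<sigma>' (upd (\<rho>(t := v)) xs vs) \<phi> = Q v vs"
    and "v < N" "length vs = length xs" "set vs \<subseteq> {..<N}"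
  shows "exec N (For t (Fors xs (Set R (t # xs) \<phi>))) \<rho> \<sigma> R (v # vs) = Q v vs"
proof -
  let ?P = "\<lambda>m \<sigma>'. (\<forall>R'. R' \<noteq> R \<longrightarrow> \<sigma>' R' = \<sigma> R') \<and>
    (\<forall>u us. u < m \<and> length us = length xs \<and> set us \<subseteq> {..<N} \<longrightarrow> \<sigma>' R (u # us) = Q u us)"
  have "?P N (exec N (For t (Fors xs (Set R (t # xs) \<phi>))) \<rho> \<sigma>)"
  proof (rule exec_For_inv[where P = ?P])
    fix m \<sigma>1 assume m: "m < N" and P1: "?P m \<sigma>1"
    let ?P2 = "\<lambda>D \<sigma>'. ?P m \<sigma>' \<and> (\<forall>vs\<in>D. \<sigma>' R (m # vs) = Q m vs)"
    have "?P2 {vs. length vs = length xs \<and> set vs \<subseteq> {..<N}} (exec N (Fors xs (Set R (t # xs) \<phi>)) (\<rho>(t := m)) \<sigma>1)"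
    proof (rule exec_Fors_processed)
      fix vs :: "nat list" and D \<sigma>' assume vs: "length vs = length xs" "set vs \<subseteq> {..<N}" and P: "?P2 D \<sigma>'"
      have "holds N \<sigma>' (upd (\<rho>(t := m)) xs vs) \<phi> = Q m vs"
        by (rule step[OF m vs]) (use P in auto)
      moreover have "map (upd (\<rho>(t := m)) xs vs) (t # xs) = m # vs"
        using map_upd_self[of xs vs] upd_other[of t xs] vs assms(1) by simp
      ultimately have "exec N (Set R (t # xs) \<phi>) (upd (\<rho>(t := m)) xs vs) \<sigma>' = \<sigma>'(R := (\<sigma>' R)(m # vs := Q m vs))"
        by simp
      then show "?P2 (insert vs D) (exec N (Set R (t # xs) \<phi>) (upd (\<rho>(t := m)) xs vs) \<sigma>')" using P by auto
    qed (use P1 in auto)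
    then show "?P (Suc m) (exec N (Fors xs (Set R (t # xs) \<phi>)) (\<rho>(t := m)) \<sigma>1)"
      by (auto simp: less_Suc_eq)
  qed auto
  then show ?thesis using assms(3-5) by blast
qed

subsection \<open>Well-formedness of the abbreviations\<close>

lemma wfc_Fors: "wfc ar V (Fors xs c) \<longleftrightarrow> distinct xs \<and> set xs \<inter> V = {} \<and> wfc ar (set xs \<union> V) c"
proof (induction xs arbitrary: V)
  case (Cons x xs)
  have "set xs \<union> insert x V = set (x # xs) \<union> V" by auto
  then show ?case using Cons by auto
qed simp

lemma wfc_Def:
  "wfc ar V (Def R ys xs \<phi>) \<longleftrightarrow> distinct xs \<and> set xs \<inter> V = {} \<and> length ys + length xs = ar R \<and>
     set ys \<subseteq> set xs \<union> V \<and> wff ar (set xs \<union> V) \<phi>"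
  by (auto simp: Def_def wfc_Fors)

lemma writes_Fors [simp]: "writes (Fors xs c) = writes c"
  by (induction xs) auto

lemma writes_Def [simp]: "writes (Def R ys xs \<phi>) = {R}"
  by (simp add: Def_def)

subsection \<open>Arithmetic terms\<close>

text \<open>The basic relations: the bits of the input, the positions below its length, equality and order, a
  set of marked elements, and the graphs of successor, addition and multiplication, as far as their values are
  below \<open>N\<close>.\<close>

abbreviation (input) rBIT :: nat where "rBIT \<equiv> 0"
abbreviation (input) rLEN :: nat where "rLEN \<equiv> Suc 0"
abbreviation (input) rEQ :: nat where "rEQ \<equiv> 2"
abbreviation (input) rLT :: nat where "rLT \<equiv> 3"
abbreviation (input) rSEEN :: nat where "rSEEN \<equiv> 4"
abbreviation (input) rSUC :: nat where "rSUC \<equiv> 5"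
abbreviation (input) rPLUS :: nat where "rPLUS \<equiv> 6"
abbreviation (input) rTIMES :: nat where "rTIMES \<equiv> 7"

datatype tm = V nat | K nat | Plus tm tm | Times tm tm

fun tval :: "env \<Rightarrow> tm \<Rightarrow> nat" where
  "tval \<rho> (V x) = \<rho> x"
| "tval \<rho> (K c) = c"
| "tval \<rho> (Plus t u) = tval \<rho> t + tval \<rho> u"
| "tval \<rho> (Times t u) = tval \<rho> t * tval \<rho> u"

fun tvars :: "tm \<Rightarrow> nat set" where
  "tvars (V x) = {x}"
| "tvars (K c) = {}"
| "tvars (Plus t u) = tvars t \<union> tvars u"
| "tvars (Times t u) = tvars t \<union> tvars u"

text \<open>All subterms have values below \<open>N\<close>, so that their values can be held by
  variables.\<close>

fun tok :: "nat \<Rightarrow> env \<Rightarrow> tm \<Rightarrow> bool" where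
  "tok N \<rho> (V x) \<longleftrightarrow> \<rho> x < N"
| "tok N \<rho> (K c) \<longleftrightarrow> c < N"
| "tok N \<rho> (Plus t u) \<longleftrightarrow> tok N \<rho> t \<and> tok N \<rho> u \<and> tval \<rho> t + tval \<rho> u < N"
| "tok N \<rho> (Times t u) \<longleftrightarrow> tok N \<rho> t \<and> tok N \<rho> u \<and> tval \<rho> t * tval \<rho> u < N"

lemma tok_tval: "tok N \<rho> t \<Longrightarrow> tval \<rho> t < N"
  by (cases t) auto

text \<open>\<open>isK f c x\<close>: the value of \<open>x\<close> is \<open>c\<close>; \<open>TE f t x\<close>: the value of \<open>x\<close> is that of \<open>t\<close>. The numbers from
  \<open>f\<close> on serve as bound variables.\<close>

fun isK :: "nat \<Rightarrow> nat \<Rightarrow> nat \<Rightarrow> fm" where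
  "isK f 0 x = Neg (Ex f (Rel rLT [f, x]))"
| "isK f (Suc c) x = Ex f (And (isK (Suc f) c f) (Rel rSUC [f, x]))"

fun TE :: "nat \<Rightarrow> tm \<Rightarrow> nat \<Rightarrow> fm" where
  "TE f (V y) x = Rel rEQ [y, x]"
| "TE f (K c) x = isK f c x"
| "TE f (Plus t u) x = Ex f (Ex (f + 1) (And (TE (f + 2) t f) (And (TE (f + 2) u (f + 1)) (Rel rPLUS [f, f + 1, x]))))"
| "TE f (Times t u) x = Ex f (Ex (f + 1) (And (TE (f + 2) t f) (And (TE (f + 2) u (f + 1)) (Rel rTIMES [f, f + 1, x]))))"

text \<open>\<open>At f R t ys\<close>: \<open>R\<close> holds of the value of \<open>t\<close>, followed by \<open>ys\<close>.\<close>

definition At :: "nat \<Rightarrow> nat \<Rightarrow> tm \<Rightarrow> nat list \<Rightarrow> fm" where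
  "At f R t ys = Ex f (And (TE (Suc f) t f) (Rel R (f # ys)))"

text \<open>The basic relations have their intended meaning.\<close>

locale arith =
  fixes N :: nat and \<sigma> :: store
  assumes EQ: "x < N \<Longrightarrow> y < N \<Longrightarrow> \<sigma> rEQ [x, y] \<longleftrightarrow> x = y"
    and LT: "x < N \<Longrightarrow> y < N \<Longrightarrow> \<sigma> rLT [x, y] \<longleftrightarrow> x < y"
    and SUC: "x < N \<Longrightarrow> y < N \<Longrightarrow> \<sigma> rSUC [x, y] \<longleftrightarrow> y = Suc x"
    and PLUS: "x < N \<Longrightarrow> y < N \<Longrightarrow> v < N \<Longrightarrow> \<sigma> rPLUS [x, y, v] \<longleftrightarrow> x + y = v"
    and TIMES: "x < N \<Longrightarrow> y < N \<Longrightarrow> v < N \<Longrightarrow> \<sigma> rTIMES [x, y, v] \<longleftrightarrow> x * y = v"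
begin

lemma holds_isK: "x < f \<Longrightarrow> \<rho> x < N \<Longrightarrow> holds N \<sigma> \<rho> (isK f c x) \<longleftrightarrow> \<rho> x = c"
proof (induction c arbitrary: f x \<rho>)
  case 0
  then have "(\<exists>v<N. v < \<rho> x) \<longleftrightarrow> \<rho> x \<noteq> 0" by (auto intro: exI[of _ 0])
  then show ?case using 0 LT by auto
next
  case (Suc c)
  have "holds N \<sigma> \<rho> (isK f (Suc c) x) \<longleftrightarrow> (\<exists>v<N. v = c \<and> \<rho> x = Suc v)"
    using Suc.prems Suc.IH[of f "Suc f"] SUC by (auto simp: less_Suc_eq)
  then show ?case using Suc.prems by auto
qed

lemma tval_cong: "(\<And>y. y \<in> tvars t \<Longrightarrow> \<rho> y = \<rho>' y) \<Longrightarrow> tval \<rho> t = tval \<rho>' t \<and> tok N \<rho> t = tok N \<rho>' t"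
  by (induction t) auto

lemma tval_fresh:
  assumes "\<And>y. y \<in> tvars t \<Longrightarrow> y < f"
  shows "tval (\<rho>(f := v, Suc f := v')) t = tval \<rho> t" "tok N (\<rho>(f := v, Suc f := v')) t = tok N \<rho> t"
    "tval (\<rho>(f := v)) t = tval \<rho> t" "tok N (\<rho>(f := v)) t = tok N \<rho> t"
  using tval_cong[of t "\<rho>(f := v, Suc f := v')" \<rho>] tval_cong[of t "\<rho>(f := v)" \<rho>] assms by fastforce+

lemma holds_TE:
  "x < f \<Longrightarrow> \<rho> x < N \<Longrightarrow> \<forall>y\<in>tvars t. y < f \<and> \<rho> y < N \<Longrightarrow>
    holds N \<sigma> \<rho> (TE f t x) \<longleftrightarrow> tok N \<rho> t \<and> tval \<rho> t = \<rho> x"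
proof (induction t arbitrary: f x \<rho>)
  case (V y)
  then show ?case using EQ by auto
next
  case (K c)
  then show ?case using holds_isK by auto
next
  case (Plus t u)
  have c: "tval (\<rho>(f := v, Suc f := v')) t' = tval \<rho> t'" "tok N (\<rho>(f := v, Suc f := v')) t' = tok N \<rho> t'"
    if "t' = t \<or> t' = u" for v v' t'
    using tval_fresh(1,2)[where t = t' and f = f and \<rho> = \<rho> and v = v and v' = v'] Plus.prems(3) that by auto
  have "holds N \<sigma> (\<rho>(f := v, Suc f := v')) (TE (f + 2) t f) \<longleftrightarrow> tok N \<rho> t \<and> tval \<rho> t = v"
    if "v < N" "v' < N" for v v'
  proof -
    have "\<forall>y\<in>tvars t. y < f + 2 \<and> (\<rho>(f := v, Suc f := v')) y < N"
      using Plus.prems(3) that by (auto intro: less_SucI)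
    then show ?thesis using Plus.IH(1)[of f "f + 2" "\<rho>(f := v, Suc f := v')"] that c
      by (simp del: fun_upd_apply add: fun_upd_same fun_upd_other)
  qed
  moreover have "holds N \<sigma> (\<rho>(f := v, Suc f := v')) (TE (f + 2) u (Suc f)) \<longleftrightarrow> tok N \<rho> u \<and> tval \<rho> u = v'"
    if "v < N" "v' < N" for v v'
  proof -
    have "\<forall>y\<in>tvars u. y < f + 2 \<and> (\<rho>(f := v, Suc f := v')) y < N"
      using Plus.prems(3) that by (auto intro: less_SucI)
    then show ?thesis using Plus.IH(2)[of "Suc f" "f + 2" "\<rho>(f := v, Suc f := v')"] that c
      by (simp del: fun_upd_apply add: fun_upd_same fun_upd_other)
  qed
  ultimately have "holds N \<sigma> \<rho> (TE f (Plus t u) x) \<longleftrightarrow>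
      (\<exists>v<N. \<exists>v'<N. (tok N \<rho> t \<and> tval \<rho> t = v) \<and> (tok N \<rho> u \<and> tval \<rho> u = v') \<and> v + v' = \<rho> x)"
    using Plus.prems(1,2) PLUS by (auto cong: conj_cong)
  then show ?case using Plus.prems(2) by (auto intro: tok_tval)
next
  case (Times t u)
  have c: "tval (\<rho>(f := v, Suc f := v')) t' = tval \<rho> t'" "tok N (\<rho>(f := v, Suc f := v')) t' = tok N \<rho> t'"
    if "t' = t \<or> t' = u" for v v' t'
    using tval_fresh(1,2)[where t = t' and f = f and \<rho> = \<rho> and v = v and v' = v'] Times.prems(3) that by auto
  have "holds N \<sigma> (\<rho>(f := v, Suc f := v')) (TE (f + 2) t f) \<longleftrightarrow> tok N \<rho> t \<and> tval \<rho> t = v"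
    if "v < N" "v' < N" for v v'
  proof -
    have "\<forall>y\<in>tvars t. y < f + 2 \<and> (\<rho>(f := v, Suc f := v')) y < N"
      using Times.prems(3) that by (auto intro: less_SucI)
    then show ?thesis using Times.IH(1)[of f "f + 2" "\<rho>(f := v, Suc f := v')"] that c
      by (simp del: fun_upd_apply add: fun_upd_same fun_upd_other)
  qed
  moreover have "holds N \<sigma> (\<rho>(f := v, Suc f := v')) (TE (f + 2) u (Suc f)) \<longleftrightarrow> tok N \<rho> u \<and> tval \<rho> u = v'"
    if "v < N" "v' < N" for v v'
  proof -
    have "\<forall>y\<in>tvars u. y < f + 2 \<and> (\<rho>(f := v, Suc f := v')) y < N"
      using Times.prems(3) that by (auto intro: less_SucI)
    then show ?thesis using Times.IH(2)[of "Suc f" "f + 2" "\<rho>(f := v, Suc f := v')"] that c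
      by (simp del: fun_upd_apply add: fun_upd_same fun_upd_other)
  qed
  ultimately have "holds N \<sigma> \<rho> (TE f (Times t u) x) \<longleftrightarrow>
      (\<exists>v<N. \<exists>v'<N. (tok N \<rho> t \<and> tval \<rho> t = v) \<and> (tok N \<rho> u \<and> tval \<rho> u = v') \<and> v * v' = \<rho> x)"
    using Times.prems(1,2) TIMES by (auto cong: conj_cong)
  then show ?case using Times.prems(2) by (auto intro: tok_tval)
qed

lemma holds_At:
  assumes "\<forall>y\<in>tvars t. y < f \<and> \<rho> y < N" "\<forall>y\<in>set ys. y < f"
  shows "holds N \<sigma> \<rho> (At f R t ys) \<longleftrightarrow> tok N \<rho> t \<and> \<sigma> R (tval \<rho> t # map \<rho> ys)"
proof -
  have "holds N \<sigma> (\<rho>(f := v)) (TE (Suc f) t f) \<longleftrightarrow> tok N \<rho> t \<and> tval \<rho> t = v" if "v < N" for v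
  proof -
    have "\<forall>y\<in>tvars t. y < Suc f \<and> (\<rho>(f := v)) y < N"
      using assms(1) that by (auto intro: less_SucI)
    then show ?thesis
      using holds_TE[of f "Suc f" "\<rho>(f := v)" t] tval_fresh(3,4)[of t f] assms(1) that
      by (simp del: fun_upd_apply add: fun_upd_same fun_upd_other)
  qed
  moreover have "map (\<rho>(f := v)) (f # ys) = v # map \<rho> ys" for v
  proof -
    have "map (\<rho>(f := v)) ys = map \<rho> ys" by (rule map_cong) (use assms(2) in auto)
    then show ?thesis by (simp only: list.map fun_upd_same)
  qed
  ultimately show ?thesis unfolding At_def holds.simps using tok_tval[of N \<rho> t] by metis
qed

end

text \<open>Quantifiers are simplified under the assumption that their variable lies in the domain.\<close>

declare holds.simps(5) [simp del] holds_Ex [simp] TE.simps [simp del] isK.simps [simp del]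

subsection \<open>Order and arithmetic\<close>

lemma exec_Def0:
  "R \<notin> rels \<phi> \<Longrightarrow> distinct xs \<Longrightarrow> length vs = length xs \<Longrightarrow> set vs \<subseteq> {..<N} \<Longrightarrow>
    exec N (Def R [] xs \<phi>) \<rho> \<sigma> R vs = holds N \<sigma> (upd \<rho> xs vs) \<phi>"
  using exec_Def(2)[of R \<phi> xs "[]" vs N \<rho> \<sigma>] by simp

text \<open>The value of \<open>x\<close> is zero; \<open>f\<close> serves as bound variable.\<close>

definition zeroF :: "nat \<Rightarrow> nat \<Rightarrow> fm" where "zeroF f x = Neg (Ex f (Rel rLT [f, x]))"

definition eq_prog :: cmd where "eq_prog = For 0 (Set rEQ [0, 0] Tr)"

text \<open>The loop visits the elements in increasing order, so that an element is less than exactly those that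
  are neither equal to it nor marked as seen.\<close>

definition lt_prog :: cmd where
  "lt_prog = For 0 (Comp (Def rLT [0] [1] (And (Neg (Rel rSEEN [1])) (Neg (Rel rEQ [0, 1])))) (Set rSEEN [0] Tr))"

definition suc_prog :: cmd where
  "suc_prog = Def rSUC [] [0, 1]
     (And (Rel rLT [0, 1]) (Neg (Ex 2 (And (Rel rLT [0, 2]) (Rel rLT [2, 1])))))"

definition plus_prog :: cmd where
  "plus_prog = For 0 (Fors [1, 2] (Set rPLUS [0, 1, 2]
     (Or (And (zeroF 3 0) (Rel rEQ [1, 2]))
         (Ex 3 (Ex 4 (And (Rel rSUC [3, 0]) (And (Rel rSUC [4, 2]) (Rel rPLUS [3, 1, 4]))))))))"

definition times_prog :: cmd where
  "times_prog = For 0 (Fors [1, 2] (Set rTIMES [0, 1, 2]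
     (Or (And (zeroF 3 0) (zeroF 3 2))
         (Ex 3 (Ex 4 (And (Rel rSUC [3, 0]) (And (Rel rTIMES [3, 1, 4]) (Rel rPLUS [4, 1, 2]))))))))"

definition arith_prog :: cmd where
  "arith_prog = Comp eq_prog (Comp lt_prog (Comp suc_prog (Comp plus_prog times_prog)))"

lemma exec_eq_prog:
  assumes "\<sigma> rEQ = (\<lambda>_. False)" "x < N" "y < N"
  shows "exec N eq_prog \<rho> \<sigma> rEQ [x, y] \<longleftrightarrow> x = y"
proof -
  have "\<forall>x<N. \<forall>y<N. exec N eq_prog \<rho> \<sigma> rEQ [x, y] \<longleftrightarrow> x < N \<and> x = y"
    unfolding eq_prog_def
    by (rule exec_For_inv[where P = "\<lambda>m \<sigma>'. \<forall>x<N. \<forall>y<N. \<sigma>' rEQ [x, y] \<longleftrightarrow> x < m \<and> x = y"])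
      (use assms in \<open>auto simp: less_Suc_eq\<close>)
  then show ?thesis using assms by blast
qed

lemma exec_lt_prog:
  assumes "\<sigma> rSEEN = (\<lambda>_. False)" and EQ: "\<And>x y. x < N \<Longrightarrow> y < N \<Longrightarrow> \<sigma> rEQ [x, y] \<longleftrightarrow> x = y"
    and "x < N" "y < N"
  shows "exec N lt_prog \<rho> \<sigma> rLT [x, y] \<longleftrightarrow> x < y"
proof -
  let ?c = "Def rLT [0] [1] (And (Neg (Rel rSEEN [1])) (Neg (Rel rEQ [0, 1])))"
  let ?P = "\<lambda>m \<sigma>'. \<sigma>' rEQ = \<sigma> rEQ \<and> (\<forall>x<N. \<sigma>' rSEEN [x] \<longleftrightarrow> x < m) \<and>
    (\<forall>x<m. \<forall>y<N. \<sigma>' rLT [x, y] \<longleftrightarrow> x < y)"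
  have "?P N (exec N lt_prog \<rho> \<sigma>)"
    unfolding lt_prog_def
  proof (rule exec_For_inv[where P = ?P])
    fix m \<sigma>' assume m: "m < N" and P: "?P m \<sigma>'"
    let ?\<sigma> = "exec N ?c (\<rho>(0 := m)) \<sigma>'"
    have seen: "?\<sigma> rSEEN = \<sigma>' rSEEN" "?\<sigma> rEQ = \<sigma>' rEQ" by (rule exec_frame, simp)+
    have new: "?\<sigma> rLT [m, y] \<longleftrightarrow> m < y" if "y < N" for y
      using exec_Def(2)[of rLT "And (Neg (Rel rSEEN [1])) (Neg (Rel rEQ [0, 1]))" "[1]" "[0]" "[y]" N "\<rho>(0 := m)" \<sigma>']
        that P EQ m by auto
    have old: "?\<sigma> rLT [x, y] \<longleftrightarrow> \<sigma>' rLT [x, y]" if "x \<noteq> m" for x y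
      using exec_Def(3)[of rLT "And (Neg (Rel rSEEN [1])) (Neg (Rel rEQ [0, 1]))" "[1]" "[0]" "[x, y]" "\<rho>(0 := m)" N \<sigma>']
        that by auto
    show "?P (Suc m) (exec N (Comp ?c (Set rSEEN [0] Tr)) (\<rho>(0 := m)) \<sigma>')"
      using P m seen new old by (auto simp: less_Suc_eq)
  qed (use assms in auto)
  then show ?thesis using assms by blast
qed

lemma exec_suc_prog:
  assumes LT: "\<And>x y. x < N \<Longrightarrow> y < N \<Longrightarrow> \<sigma> rLT [x, y] \<longleftrightarrow> x < y" and "x < N" "y < N"
  shows "exec N suc_prog \<rho> \<sigma> rSUC [x, y] \<longleftrightarrow> y = Suc x"
proof -
  have "exec N suc_prog \<rho> \<sigma> rSUC [x, y] \<longleftrightarrow> x < y \<and> \<not> (\<exists>v\<in>{..<N}. x < v \<and> v < y)"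
    using exec_Def(2)[of rSUC "And (Rel rLT [0, 1]) (Neg (Ex 2 (And (Rel rLT [0, 2]) (Rel rLT [2, 1]))))"
        "[0, 1]" "[]" "[x, y]" N \<rho> \<sigma>] assms
    by (simp add: suc_prog_def)
  also have "\<dots> \<longleftrightarrow> y = Suc x"
  proof
    assume xy: "x < y \<and> \<not> (\<exists>v\<in>{..<N}. x < v \<and> v < y)"
    then have "\<not> (Suc x < N \<and> x < Suc x \<and> Suc x < y)" by blast
    then show "y = Suc x" using xy assms(3) by linarith
  qed auto
  finally show ?thesis .
qed

lemma holds_zeroF:
  assumes "\<And>x y. x < N \<Longrightarrow> y < N \<Longrightarrow> \<sigma> rLT [x, y] \<longleftrightarrow> x < y" "\<rho> x < N" "x \<noteq> f"
  shows "holds N \<sigma> \<rho> (zeroF f x) \<longleftrightarrow> \<rho> x = 0"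
proof -
  have "(\<exists>v\<in>{..<N}. v < \<rho> x) \<longleftrightarrow> \<rho> x \<noteq> 0" using assms(2) by (auto intro: bexI[of _ 0])
  then show ?thesis using assms by (auto simp: zeroF_def)
qed

lemma two_list: "length vs = length [a, b] \<Longrightarrow> \<exists>y v. vs = [y, v]"
  by (auto simp: length_Suc_conv)

lemma exec_plus_prog:
  assumes LT: "\<And>x y. x < N \<Longrightarrow> y < N \<Longrightarrow> \<sigma> rLT [x, y] \<longleftrightarrow> x < y"
    and EQ: "\<And>x y. x < N \<Longrightarrow> y < N \<Longrightarrow> \<sigma> rEQ [x, y] \<longleftrightarrow> x = y"
    and SUC: "\<And>x y. x < N \<Longrightarrow> y < N \<Longrightarrow> \<sigma> rSUC [x, y] \<longleftrightarrow> y = Suc x"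
    and xyv: "x < N" "y < N" "v < N"
  shows "exec N plus_prog \<rho> \<sigma> rPLUS [x, y, v] \<longleftrightarrow> x + y = v"
proof -
  let ?Q = "\<lambda>u us. u + us ! 0 = us ! 1"
  have "exec N plus_prog \<rho> \<sigma> rPLUS (x # [y, v]) = ?Q x [y, v]"
    unfolding plus_prog_def
  proof (rule exec_RecDef[where Q = ?Q])
    fix u us \<sigma>' assume u: "u < N" and us: "length us = length [1, 2 :: nat]" "set us \<subseteq> {..<N}"
      and frame: "\<And>R'. R' \<noteq> rPLUS \<Longrightarrow> \<sigma>' R' = \<sigma> R'"
      and prev: "\<And>u' us. u' < u \<Longrightarrow> length us = length [1, 2 :: nat] \<Longrightarrow> set us \<subseteq> {..<N} \<Longrightarrow> \<sigma>' rPLUS (u' # us) = ?Q u' us"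
    obtain y v where yv: "us = [y, v]" "y < N" "v < N" using two_list[OF us(1)] us(2) by auto
    have prev': "\<sigma>' rPLUS [u', y, v'] \<longleftrightarrow> u' + y = v'" if "u' < u" "v' < N" for u' v'
      using prev[of u' "[y, v']"] that yv by simp
    have "(u = 0 \<and> y = v) \<or> (\<exists>a\<in>{..<N}. \<exists>b\<in>{..<N}. u = Suc a \<and> v = Suc b \<and> \<sigma>' rPLUS [a, y, b]) \<longleftrightarrow> u + y = v"
      using prev' yv u by (cases u; cases v) (auto simp: prev')
    then show "holds N \<sigma>' (upd (\<rho>(0 := u)) [1, 2] us)
        (Or (And (zeroF 3 0) (Rel rEQ [1, 2]))
         (Ex 3 (Ex 4 (And (Rel rSUC [3, 0]) (And (Rel rSUC [4, 2]) (Rel rPLUS [3, 1, 4])))))) = ?Q u us"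
      using yv u EQ SUC LT by (simp add: holds_zeroF frame)
  qed (use xyv in auto)
  then show ?thesis by simp
qed

lemma exec_times_prog:
  assumes LT: "\<And>x y. x < N \<Longrightarrow> y < N \<Longrightarrow> \<sigma> rLT [x, y] \<longleftrightarrow> x < y"
    and SUC: "\<And>x y. x < N \<Longrightarrow> y < N \<Longrightarrow> \<sigma> rSUC [x, y] \<longleftrightarrow> y = Suc x"
    and PLUS: "\<And>x y v. x < N \<Longrightarrow> y < N \<Longrightarrow> v < N \<Longrightarrow> \<sigma> rPLUS [x, y, v] \<longleftrightarrow> x + y = v"
    and xyv: "x < N" "y < N" "v < N"
  shows "exec N times_prog \<rho> \<sigma> rTIMES [x, y, v] \<longleftrightarrow> x * y = v"
proof -
  let ?Q = "\<lambda>u us. u * us ! 0 = us ! 1"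
  have "exec N times_prog \<rho> \<sigma> rTIMES (x # [y, v]) = ?Q x [y, v]"
    unfolding times_prog_def
  proof (rule exec_RecDef[where Q = ?Q])
    fix u us \<sigma>' assume u: "u < N" and us: "length us = length [1, 2 :: nat]" "set us \<subseteq> {..<N}"
      and frame: "\<And>R'. R' \<noteq> rTIMES \<Longrightarrow> \<sigma>' R' = \<sigma> R'"
      and prev: "\<And>u' us. u' < u \<Longrightarrow> length us = length [1, 2 :: nat] \<Longrightarrow> set us \<subseteq> {..<N} \<Longrightarrow> \<sigma>' rTIMES (u' # us) = ?Q u' us"
    obtain y v where yv: "us = [y, v]" "y < N" "v < N" using two_list[OF us(1)] us(2) by auto
    have prev': "\<sigma>' rTIMES [u', y, v'] \<longleftrightarrow> u' * y = v'" if "u' < u" "v' < N" for u' v'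
      using prev[of u' "[y, v']"] that yv by simp
    have "(u = 0 \<and> v = 0) \<or> (\<exists>a\<in>{..<N}. \<exists>b\<in>{..<N}. u = Suc a \<and> \<sigma>' rTIMES [a, y, b] \<and> b + y = v) \<longleftrightarrow> u * y = v"
    proof (cases u)
      case (Suc a)
      then have "(\<exists>b\<in>{..<N}. a * y = b \<and> b + y = v) \<longleftrightarrow> a * y + y = v" using yv(3) by auto
      then show ?thesis using Suc u prev'[of a] by (auto simp: algebra_simps)
    qed (use yv in auto)
    then show "holds N \<sigma>' (upd (\<rho>(0 := u)) [1, 2] us)
        (Or (And (zeroF 3 0) (zeroF 3 2))
         (Ex 3 (Ex 4 (And (Rel rSUC [3, 0]) (And (Rel rTIMES [3, 1, 4]) (Rel rPLUS [4, 1, 2])))))) = ?Q u us"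
      using yv u PLUS SUC LT by (simp add: holds_zeroF frame)
  qed (use xyv in auto)
  then show ?thesis by simp
qed

lemma arith_exec:
  assumes "\<sigma> rEQ = (\<lambda>_. False)" "\<sigma> rSEEN = (\<lambda>_. False)"
  shows "arith N (exec N arith_prog \<rho> \<sigma>)"
proof -
  define \<sigma>1 where "\<sigma>1 = exec N eq_prog \<rho> \<sigma>"
  define \<sigma>2 where "\<sigma>2 = exec N lt_prog \<rho> \<sigma>1"
  define \<sigma>3 where "\<sigma>3 = exec N suc_prog \<rho> \<sigma>2"
  define \<sigma>4 where "\<sigma>4 = exec N plus_prog \<rho> \<sigma>3"
  define \<sigma>5 where "\<sigma>5 = exec N times_prog \<rho> \<sigma>4"
  have f: "\<sigma>1 rSEEN = \<sigma> rSEEN" "\<sigma>2 rEQ = \<sigma>1 rEQ" "\<sigma>3 rEQ = \<sigma>2 rEQ" "\<sigma>3 rLT = \<sigma>2 rLT"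
    "\<sigma>4 rEQ = \<sigma>3 rEQ" "\<sigma>4 rLT = \<sigma>3 rLT" "\<sigma>4 rSUC = \<sigma>3 rSUC"
    "\<sigma>5 rEQ = \<sigma>4 rEQ" "\<sigma>5 rLT = \<sigma>4 rLT" "\<sigma>5 rSUC = \<sigma>4 rSUC" "\<sigma>5 rPLUS = \<sigma>4 rPLUS"
    unfolding \<sigma>1_def \<sigma>2_def \<sigma>3_def \<sigma>4_def \<sigma>5_def
    by (rule exec_frame, simp add: eq_prog_def lt_prog_def suc_prog_def plus_prog_def times_prog_def)+
  have EQ: "x < N \<Longrightarrow> y < N \<Longrightarrow> \<sigma>1 rEQ [x, y] \<longleftrightarrow> x = y" for x y
    unfolding \<sigma>1_def using exec_eq_prog assms by blast
  have LT: "x < N \<Longrightarrow> y < N \<Longrightarrow> \<sigma>2 rLT [x, y] \<longleftrightarrow> x < y" for x y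
    unfolding \<sigma>2_def by (rule exec_lt_prog) (use EQ f assms in simp_all)
  have SUC: "x < N \<Longrightarrow> y < N \<Longrightarrow> \<sigma>3 rSUC [x, y] \<longleftrightarrow> y = Suc x" for x y
    unfolding \<sigma>3_def by (rule exec_suc_prog) (use LT in simp_all)
  have PLUS: "x < N \<Longrightarrow> y < N \<Longrightarrow> v < N \<Longrightarrow> \<sigma>4 rPLUS [x, y, v] \<longleftrightarrow> x + y = v" for x y v
    unfolding \<sigma>4_def by (rule exec_plus_prog) (use EQ LT SUC f in simp_all)
  have TIMES: "x < N \<Longrightarrow> y < N \<Longrightarrow> v < N \<Longrightarrow> \<sigma>5 rTIMES [x, y, v] \<longleftrightarrow> x * y = v" for x y v
    unfolding \<sigma>5_def by (rule exec_times_prog) (use LT SUC PLUS f in simp_all)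
  have "arith N \<sigma>5" by unfold_locales (use EQ LT SUC PLUS TIMES f in simp_all)
  then show ?thesis unfolding \<sigma>1_def \<sigma>2_def \<sigma>3_def \<sigma>4_def \<sigma>5_def arith_prog_def by simp
qed

subsection \<open>Reading the input\<close>

text \<open>The relations \<open>unary_at\<close>, \<open>tok_pos\<close> and \<open>val\<close> of the
  input.\<close>

abbreviation (input) rUNA :: nat where "rUNA \<equiv> 8"
abbreviation (input) rTS :: nat where "rTS \<equiv> 9"
abbreviation (input) rVAL :: nat where "rVAL \<equiv> 10"

definition una_prog :: cmd where
  "una_prog = Def rUNA [] [0, 1]
     (Ex 2 (And (Rel rPLUS [0, 1, 2]) (And (Rel rLEN [2]) (And (Neg (Rel rBIT [2]))
       (All 3 (Imp (Rel rLT [3, 1]) (Ex 4 (And (Rel rPLUS [0, 3, 4]) (Rel rBIT [4])))))))))"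

definition ts_prog :: cmd where
  "ts_prog = For 0 (Fors [1] (Set rTS [0, 1]
     (Or (And (zeroF 3 0) (zeroF 3 1))
       (Ex 2 (Ex 3 (Ex 4 (Ex 5 (And (Rel rSUC [2, 0]) (And (Rel rTS [2, 3]) (And (Rel rUNA [3, 4])
         (And (Rel rPLUS [3, 4, 5]) (Rel rSUC [5, 1])))))))))))) "

definition val_prog :: cmd where
  "val_prog = Def rVAL [] [0, 1] (Ex 2 (And (Rel rTS [0, 2]) (Rel rUNA [2, 1])))"

definition read_prog :: cmd where
  "read_prog = Comp una_prog (Comp ts_prog val_prog)"

text \<open>The basic relations and the relations of blocks have their intended meaning for the input
  \<open>w\<close>.\<close>

locale parsed = arith +
  fixes w :: "bool list"
  assumes N: "N = length w + 4"
    and LEN: "x < N \<Longrightarrow> \<sigma> rLEN [x] \<longleftrightarrow> x < length w"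
    and BIT: "x < N \<Longrightarrow> \<sigma> rBIT [x] \<longleftrightarrow> x < length w \<and> w ! x"
    and TS: "x < N \<Longrightarrow> y < N \<Longrightarrow> \<sigma> rTS [x, y] \<longleftrightarrow> tok_pos w x y"
    and VAL: "x < N \<Longrightarrow> y < N \<Longrightarrow> \<sigma> rVAL [x, y] \<longleftrightarrow> val w x y"

lemma tok_pos_bounds: "tok_pos w t p \<Longrightarrow> t \<le> p \<and> p \<le> length w"
proof (induction t arbitrary: p)
  case (Suc t)
  then obtain p' v where "tok_pos w t p'" "unary_at w p' v" "p = p' + v + 1" by auto
  then show ?case using Suc.IH[of p'] by (auto simp: unary_at_def)
qed simp

lemma val_bounds: "val w t v \<Longrightarrow> t < length w \<and> v < length w"
  unfolding val_def unary_at_def using tok_pos_bounds by fastforce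

lemma parsed_exec:
  assumes ar: "arith N \<sigma>" and N: "N = length w + 4"
    and LEN: "\<And>x. x < N \<Longrightarrow> \<sigma> rLEN [x] \<longleftrightarrow> x < length w"
    and BIT: "\<And>x. x < N \<Longrightarrow> \<sigma> rBIT [x] \<longleftrightarrow> x < length w \<and> w ! x"
  shows "parsed N (exec N read_prog \<rho> \<sigma>) w"
proof -
  interpret A: arith N \<sigma> by (rule ar)
  define \<sigma>1 where "\<sigma>1 = exec N una_prog \<rho> \<sigma>"
  define \<sigma>2 where "\<sigma>2 = exec N ts_prog \<rho> \<sigma>1"
  define \<sigma>3 where "\<sigma>3 = exec N val_prog \<rho> \<sigma>2"
  have f: "R < 8 \<Longrightarrow> \<sigma>1 R = \<sigma> R" "R < 9 \<Longrightarrow> \<sigma>2 R = \<sigma>1 R" "R < 10 \<Longrightarrow> \<sigma>3 R = \<sigma>2 R" for R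
    unfolding \<sigma>1_def \<sigma>2_def \<sigma>3_def
    by (rule exec_frame, simp add: una_prog_def ts_prog_def val_prog_def)+
  have UNA: "\<sigma>1 rUNA [p, v] \<longleftrightarrow> unary_at w p v" if "p < N" "v < N" for p v
  proof -
    have "\<sigma>1 rUNA [p, v] \<longleftrightarrow> (\<exists>e\<in>{..<N}. p + v = e \<and> e < length w \<and> \<not> (e < length w \<and> w ! e) \<and>
        (\<forall>u\<in>{..<N}. u < v \<longrightarrow> (\<exists>g\<in>{..<N}. p + u = g \<and> g < length w \<and> w ! g)))"
      unfolding \<sigma>1_def una_prog_def
      using that by (simp add: exec_Def0 A.PLUS A.LT LEN BIT)
    also have "\<dots> \<longleftrightarrow> unary_at w p v"
      unfolding unary_at_def using that N by (auto intro: order.strict_trans)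
    finally show ?thesis .
  qed
  have TS: "\<sigma>2 rTS [t, p] \<longleftrightarrow> tok_pos w t p" if "t < N" "p < N" for t p
  proof -
    let ?Q = "\<lambda>t ps. tok_pos w t (ps ! 0)"
    have "exec N ts_prog \<rho> \<sigma>1 rTS (t # [p]) = ?Q t [p]"
      unfolding ts_prog_def
    proof (rule exec_RecDef[where Q = ?Q])
      fix u us \<sigma>' assume u: "u < N" and us: "length us = length [1 :: nat]" "set us \<subseteq> {..<N}"
        and frame: "\<And>R'. R' \<noteq> rTS \<Longrightarrow> \<sigma>' R' = \<sigma>1 R'"
        and prev: "\<And>u' us. u' < u \<Longrightarrow> length us = length [1 :: nat] \<Longrightarrow> set us \<subseteq> {..<N} \<Longrightarrow> \<sigma>' rTS (u' # us) = ?Q u' us"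
      obtain p where p: "us = [p]" "p < N" using us by (auto simp: length_Suc_conv)
      have prev': "\<sigma>' rTS [u', p'] \<longleftrightarrow> tok_pos w u' p'" if "u' < u" "p' < N" for u' p'
        using prev[of u' "[p']"] that by simp
      have "(u = 0 \<and> p = 0) \<or> (\<exists>a\<in>{..<N}. \<exists>b\<in>{..<N}. \<exists>c\<in>{..<N}. \<exists>d\<in>{..<N}. u = Suc a \<and> \<sigma>' rTS [a, b] \<and> unary_at w b c \<and>
          b + c = d \<and> p = Suc d) \<longleftrightarrow> tok_pos w u p"
      proof (cases u)
        case (Suc a)
        have "(\<exists>b\<in>{..<N}. \<exists>c\<in>{..<N}. \<exists>d\<in>{..<N}. \<sigma>' rTS [a, b] \<and> unary_at w b c \<and> b + c = d \<and> p = Suc d) \<longleftrightarrow>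
          (\<exists>b c. tok_pos w a b \<and> unary_at w b c \<and> p = b + c + 1)"
          using prev' Suc p(2) by (auto simp: unary_at_def N)
        then show ?thesis using Suc u by auto
      qed auto
      then show "holds N \<sigma>' (upd (\<rho>(0 := u)) [1] us)
        (Or (And (zeroF 3 0) (zeroF 3 1))
         (Ex 2 (Ex 3 (Ex 4 (Ex 5 (And (Rel rSUC [2, 0]) (And (Rel rTS [2, 3]) (And (Rel rUNA [3, 4])
         (And (Rel rPLUS [3, 4, 5]) (Rel rSUC [5, 1])))))))))) = ?Q u us"
        using p u A.PLUS A.SUC A.LT UNA by (simp add: holds_zeroF frame f)
    qed (use that in auto)
    then show ?thesis by (simp add: \<sigma>2_def)
  qed
  have VAL: "\<sigma>3 rVAL [t, v] \<longleftrightarrow> val w t v" if "t < N" "v < N" for t v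
  proof -
    have "\<sigma>3 rVAL [t, v] \<longleftrightarrow> (\<exists>p\<in>{..<N}. tok_pos w t p \<and> unary_at w p v)"
      unfolding \<sigma>3_def val_prog_def
      using that by (simp add: exec_Def0 TS UNA f)
    also have "\<dots> \<longleftrightarrow> val w t v"
      unfolding val_def using tok_pos_bounds[of w t] N by fastforce
    finally show ?thesis .
  qed
  have "parsed N \<sigma>3 w"
    by unfold_locales (use A.EQ A.LT A.SUC A.PLUS A.TIMES LEN BIT TS VAL f N in simp_all)
  then show ?thesis unfolding \<sigma>1_def \<sigma>2_def \<sigma>3_def read_prog_def by simp
qed

subsection \<open>The tables of an instance\<close>

text \<open>The sizes \<open>n\<close>, \<open>q\<close>, \<open>k\<close> and \<open>B\<close> of the instance
  as singletons; the sets of elements, scalars and indices of congruences; the graphs of addition, negation,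
  zero and scalar multiplication; and the congruences.\<close>

abbreviation (input) rNN :: nat where "rNN \<equiv> 11"
abbreviation (input) rQQ :: nat where "rQQ \<equiv> 12"
abbreviation (input) rKK :: nat where "rKK \<equiv> 13"
abbreviation (input) rBB :: nat where "rBB \<equiv> 14"
abbreviation (input) rEL :: nat where "rEL \<equiv> 15"
abbreviation (input) rFE :: nat where "rFE \<equiv> 16"
abbreviation (input) rIX :: nat where "rIX \<equiv> 17"
abbreviation (input) rADD :: nat where "rADD \<equiv> 18"
abbreviation (input) rNEG :: nat where "rNEG \<equiv> 19"
abbreviation (input) rZER :: nat where "rZER \<equiv> 20"
abbreviation (input) rSC :: nat where "rSC \<equiv> 21"
abbreviation (input) rTH :: nat where "rTH \<equiv> 22"

text \<open>A sequence of explicit definitions, each in terms of earlier relations.\<close>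

type_synonym defn = "nat \<times> nat list \<times> fm"

fun defs_prog :: "defn list \<Rightarrow> cmd" where
  "defs_prog [] = Skip"
| "defs_prog ((R, xs, \<phi>) # ds) = Comp (Def R [] xs \<phi>) (defs_prog ds)"

text \<open>No definition is circular, refers to a later one, or defines a relation a second time.\<close>

fun defs_ok :: "defn list \<Rightarrow> bool" where
  "defs_ok [] \<longleftrightarrow> True"
| "defs_ok ((R, xs, \<phi>) # ds) \<longleftrightarrow> distinct xs \<and> R \<notin> rels \<phi> \<and>
     R \<notin> fst ` set ds \<and> rels \<phi> \<inter> fst ` set ds = {} \<and> defs_ok ds"

lemma writes_defs_prog [simp]: "writes (defs_prog ds) = fst ` set ds"
  by (induction ds rule: defs_prog.induct) auto

text \<open>After all definitions have been executed, each of them holds in the final store.\<close>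

lemma exec_defs:
  "defs_ok ds \<Longrightarrow> (R, xs, \<phi>) \<in> set ds \<Longrightarrow> length vs = length xs \<Longrightarrow> set vs \<subseteq> {..<N} \<Longrightarrow>
    exec N (defs_prog ds) \<rho> \<sigma> R vs = holds N (exec N (defs_prog ds) \<rho> \<sigma>) (upd \<rho> xs vs) \<phi>"
proof (induction ds arbitrary: \<sigma> rule: defs_prog.induct)
  case (2 R' xs' \<phi>' ds)
  let ?\<sigma> = "exec N (Def R' [] xs' \<phi>') \<rho> \<sigma>"
  show ?case
  proof (cases "(R, xs, \<phi>) \<in> set ds")
    case True
    then show ?thesis using 2 by simp
  next
    case False
    then have eq: "R' = R" "xs' = xs" "\<phi>' = \<phi>" using 2(3) by auto
    have "exec N (defs_prog ds) \<rho> ?\<sigma> R vs = ?\<sigma> R vs"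
      using 2(2) eq by (subst exec_frame) auto
    also have "\<dots> = holds N \<sigma> (upd \<rho> xs vs) \<phi>"
      using 2 eq by (simp add: exec_Def0)
    also have "\<dots> = holds N (exec N (defs_prog ds) \<rho> ?\<sigma>) (upd \<rho> xs vs) \<phi>"
    proof (rule holds_cong)
      fix R'' assume R'': "R'' \<in> rels \<phi>"
      have "exec N (defs_prog ds) \<rho> ?\<sigma> R'' = ?\<sigma> R''"
        by (rule exec_frame) (use 2(2) eq R'' in auto)
      moreover have "?\<sigma> R'' = \<sigma> R''"
        by (rule exec_frame) (use 2(2) eq R'' in auto)
      ultimately show "\<sigma> R'' = exec N (defs_prog ds) \<rho> ?\<sigma> R''" by simp
    qed
    finally show ?thesis using eq by simp
  qed
qed simp

abbreviation (input) Sq :: "nat \<Rightarrow> tm" where "Sq x \<equiv> Times (V x) (V x)"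

text \<open>For \<open>c = 6\<close> the number of the block that holds the number of congruences, for \<open>c
  = 7\<close> the number of all blocks.\<close>

definition size_tm :: "nat \<Rightarrow> nat \<Rightarrow> nat \<Rightarrow> tm" where
  "size_tm c n q = Plus (Plus (Plus (K c) (Sq n)) (V n)) (Times (V q) (Plus (V n) (K 1)))"

text \<open>The definitions of the tables. The bound variables in the terms start at 50, beyond all variables
  that occur otherwise.\<close>

definition table_defs :: "defn list" where
  "table_defs =
    [(rNN, [0], At 50 rVAL (K 0) [0]),
     (rQQ, [0], Ex 1 (And (TE 50 (Plus (K 3) (V 0)) 1) (At 50 rVAL (K 1) [1]))),
     (rKK, [0], Ex 1 (Ex 2 (And (Rel rNN [1]) (And (Rel rQQ [2]) (At 50 rVAL (size_tm 6 1 2) [0]))))),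
     (rBB, [0], Ex 1 (Ex 2 (And (Rel rNN [1]) (And (Rel rQQ [2]) (At 50 rTS (size_tm 7 1 2) [0]))))),
     (rEL, [0], Ex 1 (And (Rel rNN [1]) (Rel rLT [0, 1]))),
     (rFE, [0], Ex 1 (And (Rel rQQ [1]) (Rel rLT [0, 1]))),
     (rIX, [0], Ex 1 (And (Rel rKK [1]) (Rel rLT [0, 1]))),
     (rADD, [0, 1, 2], Ex 3 (And (Rel rNN [3]) (And (Rel rEL [0]) (And (Rel rEL [1])
        (At 50 rVAL (Plus (K 3) (Plus (Times (V 0) (V 3)) (V 1))) [2]))))),
     (rNEG, [0, 1], Ex 3 (And (Rel rNN [3]) (And (Rel rEL [0])
        (At 50 rVAL (Plus (Plus (K 4) (Sq 3)) (V 0)) [1])))),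
     (rZER, [0], Ex 3 (And (Rel rNN [3]) (At 50 rVAL (Plus (Plus (K 5) (Sq 3)) (V 3)) [0]))),
     (rSC, [0, 1, 2], Ex 3 (And (Rel rNN [3]) (And (Rel rFE [0]) (And (Rel rEL [1])
        (At 50 rVAL (Plus (Plus (Plus (K 6) (Sq 3)) (V 3))
           (Plus (Times (V 0) (Plus (V 3) (K 1))) (Plus (K 1) (V 1)))) [2]))))),
     (rTH, [0, 1, 2], Ex 3 (Ex 4 (And (Rel rNN [3]) (And (Rel rBB [4]) (And (Rel rIX [0]) (And (Rel rEL [1])
        (And (Rel rEL [2]) (At 50 rBIT (Plus (V 4) (Plus (Times (V 0) (Sq 3))
           (Plus (Times (V 1) (V 3)) (V 2)))) []))))))))]"

lemma rels_isK: "rels (isK f c x) \<subseteq> {rLT, rSUC}"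
  by (induction f c x rule: isK.induct) (auto simp: isK.simps)

lemma rels_TE: "rels (TE f t x) \<subseteq> {rEQ, rLT, rSUC, rPLUS, rTIMES}"
  by (induction f t x rule: TE.induct) (use rels_isK in \<open>fastforce simp: TE.simps\<close>)+

lemma rels_At: "rels (At f R t ys) \<subseteq> {rEQ, rLT, rSUC, rPLUS, rTIMES, R}"
  using rels_TE by (fastforce simp: At_def)

lemma not_rels: "8 \<le> S \<Longrightarrow> S \<notin> rels (TE f t x)" "8 \<le> S \<Longrightarrow> S \<noteq> R \<Longrightarrow> S \<notin> rels (At f R t ys)"
  using rels_TE[of f t x] rels_At[of f R t ys] by auto

lemma disjoint_rels:
  "\<forall>S\<in>A. 8 \<le> S \<and> S \<noteq> R \<Longrightarrow> rels (At f R t ys) \<inter> A = {}"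
  by (meson disjoint_iff not_rels)

lemma table_defs_ok: "defs_ok table_defs"
  by (simp add: table_defs_def not_rels disjoint_rels)

text \<open>The tables satisfy their definitions.\<close>

locale tabled = parsed +
  fixes \<rho>0 :: env
  assumes tables: "(R, xs, \<phi>) \<in> set table_defs \<Longrightarrow> length vs = length xs \<Longrightarrow> set vs \<subseteq> {..<N} \<Longrightarrow>
    \<sigma> R vs = holds N \<sigma> (upd \<rho>0 xs vs) \<phi>"

lemma tabled_exec:
  assumes "parsed N \<sigma> w"
  shows "tabled N (exec N (defs_prog table_defs) \<rho> \<sigma>) w \<rho>"
proof -
  interpret P: parsed N \<sigma> w by (rule assms)
  let ?\<sigma> = "exec N (defs_prog table_defs) \<rho> \<sigma>"
  have f: "R < 11 \<Longrightarrow> ?\<sigma> R = \<sigma> R" for R by (rule exec_frame) (auto simp: table_defs_def)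
  have p: "parsed N ?\<sigma> w"
    by unfold_locales (use P.EQ P.LT P.SUC P.PLUS P.TIMES P.LEN P.BIT P.TS P.VAL P.N f in simp_all)
  show ?thesis
    by (rule tabled.intro[OF p], unfold_locales) (rule exec_defs[OF table_defs_ok])
qed

context tabled
begin

lemma K_less: "c < 4 \<Longrightarrow> c < N"
  using N by simp

lemma val_less: "val w t v \<Longrightarrow> t < N" "val w t v \<Longrightarrow> v < N" "tok_pos w t v \<Longrightarrow> t < N" "tok_pos w t v \<Longrightarrow> v < N"
  using val_bounds[of w t v] tok_pos_bounds[of w t v] N by auto

lemma tables_nth:
  assumes "i < length table_defs" "length vs = length (fst (snd (table_defs ! i)))" "set vs \<subseteq> {..<N}"
  shows "\<sigma> (fst (table_defs ! i)) vs = holds N \<sigma> (upd \<rho>0 (fst (snd (table_defs ! i))) vs) (snd (snd (table_defs ! i)))"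
  by (rule tables) (use assms in simp_all)

lemma holds_At_val:
  assumes "\<forall>y\<in>tvars t. y < f \<and> \<rho> y < N" "x < f" "\<rho> x < N"
  shows "holds N \<sigma> \<rho> (At f rVAL t [x]) \<longleftrightarrow> tok N \<rho> t \<and> val w (tval \<rho> t) (\<rho> x)"
    and "holds N \<sigma> \<rho> (At f rTS t [x]) \<longleftrightarrow> tok N \<rho> t \<and> tok_pos w (tval \<rho> t) (\<rho> x)"
  using assms holds_At[of t f \<rho> "[x]"] tok_tval[of N \<rho> t] VAL TS by auto

lemmas table_simps = table_defs_def holds_At_val holds_TE size_tm_def

lemma NN: "v < N \<Longrightarrow> \<sigma> rNN [v] \<longleftrightarrow> val w 0 v"
  using tables_nth[of 0 "[v]"] K_less[of 0] by (simp add: table_simps)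

lemma QQ: "v < N \<Longrightarrow> \<sigma> rQQ [v] \<longleftrightarrow> val w 1 (3 + v)"
  using tables_nth[of 1 "[v]"] K_less[of 1] K_less[of 3] by (auto simp: table_simps dest: val_less)

end

text \<open>The number \<open>n\<close> of elements and the number \<open>q\<close> of scalars have been read.\<close>

locale sized = tabled +
  fixes n q :: nat
  assumes n: "val w 0 n" and q: "val w 1 (3 + q)"
begin

lemma n_less: "n < N" and q_less: "q < N" "3 + q < N"
  using val_less(2)[OF n] val_less(2)[OF q] by auto

lemma NN': "v < N \<Longrightarrow> \<sigma> rNN [v] \<longleftrightarrow> v = n"
  using NN n val_unique by blast

lemma QQ': "v < N \<Longrightarrow> \<sigma> rQQ [v] \<longleftrightarrow> v = q"
  using QQ q val_unique by (metis add_left_imp_eq)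

lemma KK: "v < N \<Longrightarrow> \<sigma> rKK [v] \<longleftrightarrow> val w (6 + n * n + n + q * (n + 1)) v"
  using tables_nth[of 2 "[v]"] n_less q_less
  by (auto simp: table_simps NN' QQ' dest: val_less(1))

lemma BB: "v < N \<Longrightarrow> \<sigma> rBB [v] \<longleftrightarrow> tok_pos w (7 + n * n + n + q * (n + 1)) v"
  using tables_nth[of 3 "[v]"] n_less q_less
  by (auto simp: table_simps NN' QQ' dest: val_less(3))

lemma EL: "v < N \<Longrightarrow> \<sigma> rEL [v] \<longleftrightarrow> v < n"
  using tables_nth[of 4 "[v]"] n_less by (simp add: table_simps NN' LT)

lemma FE: "v < N \<Longrightarrow> \<sigma> rFE [v] \<longleftrightarrow> v < q"
  using tables_nth[of 5 "[v]"] q_less by (simp add: table_simps QQ' LT)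

lemma ADD: "x < N \<Longrightarrow> y < N \<Longrightarrow> v < N \<Longrightarrow> \<sigma> rADD [x, y, v] \<longleftrightarrow> x < n \<and> y < n \<and> val w (3 + (x * n + y)) v"
  using tables_nth[of 7 "[x, y, v]"] n_less by (auto simp: table_simps NN' EL dest: val_less(1))

lemma NEG: "x < N \<Longrightarrow> v < N \<Longrightarrow> \<sigma> rNEG [x, v] \<longleftrightarrow> x < n \<and> val w (4 + n * n + x) v"
  using tables_nth[of 8 "[x, v]"] n_less by (auto simp: table_simps NN' EL dest: val_less(1))

lemma ZER: "v < N \<Longrightarrow> \<sigma> rZER [v] \<longleftrightarrow> val w (5 + n * n + n) v"
  using tables_nth[of 9 "[v]"] n_less by (auto simp: table_simps NN' dest: val_less(1))

lemma SC: "r < N \<Longrightarrow> x < N \<Longrightarrow> v < N \<Longrightarrow>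
    \<sigma> rSC [r, x, v] \<longleftrightarrow> r < q \<and> x < n \<and> val w (6 + n * n + n + (r * (n + 1) + (1 + x))) v"
  using tables_nth[of 10 "[r, x, v]"] n_less by (auto simp: table_simps NN' EL FE dest: val_less(1))

end

text \<open>Also the number \<open>k\<close> of congruences and the start \<open>B\<close> of their matrices have been read.\<close>

locale sized_congs = sized +
  fixes k B :: nat
  assumes k: "val w (6 + n * n + n + q * (n + 1)) k"
    and B: "tok_pos w (7 + n * n + n + q * (n + 1)) B"
begin

lemma k_less: "k < N" and B_less: "B < N"
  using val_less(2)[OF k] val_less(4)[OF B] by auto

lemma KK': "v < N \<Longrightarrow> \<sigma> rKK [v] \<longleftrightarrow> v = k"
  using KK k val_unique by blast

lemma BB': "v < N \<Longrightarrow> \<sigma> rBB [v] \<longleftrightarrow> v = B"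
  using BB B tok_pos_unique by blast

lemma IX: "v < N \<Longrightarrow> \<sigma> rIX [v] \<longleftrightarrow> v < k"
  using tables_nth[of 6 "[v]"] k_less by (simp add: table_simps KK' LT)

lemma TH:
  assumes "i < N" "x < N" "y < N"
  shows "\<sigma> rTH [i, x, y] \<longleftrightarrow> i < k \<and> x < n \<and> y < n \<and>
    B + (i * (n * n) + (x * n + y)) < length w \<and> \<theta>_bit w B n i x y"
proof -
  have "\<sigma> rTH [i, x, y] \<longleftrightarrow> i < k \<and> x < n \<and> y < n \<and> n * n < N \<and> i * (n * n) < N \<and> x * n < N \<and> x * n + y < N \<and>
      i * (n * n) + (x * n + y) < N \<and> B + (i * (n * n) + (x * n + y)) < N \<and>
      \<sigma> rBIT [B + (i * (n * n) + (x * n + y))]"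
    using tables_nth[of 11 "[i, x, y]"] assms n_less B_less
    by (auto simp: table_simps holds_At NN' BB' EL IX)
  moreover have "n * n < N" if "x < n"
  proof -
    have "n * n \<le> 6 + n * n + n + q * (n + 1)" by simp
    then show ?thesis using val_less(1)[OF k] by linarith
  qed
  ultimately show ?thesis using BIT N by (auto simp: \<theta>_bit_def)
qed

end

subsection \<open>Checking the format\<close>

fun Ands :: "fm list \<Rightarrow> fm" where
  "Ands [] = Tr"
| "Ands (\<phi> # \<phi>s) = And \<phi> (Ands \<phi>s)"

text \<open>The conditions of \<open>fmt\<close> and \<open>closed_ops\<close>, with \<open>n, q, k, B\<close>
  in the variables 0 to 3.\<close>

definition format_body :: fm where
  "format_body = Ands [
     Rel rNN [0], Rel rQQ [1], Rel rKK [2], Rel rBB [3],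
     Ex 4 (And (TE 50 (K 2) 4) (At 50 rVAL (K 2) [4])),
     All 4 (Imp (Rel rEL [4]) (All 5 (Imp (Rel rEL [5]) (Ex 6 (And (Rel rEL [6]) (Rel rADD [4, 5, 6])))))),
     Ex 4 (And (TE 50 (K 1) 4) (At 50 rVAL (Plus (K 3) (Sq 0)) [4])),
     All 4 (Imp (Rel rEL [4]) (Ex 6 (And (Rel rEL [6]) (Rel rNEG [4, 6])))),
     Ex 4 (And (TE 50 (K 0) 4) (At 50 rVAL (Plus (Plus (K 4) (Sq 0)) (V 0)) [4])),
     Ex 6 (And (Rel rEL [6]) (Rel rZER [6])),
     All 4 (Imp (Rel rFE [4]) (Ex 5 (And (TE 50 (K 1) 5)
       (At 50 rVAL (Plus (Plus (Plus (K 6) (Sq 0)) (V 0)) (Times (V 4) (Plus (V 0) (K 1)))) [5])))),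
     All 4 (Imp (Rel rFE [4]) (All 5 (Imp (Rel rEL [5]) (Ex 6 (And (Rel rEL [6]) (Rel rSC [4, 5, 6])))))),
     Ex 4 (Ands [TE 50 (Plus (V 3) (Times (V 2) (Sq 0))) 4, Neg (Rel rLEN [4]),
       All 5 (Imp (Rel rLT [5, 4]) (Rel rLEN [5]))])]"

definition format_fm :: fm where
  "format_fm = Ex 0 (Ex 1 (Ex 2 (Ex 3 format_body)))"

context sized_congs
begin

lemma bounded_n:
  "(\<forall>v\<in>{..<N}. v < n \<longrightarrow> P v) \<longleftrightarrow> (\<forall>v<n. P v)" "(\<exists>v\<in>{..<N}. v < n \<and> P v) \<longleftrightarrow> (\<exists>v<n. P v)"
  "(\<forall>v\<in>{..<N}. v < q \<longrightarrow> P v) \<longleftrightarrow> (\<forall>v<q. P v)" "(\<exists>v\<in>{..<N}. v < q \<and> P v) \<longleftrightarrow> (\<exists>v<q. P v)"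
  "(\<forall>v\<in>{..<N}. v < k \<longrightarrow> P v) \<longleftrightarrow> (\<forall>v<k. P v)" "(\<exists>v\<in>{..<N}. v < k \<and> P v) \<longleftrightarrow> (\<exists>v<k. P v)"
  using n_less q_less k_less by (auto intro: order.strict_trans)

lemma bounded_less: "v < n \<Longrightarrow> v < N" "v < q \<Longrightarrow> v < N" "v < k \<Longrightarrow> v < N"
  using n_less q_less k_less by auto

lemma format_parts:
  assumes \<rho>: "\<rho> 0 = n" "\<rho> 2 = k" "\<rho> 3 = B"
  shows "holds N \<sigma> \<rho> (Ex 4 (And (TE 50 (K 2) 4) (At 50 rVAL (K 2) [4]))) \<longleftrightarrow> val w 2 2"
    and "holds N \<sigma> \<rho> (All 4 (Imp (Rel rEL [4]) (All 5 (Imp (Rel rEL [5]) (Ex 6 (And (Rel rEL [6]) (Rel rADD [4, 5, 6]))))))) \<longleftrightarrow>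
      (\<forall>x<n. \<forall>y<n. \<exists>v<n. val w (3 + (x * n + y)) v)"
    and "holds N \<sigma> \<rho> (Ex 4 (And (TE 50 (K 1) 4) (At 50 rVAL (Plus (K 3) (Sq 0)) [4]))) \<longleftrightarrow> val w (3 + n * n) 1"
    and "holds N \<sigma> \<rho> (All 4 (Imp (Rel rEL [4]) (Ex 6 (And (Rel rEL [6]) (Rel rNEG [4, 6]))))) \<longleftrightarrow>
      (\<forall>x<n. \<exists>v<n. val w (4 + n * n + x) v)"
    and "holds N \<sigma> \<rho> (Ex 4 (And (TE 50 (K 0) 4) (At 50 rVAL (Plus (Plus (K 4) (Sq 0)) (V 0)) [4]))) \<longleftrightarrow>
      val w (4 + n * n + n) 0"
    and "holds N \<sigma> \<rho> (Ex 6 (And (Rel rEL [6]) (Rel rZER [6]))) \<longleftrightarrow> (\<exists>v<n. val w (5 + n * n + n) v)"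
    and "holds N \<sigma> \<rho> (All 4 (Imp (Rel rFE [4]) (Ex 5 (And (TE 50 (K 1) 5)
       (At 50 rVAL (Plus (Plus (Plus (K 6) (Sq 0)) (V 0)) (Times (V 4) (Plus (V 0) (K 1)))) [5]))))) \<longleftrightarrow>
      (\<forall>r<q. val w (6 + n * n + n + r * (n + 1)) 1)"
    and "holds N \<sigma> \<rho> (All 4 (Imp (Rel rFE [4]) (All 5 (Imp (Rel rEL [5]) (Ex 6 (And (Rel rEL [6]) (Rel rSC [4, 5, 6]))))))) \<longleftrightarrow>
      (\<forall>r<q. \<forall>x<n. \<exists>v<n. val w (6 + n * n + n + (r * (n + 1) + (1 + x))) v)"
    and "holds N \<sigma> \<rho> (Ex 4 (Ands [TE 50 (Plus (V 3) (Times (V 2) (Sq 0))) 4, Neg (Rel rLEN [4]),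
       All 5 (Imp (Rel rLT [5, 4]) (Rel rLEN [5]))])) \<longleftrightarrow> length w = B + k * (n * n)"
proof -
  note C = K_less[of 0] K_less[of 1] K_less[of 2] K_less[of 3]
  show "holds N \<sigma> \<rho> (Ex 4 (And (TE 50 (K 2) 4) (At 50 rVAL (K 2) [4]))) \<longleftrightarrow> val w 2 2"
    using C by (simp add: holds_TE holds_At_val)
  show "holds N \<sigma> \<rho> (All 4 (Imp (Rel rEL [4]) (All 5 (Imp (Rel rEL [5]) (Ex 6 (And (Rel rEL [6]) (Rel rADD [4, 5, 6]))))))) \<longleftrightarrow>
      (\<forall>x<n. \<forall>y<n. \<exists>v<n. val w (3 + (x * n + y)) v)"
    by (simp add: EL ADD bounded_n bounded_less)
  show "holds N \<sigma> \<rho> (Ex 4 (And (TE 50 (K 1) 4) (At 50 rVAL (Plus (K 3) (Sq 0)) [4]))) \<longleftrightarrow> val w (3 + n * n) 1"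
    using C n_less by (auto simp: holds_TE holds_At_val \<rho> dest: val_less(1))
  show "holds N \<sigma> \<rho> (All 4 (Imp (Rel rEL [4]) (Ex 6 (And (Rel rEL [6]) (Rel rNEG [4, 6]))))) \<longleftrightarrow>
      (\<forall>x<n. \<exists>v<n. val w (4 + n * n + x) v)"
    by (simp add: EL NEG bounded_n bounded_less)
  show "holds N \<sigma> \<rho> (Ex 4 (And (TE 50 (K 0) 4) (At 50 rVAL (Plus (Plus (K 4) (Sq 0)) (V 0)) [4]))) \<longleftrightarrow>
      val w (4 + n * n + n) 0"
    using C n_less by (auto simp: holds_TE holds_At_val \<rho> dest: val_less(1))
  show "holds N \<sigma> \<rho> (Ex 6 (And (Rel rEL [6]) (Rel rZER [6]))) \<longleftrightarrow> (\<exists>v<n. val w (5 + n * n + n) v)"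
    by (simp add: EL ZER bounded_n bounded_less)
  show "holds N \<sigma> \<rho> (All 4 (Imp (Rel rFE [4]) (Ex 5 (And (TE 50 (K 1) 5)
       (At 50 rVAL (Plus (Plus (Plus (K 6) (Sq 0)) (V 0)) (Times (V 4) (Plus (V 0) (K 1)))) [5]))))) \<longleftrightarrow>
      (\<forall>r<q. val w (6 + n * n + n + r * (n + 1)) 1)"
  proof -
    have "(n * n < N \<and> 6 + n * n < N \<and> 6 + n * n + n < N \<and> Suc n < N \<and> r * Suc n < N \<and> 6 + n * n + n + r * Suc n < N \<and>
        6 < N \<and> val w (6 + n * n + n + r * Suc n) (Suc 0)) \<longleftrightarrow> val w (6 + n * n + n + r * Suc n) (Suc 0)" for r
      by (auto dest: val_less(1))
    then show ?thesis using C n_less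
      by (simp add: holds_TE holds_At_val \<rho> FE bounded_n bounded_less conj_ac)
  qed
  show "holds N \<sigma> \<rho> (All 4 (Imp (Rel rFE [4]) (All 5 (Imp (Rel rEL [5]) (Ex 6 (And (Rel rEL [6]) (Rel rSC [4, 5, 6]))))))) \<longleftrightarrow>
      (\<forall>r<q. \<forall>x<n. \<exists>v<n. val w (6 + n * n + n + (r * (n + 1) + (1 + x))) v)"
    by (simp add: EL FE SC bounded_n bounded_less)
  show "holds N \<sigma> \<rho> (Ex 4 (Ands [TE 50 (Plus (V 3) (Times (V 2) (Sq 0))) 4, Neg (Rel rLEN [4]),
       All 5 (Imp (Rel rLT [5, 4]) (Rel rLEN [5]))])) \<longleftrightarrow> length w = B + k * (n * n)"
  proof -
    have nn: "n * n < N" using val_less(1)[OF k] by linarith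
    have len: "\<not> e < length w \<and> (\<forall>u\<in>{..<N}. u < e \<longrightarrow> u < length w) \<longleftrightarrow> e = length w" if "e < N" for e
    proof
      assume *: "\<not> e < length w \<and> (\<forall>u\<in>{..<N}. u < e \<longrightarrow> u < length w)"
      then have "\<not> length w < e" using N by auto
      with * show "e = length w" by simp
    qed auto
    have "holds N \<sigma> \<rho> (Ex 4 (Ands [TE 50 (Plus (V 3) (Times (V 2) (Sq 0))) 4, Neg (Rel rLEN [4]),
       All 5 (Imp (Rel rLT [5, 4]) (Rel rLEN [5]))])) \<longleftrightarrow>
       (\<exists>v\<in>{..<N}. (k * (n * n) < N \<and> B + k * (n * n) < N \<and> B + k * (n * n) = v) \<and>
         (\<not> v < length w \<and> (\<forall>u\<in>{..<N}. u < v \<longrightarrow> u < length w)))"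
      using n_less k_less B_less nn by (simp add: holds_TE \<rho> LEN LT)
    also have "\<dots> \<longleftrightarrow> (\<exists>v\<in>{..<N}. (k * (n * n) < N \<and> B + k * (n * n) < N \<and> B + k * (n * n) = v) \<and> v = length w)"
      by (rule bex_cong[OF refl]) (simp only: len lessThan_iff)
    also have "\<dots> \<longleftrightarrow> length w = B + k * (n * n)" using N by auto
    finally show ?thesis .
  qed
qed

end

text \<open>The formula holds if and only if the input encodes some instance whose operations map into the
  universe; the operations are chosen from the blocks of the input.\<close>

lemma (in tabled) format_iff:
  "holds N \<sigma> \<rho> format_fm \<longleftrightarrow>
    (\<exists>n q k B a ng z s. fmt w n q k B a ng z s \<and> closed_ops n q a ng z s)"
proof -
  let ?F = "\<lambda>n q k B. sized_congs N \<sigma> w \<rho>0 n q k B \<and> val w 2 2 \<and>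
    (\<forall>x<n. \<forall>y<n. \<exists>v<n. val w (3 + (x * n + y)) v) \<and> val w (3 + n * n) 1 \<and>
    (\<forall>x<n. \<exists>v<n. val w (4 + n * n + x) v) \<and> val w (4 + n * n + n) 0 \<and> (\<exists>v<n. val w (5 + n * n + n) v) \<and>
    (\<forall>r<q. val w (6 + n * n + n + r * (n + 1)) 1) \<and>
    (\<forall>r<q. \<forall>x<n. \<exists>v<n. val w (6 + n * n + n + (r * (n + 1) + (1 + x))) v) \<and> length w = B + k * (n * n)"
  have scI: "sized_congs N \<sigma> w \<rho>0 n q k B"
    if "val w 0 n" "val w 1 (3 + q)" "val w (6 + n * n + n + q * (n + 1)) k" "tok_pos w (7 + n * n + n + q * (n + 1)) B"
    for n q k B using that by unfold_locales
  have "holds N \<sigma> \<rho> format_fm \<longleftrightarrow> (\<exists>n q k B. n < N \<and> q < N \<and> k < N \<and> B < N \<and> ?F n q k B)"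
  proof -
    let ?\<rho> = "\<lambda>n q k B. \<rho>(0 := n, 1 := q, 2 := k, 3 := B)"
    let ?R = "\<lambda>n q k B. \<sigma> rNN [n] \<and> \<sigma> rQQ [q] \<and> \<sigma> rKK [k] \<and> \<sigma> rBB [B]"
    have R: "?R n q k B \<longleftrightarrow> sized_congs N \<sigma> w \<rho>0 n q k B" if "n < N" "q < N" "k < N" "B < N" for n q k B
    proof
      assume r: "?R n q k B"
      then have *: "val w 0 n" "val w 1 (3 + q)" using NN QQ that by auto
      then have s: "sized N \<sigma> w \<rho>0 n q" by unfold_locales
      show "sized_congs N \<sigma> w \<rho>0 n q k B"
        using r * sized.KK[OF s] sized.BB[OF s] that by (intro scI) auto
    next
      assume s: "sized_congs N \<sigma> w \<rho>0 n q k B"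
      interpret S: sized_congs N \<sigma> w \<rho>0 n q k B by (rule s)
      show "?R n q k B" using S.NN' S.QQ' S.KK' S.BB' that by simp
    qed
    have body: "holds N \<sigma> (?\<rho> n q k B) format_body = ?F n q k B"
      if l: "n < N" "q < N" "k < N" "B < N" for n q k B
    proof (cases "sized_congs N \<sigma> w \<rho>0 n q k B")
      case True
      then interpret S: sized_congs N \<sigma> w \<rho>0 n q k B .
      have r: "?\<rho> n q k B 0 = n" "?\<rho> n q k B 2 = k" "?\<rho> n q k B 3 = B" by simp_all
      have "holds N \<sigma> (?\<rho> n q k B) (And (Rel rNN [0]) (And (Rel rQQ [1]) (And (Rel rKK [2]) (Rel rBB [3]))))"
        using R[OF l] True by simp
      then show ?thesis unfolding format_body_def Ands.simps holds.simps(1,3,4) S.format_parts[OF r, unfolded Ands.simps holds.simps(1,3,4)]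
        using True by blast
    next
      case False
      then have "\<not> ?R n q k B" using R[OF l] by blast
      moreover have "holds N \<sigma> (?\<rho> n q k B) (Rel rNN [0]) = \<sigma> rNN [n]" "holds N \<sigma> (?\<rho> n q k B) (Rel rQQ [1]) = \<sigma> rQQ [q]"
        "holds N \<sigma> (?\<rho> n q k B) (Rel rKK [2]) = \<sigma> rKK [k]" "holds N \<sigma> (?\<rho> n q k B) (Rel rBB [3]) = \<sigma> rBB [B]"
        by simp_all
      ultimately show ?thesis unfolding format_body_def Ands.simps holds.simps(4) using False by blast
    qed
    have "(\<exists>n\<in>{..<N}. \<exists>q\<in>{..<N}. \<exists>k\<in>{..<N}. \<exists>B\<in>{..<N}. P n q k B) \<longleftrightarrow>
        (\<exists>n q k B. n < N \<and> q < N \<and> k < N \<and> B < N \<and> Q n q k B)"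
      if "\<And>n q k B. n < N \<Longrightarrow> q < N \<Longrightarrow> k < N \<Longrightarrow> B < N \<Longrightarrow> P n q k B = Q n q k B" for P Q
      using that by (auto simp: Bex_def)
    from this[OF body] show ?thesis unfolding format_fm_def holds_Ex .
  qed
  also have "\<dots> \<longleftrightarrow> (\<exists>n q k B a ng z s. fmt w n q k B a ng z s \<and> closed_ops n q a ng z s)"
  proof
    assume "\<exists>n q k B. n < N \<and> q < N \<and> k < N \<and> B < N \<and> ?F n q k B"
    then obtain n q k B where F: "?F n q k B" by blast
    then interpret S: sized_congs N \<sigma> w \<rho>0 n q k B by blast
    define a where "a = (\<lambda>x y. SOME v. v < n \<and> val w (3 + (x * n + y)) v)"
    define ng where "ng = (\<lambda>x. SOME v. v < n \<and> val w (4 + n * n + x) v)"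
    define z where "z = (SOME v. v < n \<and> val w (5 + n * n + n) v)"
    define s where "s = (\<lambda>r x. SOME v. v < n \<and> val w (6 + n * n + n + (r * (n + 1) + (1 + x))) v)"
    have 1: "a x y < n \<and> val w (3 + (x * n + y)) (a x y)" if "x < n" "y < n" for x y
      unfolding a_def by (rule someI_ex) (use F that in blast)
    have 2: "ng x < n \<and> val w (4 + n * n + x) (ng x)" if "x < n" for x
      unfolding ng_def by (rule someI_ex) (use F that in blast)
    have 3: "z < n \<and> val w (5 + n * n + n) z"
      unfolding z_def by (rule someI_ex) (use F in blast)
    have 4: "s r x < n \<and> val w (6 + n * n + n + (r * (n + 1) + (1 + x))) (s r x)" if "r < q" "x < n" for r x
      unfolding s_def by (rule someI_ex) (use F that in blast)
    have "fmt w n q k B a ng z s"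
    proof -
      have "val w 2 2" "val w (3 + n * n) 1" "val w (4 + n * n + n) 0"
        "\<And>r. r < q \<Longrightarrow> val w (6 + n * n + n + r * (n + 1)) 1" "length w = B + k * (n * n)"
        using F by blast+
      then show ?thesis unfolding fmt_def
        by (intro conjI allI impI S.n S.q S.k S.B 1[THEN conjunct2] 2[THEN conjunct2] 3[THEN conjunct2] 4[THEN conjunct2])
    qed
    moreover have "closed_ops n q a ng z s" unfolding closed_ops_def using 1 2 3 4 by blast
    ultimately show "\<exists>n q k B a ng z s. fmt w n q k B a ng z s \<and> closed_ops n q a ng z s" by blast
  next
    assume "\<exists>n q k B a ng z s. fmt w n q k B a ng z s \<and> closed_ops n q a ng z s"
    then obtain n q k B a ng z s where f: "fmt w n q k B a ng z s" "closed_ops n q a ng z s" by blast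
    then have sc: "sized_congs N \<sigma> w \<rho>0 n q k B" by (intro scI) (auto simp: fmt_def)
    interpret S: sized_congs N \<sigma> w \<rho>0 n q k B by (rule sc)
    note g = f(1)[unfolded fmt_def] and c = f(2)[unfolded closed_ops_def]
    from g have gA: "\<forall>x<n. \<forall>y<n. val w (3 + (x * n + y)) (a x y)" by (elim conjE)
    from g have gN: "\<forall>x<n. val w (4 + n * n + x) (ng x)" by (elim conjE)
    from g have gZ: "val w (5 + n * n + n) z" by (elim conjE)
    from g have gS: "\<forall>r<q. val w (6 + n * n + n + r * (n + 1)) 1 \<and>
      (\<forall>x<n. val w (6 + n * n + n + (r * (n + 1) + (1 + x))) (s r x))" by (elim conjE)
    from g have g2: "val w 2 2" by (elim conjE)
    from g have g3: "val w (3 + n * n) 1" by (elim conjE)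
    from g have g4: "val w (4 + n * n + n) 0" by (elim conjE)
    from g have gL: "length w = B + k * (n * n)" by (elim conjE)
    have "?F n q k B"
    proof (intro conjI allI impI sc g2 g3 g4 gL)
      show "\<exists>v<n. val w (3 + (x * n + y)) v" if "x < n" "y < n" for x y by (rule exI[of _ "a x y"]) (use gA c that in simp)
      show "\<exists>v<n. val w (4 + n * n + x) v" if "x < n" for x by (rule exI[of _ "ng x"]) (use gN c that in simp)
      show "\<exists>v<n. val w (5 + n * n + n) v" by (rule exI[of _ z]) (use gZ c in simp)
      show "val w (6 + n * n + n + r * (n + 1)) 1" if "r < q" for r using gS that by blast
      show "\<exists>v<n. val w (6 + n * n + n + (r * (n + 1) + (1 + x))) v" if "r < q" "x < n" for r x
        by (rule exI[of _ "s r x"]) (use gS c that in simp)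
    qed
    then show "\<exists>n q k B. n < N \<and> q < N \<and> k < N \<and> B < N \<and> ?F n q k B"
      using S.n_less S.q_less S.k_less S.B_less by blast
  qed
  finally show ?thesis .
qed

section \<open>Checking the axioms\<close>

text \<open>The tables are those of an instance encoded by the input.\<close>

locale inst = sized_congs +
  fixes a :: "nat \<Rightarrow> nat \<Rightarrow> nat" and ng :: "nat \<Rightarrow> nat" and z :: nat and s :: "nat \<Rightarrow> nat \<Rightarrow> nat"
  assumes fmt: "fmt w n q k B a ng z s" and closed: "closed_ops n q a ng z s"
begin

lemma a_less: "x < n \<Longrightarrow> y < n \<Longrightarrow> a x y < n"
  and ng_less: "x < n \<Longrightarrow> ng x < n"
  and z_less: "z < n"
  and s_less: "r < q \<Longrightarrow> x < n \<Longrightarrow> s r x < n"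
  using closed by (auto simp: closed_ops_def)

lemma fmt_vals:
  "x < n \<Longrightarrow> y < n \<Longrightarrow> val w (3 + (x * n + y)) (a x y)"
  "x < n \<Longrightarrow> val w (4 + n * n + x) (ng x)"
  "val w (5 + n * n + n) z"
  "r < q \<Longrightarrow> x < n \<Longrightarrow> val w (6 + n * n + n + (r * (n + 1) + (1 + x))) (s r x)"
  "length w = B + k * (n * n)"
  using fmt[unfolded fmt_def] by (elim conjE; simp)+

lemma ADD': "x < n \<Longrightarrow> y < n \<Longrightarrow> v < N \<Longrightarrow> \<sigma> rADD [x, y, v] \<longleftrightarrow> v = a x y"
  using ADD[of x y v] bounded_less(1)[of x] bounded_less(1)[of y] fmt_vals(1)[of x y]
    val_unique[of w "3 + (x * n + y)" v "a x y"] by auto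

lemma NEG': "x < n \<Longrightarrow> v < N \<Longrightarrow> \<sigma> rNEG [x, v] \<longleftrightarrow> v = ng x"
  using NEG[of x v] bounded_less(1)[of x] fmt_vals(2)[of x] val_unique[of w "4 + n * n + x" v "ng x"] by auto

lemma ZER': "v < N \<Longrightarrow> \<sigma> rZER [v] \<longleftrightarrow> v = z"
  using ZER[of v] fmt_vals(3) val_unique[of w "5 + n * n + n" v z] by auto

lemma SC': "r < q \<Longrightarrow> x < n \<Longrightarrow> v < N \<Longrightarrow> \<sigma> rSC [r, x, v] \<longleftrightarrow> v = s r x"
  using SC[of r x v] bounded_less(1)[of x] bounded_less(2)[of r] fmt_vals(4)[of r x]
    val_unique[of w "6 + n * n + n + (r * (n + 1) + (1 + x))" v "s r x"] by auto

lemma TH': "i < k \<Longrightarrow> x < n \<Longrightarrow> y < n \<Longrightarrow> \<sigma> rTH [i, x, y] \<longleftrightarrow> \<theta>_bit w B n i x y"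
proof -
  assume l: "i < k" "x < n" "y < n"
  have "i * (n * n) + (x * n + y) < k * (n * n)"
    using pair_index_less[OF l(1) pair_index_less[OF l(2,3)]] .
  moreover note fmt_vals(5)
  ultimately show ?thesis using TH[of i x y] l bounded_less by auto
qed

end

text \<open>Quantifiers over the elements, the scalars and the congruences, and local definitions.\<close>

definition AllE :: "nat \<Rightarrow> fm \<Rightarrow> fm" where "AllE x \<phi> = All x (Imp (Rel rEL [x]) \<phi>)"
definition ExE :: "nat \<Rightarrow> fm \<Rightarrow> fm" where "ExE x \<phi> = Ex x (And (Rel rEL [x]) \<phi>)"
definition AllF :: "nat \<Rightarrow> fm \<Rightarrow> fm" where "AllF x \<phi> = All x (Imp (Rel rFE [x]) \<phi>)"
definition ExF :: "nat \<Rightarrow> fm \<Rightarrow> fm" where "ExF x \<phi> = Ex x (And (Rel rFE [x]) \<phi>)"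
definition AllI :: "nat \<Rightarrow> fm \<Rightarrow> fm" where "AllI x \<phi> = All x (Imp (Rel rIX [x]) \<phi>)"
definition Bind :: "nat \<Rightarrow> nat list \<Rightarrow> nat \<Rightarrow> fm \<Rightarrow> fm" where
  "Bind R xs v \<phi> = Ex v (And (Rel R (xs @ [v])) \<phi>)"

lemma wff_quant [simp]:
  "wff ar W (AllE x \<phi>) \<longleftrightarrow> ar rEL = 1 \<and> x \<notin> W \<and> wff ar (insert x W) \<phi>"
  "wff ar W (ExE x \<phi>) \<longleftrightarrow> ar rEL = 1 \<and> x \<notin> W \<and> wff ar (insert x W) \<phi>"
  "wff ar W (AllF x \<phi>) \<longleftrightarrow> ar rFE = 1 \<and> x \<notin> W \<and> wff ar (insert x W) \<phi>"
  "wff ar W (ExF x \<phi>) \<longleftrightarrow> ar rFE = 1 \<and> x \<notin> W \<and> wff ar (insert x W) \<phi>"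
  "wff ar W (AllI x \<phi>) \<longleftrightarrow> ar rIX = 1 \<and> x \<notin> W \<and> wff ar (insert x W) \<phi>"
  "wff ar W (Bind R xs v \<phi>) \<longleftrightarrow> ar R = Suc (length xs) \<and> set xs \<subseteq> insert v W \<and> v \<notin> W \<and> wff ar (insert v W) \<phi>"
  by (auto simp: AllE_def ExE_def AllF_def ExF_def AllI_def Bind_def)

context inst
begin

lemma holds_quant:
  "holds N \<sigma> \<rho> (AllE x \<phi>) \<longleftrightarrow> (\<forall>v<n. holds N \<sigma> (\<rho>(x := v)) \<phi>)"
  "holds N \<sigma> \<rho> (ExE x \<phi>) \<longleftrightarrow> (\<exists>v<n. holds N \<sigma> (\<rho>(x := v)) \<phi>)"
  "holds N \<sigma> \<rho> (AllF x \<phi>) \<longleftrightarrow> (\<forall>v<q. holds N \<sigma> (\<rho>(x := v)) \<phi>)"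
  "holds N \<sigma> \<rho> (ExF x \<phi>) \<longleftrightarrow> (\<exists>v<q. holds N \<sigma> (\<rho>(x := v)) \<phi>)"
  "holds N \<sigma> \<rho> (AllI x \<phi>) \<longleftrightarrow> (\<forall>v<k. holds N \<sigma> (\<rho>(x := v)) \<phi>)"
  by (auto simp: AllE_def ExE_def AllF_def ExF_def AllI_def EL FE IX bounded_less)

lemma holds_Bind:
  "\<rho> x < n \<Longrightarrow> \<rho> y < n \<Longrightarrow> v \<noteq> x \<Longrightarrow> v \<noteq> y \<Longrightarrow>
    holds N \<sigma> \<rho> (Bind rADD [x, y] v \<phi>) \<longleftrightarrow> holds N \<sigma> (\<rho>(v := a (\<rho> x) (\<rho> y))) \<phi>"
  "\<rho> x < n \<Longrightarrow> v \<noteq> x \<Longrightarrow> holds N \<sigma> \<rho> (Bind rNEG [x] v \<phi>) \<longleftrightarrow> holds N \<sigma> (\<rho>(v := ng (\<rho> x))) \<phi>"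
  "holds N \<sigma> \<rho> (Bind rZER [] v \<phi>) \<longleftrightarrow> holds N \<sigma> (\<rho>(v := z)) \<phi>"
  "\<rho> r < q \<Longrightarrow> \<rho> x < n \<Longrightarrow> v \<noteq> r \<Longrightarrow> v \<noteq> x \<Longrightarrow>
    holds N \<sigma> \<rho> (Bind rSC [r, x] v \<phi>) \<longleftrightarrow> holds N \<sigma> (\<rho>(v := s (\<rho> r) (\<rho> x))) \<phi>"
  using bounded_less a_less ng_less z_less s_less
  by (auto simp: Bind_def ADD' NEG' ZER' SC')

end

text \<open>\<open>ge2_fm x f\<close>: the value of \<open>x\<close> is at least 2; \<open>dvd_fm x y f\<close>: that of \<open>x\<close> divides that of \<open>y\<close>.\<close>

definition ge2_fm :: "nat \<Rightarrow> nat \<Rightarrow> fm" where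
  "ge2_fm x f = Ex f (Ex (Suc f) (And (Rel rLT [f, x]) (Rel rLT [Suc f, f])))"

definition dvd_fm :: "nat \<Rightarrow> nat \<Rightarrow> nat \<Rightarrow> fm" where
  "dvd_fm x y f = Ex f (Rel rTIMES [x, f, y])"

lemma (in arith) holds_ge2: "\<rho> x < N \<Longrightarrow> x < f \<Longrightarrow> holds N \<sigma> \<rho> (ge2_fm x f) \<longleftrightarrow> 2 \<le> \<rho> x"
proof -
  assume x: "\<rho> x < N" "x < f"
  have "holds N \<sigma> \<rho> (ge2_fm x f) \<longleftrightarrow> (\<exists>u\<in>{..<N}. \<exists>v\<in>{..<N}. u < \<rho> x \<and> v < u)"
    using x by (simp add: ge2_fm_def LT)
  also have "\<dots> \<longleftrightarrow> 2 \<le> \<rho> x"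
  proof
    assume "2 \<le> \<rho> x"
    then have "1 \<in> {..<N} \<and> 0 \<in> {..<N} \<and> 1 < \<rho> x \<and> (0::nat) < 1" using x by auto
    then show "\<exists>u\<in>{..<N}. \<exists>v\<in>{..<N}. u < \<rho> x \<and> v < u" by blast
  qed auto
  finally show ?thesis .
qed

lemma (in arith) holds_dvd:
  "\<rho> x < N \<Longrightarrow> \<rho> y < N \<Longrightarrow> x \<noteq> f \<Longrightarrow> y \<noteq> f \<Longrightarrow> holds N \<sigma> \<rho> (dvd_fm x y f) \<longleftrightarrow> \<rho> x dvd \<rho> y"
proof -
  assume x: "\<rho> x < N" "\<rho> y < N" "x \<noteq> f" "y \<noteq> f"
  have "holds N \<sigma> \<rho> (dvd_fm x y f) \<longleftrightarrow> (\<exists>c\<in>{..<N}. \<rho> x * c = \<rho> y)"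
    using x by (simp add: dvd_fm_def TIMES)
  also have "\<dots> \<longleftrightarrow> \<rho> x dvd \<rho> y"
  proof
    assume "\<rho> x dvd \<rho> y"
    then obtain c where c: "\<rho> y = \<rho> x * c" by auto
    show "\<exists>c\<in>{..<N}. \<rho> x * c = \<rho> y"
    proof (cases "\<rho> x = 0")
      case True
      then show ?thesis using c x by (intro bexI[of _ 0]) auto
    next
      case False
      then have "1 * c \<le> \<rho> x * c" by (intro mult_le_mono1) simp
      then have "c \<le> \<rho> y" using c by simp
      then have "c < N" using x(2) by linarith
      then show ?thesis using c by (intro bexI[of _ c]) auto
    qed
  qed (auto intro: dvdI[OF sym])
  finally show ?thesis .
qed

text \<open>The formulas below state the conditions \<open>vs_cond\<close> and \<open>cong_cond\<close>, one
  conjunct for each of their conjuncts.\<close>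

definition group_fm :: fm where
  "group_fm = Ands [
     AllE 0 (AllE 1 (AllE 2 (Bind rADD [0, 1] 3 (Bind rADD [3, 2] 4 (Bind rADD [1, 2] 5 (Rel rADD [0, 5, 4])))))),
     AllE 0 (AllE 1 (Bind rADD [0, 1] 2 (Rel rADD [1, 0, 2]))),
     Bind rZER [] 0 (AllE 1 (Rel rADD [0, 1, 1])),
     Bind rZER [] 0 (AllE 1 (Bind rNEG [1] 2 (Rel rADD [2, 1, 0]))),
     AllF 0 (AllE 1 (AllE 2 (Bind rADD [1, 2] 3 (Bind rSC [0, 3] 4 (Bind rSC [0, 1] 5 (Bind rSC [0, 2] 6
       (Rel rADD [5, 6, 4])))))))]"

definition trivial_fm :: fm where "trivial_fm = AllE 0 (AllE 1 (Rel rEQ [0, 1]))"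

definition prime_power_fm :: fm where
  "prime_power_fm = Ex 0 (Ands [Rel rQQ [0], ge2_fm 0 10,
     Ex 1 (And (ge2_fm 1 10) (All 2 (Imp (And (ge2_fm 2 10) (dvd_fm 2 0 10)) (dvd_fm 1 2 10))))])"

definition action_fm :: fm where
  "action_fm = Ands [
     AllF 0 (AllF 1 (Imp (AllE 2 (Bind rSC [0, 2] 3 (Rel rSC [1, 2, 3]))) (Rel rEQ [0, 1]))),
     ExF 0 (AllE 1 (Rel rSC [0, 1, 1])),
     ExF 0 (Bind rZER [] 1 (AllE 2 (Rel rSC [0, 2, 1]))),
     AllF 0 (AllF 1 (ExF 2 (AllE 3 (Bind rSC [0, 3] 4 (Bind rSC [1, 3] 5 (Bind rADD [4, 5] 6 (Rel rSC [2, 3, 6]))))))),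
     AllF 0 (ExF 1 (AllE 2 (Bind rSC [0, 2] 3 (Bind rNEG [3] 4 (Rel rSC [1, 2, 4]))))),
     AllF 0 (AllF 1 (ExF 2 (AllE 3 (Bind rSC [1, 3] 4 (Bind rSC [0, 4] 5 (Rel rSC [2, 3, 5])))))),
     AllF 0 (AllF 1 (AllE 2 (Bind rSC [1, 2] 3 (Bind rSC [0, 3] 4 (Bind rSC [0, 2] 5 (Rel rSC [1, 5, 4])))))),
     AllF 0 (Imp (ExE 1 (Bind rSC [0, 1] 2 (Bind rZER [] 3 (Neg (Rel rEQ [2, 3])))))
       (ExF 4 (AllE 5 (Bind rSC [0, 5] 6 (Rel rSC [4, 6, 5])))))]"

definition cong_fm :: fm where
  "cong_fm = AllI 0 (Ands [
     AllE 1 (Rel rTH [0, 1, 1]),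
     AllE 1 (AllE 2 (Imp (Rel rTH [0, 1, 2]) (Rel rTH [0, 2, 1]))),
     AllE 1 (AllE 2 (AllE 3 (Imp (And (Rel rTH [0, 1, 2]) (Rel rTH [0, 2, 3])) (Rel rTH [0, 1, 3])))),
     AllE 1 (AllE 2 (AllE 3 (AllE 4 (Imp (And (Rel rTH [0, 1, 2]) (Rel rTH [0, 3, 4]))
       (Bind rADD [1, 3] 5 (Bind rADD [2, 4] 6 (Rel rTH [0, 5, 6]))))))),
     AllE 1 (AllE 2 (Imp (Rel rTH [0, 1, 2]) (Bind rNEG [1] 3 (Bind rNEG [2] 4 (Rel rTH [0, 3, 4]))))),
     AllF 5 (AllE 1 (AllE 2 (Imp (Rel rTH [0, 1, 2]) (Bind rSC [5, 1] 3 (Bind rSC [5, 2] 4 (Rel rTH [0, 3, 4]))))))])"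

definition valid_fm :: fm where
  "valid_fm = Ands [group_fm, Or (And trivial_fm prime_power_fm) (And (Neg trivial_fm) action_fm), cong_fm]"

context inst
begin

lemmas inst_simps = holds_quant holds_Bind ADD' NEG' ZER' SC' TH' EQ a_less ng_less z_less s_less bounded_less

lemma holds_group: "holds N \<sigma> \<rho> group_fm \<longleftrightarrow>
    abgrp n a ng z \<and> (\<forall>r<q. \<forall>x<n. \<forall>y<n. s r (a x y) = a (s r x) (s r y))"
proof -
  have "abgrp n a ng z \<longleftrightarrow> (\<forall>x<n. \<forall>y<n. \<forall>v<n. a (a x y) v = a x (a y v)) \<and> (\<forall>x<n. \<forall>y<n. a x y = a y x) \<and>
      (\<forall>x<n. x = a z x) \<and> (\<forall>x<n. z = a (ng x) x)"
    unfolding abgrp_def using a_less ng_less z_less by (auto simp: eq_commute)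
  then show ?thesis unfolding group_fm_def by (simp add: inst_simps)
qed

lemma holds_trivial: "holds N \<sigma> \<rho> trivial_fm \<longleftrightarrow> n = 1"
proof -
  have "(\<forall>x<n. \<forall>y<n. x = y) \<longleftrightarrow> n = 1"
  proof
    assume *: "\<forall>x<n. \<forall>y<n. x = y"
    show "n = 1"
    proof (rule ccontr)
      assume "n \<noteq> 1"
      then have "0 < n \<and> 1 < n" using z_less by linarith
      with * show False by (metis zero_neq_one)
    qed
  qed simp
  then show ?thesis unfolding trivial_fm_def by (simp add: inst_simps)
qed

lemma holds_prime_power: "holds N \<sigma> \<rho> prime_power_fm \<longleftrightarrow> 2 \<le> q \<and> (\<exists>p\<ge>2. \<forall>d\<ge>2. d dvd q \<longrightarrow> p dvd d)"
proof -
  have "holds N \<sigma> \<rho> prime_power_fm \<longleftrightarrow>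
      2 \<le> q \<and> (\<exists>p\<in>{..<N}. 2 \<le> p \<and> (\<forall>d\<in>{..<N}. 2 \<le> d \<and> d dvd q \<longrightarrow> p dvd d))"
    unfolding prime_power_fm_def using q_less by (simp add: QQ' holds_ge2 holds_dvd)
  also have "\<dots> \<longleftrightarrow> 2 \<le> q \<and> (\<exists>p\<ge>2. \<forall>d\<ge>2. d dvd q \<longrightarrow> p dvd d)"
  proof (rule conj_cong[OF refl])
    assume q2: "2 \<le> q"
    have d: "d dvd q \<Longrightarrow> d < N" for d using q2 q_less dvd_imp_le[of d q] by linarith
    have p: "p < N" if "2 \<le> p" "\<forall>d\<ge>2. d dvd q \<longrightarrow> p dvd d" for p
    proof -
      have "p dvd q" using that(2) q2 by simp
      then show ?thesis using d by simp
    qed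
    show "(\<exists>p\<in>{..<N}. 2 \<le> p \<and> (\<forall>d\<in>{..<N}. 2 \<le> d \<and> d dvd q \<longrightarrow> p dvd d)) \<longleftrightarrow>
        (\<exists>p\<ge>2. \<forall>d\<ge>2. d dvd q \<longrightarrow> p dvd d)"
    proof
      assume "\<exists>p\<in>{..<N}. 2 \<le> p \<and> (\<forall>d\<in>{..<N}. 2 \<le> d \<and> d dvd q \<longrightarrow> p dvd d)"
      then obtain p where "2 \<le> p" "\<forall>d\<in>{..<N}. 2 \<le> d \<and> d dvd q \<longrightarrow> p dvd d" by blast
      then show "\<exists>p\<ge>2. \<forall>d\<ge>2. d dvd q \<longrightarrow> p dvd d" using d by (intro exI[of _ p]) simp
    next
      assume "\<exists>p\<ge>2. \<forall>d\<ge>2. d dvd q \<longrightarrow> p dvd d"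
      then obtain r where "2 \<le> r" "\<forall>d\<ge>2. d dvd q \<longrightarrow> r dvd d" by blast
      with p[OF this] show "\<exists>p\<in>{..<N}. 2 \<le> p \<and> (\<forall>d\<in>{..<N}. 2 \<le> d \<and> d dvd q \<longrightarrow> p dvd d)"
        by (intro bexI[of _ r]) simp_all
    qed
  qed
  finally show ?thesis .
qed

lemma holds_action: "holds N \<sigma> \<rho> action_fm \<longleftrightarrow> field_action n q a ng z s"
  unfolding action_fm_def field_action_def by (simp add: inst_simps eq_commute cong: conj_cong)

lemma holds_congruences: "holds N \<sigma> \<rho> cong_fm \<longleftrightarrow> (\<forall>i<k. cong_cond n q a ng s (\<theta>_bit w B n i))"
  unfolding cong_fm_def cong_cond_def by (simp add: inst_simps)

lemma holds_valid:
  "holds N \<sigma> \<rho> valid_fm \<longleftrightarrow> vs_cond n q a ng z s \<and> (\<forall>i<k. cong_cond n q a ng s (\<theta>_bit w B n i))"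
  unfolding valid_fm_def vs_cond_def
  by (simp only: Ands.simps holds.simps(1,3,4) holds_Or holds_group holds_trivial holds_prime_power
      holds_action holds_congruences) auto

end

section \<open>The algorithm\<close>

text \<open>The relations of the algorithm. \<open>rX\<close> holds the generators: the quadruple \<open>a, b,
  c, d\<close> numbers a tuple, and the entry of this tuple at \<open>l\<close> is the \<open>v\<close> with
  \<open>rX [a, b, c, d, l, v]\<close>. \<open>rPH\<close> holds the values of the generators under
  \<open>\<phi> i j\<close>, \<open>rP\<close> and \<open>rT\<close> the table of representatives, and
  \<open>rU\<close> and \<open>rY\<close> are auxiliary copies, since a relation must not be changed while it is
  read. The current \<open>i\<close> and \<open>j\<close> are in the variables 10 and 11.\<close>

abbreviation (input) rX :: nat where "rX \<equiv> 23"
abbreviation (input) rPH :: nat where "rPH \<equiv> 24"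
abbreviation (input) rP :: nat where "rP \<equiv> 25"
abbreviation (input) rT :: nat where "rT \<equiv> 26"
abbreviation (input) rU :: nat where "rU \<equiv> 27"
abbreviation (input) rY :: nat where "rY \<equiv> 28"

text \<open>The initial generators.\<close>

definition start_fm :: fm where
  "start_fm = And (Rel rEL [5]) (Or
     (Ands [Rel rEQ [0, 1], Rel rEQ [4, 0], Rel rEL [2], Rel rIX [0], Rel rEQ [5, 2]])
     (And (Neg (Ands [Rel rEQ [0, 1], Rel rEQ [4, 0], Rel rEL [2], Rel rIX [0]])) (Rel rZER [5])))"

text \<open>The value in variable 6 is that of the generator in the variables 0 to 3 under \<open>\<phi> i
  j\<close>.\<close>

definition diff_fm :: fm where
  "diff_fm = And (Rel rEL [6]) (Ex 7 (Ex 8 (Ands [Rel rX [0, 1, 2, 3, 10, 7], Rel rX [0, 1, 2, 3, 11, 8],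
     Rel rADD [6, 8, 7]])))"

text \<open>The value in variable 0 lies in \<open>Z i j\<close>.\<close>

definition zero_fm :: fm where
  "zero_fm = And (Rel rEL [0]) (Ex 1 (Ex 2 (Ands [Rel rEL [1], Rel rTH [10, 0, 1], Rel rZER [2], Rel rTH [11, 1, 2]])))"

text \<open>The sum of the value in variable 4, which occurs in the table, and the value of a generator is the
  value in variable 5, and does not occur in the table.\<close>

definition new_fm :: fm where
  "new_fm = Ands [Rel rP [4], Ex 6 (And (Rel rPH [0, 1, 2, 3, 6]) (Rel rADD [4, 6, 5])), Neg (Rel rP [5])]"

text \<open>The entry of the representative of the new value: the representative of the old value plus the
  generator.\<close>

definition entry_fm :: fm where
  "entry_fm = Ex 9 (Ex 12 (Ands [Rel rT [4, 7, 9], Rel rX [0, 1, 2, 3, 7, 12], Rel rADD [9, 12, 8]]))"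

text \<open>Tries to extend the table by all sums of a value in the table and the value of a generator.\<close>

definition pass :: cmd where
  "pass = Fors [0, 1, 2, 3, 4, 5] (If new_fm
     (Comp (Def rU [] [7, 8] entry_fm) (Comp (Def rT [5] [7, 8] (Rel rU [7, 8])) (Set rP [5] Tr))))"

text \<open>The generators for the next constraint.\<close>

definition next_fm :: fm where
  "next_fm = And (Rel rEL [5]) (Or
     (And (And (Rel rEQ [0, 10]) (Rel rEQ [1, 11])) (Or
       (And (And (Rel rP [2]) (Rel rP [3])) (Ex 6 (Ex 7 (Ex 8 (Ex 9 (Ex 12 (Ands [Rel rADD [2, 3, 6],
          Rel rT [2, 4, 7], Rel rT [3, 4, 8], Rel rT [6, 4, 9], Rel rADD [7, 8, 12], Rel rADD [5, 9, 12]])))))))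
       (And (Neg (And (Rel rP [2]) (Rel rP [3]))) (Rel rZER [5]))))
     (And (Neg (And (Rel rEQ [0, 10]) (Rel rEQ [1, 11])))
       (Ex 6 (Ex 7 (Ex 8 (Ands [Rel rPH [0, 1, 2, 3, 6], Rel rT [6, 4, 7], Rel rX [0, 1, 2, 3, 4, 8],
          Rel rADD [5, 7, 8]]))))))"

definition start_prog :: cmd where "start_prog = Def rX [] [0, 1, 2, 3, 4, 5] start_fm"

text \<open>Every pass extends the table unless it is closed. As the table has at most \<open>n < N\<close>
  values, \<open>N\<close> passes suffice.\<close>

definition table_prog :: cmd where
  "table_prog = Comp (Def rPH [] [0, 1, 2, 3, 6] diff_fm) (Comp (Def rP [] [0] zero_fm)
     (Comp (Def rT [] [0, 1, 2] (Rel rZER [2])) (For 20 pass)))"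

definition next_prog :: cmd where
  "next_prog = Comp (Def rY [] [0, 1, 2, 3, 4, 5] next_fm)
     (Def rX [] [0, 1, 2, 3, 4, 5] (Rel rY [0, 1, 2, 3, 4, 5]))"

definition gens_prog :: cmd where
  "gens_prog = Comp start_prog (For 10 (For 11
     (If (Ands [Rel rIX [10], Rel rIX [11], Neg (Rel rEQ [10, 11])]) (Comp table_prog next_prog))))"

definition solvable_fm :: fm where
  "solvable_fm = All 0 (All 1 (All 2 (All 3 (Ex 4 (And (Rel rEL [4])
     (AllI 5 (Ex 6 (And (Rel rX [0, 1, 2, 3, 5, 6]) (Rel rTH [5, 4, 6])))))))))"

text \<open>The relations represent a family of tuples, a set of values, a partial table of tuples, and a value
  for each member of a family.\<close>

definition repX :: "nat \<Rightarrow> store \<Rightarrow> (nat list \<Rightarrow> nat \<Rightarrow> nat) \<Rightarrow> bool" where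
  "repX N \<sigma> x \<longleftrightarrow> (\<forall>a<N. \<forall>b<N. \<forall>c<N. \<forall>d<N. \<forall>l<N. \<forall>v<N. \<sigma> rX [a, b, c, d, l, v] \<longleftrightarrow> v = x [a, b, c, d] l)"

definition repP :: "nat \<Rightarrow> store \<Rightarrow> nat set \<Rightarrow> bool" where
  "repP N \<sigma> P \<longleftrightarrow> (\<forall>v<N. \<sigma> rP [v] \<longleftrightarrow> v \<in> P)"

definition repT :: "nat \<Rightarrow> store \<Rightarrow> nat set \<Rightarrow> (nat \<Rightarrow> nat \<Rightarrow> nat) \<Rightarrow> bool" where
  "repT N \<sigma> P t \<longleftrightarrow> (\<forall>e\<in>P. \<forall>l<N. \<forall>v<N. \<sigma> rT [e, l, v] \<longleftrightarrow> v = t e l)"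

lemma repX_D: "repX N \<sigma> x \<Longrightarrow> a < N \<Longrightarrow> b < N \<Longrightarrow> c < N \<Longrightarrow> d < N \<Longrightarrow> l < N \<Longrightarrow> v < N \<Longrightarrow>
    \<sigma> rX [a, b, c, d, l, v] \<longleftrightarrow> v = x [a, b, c, d] l"
  by (simp add: repX_def)

lemma repP_D: "repP N \<sigma> P \<Longrightarrow> v < N \<Longrightarrow> \<sigma> rP [v] \<longleftrightarrow> v \<in> P"
  by (simp add: repP_def)

lemma repT_D: "repT N \<sigma> P t \<Longrightarrow> e \<in> P \<Longrightarrow> l < N \<Longrightarrow> v < N \<Longrightarrow> \<sigma> rT [e, l, v] \<longleftrightarrow> v = t e l"
  by (simp add: repT_def)

definition repH :: "nat \<Rightarrow> store \<Rightarrow> (nat list \<Rightarrow> nat) \<Rightarrow> bool" where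
  "repH N \<sigma> h \<longleftrightarrow> (\<forall>a<N. \<forall>b<N. \<forall>c<N. \<forall>d<N. \<forall>v<N. \<sigma> rPH [a, b, c, d, v] \<longleftrightarrow> v = h [a, b, c, d])"

lemma repH_D: "repH N \<sigma> h \<Longrightarrow> a < N \<Longrightarrow> b < N \<Longrightarrow> c < N \<Longrightarrow> d < N \<Longrightarrow> v < N \<Longrightarrow>
    \<sigma> rPH [a, b, c, d, v] \<longleftrightarrow> v = h [a, b, c, d]"
  by (simp add: repH_def)

lemma quads_iff: "[a, b, c, d] \<in> quads N \<longleftrightarrow> a < N \<and> b < N \<and> c < N \<and> d < N"
  by (auto simp: quads_def)

lemma quadsE:
  assumes "g \<in> quads N" obtains a b c d where "g = [a, b, c, d]" "a < N" "b < N" "c < N" "d < N"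
  using assms by (auto simp: quads_def length_Suc_conv numeral_eq_Suc)

text \<open>The instance is a vector space with congruences.\<close>

locale valid_inst = inst +
  assumes group: "abgrp n a ng z" and congs: "\<forall>i<k. cong_cond n q a ng s (\<theta>_bit w B n i)"
begin

abbreviation "\<theta> \<equiv> \<lambda>i x y. x < n \<and> y < n \<and> \<theta>_bit w B n i x y"

sublocale C: crt n a ng z k \<theta>
proof (rule crt.intro[OF group], unfold_locales)
  fix i x y u v assume i: "i < k"
  note c = congs[rule_format, OF i, unfolded cong_cond_def]
  show "x < n \<Longrightarrow> \<theta> i x x" using c[THEN conjunct1] by blast
  show "\<theta> i x y \<Longrightarrow> \<theta> i y x" using c[THEN conjunct2, THEN conjunct1] by blast
  show "\<theta> i x y \<Longrightarrow> \<theta> i y u \<Longrightarrow> \<theta> i x u"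
    using c[THEN conjunct2, THEN conjunct2, THEN conjunct1] by blast
  show "\<theta> i x y \<Longrightarrow> \<theta> i u v \<Longrightarrow> \<theta> i (a x u) (a y v)"
    using c[THEN conjunct2, THEN conjunct2, THEN conjunct2, THEN conjunct1] a_less by simp
qed blast

text \<open>The interpretation of the tables does not depend on the relations of the algorithm.\<close>

lemma frame:
  assumes "\<And>R. R < 23 \<Longrightarrow> \<sigma>' R = \<sigma> R"
  shows "valid_inst N \<sigma>' w \<rho>0 n q k B a ng z s"
proof -
  have p: "parsed N \<sigma>' w"
    by unfold_locales (use EQ LT SUC PLUS TIMES LEN BIT TS VAL N assms in simp_all)
  have tab: "tabled N \<sigma>' w \<rho>0"
  proof (rule tabled.intro[OF p], unfold_locales)
    fix R xs \<phi> and vs :: "nat list" assume d: "(R, xs, \<phi>) \<in> set table_defs" "length vs = length xs" "set vs \<subseteq> {..<N}"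
    have "R < 23 \<and> rels \<phi> \<subseteq> {..<23}"
      using d(1) unfolding table_defs_def
      by (auto dest!: subsetD[OF rels_TE] subsetD[OF rels_At])
    moreover from this have "holds N \<sigma>' (upd \<rho>0 xs vs) \<phi> = holds N \<sigma> (upd \<rho>0 xs vs) \<phi>"
      by (intro holds_cong assms) auto
    ultimately have "\<sigma>' R = \<sigma> R" "holds N \<sigma>' (upd \<rho>0 xs vs) \<phi> = holds N \<sigma> (upd \<rho>0 xs vs) \<phi>"
      using assms by simp_all
    then show "\<sigma>' R vs = holds N \<sigma>' (upd \<rho>0 xs vs) \<phi>" using tables[OF d] by simp
  qed
  show ?thesis
    by (rule valid_inst.intro[OF inst.intro[OF sized_congs.intro[OF sized.intro[OF tab sized_axioms.intro[OF n q]]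
      sized_congs_axioms.intro[OF k B]] inst_axioms.intro[OF fmt closed]] valid_inst_axioms.intro[OF group congs]])
qed

lemmas eval = EL IX EQ ADD' ZER' TH' bounded_less a_less z_less holds_quant

lemma tuple_less: "C.tuple h \<Longrightarrow> h l < n" "C.tuple h \<Longrightarrow> h l < N"
  using bounded_less(1) by (auto simp: C.tuple_def)

lemma start:
  assumes R: "\<sigma>' = exec N start_prog \<rho> \<sigma>"
  shows "\<exists>x. repX N \<sigma>' x \<and> C.good N {} x"
proof -
  define x where "x g l = (if g ! 0 = g ! 1 \<and> l = g ! 0 \<and> g ! 2 < n \<and> g ! 0 < k then g ! 2 else z)"
    for g :: "nat list" and l :: nat
  have "repX N \<sigma>' x"
    unfolding repX_def R start_prog_def
  proof (intro allI impI)
    fix b0 b1 b2 b3 l v assume l: "b0 < N" "b1 < N" "b2 < N" "b3 < N" "l < N" "v < N"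
    have "exec N (Def rX [] [0, 1, 2, 3, 4, 5] start_fm) \<rho> \<sigma> rX [b0, b1, b2, b3, l, v] \<longleftrightarrow>
        v < n \<and> (b0 = b1 \<and> l = b0 \<and> b2 < n \<and> b0 < k \<and> v = b2 \<or>
          \<not> (b0 = b1 \<and> l = b0 \<and> b2 < n \<and> b0 < k) \<and> v = z)"
      using l by (subst exec_Def0) (simp_all add: start_fm_def eval)
    also have "\<dots> \<longleftrightarrow> v = x [b0, b1, b2, b3] l" using z_less by (auto simp: x_def)
    finally show "exec N (Def rX [] [0, 1, 2, 3, 4, 5] start_fm) \<rho> \<sigma> rX [b0, b1, b2, b3, l, v] \<longleftrightarrow>
        v = x [b0, b1, b2, b3] l" .
  qed
  moreover have "C.good N {} x" by (rule C.good_start) (use n_less k_less in \<open>auto simp: x_def\<close>)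
  ultimately show ?thesis by blast
qed

lemma differences:
  assumes R: "\<sigma>' = exec N (Def rPH [] [0, 1, 2, 3, 6] diff_fm) \<rho> \<sigma>" and X: "repX N \<sigma> x"
    and tup: "\<And>g. g \<in> quads N \<Longrightarrow> C.tuple (x g)" and ij: "\<rho> 10 = i" "\<rho> 11 = j" "i < k" "j < k"
  shows "repH N \<sigma>' (\<lambda>g. C.\<phi> i j (x g))"
  unfolding repH_def R
proof (intro allI impI)
  fix b0 b1 b2 b3 v assume l: "b0 < N" "b1 < N" "b2 < N" "b3 < N" "v < N"
  let ?h = "x [b0, b1, b2, b3]"
  have h: "C.tuple ?h" using tup l by (simp add: quads_iff)
  have "exec N (Def rPH [] [0, 1, 2, 3, 6] diff_fm) \<rho> \<sigma> rPH [b0, b1, b2, b3, v] \<longleftrightarrow> v < n \<and> ?h i = a v (?h j)"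
    using l ij tuple_less[OF h]
    by (subst exec_Def0) (simp_all add: diff_fm_def eval repX_D[OF X] cong: conj_cong)
  also have "\<dots> \<longleftrightarrow> v = C.\<phi> i j ?h"
    unfolding C.\<phi>_def using C.subI[of v "?h j" "?h i"] C.sub_add[of "?h i" "?h j"] C.sub_less[of "?h i" "?h j"]
      tuple_less(1)[OF h] by metis
  finally show "exec N (Def rPH [] [0, 1, 2, 3, 6] diff_fm) \<rho> \<sigma> rPH [b0, b1, b2, b3, v] \<longleftrightarrow> v = C.\<phi> i j ?h" .
qed

lemma zeros:
  assumes R: "\<sigma>' = exec N (Def rP [] [0] zero_fm) \<rho> \<sigma>" and ij: "\<rho> 10 = i" "\<rho> 11 = j" "i < k" "j < k"
  shows "repP N \<sigma>' {v. C.Z i j v}"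
  unfolding repP_def R
proof (intro allI impI)
  fix v assume l: "v < N"
  have "exec N (Def rP [] [0] zero_fm) \<rho> \<sigma> rP [v] \<longleftrightarrow> v < n \<and> (\<exists>u<n. \<theta>_bit w B n i v u \<and> \<theta>_bit w B n j u z)"
    using l ij z_less bounded_n(2)
    by (subst exec_Def0) (simp_all add: zero_fm_def eval cong: conj_cong)
  also have "\<dots> \<longleftrightarrow> v \<in> {v. C.Z i j v}" unfolding C.Z_def using z_less by auto
  finally show "exec N (Def rP [] [0] zero_fm) \<rho> \<sigma> rP [v] \<longleftrightarrow> v \<in> {v. C.Z i j v}" .
qed

lemma zero_table:
  assumes R: "\<sigma>' = exec N (Def rT [] [0, 1, 2] (Rel rZER [2])) \<rho> \<sigma>" and P: "P \<subseteq> {..<n}"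
  shows "repT N \<sigma>' P (\<lambda>_ _. z)"
  unfolding repT_def R
proof (intro allI impI ballI)
  fix e l v assume l: "e \<in> P" "l < N" "v < N"
  have "e < N" using l(1) P bounded_less(1) by auto
  then show "exec N (Def rT [] [0, 1, 2] (Rel rZER [2])) \<rho> \<sigma> rT [e, l, v] \<longleftrightarrow> v = z"
    using l by (subst exec_Def0) (simp_all add: eval)
qed

text \<open>One attempt to extend the table.\<close>

lemma entry:
  assumes X: "repX N \<sigma> x" and H: "repH N \<sigma> (\<lambda>g. C.\<phi> i j (x g))" and P: "repP N \<sigma> P" and T: "repT N \<sigma> P t"
    and tab: "C.is_table i j (x ` quads N) P t" and tup: "\<And>g. g \<in> quads N \<Longrightarrow> C.tuple (x g)"
    and l: "b0 < N" "b1 < N" "b2 < N" "b3 < N" "e < N" "e' < N"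
    and \<rho>: "\<rho> 0 = b0" "\<rho> 1 = b1" "\<rho> 2 = b2" "\<rho> 3 = b3" "\<rho> 4 = e" "\<rho> 5 = e'"
  defines "g \<equiv> [b0, b1, b2, b3]"
  shows "holds N \<sigma> \<rho> new_fm \<longleftrightarrow> e \<in> P \<and> e' = a e (C.\<phi> i j (x g)) \<and> e' \<notin> P"
    and "e \<in> P \<Longrightarrow> e' \<notin> P \<Longrightarrow> \<sigma>' = exec N (Comp (Def rU [] [7, 8] entry_fm) (Comp (Def rT [5] [7, 8] (Rel rU [7, 8])) (Set rP [5] Tr))) \<rho> \<sigma> \<Longrightarrow>
      repP N \<sigma>' (insert e' P) \<and> repT N \<sigma>' (insert e' P) (t(e' := C.tadd (t e) (x g)))"
proof -
  have g: "C.tuple (x g)" using tup l by (simp add: g_def quads_iff)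
  have Pn: "u \<in> P \<Longrightarrow> u < n" for u using tab unfolding C.is_table_def by blast
  have phi: "C.\<phi> i j (x g) < n" by (rule C.\<phi>_less[OF g])
  note \<rho>' = \<rho>(1) \<rho>(2)[unfolded One_nat_def] \<rho>(3-6)
  show "holds N \<sigma> \<rho> new_fm \<longleftrightarrow> e \<in> P \<and> e' = a e (C.\<phi> i j (x g)) \<and> e' \<notin> P"
    using l phi bounded_less(1)[OF phi] Pn
    by (auto simp: new_fm_def \<rho>' eval repH_D[OF H] repP_D[OF P] g_def[symmetric] cong: conj_cong)
  assume e: "e \<in> P" "e' \<notin> P" and R: "\<sigma>' = exec N (Comp (Def rU [] [7, 8] entry_fm) (Comp (Def rT [5] [7, 8] (Rel rU [7, 8])) (Set rP [5] Tr))) \<rho> \<sigma>"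
  define \<sigma>1 where "\<sigma>1 = exec N (Def rU [] [7, 8] entry_fm) \<rho> \<sigma>"
  define \<sigma>2 where "\<sigma>2 = exec N (Def rT [5] [7, 8] (Rel rU [7, 8])) \<rho> \<sigma>1"
  have te: "C.tuple (t e)"
    using tab e(1) C.gen_tuple[of "x ` quads N" "t e"] tup unfolding C.is_table_def by auto
  have U: "\<sigma>1 rU [u, v] \<longleftrightarrow> v = C.tadd (t e) (x g) u" if "u < N" "v < N" for u v
    unfolding \<sigma>1_def using that l e tuple_less[OF te] tuple_less[OF g]
    by (subst exec_Def0) (simp_all add: entry_fm_def eval \<rho>' repT_D[OF T e(1)] repX_D[OF X] g_def[symmetric] C.tadd_def)
  have f1: "\<sigma>1 rT = \<sigma> rT" unfolding \<sigma>1_def by (rule exec_frame) simp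
  have T1: "\<sigma>2 rT [e', u, v] \<longleftrightarrow> v = C.tadd (t e) (x g) u" if "u < N" "v < N" for u v
    using exec_Def(2)[of rT "Rel rU [7, 8]" "[7, 8]" "[5]" "[u, v]" N \<rho> \<sigma>1] that U[OF that] \<rho>
    by (simp add: \<sigma>2_def)
  have T2: "\<sigma>2 rT [d, u, v] = \<sigma> rT [d, u, v]" if "d \<noteq> e'" for d u v
    using exec_Def(3)[of rT "Rel rU [7, 8]" "[7, 8]" "[5]" "[d, u, v]" \<rho> N \<sigma>1] that \<rho> f1
    by (simp add: \<sigma>2_def)
  have f2: "\<sigma>2 rP = \<sigma> rP" unfolding \<sigma>2_def \<sigma>1_def by (subst exec_frame, simp)+ (rule refl)
  have R': "\<sigma>' = \<sigma>2(rP := (\<sigma>2 rP)([e'] := True))" unfolding R by (simp add: \<sigma>1_def \<sigma>2_def \<rho>)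
  have "repP N \<sigma>' (insert e' P)" unfolding repP_def R' by (simp add: f2 repP_D[OF P])
  moreover have "repT N \<sigma>' (insert e' P) (t(e' := C.tadd (t e) (x g)))"
    unfolding repT_def R' using e T1 T2 repT_D[OF T] by auto
  ultimately show "repP N \<sigma>' (insert e' P) \<and> repT N \<sigma>' (insert e' P) (t(e' := C.tadd (t e) (x g)))" by blast
qed

lemma rep_frame:
  assumes "\<And>R. R \<notin> {rP, rT, rU} \<Longrightarrow> \<sigma>' R = \<sigma> R"
  shows "valid_inst N \<sigma>' w \<rho>0 n q k B a ng z s" "repX N \<sigma>' x \<longleftrightarrow> repX N \<sigma> x" "repH N \<sigma>' h \<longleftrightarrow> repH N \<sigma> h"
  by (rule frame, use assms in simp) (use assms in \<open>simp_all add: repX_def repH_def\<close>)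

text \<open>A pass either leaves a closed table or extends a table that is not closed.\<close>

lemma pass:
  assumes X: "repX N \<sigma> x" and H: "repH N \<sigma> (\<lambda>g. C.\<phi> i j (x g))" and P0: "repP N \<sigma> P0" and T0: "repT N \<sigma> P0 t0"
    and tab0: "C.is_table i j (x ` quads N) P0 t0" and tup: "\<And>g. g \<in> quads N \<Longrightarrow> C.tuple (x g)"
    and ij: "i < k" "j < k" and R: "\<sigma>' = exec N pass \<rho> \<sigma>"
  shows "\<exists>P t. repP N \<sigma>' P \<and> repT N \<sigma>' P t \<and> C.is_table i j (x ` quads N) P t \<and>
    (C.table_closed i j (x ` quads N) P \<or> \<not> C.table_closed i j (x ` quads N) P0 \<and> card P0 < card P)"
proof -
  let ?X = "x ` quads N" and ?\<phi> = "\<lambda>g. C.\<phi> i j (x g)"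
  \<comment> \<open>The invariant of the pass: other relations are unchanged, the table is correct, a closed table is left alone, and if the table has not changed then no attempt in \<open>D\<close> has succeeded.\<close>
  define F where "F \<sigma>' \<longleftrightarrow> (\<forall>R. R \<notin> {rP, rT, rU} \<longrightarrow> \<sigma>' R = \<sigma> R)" for \<sigma>' :: store
  define G where "G D P \<longleftrightarrow> P0 \<subseteq> P \<and> (C.table_closed i j ?X P0 \<longrightarrow> P = P0) \<and>
      (P = P0 \<longrightarrow> (\<forall>vs\<in>D. vs ! 4 \<in> P0 \<and> vs ! 5 = a (vs ! 4) (?\<phi> (take 4 vs)) \<longrightarrow> vs ! 5 \<in> P0))"
    for D :: "nat list set" and P
  define I where "I D \<sigma>' \<longleftrightarrow> F \<sigma>' \<and> (\<exists>P t. repP N \<sigma>' P \<and> repT N \<sigma>' P t \<and> C.is_table i j ?X P t \<and> G D P)"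
    for D \<sigma>'
  let ?D = "{vs. length vs = length [0, 1, 2, 3, 4, 5 :: nat] \<and> set vs \<subseteq> {..<N}}"
  have "I ?D \<sigma>'" unfolding R pass_def
  proof (rule exec_Fors_processed[where P = I])
    show "I {} \<sigma>" unfolding I_def F_def G_def using P0 T0 tab0 by blast
    fix vs :: "nat list" and D \<sigma>1
    let ?c = "Comp (Def rU [] [7, 8] entry_fm) (Comp (Def rT [5] [7, 8] (Rel rU [7, 8])) (Set rP [5] Tr))"
    let ?\<rho> = "upd \<rho> [0, 1, 2, 3, 4, 5] vs"
    assume vs: "length vs = length [0, 1, 2, 3, 4, 5 :: nat]" "set vs \<subseteq> {..<N}" and I: "I D \<sigma>1"
    obtain b0 b1 b2 b3 e e' where vs6: "vs = [b0, b1, b2, b3, e, e']"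
      using vs(1) by (auto simp: length_Suc_conv)
    have l: "b0 < N" "b1 < N" "b2 < N" "b3 < N" "e < N" "e' < N" using vs(2) by (auto simp: vs6)
    let ?g = "[b0, b1, b2, b3]"
    have g: "?g \<in> quads N" using l by (simp add: quads_iff)
    obtain P t where P: "repP N \<sigma>1 P" "repT N \<sigma>1 P t" "C.is_table i j ?X P t" and G: "G D P" and F: "F \<sigma>1"
      using I unfolding I_def by blast
    have F1: "\<And>R. R \<notin> {rP, rT, rU} \<Longrightarrow> \<sigma>1 R = \<sigma> R" using F unfolding F_def by blast
    interpret F: valid_inst N \<sigma>1 w \<rho>0 n q k B a ng z s by (rule rep_frame(1)[OF F1])
    have X1: "repX N \<sigma>1 x" using rep_frame(2)[OF F1] X by blast
    have H1: "repH N \<sigma>1 ?\<phi>" using rep_frame(3)[OF F1] H by blast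
    have \<rho>: "?\<rho> 0 = b0" "?\<rho> 1 = b1" "?\<rho> 2 = b2" "?\<rho> 3 = b3" "?\<rho> 4 = e" "?\<rho> 5 = e'" by (simp_all add: vs6)
    note ent = F.entry[OF X1 H1 P tup l \<rho>]
    have new: "holds N \<sigma>1 ?\<rho> new_fm \<longleftrightarrow> e \<in> P \<and> e' = a e (?\<phi> ?g) \<and> e' \<notin> P" by (rule ent(1))
    show "I (insert vs D) (exec N (If new_fm ?c) ?\<rho> \<sigma>1)"
    proof (cases "e \<in> P \<and> e' = a e (?\<phi> ?g) \<and> e' \<notin> P")
      case True
      let ?\<sigma> = "exec N ?c ?\<rho> \<sigma>1"
      have ex: "exec N (If new_fm ?c) ?\<rho> \<sigma>1 = ?\<sigma>" unfolding exec.simps(5) by (rule if_P) (use True new in blast)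
      have r: "repP N ?\<sigma> (insert e' P)" "repT N ?\<sigma> (insert e' P) (t(e' := C.tadd (t e) (x ?g)))"
        using ent(2)[OF _ _ _ refl] True by blast+
      have "F ?\<sigma>" unfolding F_def by (intro allI impI, subst exec_frame) (use F1 in auto)
      moreover have "C.is_table i j ?X (insert e' P) (t(e' := C.tadd (t e) (x ?g)))"
        using C.is_table_extend[OF P(3) _ ij, of e "x ?g"] tup g True by auto
      moreover have "G (insert vs D) (insert e' P)"
      proof -
        have "\<not> C.table_closed i j ?X P0"
        proof
          assume c: "C.table_closed i j ?X P0"
          then have "P = P0" using G unfolding G_def by blast
          then show False using c True g unfolding C.table_closed_def by blast
        qed
        moreover have "P0 \<subseteq> P" using G unfolding G_def by blast
        moreover have "insert e' P \<noteq> P0" using True \<open>P0 \<subseteq> P\<close> by blast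
        ultimately show ?thesis unfolding G_def by blast
      qed
      ultimately show ?thesis unfolding I_def ex using r by blast
    next
      case False
      have ex: "exec N (If new_fm ?c) ?\<rho> \<sigma>1 = \<sigma>1" unfolding exec.simps(5) by (rule if_not_P) (use False new in blast)
      have "G (insert vs D) P"
        using G False unfolding G_def vs6 by auto
      then show ?thesis unfolding I_def ex using P F by blast
    qed
  qed
  then obtain P t where P: "repP N \<sigma>' P" "repT N \<sigma>' P t" "C.is_table i j ?X P t" and G: "G ?D P"
    unfolding I_def by blast
  have fin: "finite P" using P(3) unfolding C.is_table_def by (meson finite_lessThan finite_subset)
  have "C.table_closed i j ?X P \<or> \<not> C.table_closed i j ?X P0 \<and> card P0 < card P"
  proof (cases "P = P0")
    case True
    have "C.table_closed i j ?X P" unfolding C.table_closed_def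
    proof (intro ballI)
      fix e u assume e: "e \<in> P" and "u \<in> ?X"
      then obtain g where g: "g \<in> quads N" "u = x g" by blast
      obtain b0 b1 b2 b3 where b: "g = [b0, b1, b2, b3]" "b0 < N" "b1 < N" "b2 < N" "b3 < N" using g(1) by (rule quadsE)
      have en: "e < n" using P(3) e unfolding C.is_table_def by blast
      let ?e = "a e (C.\<phi> i j u)"
      have "?e < n" using en C.\<phi>_less[OF tup[OF g(1)]] a_less g(2) by simp
      then have "g @ [e, ?e] \<in> ?D" using b en bounded_less(1) by auto
      moreover have "\<forall>vs\<in>?D. vs ! 4 \<in> P0 \<and> vs ! 5 = a (vs ! 4) (?\<phi> (take 4 vs)) \<longrightarrow> vs ! 5 \<in> P0"
        using G True unfolding G_def by blast
      ultimately have "(g @ [e, ?e]) ! 4 \<in> P0 \<and> (g @ [e, ?e]) ! 5 = a ((g @ [e, ?e]) ! 4) (?\<phi> (take 4 (g @ [e, ?e])))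
          \<longrightarrow> (g @ [e, ?e]) ! 5 \<in> P0" by blast
      then show "?e \<in> P" using e True g(2) by (simp add: b(1))
    qed
    then show ?thesis by blast
  next
    case False
    then have "P0 \<subset> P" "\<not> C.table_closed i j ?X P0" using G unfolding G_def by blast+
    then show ?thesis using psubset_card_mono[OF fin] by blast
  qed
  with P show ?thesis by blast
qed

lemma closed_table:
  assumes X: "repX N \<sigma> x" and tup: "\<And>g. g \<in> quads N \<Longrightarrow> C.tuple (x g)"
    and ij: "i < k" "j < k" and \<rho>: "\<rho> 10 = i" "\<rho> 11 = j" and R: "\<sigma>' = exec N table_prog \<rho> \<sigma>"
  shows "repH N \<sigma>' (\<lambda>g. C.\<phi> i j (x g)) \<and> (\<exists>P t. repP N \<sigma>' P \<and> repT N \<sigma>' P t \<and>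
    C.is_table i j (x ` quads N) P t \<and> C.table_closed i j (x ` quads N) P)"
proof -
  let ?X = "x ` quads N" and ?\<phi> = "\<lambda>g. C.\<phi> i j (x g)"
  define \<sigma>1 where "\<sigma>1 = exec N (Def rPH [] [0, 1, 2, 3, 6] diff_fm) \<rho> \<sigma>"
  define \<sigma>2 where "\<sigma>2 = exec N (Def rP [] [0] zero_fm) \<rho> \<sigma>1"
  define \<sigma>3 where "\<sigma>3 = exec N (Def rT [] [0, 1, 2] (Rel rZER [2])) \<rho> \<sigma>2"
  have R: "\<sigma>' = exec N (For 20 pass) \<rho> \<sigma>3"
    unfolding R table_prog_def \<sigma>1_def \<sigma>2_def \<sigma>3_def by (simp only: exec.simps)
  have f1: "\<sigma>1 R = \<sigma> R" if "R \<noteq> rPH" for R unfolding \<sigma>1_def by (rule exec_frame) (use that in simp)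
  have f2: "\<sigma>2 R = \<sigma>1 R" if "R \<noteq> rP" for R unfolding \<sigma>2_def by (rule exec_frame) (use that in simp)
  have f3: "\<sigma>3 R = \<sigma>2 R" if "R \<noteq> rT" for R unfolding \<sigma>3_def by (rule exec_frame) (use that in simp)
  interpret F1: valid_inst N \<sigma>1 w \<rho>0 n q k B a ng z s by (rule frame) (simp add: f1)
  interpret F2: valid_inst N \<sigma>2 w \<rho>0 n q k B a ng z s by (rule frame) (simp add: f1 f2)
  interpret F3: valid_inst N \<sigma>3 w \<rho>0 n q k B a ng z s by (rule frame) (simp add: f1 f2 f3)
  have X3: "repX N \<sigma>3 x" using X by (simp add: repX_def f1 f2 f3)
  have "repH N \<sigma>1 ?\<phi>" by (rule differences[OF \<sigma>1_def X tup \<rho> ij])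
  then have H3: "repH N \<sigma>3 ?\<phi>" by (simp add: repH_def f2 f3)
  let ?P = "{v. C.Z i j v}"
  have tab3: "C.is_table i j ?X ?P (\<lambda>_ _. z)" by (rule C.is_table_start[OF ij])
  have "repP N \<sigma>2 ?P" by (rule F1.zeros[OF \<sigma>2_def \<rho> ij])
  then have P3: "repP N \<sigma>3 ?P" by (simp add: repP_def f3)
  have T3: "repT N \<sigma>3 ?P (\<lambda>_ _. z)"
    by (rule F2.zero_table[OF \<sigma>3_def]) (use tab3 in \<open>simp add: C.is_table_def\<close>)
  define I where "I m \<sigma>' \<longleftrightarrow> (\<forall>R. R \<notin> {rP, rT, rU} \<longrightarrow> \<sigma>' R = \<sigma>3 R) \<and> (\<exists>P t. repP N \<sigma>' P \<and> repT N \<sigma>' P t \<and>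
      C.is_table i j ?X P t \<and> (C.table_closed i j ?X P \<or> m \<le> card P))" for m and \<sigma>' :: store
  have "I N \<sigma>'" unfolding R
  proof (rule exec_For_inv[where P = I])
    show "I 0 \<sigma>3" unfolding I_def using P3 T3 tab3 by blast
    fix m \<sigma>4 assume I: "I m \<sigma>4"
    then obtain P t where P: "repP N \<sigma>4 P" "repT N \<sigma>4 P t" "C.is_table i j ?X P t"
      and c: "C.table_closed i j ?X P \<or> m \<le> card P" unfolding I_def by blast
    have F4: "\<And>R. R \<notin> {rP, rT, rU} \<Longrightarrow> \<sigma>4 R = \<sigma>3 R" using I unfolding I_def by blast
    interpret F4: valid_inst N \<sigma>4 w \<rho>0 n q k B a ng z s by (rule F3.rep_frame(1)[OF F4])
    have X4: "repX N \<sigma>4 x" using F3.rep_frame(2)[OF F4] X3 by blast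
    have H4: "repH N \<sigma>4 ?\<phi>" using F3.rep_frame(3)[OF F4] H3 by blast
    let ?\<sigma> = "exec N pass (\<rho>(20 := m)) \<sigma>4"
    obtain P' t' where P': "repP N ?\<sigma> P'" "repT N ?\<sigma> P' t'" "C.is_table i j ?X P' t'"
      and c': "C.table_closed i j ?X P' \<or> \<not> C.table_closed i j ?X P \<and> card P < card P'"
      using F4.pass[OF X4 H4 P tup ij refl] by blast
    have "C.table_closed i j ?X P' \<or> Suc m \<le> card P'" using c c' by auto
    moreover have "\<forall>R. R \<notin> {rP, rT, rU} \<longrightarrow> ?\<sigma> R = \<sigma>3 R"
      by (intro allI impI, subst exec_frame) (use F4 in \<open>auto simp: pass_def\<close>)
    ultimately show "I (Suc m) ?\<sigma>" unfolding I_def using P' by blast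
  qed
  then obtain P t where P: "repP N \<sigma>' P" "repT N \<sigma>' P t" "C.is_table i j ?X P t"
    and c: "C.table_closed i j ?X P \<or> N \<le> card P" unfolding I_def by blast
  have F: "\<And>R. R \<notin> {rP, rT, rU} \<Longrightarrow> \<sigma>' R = \<sigma>3 R" using \<open>I N \<sigma>'\<close> unfolding I_def by blast
  have "card P \<le> n" using P(3) card_mono[of "{..<n}" P] by (simp add: C.is_table_def)
  then have "C.table_closed i j ?X P" using c n_less by linarith
  then show ?thesis using P F3.rep_frame(3)[OF F] H3 by blast
qed

text \<open>The new generators satisfy the hypotheses of \<open>good_step\<close>.\<close>

lemma next_generators:
  assumes X: "repX N \<sigma> x" and H: "repH N \<sigma> (\<lambda>g. C.\<phi> i j (x g))" and P: "repP N \<sigma> P" and T: "repT N \<sigma> P t"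
    and tab: "C.is_table i j (x ` quads N) P t" "C.table_closed i j (x ` quads N) P"
    and ij: "i < k" "j < k" "i \<noteq> j" "(i, j) \<notin> A" "A \<subseteq> {..<k} \<times> {..<k}" and \<rho>: "\<rho> 10 = i" "\<rho> 11 = j"
    and good: "C.good N A x" and R: "\<sigma>' = exec N next_prog \<rho> \<sigma>"
  shows "\<exists>y. repX N \<sigma>' y \<and> C.good N (insert (i, j) A) y"
proof -
  have tup: "C.tuple (x g)" if "g \<in> quads N" for g using good that unfolding C.good_def by blast
  have Xt: "u \<in> x ` quads N \<Longrightarrow> C.tuple u" for u using tup by blast
  note vals = C.closed_table_values[OF tab Xt ij(1,2)]
  have Pn: "u \<in> P \<Longrightarrow> u < n" for u using tab(1) unfolding C.is_table_def by blast
  have gent: "u \<in> P \<Longrightarrow> C.gen (x ` quads N) (t u)" for u using tab(1) unfolding C.is_table_def by blast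
  have tt: "u \<in> P \<Longrightarrow> C.tuple (t u)" for u using C.gen_tuple[OF gent] Xt by blast
  have phi: "C.\<phi> i j (x g) \<in> P" if "g \<in> quads N" for g
    by (rule vals(2)) (use C.gen_base[of "x g"] that tup in auto)
  have addP: "c \<in> P \<Longrightarrow> d \<in> P \<Longrightarrow> a c d \<in> P" for c d by (rule vals(3))
  have zP: "z \<in> P" "t z = (\<lambda>_. z)" using tab(1) C.Z_zero[OF ij(1,2)] unfolding C.is_table_def by blast+
  define y where "y g = (if g ! 0 = i \<and> g ! 1 = j then
      (if g ! 2 \<in> P \<and> g ! 3 \<in> P then (\<lambda>l. C.sub (a (t (g ! 2) l) (t (g ! 3) l)) (t (a (g ! 2) (g ! 3)) l)) else (\<lambda>_. z))
      else (\<lambda>l. C.sub (x g l) (t (C.\<phi> i j (x g)) l)))" for g :: "nat list"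
  have sub_iff: "v < n \<and> u = a v u' \<longleftrightarrow> v = C.sub u u'" if "u < n" "u' < n" for u u' v
    using C.subI[of v u' u] C.sub_add[of u u'] C.sub_less[of u u'] that by metis
  define \<sigma>1 where "\<sigma>1 = exec N (Def rY [] [0, 1, 2, 3, 4, 5] next_fm) \<rho> \<sigma>"
  have Y: "\<sigma>1 rY [b0, b1, b2, b3, l, v] \<longleftrightarrow> v = y [b0, b1, b2, b3] l"
    if l: "b0 < N" "b1 < N" "b2 < N" "b3 < N" "l < N" "v < N" for b0 b1 b2 b3 l v
  proof -
    let ?g = "[b0, b1, b2, b3]"
    have g: "?g \<in> quads N" using l by (simp add: quads_iff)
    note xl = tuple_less[OF tup[OF g]]
    have pl: "C.\<phi> i j (x ?g) < n" "C.\<phi> i j (x ?g) < N" using Pn[OF phi[OF g]] bounded_less(1) by auto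
    note ptl = tuple_less[OF tt[OF phi[OF g]]]
    have "\<sigma>1 rY [b0, b1, b2, b3, l, v] = holds N \<sigma> (upd \<rho> [0, 1, 2, 3, 4, 5] [b0, b1, b2, b3, l, v]) next_fm"
      unfolding \<sigma>1_def using l by (subst exec_Def0) (simp_all add: next_fm_def)
    also have "\<dots> \<longleftrightarrow> v = y ?g l"
    proof (cases "b0 = i \<and> b1 = j")
      case True
      show ?thesis
      proof (cases "b2 \<in> P \<and> b3 \<in> P")
        case c: True
        note s = Pn[OF c[THEN conjunct1]] Pn[OF c[THEN conjunct2]] Pn[OF addP[OF c[THEN conjunct1] c[THEN conjunct2]]]
        note tl = tuple_less[OF tt[OF c[THEN conjunct1]]] tuple_less[OF tt[OF c[THEN conjunct2]]]
          tuple_less[OF tt[OF addP[OF c[THEN conjunct1] c[THEN conjunct2]]]]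
        have "holds N \<sigma> (upd \<rho> [0, 1, 2, 3, 4, 5] [b0, b1, b2, b3, l, v]) next_fm \<longleftrightarrow>
            v < n \<and> a (t b2 l) (t b3 l) = a v (t (a b2 b3) l)"
          using l True c s bounded_less(1)[OF s(3)] tl a_less[OF tl(1,3)] bounded_less(1)[OF a_less[OF tl(1,3)]]
            addP[OF c[THEN conjunct1] c[THEN conjunct2]] \<rho>
          by (simp add: next_fm_def eval repP_D[OF P] repT_D[OF T] cong: conj_cong)
        also have "\<dots> \<longleftrightarrow> v = y ?g l" using sub_iff[OF a_less[OF tl(1,3)] tl(5)] True c by (simp add: y_def)
        finally show ?thesis .
      next
        case c: False
        then have "holds N \<sigma> (upd \<rho> [0, 1, 2, 3, 4, 5] [b0, b1, b2, b3, l, v]) next_fm \<longleftrightarrow> v < n \<and> v = z"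
          using l True \<rho> by (auto simp add: next_fm_def eval repP_D[OF P])
        then show ?thesis using True c z_less by (auto simp: y_def)
      qed
    next
      case False
      have "holds N \<sigma> (upd \<rho> [0, 1, 2, 3, 4, 5] [b0, b1, b2, b3, l, v]) next_fm \<longleftrightarrow>
          v < n \<and> x ?g l = a v (t (C.\<phi> i j (x ?g)) l)"
        using l False \<rho> pl xl ptl phi[OF g] ij bounded_less(3)[OF ij(1)] bounded_less(3)[OF ij(2)]
        by (simp add: next_fm_def eval repH_D[OF H] repT_D[OF T] repX_D[OF X] cong: conj_cong)
      also have "\<dots> \<longleftrightarrow> v = y ?g l" using sub_iff[OF xl(1) ptl(1)] False by (auto simp: y_def)
      finally show ?thesis .
    qed
    finally show ?thesis .
  qed
  have "repX N \<sigma>' y" unfolding repX_def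
  proof (intro allI impI)
    fix b0 b1 b2 b3 l v assume l: "b0 < N" "b1 < N" "b2 < N" "b3 < N" "l < N" "v < N"
    have "\<sigma>' = exec N (Def rX [] [0, 1, 2, 3, 4, 5] (Rel rY [0, 1, 2, 3, 4, 5])) \<rho> \<sigma>1"
      unfolding R next_prog_def \<sigma>1_def by (simp only: exec.simps)
    then have "\<sigma>' rX [b0, b1, b2, b3, l, v] = \<sigma>1 rY [b0, b1, b2, b3, l, v]"
      using l by (simp add: exec_Def0)
    then show "\<sigma>' rX [b0, b1, b2, b3, l, v] \<longleftrightarrow> v = y [b0, b1, b2, b3] l" using Y[OF l] by simp
  qed
  moreover have "C.good N (insert (i, j) A) y"
  proof (rule C.good_step[OF good ij n_less k_less tab])
    fix g assume g: "g \<in> quads N"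
    show "C.tuple (y g)"
      using tup[OF g] tt phi[OF g] tt[OF phi[OF g]] addP z_less C.sub_less C.sub_self[OF z_less] a_less C.zero[OF z_less]
      unfolding C.tuple_def y_def by simp
  next
    fix b0 b1 b2 b3 :: nat assume b: "b0 \<noteq> b1" "(b0, b1) \<notin> insert (i, j) A"
    then have "x [b0, b1, b2, b3] = (\<lambda>_. z)" using good unfolding C.good_def by blast
    then show "y [b0, b1, b2, b3] = (\<lambda>_. z)" using b zP(2) C.\<phi>_tz C.sub_self[OF z_less] by (auto simp: y_def)
  next
    fix c d assume cd: "c \<in> P" "d \<in> P"
    have "C.tuple (t c)" "C.tuple (t d)" "C.tuple (t (a c d))" using tt cd addP by blast+
    then show "C.tadd (y [i, j, c, d]) (t (a c d)) = C.tadd (t c) (t d)"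
      using cd by (auto simp: y_def C.tadd_def C.tuple_def C.sub_add a_less)
  next
    fix c d assume "\<not> (c \<in> P \<and> d \<in> P)"
    then show "y [i, j, c, d] = (\<lambda>_. z)" by (auto simp: y_def)
  next
    fix b0 b1 b2 b3 assume g: "[b0, b1, b2, b3] \<in> quads N" and ne: "(b0, b1) \<noteq> (i, j)"
    show "C.tadd (y [b0, b1, b2, b3]) (t (C.\<phi> i j (x [b0, b1, b2, b3]))) = x [b0, b1, b2, b3]"
      using tup[OF g] tt[OF phi[OF g]] ne by (auto simp: y_def C.tadd_def C.tuple_def C.sub_add)
  qed
  ultimately show ?thesis by blast
qed

lemma impose:
  assumes X: "repX N \<sigma> x" and good: "C.good N A x" and ij: "i < k" "j < k" "i \<noteq> j" "(i, j) \<notin> A" "A \<subseteq> {..<k} \<times> {..<k}"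
    and \<rho>: "\<rho> 10 = i" "\<rho> 11 = j" and R: "\<sigma>' = exec N (Comp table_prog next_prog) \<rho> \<sigma>"
  shows "\<exists>y. repX N \<sigma>' y \<and> C.good N (insert (i, j) A) y"
proof -
  define \<sigma>1 where "\<sigma>1 = exec N table_prog \<rho> \<sigma>"
  have R: "\<sigma>' = exec N next_prog \<rho> \<sigma>1" unfolding R \<sigma>1_def by (rule exec.simps)
  have tup: "C.tuple (x g)" if "g \<in> quads N" for g using good that unfolding C.good_def by blast
  have f: "\<sigma>1 R = \<sigma> R" if "R \<le> 23" for R
    unfolding \<sigma>1_def by (rule exec_frame) (use that in \<open>auto simp: table_prog_def pass_def\<close>)
  interpret F: valid_inst N \<sigma>1 w \<rho>0 n q k B a ng z s by (rule frame) (simp add: f)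
  have X1: "repX N \<sigma>1 x" using X by (simp add: repX_def f)
  from closed_table[OF X tup ij(1,2) \<rho> \<sigma>1_def] obtain P t where
    "repH N \<sigma>1 (\<lambda>g. C.\<phi> i j (x g))" "repP N \<sigma>1 P" "repT N \<sigma>1 P t"
    "C.is_table i j (x ` quads N) P t" "C.table_closed i j (x ` quads N) P" by blast
  from F.next_generators[OF X1 this ij \<rho> good R] show ?thesis .
qed

text \<open>All constraints have been imposed, pair after pair, in lexicographic order.\<close>

lemma generators:
  assumes R: "\<sigma>' = exec N gens_prog \<rho> \<sigma>"
  shows "\<exists>x. repX N \<sigma>' x \<and> C.good N C.pairs x"
proof -
  \<comment> \<open>The pairs that precede \<open>i, j\<close>.\<close>
  define S where "S i j = {p \<in> C.pairs. fst p < i \<or> fst p = i \<and> snd p < j}" for i j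
  define I where "I A \<sigma>' \<longleftrightarrow> (\<forall>R<23. \<sigma>' R = \<sigma> R) \<and> (\<exists>x. repX N \<sigma>' x \<and> C.good N A x)"
    for A and \<sigma>' :: store
  let ?c = "Comp table_prog next_prog"
  let ?if = "If (Ands [Rel rIX [10], Rel rIX [11], Neg (Rel rEQ [10, 11])]) ?c"
  define \<sigma>1 where "\<sigma>1 = exec N start_prog \<rho> \<sigma>"
  have R: "\<sigma>' = exec N (For 10 (For 11 ?if)) \<rho> \<sigma>1"
    unfolding R gens_prog_def \<sigma>1_def by (rule exec.simps)
  have S: "S (Suc i) 0 = S i N" for i
    using k_less by (auto simp: S_def C.pairs_def less_Suc_eq)
  have "I (S N 0) \<sigma>'" unfolding R
  proof (rule exec_For_inv[where P = "\<lambda>i. I (S i 0)"])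
    have "S 0 0 = {}" by (auto simp: S_def)
    moreover have "\<sigma>1 R = \<sigma> R" if "R < 23" for R
      unfolding \<sigma>1_def start_prog_def by (rule exec_frame) (use that in simp)
    ultimately show "I (S 0 0) \<sigma>1" using start[OF \<sigma>1_def] by (simp add: I_def)
  next
    fix i \<sigma>2 assume i: "i < N" and I: "I (S i 0) \<sigma>2"
    have "I (S i N) (exec N (For 11 ?if) (\<rho>(10 := i)) \<sigma>2)"
    proof (rule exec_For_inv[where P = "\<lambda>j. I (S i j)"])
      show "I (S i 0) \<sigma>2" by (rule I)
      fix j \<sigma>3 assume j: "j < N" and I3: "I (S i j) \<sigma>3"
      let ?\<rho> = "\<rho>(10 := i, 11 := j)"
      from I3 have f: "\<And>R. R < 23 \<Longrightarrow> \<sigma>3 R = \<sigma> R" unfolding I_def by blast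
      from I3 obtain x where x: "repX N \<sigma>3 x" "C.good N (S i j) x" unfolding I_def by blast
      interpret F: valid_inst N \<sigma>3 w \<rho>0 n q k B a ng z s by (rule frame[OF f])
      have c: "holds N \<sigma>3 ?\<rho> (Ands [Rel rIX [10], Rel rIX [11], Neg (Rel rEQ [10, 11])]) \<longleftrightarrow>
          i < k \<and> j < k \<and> i \<noteq> j" using i j by (simp add: F.eval)
      show "I (S i (Suc j)) (exec N ?if ?\<rho> \<sigma>3)"
      proof (cases "i < k \<and> j < k \<and> i \<noteq> j")
        case True
        have ex: "exec N ?if ?\<rho> \<sigma>3 = exec N ?c ?\<rho> \<sigma>3"
          unfolding exec.simps(5) by (rule if_P) (use True c in blast)
        have "(i, j) \<notin> S i j" "S i j \<subseteq> {..<k} \<times> {..<k}" by (auto simp: S_def C.pairs_def)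
        then have "\<exists>y. repX N (exec N ?c ?\<rho> \<sigma>3) y \<and> C.good N (insert (i, j) (S i j)) y"
          using True by (intro F.impose[OF x _ _ _ _ _ _ _ refl]) simp_all
        moreover have "S i (Suc j) = insert (i, j) (S i j)"
          using True by (auto simp: S_def C.pairs_def)
        moreover have "exec N ?c ?\<rho> \<sigma>3 R = \<sigma> R" if "R < 23" for R
          using that f by (subst exec_frame) (auto simp: table_prog_def next_prog_def pass_def)
        ultimately show ?thesis unfolding I_def ex by simp
      next
        case False
        have "exec N ?if ?\<rho> \<sigma>3 = \<sigma>3"
          unfolding exec.simps(5) by (rule if_not_P) (use False c in blast)
        moreover have "S i (Suc j) = S i j" using False by (auto simp: S_def C.pairs_def less_Suc_eq)
        ultimately show ?thesis using I3 by (simp only:)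
      qed
    qed
    then show "I (S (Suc i) 0) (exec N (For 11 ?if) (\<rho>(10 := i)) \<sigma>2)" unfolding S .
  qed
  moreover have "S N 0 = C.pairs" using k_less by (auto simp: S_def C.pairs_def)
  ultimately show ?thesis unfolding I_def by (simp only:)
qed

lemma holds_solvable:
  assumes X: "repX N \<sigma> x" and tup: "\<And>g. g \<in> quads N \<Longrightarrow> C.tuple (x g)"
  shows "holds N \<sigma> \<rho> solvable_fm \<longleftrightarrow> (\<forall>g\<in>quads N. C.solvable (x g))"
proof -
  have "holds N \<sigma> \<rho> solvable_fm \<longleftrightarrow> (\<forall>b0\<in>{..<N}. \<forall>b1\<in>{..<N}. \<forall>b2\<in>{..<N}. \<forall>b3\<in>{..<N}. C.solvable (x [b0, b1, b2, b3]))"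
    unfolding solvable_fm_def holds_All
  proof (intro ball_cong refl)
    fix b0 b1 b2 b3 assume l: "b0 \<in> {..<N}" "b1 \<in> {..<N}" "b2 \<in> {..<N}" "b3 \<in> {..<N}"
    have h: "C.tuple (x [b0, b1, b2, b3])" using tup l by (simp add: quads_iff)
    show "holds N \<sigma> (\<rho>(0 := b0, 1 := b1, 2 := b2, 3 := b3)) (Ex 4 (And (Rel rEL [4])
     (AllI 5 (Ex 6 (And (Rel rX [0, 1, 2, 3, 5, 6]) (Rel rTH [5, 4, 6])))))) \<longleftrightarrow> C.solvable (x [b0, b1, b2, b3])"
      using l tuple_less[OF h] bounded_n(2)
      by (simp add: eval repX_D[OF X] C.solvable_def cong: conj_cong)
  qed
  also have "\<dots> \<longleftrightarrow> (\<forall>g\<in>quads N. C.solvable (x g))"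
    by (auto simp: quads_iff elim!: quadsE)
  finally show ?thesis .
qed

lemma holds_CR:
  "holds N (exec N gens_prog \<rho> \<sigma>) \<rho>' solvable_fm \<longleftrightarrow> CR_tuple (table_alg n q a ng z s) (bit_congs w B n k)"
proof -
  let ?\<sigma> = "exec N gens_prog \<rho> \<sigma>"
  obtain x where x: "repX N ?\<sigma> x" "C.good N C.pairs x" using generators[OF refl] by blast
  have tup: "C.tuple (x g)" if "g \<in> quads N" for g using x(2) that unfolding C.good_def by blast
  interpret F: valid_inst N ?\<sigma> w \<rho>0 n q k B a ng z s
    by (rule frame, rule exec_frame)
       (simp add: gens_prog_def start_prog_def table_prog_def next_prog_def pass_def)
  have "CR_tuple (table_alg n q a ng z s) (bit_congs w B n k) \<longleftrightarrow> (\<forall>g\<in>quads N. C.solvable (x g))"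
    by (rule C.CR_tuple_iff[OF x(2)]) (simp_all add: table_alg_def bit_congs_def)
  then show ?thesis using F.holds_solvable[OF x(1) tup] by blast
qed

end

section \<open>The decision procedure\<close>

text \<open>Arities of the relations, in the order of their numbers.\<close>

definition rel_arity :: "nat \<Rightarrow> nat" where
  "rel_arity R = [1, 1, 2, 2, 1, 2, 3, 3, 2, 2, 2, 1, 1, 1, 1, 1, 1, 1, 3, 2, 1, 3, 3, 6, 5, 1, 3, 2, 6] ! R"

lemma rel_arity_simps [simp]:
  "rel_arity 0 = Suc 0" "rel_arity (Suc 0) = Suc 0" "rel_arity 2 = 2" "rel_arity 3 = 2" "rel_arity 4 = Suc 0"
  "rel_arity 5 = 2" "rel_arity 6 = 3" "rel_arity 7 = 3" "rel_arity 8 = 2" "rel_arity 9 = 2"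
  "rel_arity 10 = 2" "rel_arity 11 = Suc 0" "rel_arity 12 = Suc 0" "rel_arity 13 = Suc 0" "rel_arity 14 = Suc 0"
  "rel_arity 15 = Suc 0" "rel_arity 16 = Suc 0" "rel_arity 17 = Suc 0" "rel_arity 18 = 3" "rel_arity 19 = 2"
  "rel_arity 20 = Suc 0" "rel_arity 21 = 3" "rel_arity 22 = 3" "rel_arity 23 = 6" "rel_arity 24 = 5"
  "rel_arity 25 = Suc 0" "rel_arity 26 = 3" "rel_arity 27 = 2" "rel_arity 28 = 6"
  by (simp_all add: rel_arity_def)

lemma wff_isK: "x \<in> W \<Longrightarrow> \<forall>y\<in>W. y < f \<Longrightarrow> wff rel_arity W (isK f c x)"
proof (induction c arbitrary: f W x)
  case 0
  then show ?case by (auto simp: isK.simps)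
next
  case (Suc c)
  have "\<forall>y\<in>insert f W. y < Suc f" "f \<notin> W" using Suc.prems(2) by (auto intro: less_SucI)
  then show ?case using Suc.prems(1) by (simp add: isK.simps Suc.IH)
qed

lemma wff_TE: "tvars t \<subseteq> W \<Longrightarrow> x \<in> W \<Longrightarrow> \<forall>y\<in>W. y < f \<Longrightarrow> wff rel_arity W (TE f t x)"
proof (induction t arbitrary: f W x)
  case (V y)
  then show ?case by (simp add: TE.simps)
next
  case (K c)
  then show ?case by (simp add: TE.simps wff_isK)
next
  case (Plus t u)
  have "\<forall>y\<in>insert (Suc f) (insert f W). y < Suc (Suc f)" using Plus.prems(3) by (auto intro: less_SucI)
  moreover have "f \<notin> W" "Suc f \<notin> insert f W" using Plus.prems(3) by auto
  ultimately show ?case using Plus.prems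
    by (auto simp: TE.simps intro!: Plus.IH)
next
  case (Times t u)
  have "\<forall>y\<in>insert (Suc f) (insert f W). y < Suc (Suc f)" using Times.prems(3) by (auto intro: less_SucI)
  moreover have "f \<notin> W" "Suc f \<notin> insert f W" using Times.prems(3) by auto
  ultimately show ?case using Times.prems
    by (auto simp: TE.simps intro!: Times.IH)
qed

lemma wff_At:
  "tvars t \<subseteq> W \<Longrightarrow> set ys \<subseteq> W \<Longrightarrow> \<forall>y\<in>W. y < f \<Longrightarrow> Suc (length ys) = rel_arity R \<Longrightarrow> wff rel_arity W (At f R t ys)"
proof -
  assume a: "tvars t \<subseteq> W" "set ys \<subseteq> W" "\<forall>y\<in>W. y < f" "Suc (length ys) = rel_arity R"
  have "\<forall>y\<in>insert f W. y < Suc f" using a(3) by (auto intro: less_SucI)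
  then have "wff rel_arity (insert f W) (TE (Suc f) t f)" using a(1) by (intro wff_TE) auto
  then show ?thesis using a by (auto simp: At_def)
qed

definition decide_prog :: cmd where
  "decide_prog = Comp arith_prog (Comp read_prog (Comp (defs_prog table_defs) gens_prog))"

definition decide_fm :: fm where
  "decide_fm = And format_fm (And valid_fm solvable_fm)"

lemma wfc_arith_prog: "wfc rel_arity {} arith_prog"
  by (simp add: arith_prog_def eq_prog_def lt_prog_def suc_prog_def plus_prog_def times_prog_def wfc_Def wfc_Fors
      zeroF_def)

lemma wfc_read_prog: "wfc rel_arity {} read_prog"
  by (simp add: read_prog_def una_prog_def ts_prog_def val_prog_def wfc_Def wfc_Fors zeroF_def)

lemma wfc_table_defs: "wfc rel_arity {} (defs_prog table_defs)"
  by (simp add: table_defs_def wfc_Def wff_TE wff_At size_tm_def)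

lemma wfc_gens_prog: "wfc rel_arity {} gens_prog"
  by (simp add: gens_prog_def start_prog_def table_prog_def next_prog_def pass_def wfc_Def wfc_Fors start_fm_def
      diff_fm_def zero_fm_def new_fm_def entry_fm_def next_fm_def)

lemma wfc_decide: "wfc rel_arity {} decide_prog"
  by (simp add: decide_prog_def wfc_arith_prog wfc_read_prog wfc_table_defs wfc_gens_prog)

lemma wff_format: "wff rel_arity {} format_fm"
  by (simp add: format_fm_def format_body_def wff_TE wff_At)

lemma wff_valid: "wff rel_arity {} valid_fm"
  by (simp add: valid_fm_def group_fm_def trivial_fm_def prime_power_fm_def action_fm_def cong_fm_def
      ge2_fm_def dvd_fm_def)

lemma wff_decide: "wff rel_arity {} decide_fm"
  by (simp add: decide_fm_def wff_format wff_valid solvable_fm_def)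

text \<open>The formulas for the format and the axioms only read relations that the computation of the
  generators does not change, so that they may be evaluated at the end, also when the input is not an
  instance.\<close>

lemma decide_correct:
  assumes N: "N = length w + 4"
  shows "holds N (exec N decide_prog \<rho> (store0 w)) \<rho>' decide_fm \<longleftrightarrow> w \<in> CRT_restricted VS"
proof -
  define \<sigma>1 where "\<sigma>1 = exec N arith_prog \<rho> (store0 w)"
  define \<sigma>2 where "\<sigma>2 = exec N read_prog \<rho> \<sigma>1"
  define \<sigma>3 where "\<sigma>3 = exec N (defs_prog table_defs) \<rho> \<sigma>2"
  let ?\<sigma> = "exec N gens_prog \<rho> \<sigma>3"
  have \<sigma>: "exec N decide_prog \<rho> (store0 w) = ?\<sigma>"
    by (simp add: decide_prog_def \<sigma>1_def \<sigma>2_def \<sigma>3_def)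
  have ar: "arith N \<sigma>1" unfolding \<sigma>1_def by (rule arith_exec) (auto simp: fun_eq_iff store0_def)
  have f1: "\<sigma>1 R = store0 w R" if "R \<le> 1" for R
    unfolding \<sigma>1_def by (rule exec_frame) (use that in \<open>simp add: arith_prog_def eq_prog_def lt_prog_def suc_prog_def plus_prog_def times_prog_def\<close>)
  have "parsed N \<sigma>2 w"
    unfolding \<sigma>2_def by (rule parsed_exec[OF ar N]) (simp_all add: f1 store0_def)
  then have tab3: "tabled N \<sigma>3 w \<rho>" unfolding \<sigma>3_def by (rule tabled_exec)
  interpret T: tabled N \<sigma>3 w \<rho> by (rule tab3)
  have f: "?\<sigma> R = \<sigma>3 R" if "R < 23" for R
    by (rule exec_frame) (use that in \<open>auto simp: gens_prog_def start_prog_def table_prog_def next_prog_def pass_def\<close>)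
  have rels: "rels format_fm \<union> rels valid_fm \<subseteq> {..<23}"
    by (auto simp: format_fm_def format_body_def valid_fm_def group_fm_def trivial_fm_def prime_power_fm_def
        action_fm_def cong_fm_def ge2_fm_def dvd_fm_def AllE_def ExE_def AllF_def ExF_def AllI_def Bind_def
        dest!: subsetD[OF rels_TE] subsetD[OF rels_At])
  have format: "holds N ?\<sigma> \<rho>' format_fm \<longleftrightarrow>
      (\<exists>n q k B a ng z s. fmt w n q k B a ng z s \<and> closed_ops n q a ng z s)"
    unfolding T.format_iff[of \<rho>', symmetric] by (rule holds_cong, rule f) (use rels in auto)
  have valid: "holds N ?\<sigma> \<rho>' valid_fm = holds N \<sigma>3 \<rho>' valid_fm"
    by (rule holds_cong, rule f) (use rels in auto)
  have rest: "holds N ?\<sigma> \<rho>' valid_fm \<and> holds N ?\<sigma> \<rho>' solvable_fm \<longleftrightarrow>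
      vs_cond n q a ng z s \<and> (\<forall>i<k. cong_cond n q a ng s (\<theta>_bit w B n i)) \<and>
      CR_tuple (table_alg n q a ng z s) (bit_congs w B n k)"
    if fc: "fmt w n q k B a ng z s" "closed_ops n q a ng z s" for n q k B a ng z s
  proof -
    have p: "val w 0 n" "val w 1 (3 + q)" "val w (6 + n * n + n + q * (n + 1)) k"
      "tok_pos w (7 + n * n + n + q * (n + 1)) B"
      using fc(1)[unfolded fmt_def] by simp_all
    have inst: "inst N \<sigma>3 w \<rho> n q k B a ng z s"
      by (rule inst.intro[OF sized_congs.intro[OF sized.intro[OF tab3 sized_axioms.intro[OF p(1,2)]]
        sized_congs_axioms.intro[OF p(3,4)]] inst_axioms.intro[OF fc]])
    show ?thesis
    proof (cases "vs_cond n q a ng z s \<and> (\<forall>i<k. cong_cond n q a ng s (\<theta>_bit w B n i))")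
      case True
      then have "abgrp n a ng z" unfolding vs_cond_def by blast
      then have "valid_inst N \<sigma>3 w \<rho> n q k B a ng z s"
        using True by (intro valid_inst.intro[OF inst] valid_inst_axioms.intro) blast+
      from valid_inst.holds_CR[OF this] show ?thesis
        using True inst.holds_valid[OF inst] valid by blast
    next
      case False
      then show ?thesis using inst.holds_valid[OF inst] valid by blast
    qed
  qed
  have "holds N ?\<sigma> \<rho>' decide_fm \<longleftrightarrow>
      holds N ?\<sigma> \<rho>' format_fm \<and> holds N ?\<sigma> \<rho>' valid_fm \<and> holds N ?\<sigma> \<rho>' solvable_fm"
    by (simp add: decide_fm_def)
  also have "\<dots> \<longleftrightarrow> (\<exists>n q k B a ng z s. fmt w n q k B a ng z s \<and> closed_ops n q a ng z s \<and>
      (holds N ?\<sigma> \<rho>' valid_fm \<and> holds N ?\<sigma> \<rho>' solvable_fm))"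
    unfolding format by blast
  also have "\<dots> \<longleftrightarrow> w \<in> CRT_restricted VS"
    unfolding in_CRT_VS_iff using rest by (metis (no_types, lifting))
  finally show ?thesis unfolding \<sigma> .
qed

theorem theorem4p1:
  shows "CRT_restricted VS \<in> complexity_P"
proof -
  have "{w. let N = length w + 4 in holds N (exec N decide_prog (\<lambda>_. 0) (store0 w)) (\<lambda>_. 0) decide_fm} \<in> complexity_P"
    by (rule loop_program_in_P[OF wfc_decide wff_decide]) simp_all
  moreover have "{w. let N = length w + 4 in holds N (exec N decide_prog (\<lambda>_. 0) (store0 w)) (\<lambda>_. 0) decide_fm} = CRT_restricted VS"
    using decide_correct[OF refl] by (auto simp: Let_def)
  ultimately show ?thesis by simp
qed

end
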